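(* Let $K$ be a field and let $B$ be a finitely semi-graded ($FSG$) $K$-algebra such that $K$ has a $B$-free homogeneous resolution and the Yoneda algebra $E(B)=\bigoplus_{i\ge 0}Ext_B^i(K,K)$ is finitely generated in degree $1$. Then the Poincaré series $P_B(t)=\sum_{n\ge 0}(\dim_K Ext_B^n(K,K))t^n$ is well-defined (i.e. each $\dim_K Ext_B^n(K,K)$ is finite and the Hilbert series of $E(B)$ is the same for every grading making the $K$-algebra $E(B)$ a connected $\mathbb{N}$-graded algebra finitely generated in degree $1$), and it is also given by $$P_B(t)=\sum_{n=0}^\infty(\dim_K Tor_n^B(K,K))t^n.$$
   Context: A ring $B$ is semi-graded ($SG$) if there are additive subgroups $\{B_n\}_{n\ge 0}$ (a semi-graduation) with $B=\bigoplus_{n\ge 0}B_n$, $B_mB_n\subseteq B_0\oplus\cdots\oplus B_{m+n}$ for all $m,n\ge 0$, and $1\in B_0$. It is an $FSG$ ring if moreover $B$ is generated as a ring by $B_0$ and finitely many elements, and every $B_n$ is a free $B_0$-module of finite dimension. A $K$-algebra $B$ is a finitely semi-graded ($FSG$) algebra if: (i) $B$ is an $FSG$ ring with semi-graduation $B=\bigoplus_{p\ge 0}B_p$; (ii) $B_pB_q\subseteq B_1\oplus\cdots\oplus B_{p+q}$ for all $p,q\ge 1$; (iii) $B_0=K$; (iv) $B$ is generated as a $K$-algebra by $B_1$. For an $FSG$ algebra the projection $B\to B_0=K$ with kernel $B_{\ge 1}=\bigoplus_{n\ge 1}B_n$ is a $K$-algebra homomorphism, and $K$ is regarded as a $B$-bimodule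 through it. A left $B$-module $M$ is semi-graded if $M=\bigoplus_{n\in\mathbb{Z}}M_n$ with additive subgroups $M_n$ such that $B_mM_n\subseteq\bigoplus_{k\le m+n}M_k$; a $B$-homomorphism $f:M\to N$ of semi-graded modules is homogeneous if $f(M_n)\subseteq N_n$ for all $n$. $K$ is semi-graded, concentrated in degree $0$. A $B$-free homogeneous resolution of $K$ is an exact sequence $\cdots\to B^{(X_n)}\to\cdots\to B^{(X_1)}\to B^{(X_0)}\to K\to 0$ whose terms $B^{(X_n)}$ are semi-graded free left $B$-modules (direct sums of copies of $B$ indexed by sets $X_n$) and whose maps are homogeneous. $Ext_B^n(K,K)$ and $Tor_n^B(K,K)$ are computed by applying $Hom_B(-,K)$ and $K\otimes_B-$, respectively, to such a resolution. $E(B)$ is the algebra with the Yoneda product (concatenation of extensions); it is a connected $\mathbb{N}$-graded $K$-algebra with $E^i(B)=Ext_B^i(K,K)$. *)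

theory Defs
  imports
    "HOL-Algebra.Module"
    "HOL-Algebra.AbelCoset"
    "HOL-Algebra.Generated_Groups"
    "HOL-Algebra.Generated_Rings"
    "HOL-Library.Poly_Mapping"
    "HOL-Computational_Algebra.Formal_Power_Series"
begin

section \<open>Modules, vector spaces and algebras\<close>

text \<open>
  The ground field and the algebra \<open>B\<close> are types of class \<open>field\<close> and \<open>ring_1\<close>.  Left modules
  over such a type are records \<open>('r, 'm) module\<close> of HOL-Algebra with explicit carriers, because
  kernels, quotients and homology have to be formed.  The HOL-Algebra locale \<open>module\<close> is
  restricted to commutative scalars, so the axioms are stated here.  Vector spaces over a field
  are the special case of field scalars.  The ring fields \<open>mult\<close> and \<open>one\<close> of the record carry no
  information unless the record is an algebra.
\<close>

definition module_of ::
    "'m set \<Rightarrow> ('m \<Rightarrow> 'm \<Rightarrow> 'm) \<Rightarrow> 'm \<Rightarrow> ('r \<Rightarrow> 'm \<Rightarrow> 'm) \<Rightarrow> ('r, 'm) module" where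
  "module_of C a z s =
     \<lparr>carrier = C, monoid.mult = undefined, one = undefined, zero = z, add = a, smult = s\<rparr>"

definition left_module :: "('r::ring_1, 'm) module \<Rightarrow> bool" where
  "left_module M \<longleftrightarrow>
     abelian_group M \<and>
     (\<forall>r. \<forall>x \<in> carrier M. r \<odot>\<^bsub>M\<^esub> x \<in> carrier M) \<and>
     (\<forall>r. \<forall>x \<in> carrier M. \<forall>y \<in> carrier M. r \<odot>\<^bsub>M\<^esub> (x \<oplus>\<^bsub>M\<^esub> y) = r \<odot>\<^bsub>M\<^esub> x \<oplus>\<^bsub>M\<^esub> r \<odot>\<^bsub>M\<^esub> y) \<and>
     (\<forall>r s. \<forall>x \<in> carrier M. (r + s) \<odot>\<^bsub>M\<^esub> x = r \<odot>\<^bsub>M\<^esub> x \<oplus>\<^bsub>M\<^esub> s \<odot>\<^bsub>M\<^esub> x) \<and>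
     (\<forall>r s. \<forall>x \<in> carrier M. (r * s) \<odot>\<^bsub>M\<^esub> x = r \<odot>\<^bsub>M\<^esub> (s \<odot>\<^bsub>M\<^esub> x)) \<and>
     (\<forall>x \<in> carrier M. 1 \<odot>\<^bsub>M\<^esub> x = x)"

definition module_hom :: "('r::ring_1, 'm) module \<Rightarrow> ('r, 'n) module \<Rightarrow> ('m \<Rightarrow> 'n) set" where
  "module_hom M N =
     {f \<in> carrier M \<rightarrow> carrier N.
        (\<forall>x \<in> carrier M. \<forall>y \<in> carrier M. f (x \<oplus>\<^bsub>M\<^esub> y) = f x \<oplus>\<^bsub>N\<^esub> f y) \<and>
        (\<forall>r. \<forall>x \<in> carrier M. f (r \<odot>\<^bsub>M\<^esub> x) = r \<odot>\<^bsub>N\<^esub> f x)}"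

definition quotient_module :: "('r, 'm) module \<Rightarrow> 'm set \<Rightarrow> ('r, 'm set) module" where
  "quotient_module M W =
     module_of (a_rcosets\<^bsub>M\<^esub> W) (set_add M) W (\<lambda>r A. \<Union>x\<in>A. W +>\<^bsub>M\<^esub> (r \<odot>\<^bsub>M\<^esub> x))"

definition finite_basis :: "('k::field, 'v) module \<Rightarrow> 'v set \<Rightarrow> bool" where
  "finite_basis V S \<longleftrightarrow>
     finite S \<and> S \<subseteq> carrier V \<and>
     (\<forall>v \<in> carrier V. \<exists>!c. c \<in> S \<rightarrow>\<^sub>E UNIV \<and> v = (\<Oplus>\<^bsub>V\<^esub>s\<in>S. c s \<odot>\<^bsub>V\<^esub> s))"

definition fin_dim :: "('k::field, 'v) module \<Rightarrow> bool" where
  "fin_dim V \<longleftrightarrow> (\<exists>S. finite_basis V S)"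

text \<open>Only meaningful when \<^term>\<open>fin_dim V\<close> holds.\<close>

definition vdim :: "('k::field, 'v) module \<Rightarrow> nat" where
  "vdim V = card (SOME S. finite_basis V S)"

definition K_algebra :: "('k::field, 'a) module \<Rightarrow> bool" where
  "K_algebra A \<longleftrightarrow>
     ring A \<and> left_module A \<and>
     (\<forall>c. \<forall>x \<in> carrier A. \<forall>y \<in> carrier A.
        (c \<odot>\<^bsub>A\<^esub> x) \<otimes>\<^bsub>A\<^esub> y = c \<odot>\<^bsub>A\<^esub> (x \<otimes>\<^bsub>A\<^esub> y) \<and>
        x \<otimes>\<^bsub>A\<^esub> (c \<odot>\<^bsub>A\<^esub> y) = c \<odot>\<^bsub>A\<^esub> (x \<otimes>\<^bsub>A\<^esub> y))"

inductive_set generated_algebra :: "('k::field, 'a) module \<Rightarrow> 'a set \<Rightarrow> 'a set"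
  for A :: "('k::field, 'a) module" and S :: "'a set" where
  base: "x \<in> S \<Longrightarrow> x \<in> generated_algebra A S"
| one: "\<one>\<^bsub>A\<^esub> \<in> generated_algebra A S"
| add: "x \<in> generated_algebra A S \<Longrightarrow> y \<in> generated_algebra A S
    \<Longrightarrow> x \<oplus>\<^bsub>A\<^esub> y \<in> generated_algebra A S"
| smult: "x \<in> generated_algebra A S \<Longrightarrow> c \<odot>\<^bsub>A\<^esub> x \<in> generated_algebra A S"
| mult: "x \<in> generated_algebra A S \<Longrightarrow> y \<in> generated_algebra A S
    \<Longrightarrow> x \<otimes>\<^bsub>A\<^esub> y \<in> generated_algebra A S"

definition algebra_of :: "('k::field \<Rightarrow> 'b::ring_1 \<Rightarrow> 'b) \<Rightarrow> ('k, 'b) module" where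
  "algebra_of scale =
     \<lparr>carrier = UNIV, monoid.mult = (*), one = 1, zero = 0, add = (+), smult = scale\<rparr>"


section \<open>Gradings and semi-graduations\<close>

text \<open>\<open>M = \<Oplus>\<^sub>i G i\<close>, for a family of additive subgroups indexed by a whole type.\<close>

definition internal_direct_sum :: "('m, 'z) ring_scheme \<Rightarrow> ('i \<Rightarrow> 'm set) \<Rightarrow> bool" where
  "internal_direct_sum M G \<longleftrightarrow>
     (\<forall>i. additive_subgroup (G i) M) \<and>
     (\<forall>v \<in> carrier M. \<exists>!x. (\<forall>i. x i \<in> G i) \<and> finite {i. x i \<noteq> \<zero>\<^bsub>M\<^esub>} \<and>
        v = (\<Oplus>\<^bsub>M\<^esub>i\<in>{i. x i \<noteq> \<zero>\<^bsub>M\<^esub>}. x i))"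

definition sum_of_subgroups :: "('m, 'z) ring_scheme \<Rightarrow> 'i set \<Rightarrow> ('i \<Rightarrow> 'm set) \<Rightarrow> 'm set" where
  "sum_of_subgroups M I G = {(\<Oplus>\<^bsub>M\<^esub>i\<in>J. x i) | J x. finite J \<and> J \<subseteq> I \<and> (\<forall>i\<in>J. x i \<in> G i)}"

definition semi_graded_ring :: "('b, 'z) ring_scheme \<Rightarrow> (nat \<Rightarrow> 'b set) \<Rightarrow> bool" where
  "semi_graded_ring R G \<longleftrightarrow>
     ring R \<and> internal_direct_sum R G \<and>
     (\<forall>m n. \<forall>x \<in> G m. \<forall>y \<in> G n. x \<otimes>\<^bsub>R\<^esub> y \<in> sum_of_subgroups R {0..m + n} G) \<and>
     \<one>\<^bsub>R\<^esub> \<in> G 0"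

definition fsg_ring :: "('b, 'z) ring_scheme \<Rightarrow> (nat \<Rightarrow> 'b set) \<Rightarrow> bool" where
  "fsg_ring R G \<longleftrightarrow>
     semi_graded_ring R G \<and>
     (\<exists>F. finite F \<and> F \<subseteq> carrier R \<and> generate_ring R (G 0 \<union> F) = carrier R) \<and>
     (\<forall>n. (\<forall>c \<in> G 0. \<forall>x \<in> G n. c \<otimes>\<^bsub>R\<^esub> x \<in> G n) \<and>
        (\<exists>S. finite S \<and> S \<subseteq> G n \<and>
           (\<forall>x \<in> G n. \<exists>!c. c \<in> S \<rightarrow>\<^sub>E G 0 \<and> x = (\<Oplus>\<^bsub>R\<^esub>s\<in>S. c s \<otimes>\<^bsub>R\<^esub> s))))"

definition fsg_algebra :: "('k::field \<Rightarrow> 'b::ring_1 \<Rightarrow> 'b) \<Rightarrow> (nat \<Rightarrow> 'b set) \<Rightarrow> bool" where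
  "fsg_algebra scale G \<longleftrightarrow>
     K_algebra (algebra_of scale) \<and>
     fsg_ring (algebra_of scale) G \<and>
     (\<forall>p \<ge> 1. \<forall>q \<ge> 1. \<forall>x \<in> G p. \<forall>y \<in> G q.
        x * y \<in> sum_of_subgroups (algebra_of scale) {1..p + q} G) \<and>
     G 0 = range (\<lambda>c. scale c 1) \<and>
     generated_algebra (algebra_of scale) (G 1) = UNIV"

text \<open>The projection \<open>B \<rightarrow> B\<^sub>0 = K\<close> with kernel \<open>B\<^sub>\<ge>\<^sub>1\<close>.\<close>

definition augmentation ::
    "('k::field \<Rightarrow> 'b::ring_1 \<Rightarrow> 'b) \<Rightarrow> (nat \<Rightarrow> 'b set) \<Rightarrow> 'b \<Rightarrow> 'k" where
  "augmentation scale G b =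
     (THE c. b - scale c 1 \<in> sum_of_subgroups (algebra_of scale) {1..} G)"

definition semi_graded_module ::
    "(nat \<Rightarrow> 'b::ring_1 set) \<Rightarrow> ('b, 'm) module \<Rightarrow> (int \<Rightarrow> 'm set) \<Rightarrow> bool" where
  "semi_graded_module G M gr \<longleftrightarrow>
     left_module M \<and> internal_direct_sum M gr \<and>
     (\<forall>m n. \<forall>b \<in> G m. \<forall>x \<in> gr n. b \<odot>\<^bsub>M\<^esub> x \<in> sum_of_subgroups M {..int m + n} gr)"

definition homogeneous :: "(int \<Rightarrow> 'm set) \<Rightarrow> (int \<Rightarrow> 'n set) \<Rightarrow> ('m \<Rightarrow> 'n) \<Rightarrow> bool" where
  "homogeneous gr gr' f \<longleftrightarrow> (\<forall>n. f ` gr n \<subseteq> gr' n)"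

definition connected_grading :: "('k::field, 'a) module \<Rightarrow> (nat \<Rightarrow> 'a set) \<Rightarrow> bool" where
  "connected_grading A G \<longleftrightarrow>
     internal_direct_sum A G \<and>
     (\<forall>n c. \<forall>x \<in> G n. c \<odot>\<^bsub>A\<^esub> x \<in> G n) \<and>
     (\<forall>m n. \<forall>x \<in> G m. \<forall>y \<in> G n. x \<otimes>\<^bsub>A\<^esub> y \<in> G (m + n)) \<and>
     \<one>\<^bsub>A\<^esub> \<noteq> \<zero>\<^bsub>A\<^esub> \<and> G 0 = range (\<lambda>c. c \<odot>\<^bsub>A\<^esub> \<one>\<^bsub>A\<^esub>)"

definition fin_gen_in_degree_one :: "('k::field, 'a) module \<Rightarrow> (nat \<Rightarrow> 'a set) \<Rightarrow> bool" where
  "fin_gen_in_degree_one A G \<longleftrightarrow>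
     (\<exists>S. finite S \<and> S \<subseteq> G 1 \<and> generated_algebra A S = carrier A)"

definition hilbert_series :: "('k::field, 'a) module \<Rightarrow> (nat \<Rightarrow> 'a set) \<Rightarrow> int fps" where
  "hilbert_series A G = Abs_fps (\<lambda>n. int (vdim (A\<lparr>carrier := G n\<rparr>)))"


section \<open>Free resolutions of the trivial module\<close>

text \<open>The direct sum \<open>B\<^sup>(\<^sup>X\<^sup>)\<close>, as finitely supported functions.\<close>

definition free_module :: "'x set \<Rightarrow> ('b::ring_1, 'x \<Rightarrow>\<^sub>0 'b) module" where
  "free_module X =
     module_of {p. Poly_Mapping.keys p \<subseteq> X} (+) 0 (\<lambda>b. Poly_Mapping.map (\<lambda>a. b * a))"

text \<open>The field \<open>K\<close> as a left \<open>B\<close>-module via an augmentation \<open>a\<close> of \<open>B\<close>.\<close>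

definition trivial_module :: "('b::ring_1 \<Rightarrow> 'k::field) \<Rightarrow> ('b, 'k) module" where
  "trivial_module a = module_of UNIV (+) 0 (\<lambda>b c. a b * c)"

text \<open>
  The index sets, the differentials and the augmentation of a resolution of \<open>K\<close> by free modules:
  \<open>res_diff n\<close> maps term \<open>Suc n\<close> to term \<open>n\<close>, and \<open>res_aug\<close> maps term \<open>0\<close> to \<open>K\<close>.
\<close>

record (overloaded) ('b, 'x, 'k) resolution =
  res_gens :: "nat \<Rightarrow> 'x set"
  res_diff :: "nat \<Rightarrow> ('x \<Rightarrow>\<^sub>0 'b) \<Rightarrow> ('x \<Rightarrow>\<^sub>0 'b)"
  res_aug :: "('x \<Rightarrow>\<^sub>0 'b) \<Rightarrow> 'k"

definition res_term :: "('b::ring_1, 'x, 'k) resolution \<Rightarrow> nat \<Rightarrow> ('b, 'x \<Rightarrow>\<^sub>0 'b) module" where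
  "res_term P n = free_module (res_gens P n)"

definition free_resolution ::
    "('b::ring_1 \<Rightarrow> 'k::field) \<Rightarrow> ('b, 'x, 'k) resolution \<Rightarrow> bool" where
  "free_resolution a P \<longleftrightarrow>
     (\<forall>n. res_diff P n \<in> module_hom (res_term P (Suc n)) (res_term P n)) \<and>
     res_aug P \<in> module_hom (res_term P 0) (trivial_module a) \<and>
     res_aug P ` carrier (res_term P 0) = UNIV \<and>
     a_kernel (res_term P 0) (trivial_module a) (res_aug P)
       = res_diff P 0 ` carrier (res_term P 1) \<and>
     (\<forall>n. a_kernel (res_term P (Suc n)) (res_term P n) (res_diff P n)
       = res_diff P (Suc n) ` carrier (res_term P (Suc (Suc n))))"

definition homogeneous_free_resolution ::
    "('k::field \<Rightarrow> 'b::ring_1 \<Rightarrow> 'b) \<Rightarrow> (nat \<Rightarrow> 'b set) \<Rightarrow> ('b, 'x, 'k) resolution \<Rightarrow> bool" where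
  "homogeneous_free_resolution scale G P \<longleftrightarrow>
     free_resolution (augmentation scale G) P \<and>
     (\<exists>gr. (\<forall>n. semi_graded_module G (res_term P n) (gr n)) \<and>
        (\<forall>n. homogeneous (gr (Suc n)) (gr n) (res_diff P n)) \<and>
        homogeneous (gr 0) (\<lambda>i. if i = 0 then UNIV else {0}) (res_aug P))"


section \<open>Ext and Tor\<close>

text \<open>
  The \<open>K\<close>-space of \<open>B\<close>-homomorphisms from \<open>M\<close> to the trivial module; homomorphisms are
  normalised to be \<^const>\<open>undefined\<close> outside the carrier of \<open>M\<close>.
\<close>

definition Hom_K :: "('b::ring_1 \<Rightarrow> 'k::field) \<Rightarrow> ('b, 'm) module \<Rightarrow> ('k, 'm \<Rightarrow> 'k) module" where
  "Hom_K a M =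
     module_of (module_hom M (trivial_module a) \<inter> extensional (carrier M))
       (\<lambda>f g. \<lambda>x\<in>carrier M. f x + g x)
       (\<lambda>x\<in>carrier M. 0)
       (\<lambda>c f. \<lambda>x\<in>carrier M. c * f x)"

definition cochains ::
    "('b::ring_1 \<Rightarrow> 'k::field) \<Rightarrow> ('b, 'x, 'k) resolution \<Rightarrow> nat \<Rightarrow> ('k, ('x \<Rightarrow>\<^sub>0 'b) \<Rightarrow> 'k) module" where
  "cochains a P n = Hom_K a (res_term P n)"

definition coboundary ::
    "('b::ring_1, 'x, 'k::field) resolution \<Rightarrow> nat \<Rightarrow> (('x \<Rightarrow>\<^sub>0 'b) \<Rightarrow> 'k) \<Rightarrow> ('x \<Rightarrow>\<^sub>0 'b) \<Rightarrow> 'k" where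
  "coboundary P n f = (\<lambda>x\<in>carrier (res_term P (Suc n)). f (res_diff P n x))"

definition cocycles ::
    "('b::ring_1 \<Rightarrow> 'k::field) \<Rightarrow> ('b, 'x, 'k) resolution \<Rightarrow> nat \<Rightarrow> (('x \<Rightarrow>\<^sub>0 'b) \<Rightarrow> 'k) set" where
  "cocycles a P n = a_kernel (cochains a P n) (cochains a P (Suc n)) (coboundary P n)"

definition coboundaries ::
    "('b::ring_1 \<Rightarrow> 'k::field) \<Rightarrow> ('b, 'x, 'k) resolution \<Rightarrow> nat \<Rightarrow> (('x \<Rightarrow>\<^sub>0 'b) \<Rightarrow> 'k) set" where
  "coboundaries a P n =
     (case n of 0 \<Rightarrow> {\<zero>\<^bsub>cochains a P 0\<^esub>} | Suc m \<Rightarrow> coboundary P m ` carrier (cochains a P m))"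

definition Ext ::
    "('b::ring_1 \<Rightarrow> 'k::field) \<Rightarrow> ('b, 'x, 'k) resolution \<Rightarrow> nat
       \<Rightarrow> ('k, (('x \<Rightarrow>\<^sub>0 'b) \<Rightarrow> 'k) set) module" where
  "Ext a P n =
     quotient_module ((cochains a P n)\<lparr>carrier := cocycles a P n\<rparr>) (coboundaries a P n)"

definition cohomology_class ::
    "('b::ring_1 \<Rightarrow> 'k::field) \<Rightarrow> ('b, 'x, 'k) resolution \<Rightarrow> nat
       \<Rightarrow> (('x \<Rightarrow>\<^sub>0 'b) \<Rightarrow> 'k) \<Rightarrow> (('x \<Rightarrow>\<^sub>0 'b) \<Rightarrow> 'k) set" where
  "cohomology_class a P n f = coboundaries a P n +>\<^bsub>cochains a P n\<^esub> f"

text \<open>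
  The tensor product \<open>N \<otimes>\<^sub>B M\<close> of a \<open>K\<close>-\<open>B\<close>-bimodule \<open>N\<close>, with right action \<open>ract\<close>, and a left
  \<open>B\<close>-module \<open>M\<close>: the free abelian group on \<open>N \<times> M\<close> modulo the usual relations, with \<open>K\<close> acting
  on the left factor.
\<close>

definition formal_tensors ::
    "('k::field, 'n) module \<Rightarrow> ('b::ring_1, 'm) module \<Rightarrow> ('k, 'n \<times> 'm \<Rightarrow>\<^sub>0 int) module" where
  "formal_tensors N M =
     module_of {z. Poly_Mapping.keys z \<subseteq> carrier N \<times> carrier M} (+) 0
       (\<lambda>c. frag_extend (\<lambda>(n, m). frag_of (c \<odot>\<^bsub>N\<^esub> n, m)))"

definition tensor_relations ::
    "('k::field, 'n) module \<Rightarrow> ('n \<Rightarrow> 'b \<Rightarrow> 'n) \<Rightarrow> ('b::ring_1, 'm) module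
       \<Rightarrow> ('n \<times> 'm \<Rightarrow>\<^sub>0 int) set" where
  "tensor_relations N ract M = generate (add_monoid (formal_tensors N M))
     ({frag_of (n \<oplus>\<^bsub>N\<^esub> n', m) - frag_of (n, m) - frag_of (n', m) | n n' m.
         n \<in> carrier N \<and> n' \<in> carrier N \<and> m \<in> carrier M} \<union>
      {frag_of (n, m \<oplus>\<^bsub>M\<^esub> m') - frag_of (n, m) - frag_of (n, m') | n m m'.
         n \<in> carrier N \<and> m \<in> carrier M \<and> m' \<in> carrier M} \<union>
      {frag_of (ract n b, m) - frag_of (n, b \<odot>\<^bsub>M\<^esub> m) | n b m.
         n \<in> carrier N \<and> m \<in> carrier M})"

definition tensor_product ::
    "('k::field, 'n) module \<Rightarrow> ('n \<Rightarrow> 'b \<Rightarrow> 'n) \<Rightarrow> ('b::ring_1, 'm) module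
       \<Rightarrow> ('k, ('n \<times> 'm \<Rightarrow>\<^sub>0 int) set) module" where
  "tensor_product N ract M = quotient_module (formal_tensors N M) (tensor_relations N ract M)"

definition tensor_map ::
    "('k::field, 'n) module \<Rightarrow> ('n \<Rightarrow> 'b \<Rightarrow> 'n) \<Rightarrow> ('b::ring_1, 'm') module \<Rightarrow> ('m \<Rightarrow> 'm')
       \<Rightarrow> ('n \<times> 'm \<Rightarrow>\<^sub>0 int) set \<Rightarrow> ('n \<times> 'm' \<Rightarrow>\<^sub>0 int) set" where
  "tensor_map N ract M' f A =
     (\<Union>z\<in>A. tensor_relations N ract M' +>\<^bsub>formal_tensors N M'\<^esub>
        frag_extend (\<lambda>(n, m). frag_of (n, f m)) z)"

definition ground_space :: "('k::field, 'k) module" where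
  "ground_space = module_of UNIV (+) 0 (*)"

definition tensor_chains ::
    "('b::ring_1 \<Rightarrow> 'k::field) \<Rightarrow> ('b, 'x, 'k) resolution \<Rightarrow> nat
       \<Rightarrow> ('k, ('k \<times> ('x \<Rightarrow>\<^sub>0 'b) \<Rightarrow>\<^sub>0 int) set) module" where
  "tensor_chains a P n = tensor_product ground_space (\<lambda>c b. c * a b) (res_term P n)"

definition tensor_diff ::
    "('b::ring_1 \<Rightarrow> 'k::field) \<Rightarrow> ('b, 'x, 'k) resolution \<Rightarrow> nat
       \<Rightarrow> ('k \<times> ('x \<Rightarrow>\<^sub>0 'b) \<Rightarrow>\<^sub>0 int) set \<Rightarrow> ('k \<times> ('x \<Rightarrow>\<^sub>0 'b) \<Rightarrow>\<^sub>0 int) set" where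
  "tensor_diff a P n = tensor_map ground_space (\<lambda>c b. c * a b) (res_term P n) (res_diff P n)"

definition Tor ::
    "('b::ring_1 \<Rightarrow> 'k::field) \<Rightarrow> ('b, 'x, 'k) resolution \<Rightarrow> nat
       \<Rightarrow> ('k, ('k \<times> ('x \<Rightarrow>\<^sub>0 'b) \<Rightarrow>\<^sub>0 int) set set) module" where
  "Tor a P n =
     quotient_module
       ((tensor_chains a P n)\<lparr>carrier := (case n of
           0 \<Rightarrow> carrier (tensor_chains a P 0)
         | Suc m \<Rightarrow> a_kernel (tensor_chains a P n) (tensor_chains a P m) (tensor_diff a P m))\<rparr>)
       (tensor_diff a P n ` carrier (tensor_chains a P (Suc n)))"


section \<open>Extensions and the Yoneda algebra\<close>

text \<open>
  An \<open>n\<close>-fold extension \<open>0 \<rightarrow> K \<rightarrow> E (n - 1) \<rightarrow> \<dots> \<rightarrow> E 0 \<rightarrow> K \<rightarrow> 0\<close> of \<open>K\<close> by \<open>K\<close>, for \<open>n \<ge> 1\<close>;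
  \<open>ext_diff i\<close> maps term \<open>Suc i\<close> to term \<open>i\<close>.
\<close>

record ('b, 'e, 'k) extension =
  ext_term :: "nat \<Rightarrow> ('b, 'e) module"
  ext_diff :: "nat \<Rightarrow> 'e \<Rightarrow> 'e"
  ext_aug :: "'e \<Rightarrow> 'k"
  ext_inc :: "'k \<Rightarrow> 'e"

definition is_extension ::
    "('b::ring_1 \<Rightarrow> 'k::field) \<Rightarrow> nat \<Rightarrow> ('b, 'e, 'k) extension \<Rightarrow> bool" where
  "is_extension a n E \<longleftrightarrow>
     0 < n \<and>
     (\<forall>i<n. left_module (ext_term E i)) \<and>
     (\<forall>i. Suc i < n \<longrightarrow> ext_diff E i \<in> module_hom (ext_term E (Suc i)) (ext_term E i)) \<and>
     ext_aug E \<in> module_hom (ext_term E 0) (trivial_module a) \<and>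
     ext_inc E \<in> module_hom (trivial_module a) (ext_term E (n - 1)) \<and>
     ext_aug E ` carrier (ext_term E 0) = UNIV \<and>
     inj (ext_inc E) \<and>
     (\<forall>i<n.
        (case i of
           0 \<Rightarrow> a_kernel (ext_term E 0) (trivial_module a) (ext_aug E)
         | Suc j \<Rightarrow> a_kernel (ext_term E i) (ext_term E j) (ext_diff E j))
        = (if Suc i < n then ext_diff E i ` carrier (ext_term E (Suc i)) else range (ext_inc E)))"

text \<open>
  \<open>splice E n F\<close> is the concatenation of \<open>E\<close> (on the left) with the \<open>n\<close>-fold extension \<open>F\<close> (on the
  right): the map from the last term of \<open>E\<close> to the first term of \<open>F\<close> is the composite through \<open>K\<close>.
\<close>

definition splice ::
    "('b, 'e, 'k) extension \<Rightarrow> nat \<Rightarrow> ('b, 'e, 'k) extension \<Rightarrow> ('b, 'e, 'k) extension" where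
  "splice E n F =
     \<lparr>ext_term = (\<lambda>i. if i < n then ext_term F i else ext_term E (i - n)),
      ext_diff = (\<lambda>i. if Suc i < n then ext_diff F i
                      else if Suc i = n then (\<lambda>x. ext_inc F (ext_aug E x))
                      else ext_diff E (i - n)),
      ext_aug = ext_aug F,
      ext_inc = ext_inc E\<rparr>"

text \<open>
  The cochain \<open>f\<close> represents the extension \<open>E\<close> when it is the last component of a chain map from
  the resolution to \<open>E\<close> that lifts the identity of \<open>K\<close>.  Such an \<open>f\<close> is a cocycle and its class
  depends on \<open>E\<close> only; this is the usual correspondence between extensions and \<open>Ext\<close>.
\<close>

definition represents ::
    "('b::ring_1 \<Rightarrow> 'k::field) \<Rightarrow> ('b, 'x, 'k) resolution \<Rightarrow> nat \<Rightarrow> ('b, 'e, 'k) extension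
       \<Rightarrow> (('x \<Rightarrow>\<^sub>0 'b) \<Rightarrow> 'k) \<Rightarrow> bool" where
  "represents a P n E f \<longleftrightarrow>
     f \<in> carrier (cochains a P n) \<and>
     (\<exists>\<phi>. (\<forall>i<n. \<phi> i \<in> module_hom (res_term P i) (ext_term E i)) \<and>
        (\<forall>x \<in> carrier (res_term P 0). ext_aug E (\<phi> 0 x) = res_aug P x) \<and>
        (\<forall>i. Suc i < n \<longrightarrow> (\<forall>x \<in> carrier (res_term P (Suc i)).
           ext_diff E i (\<phi> (Suc i) x) = \<phi> i (res_diff P i x))) \<and>
        (\<forall>x \<in> carrier (res_term P n). ext_inc E (f x) = \<phi> (n - 1) (res_diff P (n - 1) x)))"

definition is_class_of ::
    "('b::ring_1 \<Rightarrow> 'k::field) \<Rightarrow> ('b, 'x, 'k) resolution \<Rightarrow> nat \<Rightarrow> ('b, 'e, 'k) extension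
       \<Rightarrow> (('x \<Rightarrow>\<^sub>0 'b) \<Rightarrow> 'k) set \<Rightarrow> bool" where
  "is_class_of a P n E u \<longleftrightarrow> (\<exists>f. represents a P n E f \<and> u = cohomology_class a P n f)"

text \<open>The class in \<open>Ext\<^sup>0 = Hom\<^sub>B(K, K)\<close> of the identity of \<open>K\<close>.\<close>

definition ext_one ::
    "('b::ring_1 \<Rightarrow> 'k::field) \<Rightarrow> ('b, 'x, 'k) resolution \<Rightarrow> (('x \<Rightarrow>\<^sub>0 'b) \<Rightarrow> 'k) set" where
  "ext_one a P = cohomology_class a P 0 (restrict (res_aug P) (carrier (res_term P 0)))"

text \<open>
  In positive degrees the product of two classes is the class of the concatenation of extensions
  that realise them.  An element of \<open>Ext\<^sup>0 = Hom\<^sub>B(K, K) = K\<close> is multiplication by a scalar; it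
  acts by pushout, respectively pullback, along that scalar, which is scalar multiplication.

  The extensions range over modules whose elements are sets of pairs in \<open>K \<times> B\<^sup>(\<^sup>X\<^sup>)\<close>.  This
  bounded supply suffices: each class in \<open>Ext\<^sup>n\<close> with \<open>n \<ge> 1\<close> is realised by the pushout of the
  resolution along a cocycle, whose terms are \<open>(K \<times> B\<^sup>(\<^sup>X\<^sup>)) / {(f x, - d x)}\<close> and copies of the
  \<open>B\<^sup>(\<^sup>X\<^sup>)\<close>, and the class of a concatenation only depends on the classes of its factors.
\<close>

definition yoneda_product ::
    "('b::ring_1 \<Rightarrow> 'k::field) \<Rightarrow> ('b, 'x, 'k) resolution \<Rightarrow> nat \<Rightarrow> nat
       \<Rightarrow> (('x \<Rightarrow>\<^sub>0 'b) \<Rightarrow> 'k) set \<Rightarrow> (('x \<Rightarrow>\<^sub>0 'b) \<Rightarrow> 'k) set \<Rightarrow> (('x \<Rightarrow>\<^sub>0 'b) \<Rightarrow> 'k) set" where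
  "yoneda_product a P m n u v =
     (if m = 0 then (THE c. u = c \<odot>\<^bsub>Ext a P 0\<^esub> ext_one a P) \<odot>\<^bsub>Ext a P n\<^esub> v
      else if n = 0 then (THE c. v = c \<odot>\<^bsub>Ext a P 0\<^esub> ext_one a P) \<odot>\<^bsub>Ext a P m\<^esub> u
      else (THE w. \<exists>E F :: ('b, ('k \<times> ('x \<Rightarrow>\<^sub>0 'b)) set, 'k) extension.
              is_extension a m E \<and> is_class_of a P m E u \<and>
              is_extension a n F \<and> is_class_of a P n F v \<and>
              is_class_of a P (m + n) (splice E n F) w))"

definition yoneda_algebra ::
    "('b::ring_1 \<Rightarrow> 'k::field) \<Rightarrow> ('b, 'x, 'k) resolution
       \<Rightarrow> ('k, nat \<Rightarrow> (('x \<Rightarrow>\<^sub>0 'b) \<Rightarrow> 'k) set) module" where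
  "yoneda_algebra a P =
     \<lparr>carrier = {u. (\<forall>n. u n \<in> carrier (Ext a P n)) \<and> finite {n. u n \<noteq> \<zero>\<^bsub>Ext a P n\<^esub>}},
      monoid.mult = (\<lambda>u v n. \<Oplus>\<^bsub>Ext a P n\<^esub>i\<in>{..n}. yoneda_product a P i (n - i) (u i) (v (n - i))),
      one = (\<lambda>n. if n = 0 then ext_one a P else \<zero>\<^bsub>Ext a P n\<^esub>),
      zero = (\<lambda>n. \<zero>\<^bsub>Ext a P n\<^esub>),
      add = (\<lambda>u v n. u n \<oplus>\<^bsub>Ext a P n\<^esub> v n),
      smult = (\<lambda>c u n. c \<odot>\<^bsub>Ext a P n\<^esub> u n)\<rparr>"

definition ext_grading ::
    "('b::ring_1 \<Rightarrow> 'k::field) \<Rightarrow> ('b, 'x, 'k) resolution \<Rightarrow> nat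
       \<Rightarrow> (nat \<Rightarrow> (('x \<Rightarrow>\<^sub>0 'b) \<Rightarrow> 'k) set) set" where
  "ext_grading a P n =
     {u \<in> carrier (yoneda_algebra a P). \<forall>m. m \<noteq> n \<longrightarrow> u m = \<zero>\<^bsub>Ext a P m\<^esub>}"

definition poincare_series ::
    "('b::ring_1 \<Rightarrow> 'k::field) \<Rightarrow> ('b, 'x, 'k) resolution \<Rightarrow> int fps" where
  "poincare_series a P = Abs_fps (\<lambda>n. int (vdim (Ext a P n)))"

end

theory Submission
  imports Defs
begin

text \<open>
  Finiteness. The Yoneda product of the classes of two cocycles \<open>f\<close> and \<open>g\<close> is the class of
  \<open>f \<circ> \<psi>\<close>, where the chain map \<open>\<psi>\<close> lifts \<open>g\<close> to the resolution: any class is realised by a pushout of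
  the resolution, and a concatenation of extensions is represented by the composed lift. Hence the
  product is bilinear, and \<open>Ext\<^sup>n\<close> is spanned by the finitely many bracketed words of length \<open>n\<close> in
  the degree-one generators.

  Independence of the grading. Let \<open>E\<close> and \<open>H\<close> be connected gradings of the same algebra, with \<open>E\<close>
  generated in degree one. Subtracting their \<open>H\<^sub>0\<close>-components from the generators of \<open>E\<close> gives
  generators in \<open>E\<^sub>\<le>\<^sub>1 \<inter> H\<^sub>\<ge>\<^sub>1\<close>, so the algebra is \<open>E\<^sub>\<le>\<^sub>n + H\<^sub>>\<^sub>n\<close> and \<open>dim H\<^sub>\<le>\<^sub>n \<le> dim E\<^sub>\<le>\<^sub>n\<close> for all \<open>n\<close>.
  By symmetry all these dimensions agree. None of this uses associativity of the product.

  Tor. Evaluating cochains on \<open>K \<otimes>\<^sub>B P\<^sub>n = K\<^sup>(\<^sup>X\<^sup>)\<close> induces a pairing of \<open>Ext\<^sup>n\<close> with \<open>Tor\<^sub>n\<close> that is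
  nondegenerate on both sides.
\<close>

section \<open>Left modules, quotients and homomorphisms\<close>

text \<open>The definitions are full of choices: the Yoneda product is a \<open>THE\<close> over
  pairs of extensions, the dimension a \<open>SOME\<close> over bases, the tensor product a quotient
  of a free abelian group. Each is first replaced by something computable. A product of
  positive-degree classes becomes a composition of cochains. This needs one homotopy argument, run
  once with the resolution as target (independence of the lift) and once with an extension as target
  (independence of the representing cochain). Dimensions are compared by passing to coordinate
  vectors of type \<open>'x \<Rightarrow>\<^sub>0 'k\<close>, where the type-based theory of vector
  spaces applies. The tensor relations turn out to be the kernel of an explicit coordinate map, so
  the tensor product may be read as finitely supported families of scalars. Nondegeneracy of the
  pairing rests on subspaces splitting off over a field: a splitting of the reduced differential
  turns cocycles vanishing on cycles into coboundaries, and a separating functional detects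
  non-boundaries. Since products are never regrouped, spanning sets of \<open>Ext\<close> are built
  degree by degree from products of spanning sets of lower degrees.\<close>

locale lmod = abelian_group M for M :: "('r::ring_1, 'm) module" (structure) +
  assumes smult_closed [intro, simp]: "x \<in> carrier M \<Longrightarrow> r \<odot> x \<in> carrier M"
    and smult_r_distr: "x \<in> carrier M \<Longrightarrow> y \<in> carrier M \<Longrightarrow> r \<odot> (x \<oplus> y) = r \<odot> x \<oplus> r \<odot> y"
    and smult_l_distr: "x \<in> carrier M \<Longrightarrow> (r + s) \<odot> x = r \<odot> x \<oplus> s \<odot> x"
    and smult_assoc1: "x \<in> carrier M \<Longrightarrow> (r * s) \<odot> x = r \<odot> (s \<odot> x)"
    and smult_one [simp]: "x \<in> carrier M \<Longrightarrow> 1 \<odot> x = x"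

lemma left_module_iff: "left_module M \<longleftrightarrow> lmod M"
  unfolding left_module_def lmod_def lmod_axioms_def by blast

text \<open>Asking for \<open>0 \<odot> x = \<zero>\<close> in place of additive inverses makes all
  obligations equations or closure facts: \<open>(-1) \<odot> x\<close> then serves as the inverse
  of \<open>x\<close>.\<close>

lemma lmodI:
  fixes M :: "('r::ring_1, 'm) module" (structure)
  assumes add: "\<And>x y. x \<in> carrier M \<Longrightarrow> y \<in> carrier M \<Longrightarrow> x \<oplus> y \<in> carrier M"
    and zero: "\<zero> \<in> carrier M"
    and assoc: "\<And>x y z. x \<in> carrier M \<Longrightarrow> y \<in> carrier M \<Longrightarrow> z \<in> carrier M \<Longrightarrow>
      (x \<oplus> y) \<oplus> z = x \<oplus> (y \<oplus> z)"
    and comm: "\<And>x y. x \<in> carrier M \<Longrightarrow> y \<in> carrier M \<Longrightarrow> x \<oplus> y = y \<oplus> x"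
    and l_zero: "\<And>x. x \<in> carrier M \<Longrightarrow> \<zero> \<oplus> x = x"
    and sm: "\<And>r x. x \<in> carrier M \<Longrightarrow> r \<odot> x \<in> carrier M"
    and rd: "\<And>r x y. x \<in> carrier M \<Longrightarrow> y \<in> carrier M \<Longrightarrow> r \<odot> (x \<oplus> y) = r \<odot> x \<oplus> r \<odot> y"
    and ld: "\<And>r s x. x \<in> carrier M \<Longrightarrow> (r + s) \<odot> x = r \<odot> x \<oplus> s \<odot> x"
    and as: "\<And>r s x. x \<in> carrier M \<Longrightarrow> (r * s) \<odot> x = r \<odot> (s \<odot> x)"
    and one: "\<And>x. x \<in> carrier M \<Longrightarrow> 1 \<odot> x = x"
    and nul: "\<And>x. x \<in> carrier M \<Longrightarrow> 0 \<odot> x = \<zero>"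
  shows "lmod M"
proof -
  have "abelian_group M"
  proof (rule abelian_groupI)
    fix x assume x: "x \<in> carrier M"
    have "(-1) \<odot> x \<oplus> x = \<zero>"
      using ld[OF x, of "-1" 1] one[OF x] nul[OF x] by simp
    then show "\<exists>y\<in>carrier M. y \<oplus> x = \<zero>" using sm[OF x] by blast
  qed (use add zero assoc comm l_zero in auto)
  then show ?thesis
    using sm rd ld as one by (simp add: lmod_def lmod_axioms_def)
qed

context lmod begin

lemma smult_l_zero [simp]: assumes x: "x \<in> carrier M" shows "0 \<odot> x = \<zero>"
  using smult_l_distr[OF x, of 0 0] x by simp

lemma smult_r_zero [simp]: "r \<odot> \<zero> = \<zero>"
  using smult_r_distr[of \<zero> \<zero> r] by simp

lemma a_inv_smult: assumes x: "x \<in> carrier M" shows "\<ominus> x = (-1) \<odot> x"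
proof -
  have "(-1) \<odot> x \<oplus> x = \<zero>" using smult_l_distr[OF x, of "-1" 1] x by simp
  then show ?thesis using x by (simp add: minus_equality)
qed

lemma smult_a_inv: assumes x: "x \<in> carrier M" shows "r \<odot> (\<ominus> x) = \<ominus> (r \<odot> x)"
  using x by (simp add: a_inv_smult flip: smult_assoc1)

lemma smult_uminus: assumes x: "x \<in> carrier M" shows "(- r) \<odot> x = \<ominus> (r \<odot> x)"
  using x by (simp add: a_inv_smult flip: smult_assoc1)

lemma smult_minus: "x \<in> carrier M \<Longrightarrow> y \<in> carrier M \<Longrightarrow> r \<odot> (x \<ominus> y) = r \<odot> x \<ominus> r \<odot> y"
  by (simp add: minus_eq smult_r_distr smult_a_inv)

lemma smult_diff: "x \<in> carrier M \<Longrightarrow> (r - s) \<odot> x = r \<odot> x \<ominus> s \<odot> x"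
  using smult_l_distr[of x r "- s"] by (simp add: minus_eq smult_uminus)

lemma finsum_smult:
  assumes "f \<in> A \<rightarrow> carrier M"
  shows "r \<odot> (\<Oplus>i\<in>A. f i) = (\<Oplus>i\<in>A. r \<odot> f i)"
  using assms by (induction A rule: infinite_finite_induct) (auto simp: smult_r_distr Pi_def)

lemma minus_add_cancel: "x \<in> carrier M \<Longrightarrow> y \<in> carrier M \<Longrightarrow> (x \<ominus> y) \<oplus> y = x"
  by (simp add: minus_eq a_assoc l_neg)

lemma minus_eq_zero_iff: "x \<in> carrier M \<Longrightarrow> y \<in> carrier M \<Longrightarrow> x \<ominus> y = \<zero> \<longleftrightarrow> x = y"
  using minus_add_cancel[of x y] by (auto simp: minus_eq r_neg)

lemma add_minus_cancel: "x \<in> carrier M \<Longrightarrow> y \<in> carrier M \<Longrightarrow> (x \<oplus> y) \<ominus> y = x"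
  by (simp add: minus_eq a_assoc r_neg)

lemma add_minus_add:
  assumes "x \<in> carrier M" "y \<in> carrier M" "x' \<in> carrier M" "y' \<in> carrier M"
  shows "(x \<oplus> y) \<ominus> (x' \<oplus> y') = (x \<ominus> x') \<oplus> (y \<ominus> y')"
  using assms by (simp add: minus_eq minus_add a_ac)

end

section \<open>Submodules and quotient modules\<close>

definition lsubmodule :: "'m set \<Rightarrow> ('r::ring_1, 'm) module \<Rightarrow> bool" where
  "lsubmodule W M \<longleftrightarrow> W \<subseteq> carrier M \<and> \<zero>\<^bsub>M\<^esub> \<in> W \<and>
     (\<forall>x\<in>W. \<forall>y\<in>W. x \<oplus>\<^bsub>M\<^esub> y \<in> W) \<and> (\<forall>r. \<forall>x\<in>W. r \<odot>\<^bsub>M\<^esub> x \<in> W)"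

context
  fixes M :: "('r::ring_1, 'm) module" (structure) and W
  assumes M: "lmod M" and W: "lsubmodule W M"
begin

interpretation lmod M by (rule M)

lemma lsub_subset: "W \<subseteq> carrier M" and lsub_carrier: "x \<in> W \<Longrightarrow> x \<in> carrier M"
  and lsub_zero: "\<zero> \<in> W"
  and lsub_add: "x \<in> W \<Longrightarrow> y \<in> W \<Longrightarrow> x \<oplus> y \<in> W" and lsub_smult: "x \<in> W \<Longrightarrow> r \<odot> x \<in> W"
  using W unfolding lsubmodule_def by auto

text \<open>Negatives come from the action of -1, which is why \<open>lsubmodule\<close> does not
  ask for them.\<close>

lemma lsub_uminus: "x \<in> W \<Longrightarrow> \<ominus> x \<in> W"
  by (simp add: a_inv_smult lsub_carrier lsub_smult)

lemma lsub_minus: "x \<in> W \<Longrightarrow> y \<in> W \<Longrightarrow> x \<ominus> y \<in> W"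
  by (simp add: minus_eq lsub_add lsub_uminus)

lemma lsub_finsum: "f \<in> A \<rightarrow> W \<Longrightarrow> (\<Oplus>i\<in>A. f i) \<in> W"
proof (induction A rule: infinite_finite_induct)
  case (insert x F)
  then have "f \<in> F \<rightarrow> carrier M" "f x \<in> carrier M" using lsub_carrier by auto
  then show ?case using insert by (simp add: lsub_add)
qed (use lsub_zero in auto)

lemma lsub_additive: "additive_subgroup W M"
proof (rule additive_subgroup.intro, rule subgroup.intro)
  fix x assume "x \<in> W"
  then show "inv\<^bsub>add_monoid M\<^esub> x \<in> W"
    using lsub_uminus by (simp add: a_inv_def)
qed (use lsub_subset lsub_add lsub_zero in auto)

lemma lsub_lmod: "lmod (M\<lparr>carrier := W\<rparr>)"
  by (rule lmodI)
    (auto simp: lsub_add lsub_zero lsub_smult lsub_carrier a_ac smult_r_distr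
      smult_l_distr smult_assoc1)

text \<open>\<open>finsum\<close> is a fold that refers to the carrier, so passing to
  \<open>carrier := W\<close> has to be justified by induction. This is what allows linear relations
  to move between a submodule and the ambient module.\<close>

lemma lsub_finsum_eq: "f \<in> A \<rightarrow> W \<Longrightarrow> finsum (M\<lparr>carrier := W\<rparr>) f A = finsum M f A"
proof (induction A rule: infinite_finite_induct)
  case (infinite A)
  interpret N: lmod "M\<lparr>carrier := W\<rparr>" by (rule lsub_lmod)
  show ?case using infinite N.finsum_infinite[of A f] finsum_infinite[of A f] by simp
next
  case empty
  interpret N: lmod "M\<lparr>carrier := W\<rparr>" by (rule lsub_lmod)
  show ?case using N.finsum_empty by simp
next
  case (insert x F)
  interpret N: lmod "M\<lparr>carrier := W\<rparr>" by (rule lsub_lmod)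
  have "f \<in> F \<rightarrow> carrier M" "f x \<in> carrier M" using insert lsub_carrier by auto
  then show ?case using insert N.finsum_insert[of F x f] by simp
qed

text \<open>The additive inverse is chosen inside the carrier, so it might depend on
  \<open>W\<close>; in both modules it is the action of -1.\<close>

lemma lsub_minus_eq: "x \<in> W \<Longrightarrow> y \<in> W \<Longrightarrow> x \<ominus>\<^bsub>M\<lparr>carrier := W\<rparr>\<^esub> y = x \<ominus> y"
proof -
  assume xy: "x \<in> W" "y \<in> W"
  interpret N: lmod "M\<lparr>carrier := W\<rparr>" by (rule lsub_lmod)
  show ?thesis using xy N.a_inv_smult[of y] a_inv_smult[of y] lsub_carrier
    by (simp add: N.minus_eq minus_eq)
qed

lemma coset_eq_iff: 
  assumes "x \<in> carrier M" "y \<in> carrier M"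
  shows "W +> x = W +> y \<longleftrightarrow> x \<ominus> y \<in> W"
proof
  assume "W +> x = W +> y"
  moreover have "x \<in> W +> x" using lsub_zero assms unfolding a_r_coset_def' by force
  ultimately obtain w where "w \<in> W" "x = w \<oplus> y" unfolding a_r_coset_def' by auto
  then show "x \<ominus> y \<in> W" using assms lsub_carrier by (simp add: add_minus_cancel)
next
  assume w: "x \<ominus> y \<in> W"
  have x: "x = (x \<ominus> y) \<oplus> y" using assms by (simp add: minus_add_cancel)
  have "x \<in> W +> y" using w x unfolding a_r_coset_def' by blast
  then show "W +> x = W +> y"
    using a_repr_independence[of x W y] assms lsub_additive by (auto simp: additive_subgroup_def)
qed

lemma coset_zero_iff: "x \<in> carrier M \<Longrightarrow> W +> x = W \<longleftrightarrow> x \<in> W"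
  using coset_eq_iff[of x \<zero>] lsub_subset minus_add_cancel[of x \<zero>] by simp

lemma coset_mem_iff: "x \<in> carrier M \<Longrightarrow> y \<in> carrier M \<Longrightarrow> x \<in> W +> y \<longleftrightarrow> x \<ominus> y \<in> W"
proof
  assume *: "x \<in> carrier M" "y \<in> carrier M" and "x \<in> W +> y"
  then obtain w where "w \<in> W" "x = w \<oplus> y" unfolding a_r_coset_def' by auto
  then show "x \<ominus> y \<in> W" using * lsub_carrier by (simp add: add_minus_cancel)
next
  assume *: "x \<in> carrier M" "y \<in> carrier M" and w: "x \<ominus> y \<in> W"
  have x: "x = (x \<ominus> y) \<oplus> y" using * by (simp add: minus_add_cancel)
  then show "x \<in> W +> y" using w unfolding a_r_coset_def' by blast
qed

lemma coset_self: "x \<in> carrier M \<Longrightarrow> x \<in> W +> x"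
  by (simp add: coset_mem_iff minus_eq_zero_iff[THEN iffD2] lsub_zero)

lemma coset_carrier: "x \<in> W +> y \<Longrightarrow> y \<in> carrier M \<Longrightarrow> x \<in> carrier M"
  using a_r_coset_subset_G[OF lsub_subset] by blast

lemma quot_carrier: "carrier (quotient_module M W) = (\<lambda>x. W +> x) ` carrier M"
  by (auto simp: quotient_module_def module_of_def A_RCOSETS_def')

lemma quot_zero: "\<zero>\<^bsub>quotient_module M W\<^esub> = W"
  by (simp add: quotient_module_def module_of_def)

lemma quot_add:
  assumes "x \<in> carrier M" "y \<in> carrier M"
  shows "(W +> x) \<oplus>\<^bsub>quotient_module M W\<^esub> (W +> y) = W +> (x \<oplus> y)"
proof -
  interpret abelian_subgroup W M by (rule abelian_subgroupI3[OF lsub_additive abelian_group_axioms])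
  show ?thesis using a_rcos_sum[OF assms] by (simp add: quotient_module_def module_of_def)
qed

text \<open>The action on cosets is a union over all representatives. It is a single coset because
  the members of that union coincide: representatives differ by an element of \<open>W\<close>, and
  \<open>W\<close> is stable under \<open>r\<close>.\<close>

lemma quot_smult:
  assumes x: "x \<in> carrier M"
  shows "r \<odot>\<^bsub>quotient_module M W\<^esub> (W +> x) = W +> (r \<odot> x)"
proof -
  have "W +> (r \<odot> y) = W +> (r \<odot> x)" if "y \<in> W +> x" for y
  proof -
    have y: "y \<in> carrier M" using coset_carrier[OF that x] .
    have "r \<odot> (y \<ominus> x) \<in> W" using that x y by (auto simp: coset_mem_iff lsub_smult)
    then show ?thesis using x y by (simp add: coset_eq_iff smult_minus)
  qed
  then have "(\<Union>y\<in>W +> x. W +> (r \<odot> y)) = W +> (r \<odot> x)"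
    using coset_self[OF x] by blast
  then show ?thesis by (simp add: quotient_module_def module_of_def)
qed

lemma quot_lmod: "lmod (quotient_module M W)"
proof -
  \<comment> \<open>Writing the zero class as the coset of zero gives every element of the quotient
    the form \<open>W +> x\<close>, and all module laws reduce to laws for representatives.\<close>
  have z: "W = W +> \<zero>" using coset_zero_iff[of \<zero>] lsub_zero by simp
  have z': "\<zero>\<^bsub>quotient_module M W\<^esub> = W +> \<zero>" using quot_zero z by simp
  show ?thesis
    by (rule lmodI; (unfold quot_carrier z')?)
      (auto simp: quot_add quot_smult a_ac smult_r_distr smult_l_distr smult_assoc1)
qed

lemma quot_hom: "(\<lambda>x. W +> x) \<in> module_hom M (quotient_module M W)"
  by (auto simp: module_hom_def quot_carrier quot_add quot_smult)

end

section \<open>Module homomorphisms, kernels and images\<close>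

lemma module_homI:
  assumes "\<And>x. x \<in> carrier M \<Longrightarrow> f x \<in> carrier N"
    and "\<And>x y. x \<in> carrier M \<Longrightarrow> y \<in> carrier M \<Longrightarrow> f (x \<oplus>\<^bsub>M\<^esub> y) = f x \<oplus>\<^bsub>N\<^esub> f y"
    and "\<And>r x. x \<in> carrier M \<Longrightarrow> f (r \<odot>\<^bsub>M\<^esub> x) = r \<odot>\<^bsub>N\<^esub> f x"
  shows "f \<in> module_hom M N"
  using assms by (auto simp: module_hom_def)

lemma hom_carrier: "f \<in> module_hom M N \<Longrightarrow> x \<in> carrier M \<Longrightarrow> f x \<in> carrier N"
  and hom_add: "f \<in> module_hom M N \<Longrightarrow> x \<in> carrier M \<Longrightarrow> y \<in> carrier M \<Longrightarrow>
    f (x \<oplus>\<^bsub>M\<^esub> y) = f x \<oplus>\<^bsub>N\<^esub> f y"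
  and hom_smult: "f \<in> module_hom M N \<Longrightarrow> x \<in> carrier M \<Longrightarrow> f (r \<odot>\<^bsub>M\<^esub> x) = r \<odot>\<^bsub>N\<^esub> f x"
  by (auto simp: module_hom_def)

lemma hom_zero:
  assumes "lmod M" "lmod N" "f \<in> module_hom M N"
  shows "f \<zero>\<^bsub>M\<^esub> = \<zero>\<^bsub>N\<^esub>"
proof -
  interpret M: lmod M by fact
  interpret N: lmod N by fact
  have "f (0 \<odot>\<^bsub>M\<^esub> \<zero>\<^bsub>M\<^esub>) = 0 \<odot>\<^bsub>N\<^esub> f \<zero>\<^bsub>M\<^esub>" by (rule hom_smult[OF assms(3)]) simp
  then show ?thesis using hom_carrier[OF assms(3), of "\<zero>\<^bsub>M\<^esub>"] by simp
qed

lemma hom_uminus: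
  assumes "lmod M" "lmod N" "f \<in> module_hom M N" "x \<in> carrier M"
  shows "f (\<ominus>\<^bsub>M\<^esub> x) = \<ominus>\<^bsub>N\<^esub> f x"
  using lmod.a_inv_smult[OF assms(1,4)] lmod.a_inv_smult[OF assms(2), of "f x"] assms
  by (simp add: hom_smult hom_carrier)

lemma hom_minus:
  assumes "lmod M" "lmod N" "f \<in> module_hom M N" "x \<in> carrier M" "y \<in> carrier M"
  shows "f (x \<ominus>\<^bsub>M\<^esub> y) = f x \<ominus>\<^bsub>N\<^esub> f y"
proof -
  interpret M: lmod M by fact
  interpret N: lmod N by fact
  show ?thesis using assms by (simp add: M.minus_eq N.minus_eq hom_add hom_uminus)
qed

lemma hom_finsum:
  assumes "lmod M" "lmod N" "f \<in> module_hom M N" "g \<in> A \<rightarrow> carrier M"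
  shows "f (finsum M g A) = finsum N (\<lambda>i. f (g i)) A"
proof -
  interpret M: lmod M by fact
  interpret N: lmod N by fact
  show ?thesis using assms(4)
  proof (induction A rule: infinite_finite_induct)
    case (insert x F)
    then have "g \<in> F \<rightarrow> carrier M" "g x \<in> carrier M" by auto
    moreover have "(\<lambda>i. f (g i)) \<in> F \<rightarrow> carrier N" using insert assms(3) by (auto intro: hom_carrier)
    ultimately show ?case using insert assms(3) by (simp add: hom_add hom_carrier)
  qed (use hom_zero[OF assms(1-3)] in auto)
qed

lemma hom_comp:
  "f \<in> module_hom M N \<Longrightarrow> g \<in> module_hom N L \<Longrightarrow> (\<lambda>x. g (f x)) \<in> module_hom M L"
  by (auto simp: module_hom_def Pi_def)

lemma hom_pointwise_minus:
  assumes "lmod M" "lmod N" "f \<in> module_hom M N" "g \<in> module_hom M N"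
  shows "(\<lambda>x. f x \<ominus>\<^bsub>N\<^esub> g x) \<in> module_hom M N"
proof -
  interpret M: lmod M by fact
  interpret N: lmod N by fact
  show ?thesis
    by (rule module_homI) (use assms in \<open>auto simp: hom_add hom_smult hom_carrier N.add_minus_add N.smult_minus\<close>)
qed

lemma a_kernel_eq: "a_kernel M N f = {x \<in> carrier M. f x = \<zero>\<^bsub>N\<^esub>}"
  by (simp add: a_kernel_def kernel_def)

lemma kernel_lsub:
  assumes "lmod M" "lmod N" "f \<in> module_hom M N"
  shows "lsubmodule (a_kernel M N f) M"
proof -
  interpret M: lmod M by fact
  interpret N: lmod N by fact
  show ?thesis unfolding lsubmodule_def a_kernel_eq
    using assms by (auto simp: hom_zero hom_add hom_smult)
qed

lemma image_lsub:
  assumes "lmod M" "lmod N" "f \<in> module_hom M N"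
  shows "lsubmodule (f ` carrier M) N"
proof -
  interpret M: lmod M by fact
  interpret N: lmod N by fact
  have "\<zero>\<^bsub>N\<^esub> = f \<zero>\<^bsub>M\<^esub>" using assms by (simp add: hom_zero)
  then show ?thesis unfolding lsubmodule_def 
    using assms by (auto simp: hom_carrier simp flip: hom_add hom_smult)
qed

section \<open>Finite-dimensional linear algebra\<close>

lemma lookup_map: "f 0 = 0 \<Longrightarrow> Poly_Mapping.lookup (Poly_Mapping.map f p) x = f (Poly_Mapping.lookup p x)"
  by (simp add: Poly_Mapping.map.rep_eq when_def)

text \<open>One operation for two roles: the \<open>B\<close>-action on free modules and the
  \<open>K\<close>-action on coordinate vectors.\<close>

definition pscale :: "'k::ring_1 \<Rightarrow> ('x \<Rightarrow>\<^sub>0 'k) \<Rightarrow> ('x \<Rightarrow>\<^sub>0 'k)" where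
  "pscale c = Poly_Mapping.map (\<lambda>a. c * a)"

lemma lookup_pscale [simp]: "Poly_Mapping.lookup (pscale c p) x = c * Poly_Mapping.lookup p x"
  by (simp add: lookup_map pscale_def)

lemma pscale_zero_right [simp]: "pscale c 0 = 0" and pscale_zero_left [simp]: "pscale 0 p = 0"
  and pscale_one [simp]: "pscale 1 p = p"
  and pscale_single [simp]: "pscale c (Poly_Mapping.single x d) = Poly_Mapping.single x (c * d)"
  by (auto intro!: poly_mapping_eqI simp: lookup_single when_def)

text \<open>Makes the type-based theory of vector spaces (spans, independence, extension of linear
  maps) available for finitely supported families. The carrier-based spaces are compared with this
  one through coordinates.\<close>

interpretation pm: vector_space "pscale :: 'k::field \<Rightarrow> ('x \<Rightarrow>\<^sub>0 'k) \<Rightarrow> _"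
  by unfold_locales (auto intro!: poly_mapping_eqI simp: lookup_add algebra_simps)

text \<open>Spans are inductive sets so that linearity arguments become inductions without finite
  sums; coefficients are extracted only for finite \<open>T\<close>, in
  \<open>lspan_finite_comb\<close>.\<close>

inductive_set lspan :: "('r::ring_1, 'm) module \<Rightarrow> 'm set \<Rightarrow> 'm set"
  for M :: "('r, 'm) module" and T where
  lspan_zero: "\<zero>\<^bsub>M\<^esub> \<in> lspan M T"
| lspan_base: "x \<in> T \<Longrightarrow> x \<in> lspan M T"
| lspan_add: "x \<in> lspan M T \<Longrightarrow> y \<in> lspan M T \<Longrightarrow> x \<oplus>\<^bsub>M\<^esub> y \<in> lspan M T"
| lspan_smult: "x \<in> lspan M T \<Longrightarrow> r \<odot>\<^bsub>M\<^esub> x \<in> lspan M T"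

lemma lspan_least: "lsubmodule W M \<Longrightarrow> T \<subseteq> W \<Longrightarrow> lspan M T \<subseteq> W"
proof
  fix x assume "lsubmodule W M" "T \<subseteq> W" "x \<in> lspan M T"
  from this(3,1,2) show "x \<in> W"
    by (induction rule: lspan.induct) (auto simp: lsubmodule_def)
qed

lemma lmod_carrier_lsub: "lmod M \<Longrightarrow> lsubmodule (carrier M) M"
proof -
  assume "lmod M"
  then interpret lmod M .
  show ?thesis by (auto simp: lsubmodule_def)
qed

lemma lspan_carrier: "lmod M \<Longrightarrow> T \<subseteq> carrier M \<Longrightarrow> lspan M T \<subseteq> carrier M"
  by (simp add: lspan_least lmod_carrier_lsub)

lemma lspan_lsub: "lmod M \<Longrightarrow> T \<subseteq> carrier M \<Longrightarrow> lsubmodule (lspan M T) M"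
  using lspan_carrier[of M T] by (auto simp: lsubmodule_def intro: lspan.intros)

lemma lspan_mono: "T \<subseteq> T' \<Longrightarrow> lspan M T \<subseteq> lspan M T'"
proof
  fix x assume T: "T \<subseteq> T'" and "x \<in> lspan M T"
  from this(2) show "x \<in> lspan M T'"
    by (induction rule: lspan.induct) (use T in \<open>auto intro: lspan.intros\<close>)
qed

lemma lspan_hom_image:
  assumes M: "lmod M" and N: "lmod N" and f: "f \<in> module_hom M N" and T: "T \<subseteq> carrier M"
    and x: "x \<in> lspan M T"
  shows "f x \<in> lspan N (f ` T)"
  using x
proof (induction rule: lspan.induct)
  case lspan_zero
  then show ?case using hom_zero[OF M N f] by (simp add: lspan.lspan_zero)
next
  case (lspan_add x y)
  then have "x \<in> carrier M" "y \<in> carrier M" using lspan_carrier[OF M T] by auto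
  then show ?case using lspan_add.IH by (simp add: hom_add[OF f] lspan.lspan_add)
next
  case (lspan_smult x r)
  then have "x \<in> carrier M" using lspan_carrier[OF M T] by auto
  then show ?case using lspan_smult.IH by (simp add: hom_smult[OF f] lspan.lspan_smult)
qed (auto intro: lspan.lspan_base)

lemma lspan_finite_comb:
  assumes M: "lmod M" and T: "T \<subseteq> carrier M" "finite T" and x: "x \<in> lspan M T"
  shows "\<exists>c. x = (\<Oplus>\<^bsub>M\<^esub>t\<in>T. c t \<odot>\<^bsub>M\<^esub> t)"
proof -
  interpret lmod M by fact
  have cl: "(\<lambda>t. c t \<odot>\<^bsub>M\<^esub> t) \<in> T \<rightarrow> carrier M" for c using T by auto
  show ?thesis using x
  proof (induction rule: lspan.induct)
    case lspan_zero
    have "(\<Oplus>\<^bsub>M\<^esub>t\<in>T. 0 \<odot>\<^bsub>M\<^esub> t) = (\<Oplus>\<^bsub>M\<^esub>t\<in>T. \<zero>\<^bsub>M\<^esub>)" using T by (intro finsum_cong') auto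
    also have "\<dots> = \<zero>\<^bsub>M\<^esub>" by simp
    finally show ?case by (intro exI[of _ "\<lambda>_. 0"]) simp
  next
    case (lspan_base x)
    have "(\<Oplus>\<^bsub>M\<^esub>t\<in>T. (if x = t then 1 else 0) \<odot>\<^bsub>M\<^esub> t) = (\<Oplus>\<^bsub>M\<^esub>t\<in>T. if x = t then t else \<zero>\<^bsub>M\<^esub>)"
      using T by (intro finsum_cong') auto
    also have "\<dots> = x" using finsum_singleton[OF lspan_base T(2), of "\<lambda>t. t"] T by auto
    finally show ?case by (intro exI[of _ "\<lambda>t. if x = t then 1 else 0"]) simp
  next
    case (lspan_add x y)
    then obtain c d where "x = (\<Oplus>\<^bsub>M\<^esub>t\<in>T. c t \<odot>\<^bsub>M\<^esub> t)" "y = (\<Oplus>\<^bsub>M\<^esub>t\<in>T. d t \<odot>\<^bsub>M\<^esub> t)" by blast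
    then have "x \<oplus>\<^bsub>M\<^esub> y = (\<Oplus>\<^bsub>M\<^esub>t\<in>T. c t \<odot>\<^bsub>M\<^esub> t \<oplus>\<^bsub>M\<^esub> d t \<odot>\<^bsub>M\<^esub> t)"
      using finsum_addf[OF cl cl] by simp
    also have "\<dots> = (\<Oplus>\<^bsub>M\<^esub>t\<in>T. (c t + d t) \<odot>\<^bsub>M\<^esub> t)"
      using T by (intro finsum_cong') (auto simp: smult_l_distr)
    finally show ?case by (intro exI[of _ "\<lambda>t. c t + d t"])
  next
    case (lspan_smult x r)
    then obtain c where "x = (\<Oplus>\<^bsub>M\<^esub>t\<in>T. c t \<odot>\<^bsub>M\<^esub> t)" by blast
    then have "r \<odot>\<^bsub>M\<^esub> x = (\<Oplus>\<^bsub>M\<^esub>t\<in>T. r \<odot>\<^bsub>M\<^esub> (c t \<odot>\<^bsub>M\<^esub> t))" using finsum_smult[OF cl, of r c] by simp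
    also have "\<dots> = (\<Oplus>\<^bsub>M\<^esub>t\<in>T. (r * c t) \<odot>\<^bsub>M\<^esub> t)"
      using T by (intro finsum_cong') (auto simp: smult_assoc1)
    finally show ?case by (intro exI[of _ "\<lambda>t. r * c t"])
  qed
qed

lemma lcomb_lspan:
  assumes M: "lmod M" and T: "T \<subseteq> carrier M" "A \<subseteq> T"
  shows "(\<Oplus>\<^bsub>M\<^esub>t\<in>A. c t \<odot>\<^bsub>M\<^esub> t) \<in> lspan M T"
  using T(2) by (intro lsub_finsum[OF M lspan_lsub[OF M T(1)]]) (auto intro: lspan.intros)

section \<open>Independence, bases and dimension\<close>

definition lindependent :: "('k::field, 'v) module \<Rightarrow> 'v set \<Rightarrow> bool" where
  "lindependent V S \<longleftrightarrow> finite S \<and> S \<subseteq> carrier V \<and>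
     (\<forall>c. (\<Oplus>\<^bsub>V\<^esub>s\<in>S. c s \<odot>\<^bsub>V\<^esub> s) = \<zero>\<^bsub>V\<^esub> \<longrightarrow> (\<forall>s\<in>S. c s = 0))"

lemma lindependentD:
  "lindependent V S \<Longrightarrow> (\<Oplus>\<^bsub>V\<^esub>s\<in>S. c s \<odot>\<^bsub>V\<^esub> s) = \<zero>\<^bsub>V\<^esub> \<Longrightarrow> \<forall>s\<in>S. c s = 0"
  by (simp add: lindependent_def)

text \<open>Two coordinate functions of one vector differ by a linear relation on \<open>S\<close>,
  so unique coordinates amount to independence. The restrictions to \<open>S\<close> pick the
  extensional representatives that \<open>finite_basis\<close> asks for.\<close>

lemma finite_basis_iff:
  assumes V: "lmod V"
  shows "finite_basis V S \<longleftrightarrow> lindependent V S \<and> carrier V \<subseteq> lspan V S"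
proof (cases "finite S \<and> S \<subseteq> carrier V")
  case True
  interpret lmod V by fact
  let ?R = "\<lambda>c v. c \<in> S \<rightarrow>\<^sub>E UNIV \<and> v = (\<Oplus>\<^bsub>V\<^esub>s\<in>S. c s \<odot>\<^bsub>V\<^esub> s)"
  have cl: "(\<lambda>t. c t \<odot>\<^bsub>V\<^esub> t) \<in> S \<rightarrow> carrier V" for c using True by auto
  have res: "(\<Oplus>\<^bsub>V\<^esub>s\<in>S. restrict c S s \<odot>\<^bsub>V\<^esub> s) = (\<Oplus>\<^bsub>V\<^esub>s\<in>S. c s \<odot>\<^bsub>V\<^esub> s)" for c
    using cl by (intro finsum_cong') auto
  show ?thesis
  proof
    assume B: "finite_basis V S"
    then have ex: "\<exists>!c. ?R c v" if "v \<in> carrier V" for v using that by (simp add: finite_basis_def)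
    have "carrier V \<subseteq> lspan V S"
    proof
      fix v assume "v \<in> carrier V"
      then obtain c where "?R c v" using ex by blast
      then show "v \<in> lspan V S" using lcomb_lspan[OF V, of S S c] True by simp
    qed
    moreover have "lindependent V S" unfolding lindependent_def
    proof (intro conjI allI impI)
      fix c assume c: "(\<Oplus>\<^bsub>V\<^esub>s\<in>S. c s \<odot>\<^bsub>V\<^esub> s) = \<zero>\<^bsub>V\<^esub>"
      have "(\<Oplus>\<^bsub>V\<^esub>s\<in>S. 0 \<odot>\<^bsub>V\<^esub> s) = (\<Oplus>\<^bsub>V\<^esub>s\<in>S. \<zero>\<^bsub>V\<^esub>)" using True by (intro finsum_cong') auto
      then have "?R (restrict (\<lambda>s. 0) S) \<zero>\<^bsub>V\<^esub>" using res[of "\<lambda>s. 0"] by auto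
      moreover have "?R (restrict c S) \<zero>\<^bsub>V\<^esub>" using res[of c] c by auto
      ultimately have "restrict c S = restrict (\<lambda>s. 0) S" using ex[of "\<zero>\<^bsub>V\<^esub>"] by blast
      then show "\<forall>s\<in>S. c s = 0" by (metis restrict_apply')
    qed (use True in auto)
    ultimately show "lindependent V S \<and> carrier V \<subseteq> lspan V S" by blast
  next
    assume I: "lindependent V S \<and> carrier V \<subseteq> lspan V S"
    show "finite_basis V S" unfolding finite_basis_def
    proof (intro conjI ballI)
      fix v assume "v \<in> carrier V"
      then obtain c where c: "v = (\<Oplus>\<^bsub>V\<^esub>s\<in>S. c s \<odot>\<^bsub>V\<^esub> s)"
        using I lspan_finite_comb[OF V] True by blast
      show "\<exists>!c. ?R c v"
      proof (rule ex1I)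
        show "?R (restrict c S) v" using c res[of c] by auto
        fix d assume d: "?R d v"
        have "(\<Oplus>\<^bsub>V\<^esub>s\<in>S. (d s - c s) \<odot>\<^bsub>V\<^esub> s) = (\<Oplus>\<^bsub>V\<^esub>s\<in>S. d s \<odot>\<^bsub>V\<^esub> s \<oplus>\<^bsub>V\<^esub> (- 1) \<odot>\<^bsub>V\<^esub> (c s \<odot>\<^bsub>V\<^esub> s))"
          using True by (intro finsum_cong') (auto simp: smult_diff minus_eq a_inv_smult)
        also have "\<dots> = v \<oplus>\<^bsub>V\<^esub> (\<Oplus>\<^bsub>V\<^esub>s\<in>S. (- 1) \<odot>\<^bsub>V\<^esub> (c s \<odot>\<^bsub>V\<^esub> s))"
          using d True by (subst finsum_addf) auto
        also have "\<dots> = v \<oplus>\<^bsub>V\<^esub> (- 1) \<odot>\<^bsub>V\<^esub> v"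
          using finsum_smult[OF cl, of "-1" c] c by simp
        also have "\<dots> = \<zero>\<^bsub>V\<^esub>" using \<open>v \<in> carrier V\<close> a_inv_smult[of v] r_neg[of v] by simp
        finally have "\<forall>s\<in>S. d s - c s = 0"
          using lindependentD[OF conjunct1[OF I], of "\<lambda>s. d s - c s"] by simp
        then show "d = restrict c S" using d by (auto simp: PiE_iff extensional_def)
      qed
    qed (use True in auto)
  qed
qed (auto simp: finite_basis_def lindependent_def)

text \<open>Stated for families because \<open>vec\<close> will be the coordinate map of an abstract
  independent set. Its injectivity is itself a consequence of independence, since
  \<open>vec s = vec t\<close> gives a relation with coefficients 1 and -1.\<close>

lemma pm_family_card_le:
  fixes vec :: "'s \<Rightarrow> ('x \<Rightarrow>\<^sub>0 'k::field)"
  assumes S: "finite S" and C: "finite C" and sp: "vec ` S \<subseteq> pm.span C"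
    and ind: "\<And>u. (\<Sum>s\<in>S. pscale (u s) (vec s)) = 0 \<Longrightarrow> \<forall>s\<in>S. u s = 0"
  shows "card S \<le> card C"
proof -
  have inj: "inj_on vec S"
  proof (rule inj_onI, rule ccontr)
    fix s t assume st: "s \<in> S" "t \<in> S" "vec s = vec t" "s \<noteq> t"
    let ?u = "\<lambda>r. if r = s then 1 else if r = t then - 1 else (0::'k)"
    have "(\<Sum>r\<in>S. pscale (?u r) (vec r)) = (\<Sum>r\<in>{s,t}. pscale (?u r) (vec r))"
      using S st by (intro sum.mono_neutral_right) auto
    also have "\<dots> = 0" using st by (auto intro!: poly_mapping_eqI simp: lookup_add)
    finally show False using ind[of ?u] st(1) by auto
  qed
  have "pm.independent (vec ` S)"
  proof -
    have "u v = 0" if "(\<Sum>v\<in>vec ` S. pscale (u v) v) = 0" "v \<in> vec ` S" for u v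
      using ind[of "u \<circ> vec"] that by (auto simp: sum.reindex[OF inj])
    then show ?thesis using pm.dependent_finite[of "vec ` S"] S by blast
  qed
  then have "card (vec ` S) \<le> card C" using pm.independent_span_bound[OF C _ sp] by blast
  then show ?thesis by (simp add: card_image[OF inj])
qed

lemma pm_in_span_single: "finite T \<Longrightarrow> (\<Sum>t\<in>T. Poly_Mapping.single t (c t)) \<in> pm.span ((\<lambda>t. Poly_Mapping.single t (1::'k::field)) ` T)"
proof (rule pm.span_sum)
  fix t assume "t \<in> T"
  then have "pscale (c t) (Poly_Mapping.single t 1) \<in> pm.span ((\<lambda>t. Poly_Mapping.single t (1::'k::field)) ` T)"
    by (intro pm.span_scale pm.span_base) auto
  then show "Poly_Mapping.single t (c t) \<in> pm.span ((\<lambda>t. Poly_Mapping.single t (1::'k::field)) ` T)"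
    by simp
qed

lemma lookup_sum_single: "finite T \<Longrightarrow> Poly_Mapping.lookup (\<Sum>t\<in>T. Poly_Mapping.single t (c t)) x = (if x \<in> T then c x else 0)"
  by (simp add: lookup_sum lookup_single when_def)

lemma quot_cases:
  assumes "lmod M" "lsubmodule W M" "A \<in> carrier (quotient_module M W)"
  obtains x where "x \<in> carrier M" "A = W +>\<^bsub>M\<^esub> x"
  using assms by (auto simp: quot_carrier)

text \<open>Steinitz's bound. The coordinates \<open>m s t\<close> are chosen arbitrarily, as
  \<open>T\<close> may be dependent; the evaluation map \<open>\<rho>\<close> sends each coordinate
  vector back to its element, so a relation between the coordinate vectors is a relation in
  \<open>S\<close>.\<close>

lemma lindependent_card_le:
  fixes V :: "('k::field, 'v) module"
  assumes V: "lmod V" and S: "lindependent V S" and T: "finite T" "T \<subseteq> carrier V" "S \<subseteq> lspan V T"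
  shows "card S \<le> card T"
proof -
  interpret lmod V by fact
  have "\<forall>s\<in>S. \<exists>c. s = (\<Oplus>\<^bsub>V\<^esub>t\<in>T. c t \<odot>\<^bsub>V\<^esub> t)"
    using lspan_finite_comb[OF V T(2,1)] T by blast
  then obtain m where m: "\<And>s. s \<in> S \<Longrightarrow> s = (\<Oplus>\<^bsub>V\<^esub>t\<in>T. m s t \<odot>\<^bsub>V\<^esub> t)" by metis
  define vec where "vec s = (\<Sum>t\<in>T. Poly_Mapping.single t (m s t))" for s
  define \<rho> where "\<rho> p = (\<Oplus>\<^bsub>V\<^esub>t\<in>T. Poly_Mapping.lookup p t \<odot>\<^bsub>V\<^esub> t)" for p :: "'v \<Rightarrow>\<^sub>0 'k"
  have cl: "(\<lambda>t. c t \<odot>\<^bsub>V\<^esub> t) \<in> T \<rightarrow> carrier V" for c using T by auto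
  have \<rho>_vec: "\<rho> (vec s) = s" if "s \<in> S" for s
    unfolding \<rho>_def vec_def using m[OF that] T cl
    by (simp add: lookup_sum_single cong: finsum_cong)
  have \<rho>_car: "\<rho> p \<in> carrier V" for p unfolding \<rho>_def using cl by (rule finsum_closed)
  have \<rho>_add: "\<rho> (p + q) = \<rho> p \<oplus>\<^bsub>V\<^esub> \<rho> q" for p q
  proof -
    have "\<rho> (p + q) = (\<Oplus>\<^bsub>V\<^esub>t\<in>T. Poly_Mapping.lookup p t \<odot>\<^bsub>V\<^esub> t \<oplus>\<^bsub>V\<^esub> Poly_Mapping.lookup q t \<odot>\<^bsub>V\<^esub> t)"
      unfolding \<rho>_def using T by (intro finsum_cong') (auto simp: lookup_add smult_l_distr)
    then show ?thesis using finsum_addf[OF cl cl] by (simp add: \<rho>_def)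
  qed
  have \<rho>_smult: "\<rho> (pscale c p) = c \<odot>\<^bsub>V\<^esub> \<rho> p" for c p
  proof -
    have "\<rho> (pscale c p) = (\<Oplus>\<^bsub>V\<^esub>t\<in>T. c \<odot>\<^bsub>V\<^esub> (Poly_Mapping.lookup p t \<odot>\<^bsub>V\<^esub> t))"
      unfolding \<rho>_def using T by (intro finsum_cong') (auto simp: smult_assoc1)
    then show ?thesis using finsum_smult[OF cl, of c] by (simp add: \<rho>_def)
  qed
  have \<rho>_0: "\<rho> 0 = \<zero>\<^bsub>V\<^esub>" using \<rho>_smult[of 0 0] \<rho>_car[of 0] by simp
  have \<rho>_sum: "\<rho> (\<Sum>s\<in>A. pscale (u s) (vec s)) = (\<Oplus>\<^bsub>V\<^esub>s\<in>A. u s \<odot>\<^bsub>V\<^esub> \<rho> (vec s))" if fin: "finite A" for A u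
    using fin
  proof (induction A rule: finite_induct)
    case empty
    then show ?case using \<rho>_0 by simp
  next
    case (insert x F)
    then show ?case by (subst finsum_insert) (auto simp: \<rho>_add \<rho>_smult \<rho>_car)
  qed
  have fS: "finite S" "S \<subseteq> carrier V" using S by (auto simp: lindependent_def)
  have "card S \<le> card ((\<lambda>t. Poly_Mapping.single t (1::'k)) ` T)"
  proof (rule pm_family_card_le[where vec = vec])
    show "vec ` S \<subseteq> pm.span ((\<lambda>t. Poly_Mapping.single t (1::'k)) ` T)"
      using pm_in_span_single[OF T(1)] by (auto simp: vec_def)
    fix u assume "(\<Sum>s\<in>S. pscale (u s) (vec s)) = 0"
    then have "(\<Oplus>\<^bsub>V\<^esub>s\<in>S. u s \<odot>\<^bsub>V\<^esub> \<rho> (vec s)) = \<zero>\<^bsub>V\<^esub>"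
      using \<rho>_sum[OF fS(1), of u] \<rho>_0 by simp
    moreover have "(\<Oplus>\<^bsub>V\<^esub>s\<in>S. u s \<odot>\<^bsub>V\<^esub> \<rho> (vec s)) = (\<Oplus>\<^bsub>V\<^esub>s\<in>S. u s \<odot>\<^bsub>V\<^esub> s)"
      using fS by (intro finsum_cong') (auto simp: \<rho>_vec)
    ultimately show "\<forall>s\<in>S. u s = 0" using S by (simp add: lindependent_def)
  qed (use fS T in auto)
  also have "\<dots> \<le> card T" using card_image_le T by blast
  finally show ?thesis .
qed

text \<open>\<open>vdim\<close> measures an arbitrarily chosen basis; bounding each of two bases by
  the other shows that the choice does not matter.\<close>

lemma vdim_eq_card:
  assumes V: "lmod V" and S: "finite_basis V S"
  shows "vdim V = card S"
proof -
  let ?S = "SOME S. finite_basis V S"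
  have S': "finite_basis V ?S" using S by (rule someI)
  have *: "lindependent V S" "carrier V \<subseteq> lspan V S" "lindependent V ?S" "carrier V \<subseteq> lspan V ?S"
    using S S' finite_basis_iff[OF V] by auto
  have "finite S" "S \<subseteq> carrier V" "finite ?S" "?S \<subseteq> carrier V"
    using *(1,3) by (auto simp: lindependent_def)
  then have "card S \<le> card ?S" "card ?S \<le> card S"
    using lindependent_card_le[OF V] * by (meson subset_trans)+
  then show ?thesis by (simp add: vdim_def)
qed

lemma lspan_drop:
  assumes V: "lmod V" and T: "finite T" "T \<subseteq> carrier V" and t: "t \<in> T" "c t \<noteq> (0::'k::field)"
    and z: "(\<Oplus>\<^bsub>V\<^esub>s\<in>T. c s \<odot>\<^bsub>V\<^esub> s) = \<zero>\<^bsub>V\<^esub>"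
  shows "t \<in> lspan V (T - {t})"
proof -
  interpret lmod V by fact
  let ?y = "\<Oplus>\<^bsub>V\<^esub>s\<in>T - {t}. c s \<odot>\<^bsub>V\<^esub> s"
  have tc: "t \<in> carrier V" using t T by auto
  have y: "?y \<in> lspan V (T - {t})" using lcomb_lspan[OF V, of "T - {t}" "T - {t}" c] T by auto
  have yc: "?y \<in> carrier V" using y lspan_carrier[OF V, of "T - {t}"] T by auto
  have "(\<Oplus>\<^bsub>V\<^esub>s\<in>insert t (T - {t}). c s \<odot>\<^bsub>V\<^esub> s) = c t \<odot>\<^bsub>V\<^esub> t \<oplus>\<^bsub>V\<^esub> ?y"
    using T tc by (intro finsum_insert) auto
  then have "c t \<odot>\<^bsub>V\<^esub> t \<oplus>\<^bsub>V\<^esub> ?y = \<zero>\<^bsub>V\<^esub>" using z t by (simp add: insert_absorb)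
  then have "c t \<odot>\<^bsub>V\<^esub> t = (- 1) \<odot>\<^bsub>V\<^esub> ?y"
    using minus_equality[of "c t \<odot>\<^bsub>V\<^esub> t" ?y] tc yc by (simp add: a_inv_smult)
  then have "t = (inverse (c t)) \<odot>\<^bsub>V\<^esub> ((- 1) \<odot>\<^bsub>V\<^esub> ?y)"
    using t smult_assoc1[OF tc, of "inverse (c t)" "c t"] tc by simp
  moreover have "(inverse (c t)) \<odot>\<^bsub>V\<^esub> ((- 1) \<odot>\<^bsub>V\<^esub> ?y) \<in> lspan V (T - {t})"
    using y by (intro lspan.lspan_smult)
  ultimately show ?thesis by simp
qed

text \<open>A dependent spanning set can lose a vector that occurs with nonzero coefficient in a
  relation and still span; induction on proper subsets stops at a basis.\<close>

lemma spanning_contains_basis: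
  fixes V :: "('k::field, 'v) module"
  assumes V: "lmod V" and T: "finite T" "T \<subseteq> carrier V" "carrier V \<subseteq> lspan V T"
  shows "\<exists>S\<subseteq>T. finite_basis V S"
  using T
proof (induction T rule: finite_psubset_induct)
  case (psubset T)
  show ?case
  proof (cases "lindependent V T")
    case True
    then show ?thesis using psubset.prems finite_basis_iff[OF V] by blast
  next
    case False
    then obtain c t where ct: "(\<Oplus>\<^bsub>V\<^esub>s\<in>T. c s \<odot>\<^bsub>V\<^esub> s) = \<zero>\<^bsub>V\<^esub>" "t \<in> T" "c t \<noteq> 0"
      using psubset by (auto simp: lindependent_def)
    then have "t \<in> lspan V (T - {t})" using lspan_drop[OF V] psubset by blast
    then have "T \<subseteq> lspan V (T - {t})" by (auto intro: lspan.lspan_base)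
    then have "lspan V T \<subseteq> lspan V (T - {t})"
      by (rule lspan_least[OF lspan_lsub[OF V], rotated]) (use psubset.prems in auto)
    then show ?thesis using psubset.IH[of "T - {t}"] ct psubset.prems by blast
  qed
qed

lemma fin_dim_spanned:
  fixes V :: "('k::field, 'v) module"
  assumes V: "lmod V" and T: "finite T" "T \<subseteq> carrier V" "carrier V \<subseteq> lspan V T"
  shows "fin_dim V \<and> vdim V \<le> card T"
proof -
  obtain S where S: "S \<subseteq> T" "finite_basis V S" using spanning_contains_basis[OF assms] by blast
  then show ?thesis using vdim_eq_card[OF V S(2)] card_mono[OF T(1) S(1)] by (auto simp: fin_dim_def)
qed

lemma fin_dim_basis:
  assumes V: "lmod V" and "fin_dim V"
  shows "\<exists>S. finite S \<and> S \<subseteq> carrier V \<and> lindependent V S \<and> carrier V \<subseteq> lspan V S \<and> vdim V = card S"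
proof -
  obtain S where S: "finite_basis V S" using assms by (auto simp: fin_dim_def)
  then show ?thesis using vdim_eq_card[OF V S] finite_basis_iff[OF V, of S]
    unfolding lindependent_def by blast
qed

lemma fin_dim_surj:
  assumes V: "lmod V" and W: "lmod W" and g: "g \<in> module_hom V W" and onto: "g ` carrier V = carrier W"
    and fd: "fin_dim V"
  shows "fin_dim W \<and> vdim W \<le> vdim V"
proof -
  from fin_dim_basis[OF V fd] obtain S where S': "finite S \<and> S \<subseteq> carrier V \<and> lindependent V S \<and> carrier V \<subseteq> lspan V S \<and> vdim V = card S" ..
  have S: "finite S" "S \<subseteq> carrier V" "carrier V \<subseteq> lspan V S" "vdim V = card S"
    using S' by simp_all
  have "carrier W \<subseteq> lspan W (g ` S)"
  proof
    fix w assume "w \<in> carrier W"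
    then obtain v where v: "v \<in> carrier V" "w = g v" using onto by auto
    then show "w \<in> lspan W (g ` S)" using lspan_hom_image[OF V W g S(2), of v] S(3) by auto
  qed
  moreover have "g ` S \<subseteq> carrier W" using S onto by auto
  ultimately have "fin_dim W \<and> vdim W \<le> card (g ` S)"
    using fin_dim_spanned[OF W] S(1) by blast
  then show ?thesis using card_image_le[OF S(1), of g] S(4) by simp
qed

lemma vdim_direct_sum:
  fixes V :: "('k::field, 'v) module"
  assumes V: "lmod V" and U: "lsubmodule U V" and W: "lsubmodule W V"
    and sum: "\<And>v. v \<in> carrier V \<Longrightarrow> \<exists>u\<in>U. \<exists>w\<in>W. v = u \<oplus>\<^bsub>V\<^esub> w"
    and int: "U \<inter> W \<subseteq> {\<zero>\<^bsub>V\<^esub>}"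
    and fU: "fin_dim (V\<lparr>carrier := U\<rparr>)" and fW: "fin_dim (V\<lparr>carrier := W\<rparr>)"
  shows "fin_dim V \<and> vdim V = vdim (V\<lparr>carrier := U\<rparr>) + vdim (V\<lparr>carrier := W\<rparr>)"
proof -
  interpret lmod V by fact
  note lU = lsub_lmod[OF V U] and lW = lsub_lmod[OF V W]
  obtain S where S: "finite S" "S \<subseteq> U" "lindependent (V\<lparr>carrier := U\<rparr>) S"
      "U \<subseteq> lspan (V\<lparr>carrier := U\<rparr>) S" "vdim (V\<lparr>carrier := U\<rparr>) = card S"
    using fin_dim_basis[OF lU fU] 
    by (elim exE conjE) (rule that; simp)
  obtain T where T: "finite T" "T \<subseteq> W" "lindependent (V\<lparr>carrier := W\<rparr>) T"
      "W \<subseteq> lspan (V\<lparr>carrier := W\<rparr>) T" "vdim (V\<lparr>carrier := W\<rparr>) = card T"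
    using fin_dim_basis[OF lW fW] 
    by (elim exE conjE) (rule that; simp)
  have Uc: "U \<subseteq> carrier V" and Wc: "W \<subseteq> carrier V" using U W by (auto simp: lsubmodule_def)
  have STc: "S \<subseteq> carrier V" "T \<subseteq> carrier V" using S T Uc Wc by auto
  have sub: "lspan (V\<lparr>carrier := X\<rparr>) R \<subseteq> lspan V R" for X R
  proof
    fix x assume "x \<in> lspan (V\<lparr>carrier := X\<rparr>) R"
    then show "x \<in> lspan V R"
      by (induction rule: lspan.induct) (auto intro: lspan.intros)
  qed
  have cU: "(\<lambda>s. c s \<odot>\<^bsub>V\<^esub> s) \<in> S \<rightarrow> U" and cW: "(\<lambda>s. c s \<odot>\<^bsub>V\<^esub> s) \<in> T \<rightarrow> W" for c
    using S T U W by (auto simp: lsubmodule_def)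
  have inS: "(\<Oplus>\<^bsub>V\<^esub>s\<in>S. c s \<odot>\<^bsub>V\<^esub> s) = \<zero>\<^bsub>V\<^esub> \<Longrightarrow> \<forall>s\<in>S. c s = 0" for c
    using S(3) lsub_finsum_eq[OF V U cU, of c] by (simp add: lindependent_def)
  have inT: "(\<Oplus>\<^bsub>V\<^esub>s\<in>T. c s \<odot>\<^bsub>V\<^esub> s) = \<zero>\<^bsub>V\<^esub> \<Longrightarrow> \<forall>s\<in>T. c s = 0" for c
    using T(3) lsub_finsum_eq[OF V W cW, of c] by (simp add: lindependent_def)
  \<comment> \<open>A common element would lie in \<open>U \<inter> W\<close>, hence be zero, and
    zero cannot belong to an independent set: its own coefficient could be 1.\<close>
  have disj: "S \<inter> T = {}"
  proof (rule ccontr)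
    assume "S \<inter> T \<noteq> {}"
    then obtain z where z: "z \<in> S" "z \<in> T" by auto
    then have "z = \<zero>\<^bsub>V\<^esub>" using S T int by auto
    then have "(\<Oplus>\<^bsub>V\<^esub>s\<in>S. (if z = s then 1 else 0) \<odot>\<^bsub>V\<^esub> s) = (\<Oplus>\<^bsub>V\<^esub>s\<in>S. \<zero>\<^bsub>V\<^esub>)"
      using STc by (intro finsum_cong') auto
    then have "\<forall>s\<in>S. (if z = s then 1 else 0) = (0::'k)"
      by (intro inS[where c = "\<lambda>s. if z = s then 1 else 0"]) simp
    then show False using z(1) by auto
  qed
  have "lindependent V (S \<union> T)" unfolding lindependent_def
  proof (intro conjI allI impI)
    fix c assume "(\<Oplus>\<^bsub>V\<^esub>s\<in>S \<union> T. c s \<odot>\<^bsub>V\<^esub> s) = \<zero>\<^bsub>V\<^esub>"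
    moreover have "(\<Oplus>\<^bsub>V\<^esub>s\<in>S \<union> T. c s \<odot>\<^bsub>V\<^esub> s) = (\<Oplus>\<^bsub>V\<^esub>s\<in>S. c s \<odot>\<^bsub>V\<^esub> s) \<oplus>\<^bsub>V\<^esub> (\<Oplus>\<^bsub>V\<^esub>s\<in>T. c s \<odot>\<^bsub>V\<^esub> s)"
      using S(1) T(1) disj STc by (intro finsum_Un_disjoint) auto
    ultimately have z: "(\<Oplus>\<^bsub>V\<^esub>s\<in>S. c s \<odot>\<^bsub>V\<^esub> s) \<oplus>\<^bsub>V\<^esub> (\<Oplus>\<^bsub>V\<^esub>s\<in>T. c s \<odot>\<^bsub>V\<^esub> s) = \<zero>\<^bsub>V\<^esub>" by simp
    have a: "(\<Oplus>\<^bsub>V\<^esub>s\<in>S. c s \<odot>\<^bsub>V\<^esub> s) \<in> U" by (rule lsub_finsum[OF V U cU])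
    have b: "(\<Oplus>\<^bsub>V\<^esub>s\<in>T. c s \<odot>\<^bsub>V\<^esub> s) \<in> W" by (rule lsub_finsum[OF V W cW])
    \<comment> \<open>The relation splits into two sums that are negatives of each other, so both
      lie in \<open>U \<inter> W\<close> and vanish.\<close>
    have "(\<Oplus>\<^bsub>V\<^esub>s\<in>S. c s \<odot>\<^bsub>V\<^esub> s) = \<ominus>\<^bsub>V\<^esub> (\<Oplus>\<^bsub>V\<^esub>s\<in>T. c s \<odot>\<^bsub>V\<^esub> s)"
      by (rule minus_equality[symmetric]) (use z a b Uc Wc in auto)
    then have "(\<Oplus>\<^bsub>V\<^esub>s\<in>S. c s \<odot>\<^bsub>V\<^esub> s) \<in> W" using lsub_uminus[OF V W b] by simp
    then have 1: "(\<Oplus>\<^bsub>V\<^esub>s\<in>S. c s \<odot>\<^bsub>V\<^esub> s) = \<zero>\<^bsub>V\<^esub>" using a int by auto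
    then have 2: "(\<Oplus>\<^bsub>V\<^esub>s\<in>T. c s \<odot>\<^bsub>V\<^esub> s) = \<zero>\<^bsub>V\<^esub>" using z b Wc by auto
    show "\<forall>s\<in>S \<union> T. c s = 0" using inS[OF 1] inT[OF 2] by auto
  qed (use S T STc in auto)
  moreover have "carrier V \<subseteq> lspan V (S \<union> T)"
  proof
    fix v assume "v \<in> carrier V"
    then obtain u w where uw: "u \<in> U" "w \<in> W" "v = u \<oplus>\<^bsub>V\<^esub> w" using sum by blast
    have "u \<in> lspan V (S \<union> T)" "w \<in> lspan V (S \<union> T)"
      using uw S(4) T(4) sub lspan_mono[of S "S \<union> T" V] lspan_mono[of T "S \<union> T" V] by blast+
    then show "v \<in> lspan V (S \<union> T)" using uw by (simp add: lspan.lspan_add)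
  qed
  ultimately have B: "finite_basis V (S \<union> T)" using finite_basis_iff[OF V] by blast
  show ?thesis using vdim_eq_card[OF V B] B S T disj by (auto simp: fin_dim_def card_Un_disjoint)
qed

lemma lindependent_insert:
  fixes V :: "('k::field, 'v) module"
  assumes V: "lmod V" and T: "lindependent V T" and z: "z \<in> carrier V" "z \<notin> lspan V T"
  shows "lindependent V (insert z T)"
  unfolding lindependent_def
proof (intro conjI allI impI)
  interpret lmod V by fact
  have zT: "z \<notin> T" using z by (auto intro: lspan.lspan_base)
  have T': "finite T" "T \<subseteq> carrier V" using T by (auto simp: lindependent_def)
  then show "finite (insert z T)" "insert z T \<subseteq> carrier V" using z by auto
  fix c assume *: "(\<Oplus>\<^bsub>V\<^esub>s\<in>insert z T. c s \<odot>\<^bsub>V\<^esub> s) = \<zero>\<^bsub>V\<^esub>"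
  have cz: "c z = 0"
  proof (rule ccontr)
    assume "c z \<noteq> 0"
    then have "z \<in> lspan V (insert z T - {z})" by (intro lspan_drop[OF V _ _ _ _ *]) (use z T' in auto)
    then show False using zT z by simp
  qed
  have "(\<Oplus>\<^bsub>V\<^esub>s\<in>insert z T. c s \<odot>\<^bsub>V\<^esub> s) = c z \<odot>\<^bsub>V\<^esub> z \<oplus>\<^bsub>V\<^esub> (\<Oplus>\<^bsub>V\<^esub>s\<in>T. c s \<odot>\<^bsub>V\<^esub> s)"
    using T' z zT by (intro finsum_insert) auto
  moreover have "(\<Oplus>\<^bsub>V\<^esub>s\<in>T. c s \<odot>\<^bsub>V\<^esub> s) \<in> carrier V" using T' by (intro finsum_closed) auto
  ultimately have "(\<Oplus>\<^bsub>V\<^esub>s\<in>T. c s \<odot>\<^bsub>V\<^esub> s) = \<zero>\<^bsub>V\<^esub>" using * cz z by simp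
  then show "\<forall>s\<in>insert z T. c s = 0" using T cz by (simp add: lindependent_def)
qed

text \<open>An independent set of largest size spans, since any vector outside its span could be
  added. This gives dimension bounds where no finite spanning set is at hand, as for subspaces and
  for the second factor of a pairing.\<close>

lemma bounded_independent_fin_dim:
  fixes V :: "('k::field, 'v) module"
  assumes V: "lmod V" and bd: "\<And>T. lindependent V T \<Longrightarrow> card T \<le> n"
  shows "fin_dim V \<and> vdim V \<le> n"
proof -
  interpret lmod V by fact
  have "lindependent V {}" by (simp add: lindependent_def)
  then obtain T where T: "lindependent V T" "\<And>T'. lindependent V T' \<Longrightarrow> card T' \<le> card T"
    using ex_has_greatest_nat[of "lindependent V" "{}" card "Suc n"] bd le_imp_less_Suc by metis
  have "carrier V \<subseteq> lspan V T"
  proof (rule ccontr)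
    assume "\<not> carrier V \<subseteq> lspan V T"
    then obtain z where z: "z \<in> carrier V" "z \<notin> lspan V T" by auto
    then have "card (insert z T) \<le> card T" using T(2) lindependent_insert[OF V T(1)] by blast
    moreover have "z \<notin> T" "finite T" using z T by (auto intro: lspan.lspan_base simp: lindependent_def)
    ultimately show False by simp
  qed
  then have "finite_basis V T" using T finite_basis_iff[OF V] by blast
  then show ?thesis using vdim_eq_card[OF V] bd[OF T(1)] by (auto simp: fin_dim_def)
qed

section \<open>Pairings between vector spaces\<close>

locale bilinear_pairing = V: lmod V + N: lmod N
  for V :: "('k::field, 'v) module" and N :: "('k, 'n) module" +
  fixes \<beta> :: "'v \<Rightarrow> 'n \<Rightarrow> 'k"
  assumes add_l: "f \<in> carrier V \<Longrightarrow> g \<in> carrier V \<Longrightarrow> z \<in> carrier N \<Longrightarrow> \<beta> (f \<oplus>\<^bsub>V\<^esub> g) z = \<beta> f z + \<beta> g z"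
    and smult_l: "f \<in> carrier V \<Longrightarrow> z \<in> carrier N \<Longrightarrow> \<beta> (c \<odot>\<^bsub>V\<^esub> f) z = c * \<beta> f z"
    and add_r: "f \<in> carrier V \<Longrightarrow> y \<in> carrier N \<Longrightarrow> z \<in> carrier N \<Longrightarrow> \<beta> f (y \<oplus>\<^bsub>N\<^esub> z) = \<beta> f y + \<beta> f z"
    and smult_r: "f \<in> carrier V \<Longrightarrow> z \<in> carrier N \<Longrightarrow> \<beta> f (c \<odot>\<^bsub>N\<^esub> z) = c * \<beta> f z"
begin

text \<open>Lets the one-sided bound \<open>fin_dim_right\<close> be applied in both
  directions.\<close>

lemma flip: "bilinear_pairing N V (\<lambda>z f. \<beta> f z)"
  by unfold_locales (auto simp: add_l add_r smult_l smult_r)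

lemma zero_l: "z \<in> carrier N \<Longrightarrow> \<beta> \<zero>\<^bsub>V\<^esub> z = 0"
  using smult_l[of "\<zero>\<^bsub>V\<^esub>" z 0] by simp

lemma zero_r: "f \<in> carrier V \<Longrightarrow> \<beta> f \<zero>\<^bsub>N\<^esub> = 0"
  using smult_r[of f "\<zero>\<^bsub>N\<^esub>" 0] by simp

lemma minus_l: "f \<in> carrier V \<Longrightarrow> g \<in> carrier V \<Longrightarrow> z \<in> carrier N \<Longrightarrow> \<beta> (f \<ominus>\<^bsub>V\<^esub> g) z = \<beta> f z - \<beta> g z"
  using smult_l[of g z "- 1"] by (simp add: V.minus_eq V.a_inv_smult add_l)

lemma minus_r: "f \<in> carrier V \<Longrightarrow> y \<in> carrier N \<Longrightarrow> z \<in> carrier N \<Longrightarrow> \<beta> f (y \<ominus>\<^bsub>N\<^esub> z) = \<beta> f y - \<beta> f z"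
  using smult_r[of f z "- 1"] by (simp add: N.minus_eq N.a_inv_smult add_r)

text \<open>Evaluation against a basis \<open>S\<close> of \<open>V\<close> is an injective linear
  map \<open>\<Phi>\<close> from \<open>N\<close> to coordinate vectors on \<open>S\<close>, so
  independent sets of \<open>N\<close> have at most \<open>card S\<close> elements.\<close>

lemma fin_dim_right:
  assumes fd: "fin_dim V"
    and nd: "\<And>z. z \<in> carrier N \<Longrightarrow> (\<And>f. f \<in> carrier V \<Longrightarrow> \<beta> f z = 0) \<Longrightarrow> z = \<zero>\<^bsub>N\<^esub>"
  shows "fin_dim N \<and> vdim N \<le> vdim V"
proof -
  have V: "lmod V" and N: "lmod N" by unfold_locales
  from fin_dim_basis[OF V fd] obtain S where S': "finite S \<and> S \<subseteq> carrier V \<and> lindependent V S \<and> carrier V \<subseteq> lspan V S \<and> vdim V = card S" ..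
  have S: "finite S" "S \<subseteq> carrier V" "carrier V \<subseteq> lspan V S" "vdim V = card S"
    using S' by simp_all
  define \<Phi> where "\<Phi> z = (\<Sum>s\<in>S. Poly_Mapping.single s (\<beta> s z))" for z
  have lk: "Poly_Mapping.lookup (\<Phi> z) s = (if s \<in> S then \<beta> s z else 0)" for z s
    using lookup_sum_single[OF S(1), of "\<lambda>s. \<beta> s z" s] by (simp only: \<Phi>_def)
  have ker: "z = \<zero>\<^bsub>N\<^esub>" if z: "z \<in> carrier N" "\<Phi> z = 0" for z
  proof (rule nd[OF z(1)])
    fix f assume "f \<in> carrier V"
    then have "f \<in> lspan V S" using S by auto
    then show "\<beta> f z = 0"
    proof (induction rule: lspan.induct)
      case (lspan_base s)
      then show ?case using lk[of z s] z(2) by simp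
    next
      case (lspan_add f g)
      then have "f \<in> carrier V" "g \<in> carrier V" using lspan_carrier[OF V S(2)] by auto
      then show ?case using z add_l lspan_add.IH by simp
    next
      case (lspan_smult f c)
      then have "f \<in> carrier V" using lspan_carrier[OF V S(2)] by auto
      then show ?case using z smult_l lspan_smult.IH by simp
    qed (use zero_l z in auto)
  qed
  have \<Phi>_add: "\<Phi> (y \<oplus>\<^bsub>N\<^esub> z) = \<Phi> y + \<Phi> z" if "y \<in> carrier N" "z \<in> carrier N" for y z
    using that S by (intro poly_mapping_eqI) (auto simp: lk lookup_add add_r)
  have \<Phi>_smult: "\<Phi> (c \<odot>\<^bsub>N\<^esub> z) = pscale c (\<Phi> z)" if "z \<in> carrier N" for c z
    using that S by (intro poly_mapping_eqI) (auto simp: lk smult_r)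
  have "card T \<le> card S" if T: "lindependent N T" for T
  proof -
    have T': "finite T" "T \<subseteq> carrier N" using T by (auto simp: lindependent_def)
    have \<Phi>_sum: "\<Phi> (\<Oplus>\<^bsub>N\<^esub>t\<in>A. u t \<odot>\<^bsub>N\<^esub> t) = (\<Sum>t\<in>A. pscale (u t) (\<Phi> t))"
      if "finite A" "A \<subseteq> carrier N" for A u
      using that
    proof (induction A rule: finite_induct)
      case empty
      then show ?case using S by (auto intro!: poly_mapping_eqI simp: lk zero_r)
    next
      case (insert x F)
      then have "(\<Oplus>\<^bsub>N\<^esub>t\<in>F. u t \<odot>\<^bsub>N\<^esub> t) \<in> carrier N" by (intro N.finsum_closed) auto
      then show ?case using insert by (subst N.finsum_insert) (auto simp: \<Phi>_add \<Phi>_smult)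
    qed
    have "card T \<le> card ((\<lambda>t. Poly_Mapping.single t (1::'k)) ` S)"
    proof (rule pm_family_card_le[where vec = \<Phi>])
      show "\<Phi> ` T \<subseteq> pm.span ((\<lambda>t. Poly_Mapping.single t (1::'k)) ` S)"
        using pm_in_span_single[OF S(1)] by (auto simp: \<Phi>_def)
      fix u assume "(\<Sum>t\<in>T. pscale (u t) (\<Phi> t)) = 0"
      then have "(\<Oplus>\<^bsub>N\<^esub>t\<in>T. u t \<odot>\<^bsub>N\<^esub> t) = \<zero>\<^bsub>N\<^esub>"
        using \<Phi>_sum[OF T', of u] T' by (intro ker N.finsum_closed) auto
      then show "\<forall>t\<in>T. u t = 0" using T by (simp add: lindependent_def)
    qed (use T' S in auto)
    then show ?thesis using card_image_le[OF S(1)] le_trans by blast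
  qed
  then show ?thesis using bounded_independent_fin_dim[OF N] S(4) by metis
qed

end

text \<open>Modulo its two radicals the pairing is nondegenerate on both sides, so each quotient
  embeds into the dual of the other. Finiteness of the first quotient yields that of the second, and
  then the reverse inequality.\<close>

lemma (in bilinear_pairing) perfect_pairing_vdim:
  assumes W: "lsubmodule W V" "W = {f \<in> carrier V. \<forall>z \<in> carrier N. \<beta> f z = 0}"
    and Z: "lsubmodule Z N" "Z = {z \<in> carrier N. \<forall>f \<in> carrier V. \<beta> f z = 0}"
    and fd: "fin_dim (quotient_module V W)"
  shows "fin_dim (quotient_module N Z) \<and> vdim (quotient_module N Z) = vdim (quotient_module V W)"
proof -
  have V: "lmod V" and N: "lmod N" by unfold_locales
  let ?V = "quotient_module V W" and ?N = "quotient_module N Z"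
  \<comment> \<open>Evaluated at chosen representatives; changing them inside their cosets alters
    \<open>\<beta>\<close> only by terms with one argument in a radical.\<close>
  define \<gamma> where "\<gamma> F A = \<beta> (SOME f. f \<in> F) (SOME z. z \<in> A)" for F A
  have \<gamma>: "\<gamma> (W +>\<^bsub>V\<^esub> f) (Z +>\<^bsub>N\<^esub> z) = \<beta> f z" if fz: "f \<in> carrier V" "z \<in> carrier N" for f z
  proof -
    define f' where "f' = (SOME g. g \<in> W +>\<^bsub>V\<^esub> f)"
    define z' where "z' = (SOME y. y \<in> Z +>\<^bsub>N\<^esub> z)"
    have "f' \<in> W +>\<^bsub>V\<^esub> f" unfolding f'_def by (rule someI, rule coset_self[OF V W(1) fz(1)])
    then have f': "f' \<in> carrier V" "f' \<ominus>\<^bsub>V\<^esub> f \<in> W"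
      using coset_mem_iff[OF V W(1)] coset_carrier[OF V W(1)] fz(1) by blast+
    have "z' \<in> Z +>\<^bsub>N\<^esub> z" unfolding z'_def by (rule someI, rule coset_self[OF N Z(1) fz(2)])
    then have z': "z' \<in> carrier N" "z' \<ominus>\<^bsub>N\<^esub> z \<in> Z"
      using coset_mem_iff[OF N Z(1)] coset_carrier[OF N Z(1)] fz(2) by blast+
    have "\<beta> f' z' = \<beta> f z'" using f' z' fz W(2) minus_l[of f' f z'] by simp
    also have "\<dots> = \<beta> f z" using f' z' fz Z(2) minus_r[of f z' z] by simp
    finally show ?thesis by (simp add: \<gamma>_def f'_def z'_def)
  qed
  interpret Q: bilinear_pairing ?V ?N \<gamma>
  proof (intro bilinear_pairing.intro bilinear_pairing_axioms.intro)
    show "lmod ?V" "lmod ?N" by (rule quot_lmod[OF V W(1)], rule quot_lmod[OF N Z(1)])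
    fix F H A B :: "_ set" and c
    assume "F \<in> carrier ?V" "H \<in> carrier ?V" "A \<in> carrier ?N" "B \<in> carrier ?N"
    then obtain f h z y where *: "f \<in> carrier V" "h \<in> carrier V" "z \<in> carrier N" "y \<in> carrier N"
      "F = W +>\<^bsub>V\<^esub> f" "H = W +>\<^bsub>V\<^esub> h" "A = Z +>\<^bsub>N\<^esub> z" "B = Z +>\<^bsub>N\<^esub> y"
      using quot_cases[OF V W(1)] quot_cases[OF N Z(1)] by metis
    show "\<gamma> (F \<oplus>\<^bsub>?V\<^esub> H) A = \<gamma> F A + \<gamma> H A" "\<gamma> (c \<odot>\<^bsub>?V\<^esub> F) A = c * \<gamma> F A"
      "\<gamma> F (A \<oplus>\<^bsub>?N\<^esub> B) = \<gamma> F A + \<gamma> F B" "\<gamma> F (c \<odot>\<^bsub>?N\<^esub> A) = c * \<gamma> F A"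
      unfolding * using *(1-4)
      by (simp_all add: quot_add[OF V W(1)] quot_add[OF N Z(1)] quot_smult[OF V W(1)]
        quot_smult[OF N Z(1)] \<gamma> add_l add_r smult_l smult_r)
  qed
  have 1: "A = \<zero>\<^bsub>?N\<^esub>" if "A \<in> carrier ?N" "\<And>F. F \<in> carrier ?V \<Longrightarrow> \<gamma> F A = 0" for A
  proof -
    obtain z where z: "z \<in> carrier N" "A = Z +>\<^bsub>N\<^esub> z" using quot_cases[OF N Z(1) \<open>A \<in> carrier ?N\<close>] .
    have "\<beta> f z = 0" if f: "f \<in> carrier V" for f
      using \<gamma>[OF f z(1)] \<open>\<And>F. F \<in> carrier ?V \<Longrightarrow> \<gamma> F A = 0\<close>[of "W +>\<^bsub>V\<^esub> f"] z f
      by (auto simp: quot_carrier[OF V W(1)])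
    then have "z \<in> Z" using z Z(2) by auto
    then show ?thesis using coset_zero_iff[OF N Z(1)] quot_zero[OF N Z(1)] z by simp
  qed
  have 2: "F = \<zero>\<^bsub>?V\<^esub>" if "F \<in> carrier ?V" "\<And>A. A \<in> carrier ?N \<Longrightarrow> \<gamma> F A = 0" for F
  proof -
    obtain f where f: "f \<in> carrier V" "F = W +>\<^bsub>V\<^esub> f" using quot_cases[OF V W(1) \<open>F \<in> carrier ?V\<close>] .
    have "\<beta> f z = 0" if z: "z \<in> carrier N" for z
      using \<gamma>[OF f(1) z] \<open>\<And>A. A \<in> carrier ?N \<Longrightarrow> \<gamma> F A = 0\<close>[of "Z +>\<^bsub>N\<^esub> z"] z f
      by (auto simp: quot_carrier[OF N Z(1)])
    then have "f \<in> W" using f W(2) by auto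
    then show ?thesis using coset_zero_iff[OF V W(1)] quot_zero[OF V W(1)] f by simp
  qed
  have a: "fin_dim ?N \<and> vdim ?N \<le> vdim ?V" by (rule Q.fin_dim_right[OF fd 1])
  interpret Q': bilinear_pairing ?N ?V "\<lambda>z f. \<gamma> f z" by (rule Q.flip)
  have "fin_dim ?V \<and> vdim ?V \<le> vdim ?N" by (rule Q'.fin_dim_right) (use a 2 in auto)
  then show ?thesis using a by simp
qed

section \<open>Gradings of not necessarily associative algebras\<close>

lemma lspan_of_lsub:
  assumes "lmod M" "lsubmodule W M"
  shows "lspan M W = W"
  using lspan_least[OF assms(2), of W] by (auto intro: lspan.lspan_base)

lemma lspan_Un:
  assumes M: "lmod M" and XY: "X \<subseteq> carrier M" "Y \<subseteq> carrier M" and z: "z \<in> lspan M (X \<union> Y)"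
  shows "\<exists>x\<in>lspan M X. \<exists>y\<in>lspan M Y. z = x \<oplus>\<^bsub>M\<^esub> y"
proof -
  interpret lmod M by fact
  note cX = subsetD[OF lspan_carrier[OF M XY(1)]] and cY = subsetD[OF lspan_carrier[OF M XY(2)]]
  show ?thesis using z
  proof (induction rule: lspan.induct)
    case lspan_zero
    then show ?case by (intro bexI[of _ "\<zero>\<^bsub>M\<^esub>"]) (auto intro: lspan.intros)
  next
    case (lspan_base x)
    then show ?case
    proof
      assume "x \<in> X"
      then show ?thesis using XY by (intro bexI[of _ x] bexI[of _ "\<zero>\<^bsub>M\<^esub>"]) (auto intro: lspan.intros)
    next
      assume "x \<in> Y"
      then show ?thesis using XY by (intro bexI[of _ "\<zero>\<^bsub>M\<^esub>"] bexI[of _ x]) (auto intro: lspan.intros)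
    qed
  next
    case (lspan_add u v)
    then obtain a b c d where *: "a \<in> lspan M X" "b \<in> lspan M Y" "u = a \<oplus>\<^bsub>M\<^esub> b"
      "c \<in> lspan M X" "d \<in> lspan M Y" "v = c \<oplus>\<^bsub>M\<^esub> d" by blast
    have "u \<oplus>\<^bsub>M\<^esub> v = (a \<oplus>\<^bsub>M\<^esub> c) \<oplus>\<^bsub>M\<^esub> (b \<oplus>\<^bsub>M\<^esub> d)" using * cX cY by (simp add: a_ac)
    then show ?case using * by (blast intro: lspan.lspan_add)
  next
    case (lspan_smult u r)
    then obtain a b where *: "a \<in> lspan M X" "b \<in> lspan M Y" "u = a \<oplus>\<^bsub>M\<^esub> b" by blast
    have "r \<odot>\<^bsub>M\<^esub> u = r \<odot>\<^bsub>M\<^esub> a \<oplus>\<^bsub>M\<^esub> r \<odot>\<^bsub>M\<^esub> b" using * cX cY by (simp add: smult_r_distr)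
    then show ?case using * by (blast intro: lspan.lspan_smult)
  qed
qed

text \<open>Independence in a subspace is independence in \<open>V\<close>, so the size of
  independent sets stays bounded by that of a basis of \<open>V\<close>.\<close>

lemma fin_dim_sub:
  fixes V :: "('k::field, 'v) module"
  assumes V: "lmod V" and fd: "fin_dim V" and W: "lsubmodule W V"
  shows "fin_dim (V\<lparr>carrier := W\<rparr>)"
proof -
  note lW = lsub_lmod[OF V W]
  from fin_dim_basis[OF V fd] obtain S where
    "finite S \<and> S \<subseteq> carrier V \<and> lindependent V S \<and> carrier V \<subseteq> lspan V S \<and> vdim V = card S" ..
  then have S: "finite S" "S \<subseteq> carrier V" "carrier V \<subseteq> lspan V S" by simp_all
  have "card T \<le> card S" if T: "lindependent (V\<lparr>carrier := W\<rparr>) T" for T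
  proof -
    have T': "finite T" "T \<subseteq> W" using T by (auto simp: lindependent_def)
    have WV: "W \<subseteq> carrier V" using W by (simp add: lsubmodule_def)
    have "(\<lambda>t. c t \<odot>\<^bsub>V\<^esub> t) \<in> T \<rightarrow> W" for c using T' W by (auto simp: lsubmodule_def)
    then have "finsum (V\<lparr>carrier := W\<rparr>) (\<lambda>t. c t \<odot>\<^bsub>V\<^esub> t) T = finsum V (\<lambda>t. c t \<odot>\<^bsub>V\<^esub> t) T" for c
      by (rule lsub_finsum_eq[OF V W])
    then have "lindependent V T" using T T' WV by (simp add: lindependent_def)
    then show ?thesis using lindependent_card_le[OF V _ S(1,2)] S(3) T' WV by blast
  qed
  then show ?thesis using bounded_independent_fin_dim[OF lW] by blast
qed

text \<open>Taken as a span in order to argue by induction on homogeneous generators; for a grading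
  by submodules it agrees with \<open>sum_of_subgroups\<close>
  (\<open>sum_of_subgroups_part\<close>).\<close>

definition graded_part :: "('r::ring_1, 'm) module \<Rightarrow> (nat \<Rightarrow> 'm set) \<Rightarrow> nat set \<Rightarrow> 'm set" where
  "graded_part M G I = lspan M (\<Union>i\<in>I. G i)"

section \<open>Modules with a grading by submodules\<close>

locale graded_lmod = lmod M for M :: "('r::ring_1, 'm) module" (structure) +
  fixes G :: "nat \<Rightarrow> 'm set"
  assumes direct: "internal_direct_sum M G"
    and smult_G: "x \<in> G n \<Longrightarrow> r \<odot> x \<in> G n"
begin

lemma M: "lmod M" by unfold_locales

lemma G_add_subgroup: "additive_subgroup (G i) M"
  using direct by (simp add: internal_direct_sum_def)

lemma G_lsub: "lsubmodule (G i) M"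
proof -
  interpret H: additive_subgroup "G i" M by (rule G_add_subgroup)
  show ?thesis using H.a_subset smult_G by (auto simp: lsubmodule_def)
qed

lemma G_carrier: "x \<in> G i \<Longrightarrow> x \<in> carrier M"
  using G_lsub[of i] by (auto simp: lsubmodule_def)

lemma UN_carrier: "(\<Union>i\<in>I. G i) \<subseteq> carrier M"
  using G_carrier by auto

lemma part_lsub: "lsubmodule (graded_part M G I) M"
  unfolding graded_part_def by (rule lspan_lsub[OF M UN_carrier])

lemma part_carrier: "x \<in> graded_part M G I \<Longrightarrow> x \<in> carrier M"
  using part_lsub[of I] by (auto simp: lsubmodule_def)

lemma part_mono: "I \<subseteq> J \<Longrightarrow> graded_part M G I \<subseteq> graded_part M G J"
  unfolding graded_part_def by (rule lspan_mono) auto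

lemma part_base: "x \<in> G i \<Longrightarrow> i \<in> I \<Longrightarrow> x \<in> graded_part M G I"
  unfolding graded_part_def by (rule lspan.lspan_base) auto

lemma part_single: "graded_part M G {i} = G i"
  unfolding graded_part_def by (simp add: lspan_of_lsub[OF M G_lsub])

lemma part_Un: "z \<in> graded_part M G (I \<union> J) \<Longrightarrow>
    \<exists>x\<in>graded_part M G I. \<exists>y\<in>graded_part M G J. z = x \<oplus> y"
  unfolding graded_part_def using lspan_Un[OF M UN_carrier UN_carrier, of z I J] by (simp add: UN_Un)

text \<open>The family whose uniqueness \<open>internal_direct_sum\<close> asserts. The sum runs
  over the exact support, which may shrink under addition; \<open>decompI\<close> and
  \<open>decomp_superset\<close> therefore pass to larger index sets.\<close>

definition decomp :: "'m \<Rightarrow> (nat \<Rightarrow> 'm) \<Rightarrow> bool" where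
  "decomp v x \<longleftrightarrow> (\<forall>i. x i \<in> G i) \<and> finite {i. x i \<noteq> \<zero>} \<and> v = (\<Oplus>i\<in>{i. x i \<noteq> \<zero>}. x i)"

lemma decomp_ex1: "v \<in> carrier M \<Longrightarrow> \<exists>!x. decomp v x"
  using direct by (simp add: internal_direct_sum_def decomp_def)

lemma decomp_superset:
  assumes "decomp v x" "finite J" "{i. x i \<noteq> \<zero>} \<subseteq> J"
  shows "v = (\<Oplus>i\<in>J. x i)"
proof -
  have "(\<Oplus>i\<in>{i. x i \<noteq> \<zero>}. x i) = (\<Oplus>i\<in>J. x i)"
    using assms G_carrier by (intro add.finprod_mono_neutral_cong_left) (auto simp: decomp_def)
  then show ?thesis using assms by (simp add: decomp_def)
qed

lemma decompI:
  assumes "\<And>i. x i \<in> G i" "finite J" "{i. x i \<noteq> \<zero>} \<subseteq> J" "v = (\<Oplus>i\<in>J. x i)"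
  shows "decomp v x"
proof -
  have "(\<Oplus>i\<in>{i. x i \<noteq> \<zero>}. x i) = (\<Oplus>i\<in>J. x i)"
    using assms G_carrier by (intro add.finprod_mono_neutral_cong_left) auto
  then show ?thesis using assms finite_subset by (auto simp: decomp_def)
qed

lemma decomp_add:
  assumes "decomp v x" "decomp w y"
  shows "decomp (v \<oplus> w) (\<lambda>i. x i \<oplus> y i)"
proof -
  let ?J = "{i. x i \<noteq> \<zero>} \<union> {i. y i \<noteq> \<zero>}"
  have fin: "finite ?J" and G: "x i \<in> G i" "y i \<in> G i" for i using assms by (auto simp: decomp_def)
  show ?thesis
  proof (rule decompI[OF _ fin])
    show "x i \<oplus> y i \<in> G i" for i using G_lsub G by (auto simp: lsubmodule_def)
    have "v = (\<Oplus>i\<in>?J. x i)" "w = (\<Oplus>i\<in>?J. y i)" using assms fin by (auto intro!: decomp_superset)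
    then show "v \<oplus> w = (\<Oplus>i\<in>?J. x i \<oplus> y i)"
      using G G_carrier by (subst finsum_addf) auto
  qed auto
qed

lemma decomp_smult:
  assumes "decomp v x"
  shows "decomp (r \<odot> v) (\<lambda>i. r \<odot> x i)"
proof -
  let ?J = "{i. x i \<noteq> \<zero>}"
  have fin: "finite ?J" and G: "x i \<in> G i" for i using assms by (auto simp: decomp_def)
  show ?thesis
  proof (rule decompI[OF _ fin])
    show "r \<odot> x i \<in> G i" for i using smult_G G by auto
    show "r \<odot> v = (\<Oplus>i\<in>?J. r \<odot> x i)"
      using G G_carrier assms finsum_smult[of x ?J r] by (auto simp: decomp_def)
  qed auto
qed

lemma zero_G: "\<zero> \<in> G i"
  using G_lsub by (simp add: lsubmodule_def)

lemma decomp_zero: "decomp \<zero> (\<lambda>i. \<zero>)"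
  by (simp add: decomp_def zero_G)

lemma decomp_in:
  assumes "v \<in> G n"
  shows "decomp v (\<lambda>i. if i = n then v else \<zero>)"
  by (rule decompI[where J = "{n}"]) (use assms zero_G G_carrier in auto)

lemma part_decomp: "v \<in> graded_part M G I \<Longrightarrow> \<exists>x. decomp v x \<and> (\<forall>i. i \<notin> I \<longrightarrow> x i = \<zero>)"
  unfolding graded_part_def
proof (induction rule: lspan.induct)
  case lspan_zero
  then show ?case using decomp_zero by blast
next
  case (lspan_base v)
  then obtain n where "n \<in> I" "v \<in> G n" by auto
  then show ?case using decomp_in[of v n] by (intro exI[of _ "\<lambda>i. if i = n then v else \<zero>"]) auto
next
  case (lspan_add v w)
  then obtain x y where "decomp v x" "\<forall>i. i \<notin> I \<longrightarrow> x i = \<zero>" "decomp w y" "\<forall>i. i \<notin> I \<longrightarrow> y i = \<zero>"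
    by blast
  then show ?case using decomp_add[of v x w y] by (intro exI[of _ "\<lambda>i. x i \<oplus> y i"]) auto
next
  case (lspan_smult v r)
  then obtain x where "decomp v x" "\<forall>i. i \<notin> I \<longrightarrow> x i = \<zero>" by blast
  then show ?case using decomp_smult[of v x r] by (intro exI[of _ "\<lambda>i. r \<odot> x i"]) auto
qed

text \<open>The homogeneous components of a common element are supported in \<open>I\<close> and in
  \<open>J\<close>; they are unique, so all of them vanish.\<close>

lemma part_disjoint:
  assumes "I \<inter> J = {}"
  shows "graded_part M G I \<inter> graded_part M G J \<subseteq> {\<zero>}"
proof
  fix v assume v: "v \<in> graded_part M G I \<inter> graded_part M G J"
  obtain x where x: "decomp v x" "\<And>i. i \<notin> I \<Longrightarrow> x i = \<zero>" using part_decomp v by blast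
  obtain y where y: "decomp v y" "\<And>i. i \<notin> J \<Longrightarrow> y i = \<zero>" using part_decomp v by blast
  have "x = y" using decomp_ex1[of v] x(1) y(1) v part_carrier by blast
  then have "x i = \<zero>" for i using x(2) y(2) assms by (cases "i \<in> I") auto
  then show "v \<in> {\<zero>}" using x(1) by (simp add: decomp_def)
qed

lemma part_UNIV: "graded_part M G UNIV = carrier M"
proof
  show "carrier M \<subseteq> graded_part M G UNIV"
  proof
    fix v assume "v \<in> carrier M"
    then obtain x where x: "decomp v x" using decomp_ex1 by blast
    then have "v = (\<Oplus>i\<in>{i. x i \<noteq> \<zero>}. x i)" by (simp add: decomp_def)
    moreover have "(\<Oplus>i\<in>{i. x i \<noteq> \<zero>}. x i) \<in> graded_part M G UNIV"
      using x part_base by (intro lsub_finsum[OF M part_lsub]) (auto simp: decomp_def)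
    ultimately show "v \<in> graded_part M G UNIV" by simp
  qed
qed (use part_carrier in auto)

lemma split_carrier:
  assumes "v \<in> carrier M"
  shows "\<exists>x\<in>graded_part M G I. \<exists>y\<in>graded_part M G (- I). v = x \<oplus> y"
  using assms part_Un[of v I "- I"] by (simp add: part_UNIV)

end

lemma (in graded_lmod) part_atMost_Suc:
  "z \<in> graded_part M G {..Suc n} \<Longrightarrow> \<exists>x\<in>graded_part M G {..n}. \<exists>y\<in>G (Suc n). z = x \<oplus> y"
proof -
  have "{..Suc n} = {..n} \<union> {Suc n}" by auto
  then show "z \<in> graded_part M G {..Suc n} \<Longrightarrow> ?thesis" using part_Un[of z "{..n}" "{Suc n}"] by (simp add: part_single)
qed

lemma vdim_atMost:
  fixes V :: "('k::field, 'v) module"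
  assumes "graded_lmod V G" and fd: "\<And>i. i \<le> n \<Longrightarrow> fin_dim (V\<lparr>carrier := G i\<rparr>)"
  shows "fin_dim (V\<lparr>carrier := graded_part V G {..n}\<rparr>) \<and>
    vdim (V\<lparr>carrier := graded_part V G {..n}\<rparr>) = (\<Sum>i\<le>n. vdim (V\<lparr>carrier := G i\<rparr>))"
  using fd
proof (induction n)
  case 0
  interpret graded_lmod V G by fact
  have "{..0::nat} = {0}" by auto
  then show ?case using 0[of 0] by (simp add: part_single)
next
  case (Suc n)
  interpret graded_lmod V G by fact
  let ?V = "V\<lparr>carrier := graded_part V G {..Suc n}\<rparr>"
  have IH: "fin_dim (V\<lparr>carrier := graded_part V G {..n}\<rparr>)"
    "vdim (V\<lparr>carrier := graded_part V G {..n}\<rparr>) = (\<Sum>i\<le>n. vdim (V\<lparr>carrier := G i\<rparr>))"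
    using Suc by auto
  have "fin_dim ?V \<and> vdim ?V =
    vdim (?V\<lparr>carrier := graded_part V G {..n}\<rparr>) + vdim (?V\<lparr>carrier := G (Suc n)\<rparr>)"
  proof (rule vdim_direct_sum)
    show "lmod ?V" by (rule lsub_lmod[OF M part_lsub])
    show "lsubmodule (graded_part V G {..n}) ?V"
      using part_lsub[of "{..n}"] part_mono[of "{..n}" "{..Suc n}"] by (auto simp: lsubmodule_def)
    show "lsubmodule (G (Suc n)) ?V"
      using G_lsub[of "Suc n"] part_base[of _ "Suc n" "{..Suc n}"] by (auto simp: lsubmodule_def)
    show "graded_part V G {..n} \<inter> G (Suc n) \<subseteq> {\<zero>\<^bsub>?V\<^esub>}"
      using part_disjoint[of "{..n}" "{Suc n}"] by (simp add: part_single)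
  qed (use part_atMost_Suc IH Suc.prems in auto)
  then show ?case using IH by simp
qed

section \<open>Bilinear products and the comparison of two gradings\<close>

locale bilinear_algebra = lmod A for A :: "('k::field, 'a) module" (structure) +
  assumes mult_closed [intro, simp]: "x \<in> carrier A \<Longrightarrow> y \<in> carrier A \<Longrightarrow> x \<otimes> y \<in> carrier A"
    and one_closed [intro, simp]: "\<one> \<in> carrier A"
    and mult_add_l: "x \<in> carrier A \<Longrightarrow> y \<in> carrier A \<Longrightarrow> z \<in> carrier A \<Longrightarrow>
      (x \<oplus> y) \<otimes> z = x \<otimes> z \<oplus> y \<otimes> z"
    and mult_add_r: "x \<in> carrier A \<Longrightarrow> y \<in> carrier A \<Longrightarrow> z \<in> carrier A \<Longrightarrow>
      z \<otimes> (x \<oplus> y) = z \<otimes> x \<oplus> z \<otimes> y"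
    and mult_smult_l: "x \<in> carrier A \<Longrightarrow> y \<in> carrier A \<Longrightarrow> (c \<odot> x) \<otimes> y = c \<odot> (x \<otimes> y)"
    and mult_smult_r: "x \<in> carrier A \<Longrightarrow> y \<in> carrier A \<Longrightarrow> x \<otimes> (c \<odot> y) = c \<odot> (x \<otimes> y)"
begin

lemma mult_zero_l: "x \<in> carrier A \<Longrightarrow> \<zero> \<otimes> x = \<zero>"
  using mult_smult_l[of \<zero> x 0] by simp

lemma mult_zero_r: "x \<in> carrier A \<Longrightarrow> x \<otimes> \<zero> = \<zero>"
  using mult_smult_r[of x \<zero> 0] by simp

text \<open>With one factor fixed the product is linear in the other, so two inductions reduce
  closure under products to generators.\<close>

lemma lspan_mult:
  assumes X: "X \<subseteq> carrier A" and Y: "Y \<subseteq> carrier A" and Z: "lsubmodule Z A"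
    and XY: "\<And>x y. x \<in> X \<Longrightarrow> y \<in> Y \<Longrightarrow> x \<otimes> y \<in> Z"
    and x: "x \<in> lspan A X" and y: "y \<in> lspan A Y"
  shows "x \<otimes> y \<in> Z"
proof -
  have A: "lmod A" by unfold_locales
  note cX = subsetD[OF lspan_carrier[OF A X]] and cY = subsetD[OF lspan_carrier[OF A Y]]
  note z = lsub_zero[OF A Z] and a = lsub_add[OF A Z] and s = lsub_smult[OF A Z]
  have *: "x \<otimes> y \<in> Z" if "x \<in> X" for x
    using y by (induction rule: lspan.induct)
      (use that X XY cY in \<open>auto simp: mult_zero_r mult_add_r mult_smult_r z a s\<close>)
  show ?thesis
    using x by (induction rule: lspan.induct)
      (use y * cX cY in \<open>auto simp: mult_zero_l mult_add_l mult_smult_l z a s\<close>)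
qed

lemma connected_graded: "connected_grading A G \<Longrightarrow> graded_lmod A G"
  by unfold_locales (auto simp: connected_grading_def)

lemma part_mult:
  assumes G: "connected_grading A G" and x: "x \<in> graded_part A G I" and y: "y \<in> graded_part A G J"
    and IJ: "\<And>i j. i \<in> I \<Longrightarrow> j \<in> J \<Longrightarrow> i + j \<in> L"
  shows "x \<otimes> y \<in> graded_part A G L"
proof -
  interpret G: graded_lmod A G by (rule connected_graded[OF G])
  show ?thesis
  proof (rule lspan_mult[OF G.UN_carrier[of I] G.UN_carrier[of J] G.part_lsub])
    fix u v assume "u \<in> (\<Union>i\<in>I. G i)" "v \<in> (\<Union>j\<in>J. G j)"
    then obtain i j where "i \<in> I" "j \<in> J" "u \<in> G i" "v \<in> G j" by auto
    then show "u \<otimes> v \<in> graded_part A G L"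
      using G G.part_base[of "u \<otimes> v" "i + j" L] IJ by (auto simp: connected_grading_def)
  qed (use x y in \<open>auto simp: graded_part_def\<close>)
qed

text \<open>
  Shifting the degree-one generators of the grading \<open>E\<close> by scalars moves them into the augmentation
  ideal of \<open>H\<close>. Words of length \<open>k\<close> in the shifted generators lie in \<open>E\<^sub>\<le>\<^sub>k \<inter> H\<^sub>\<ge>\<^sub>k\<close>.
\<close>

lemma two_gradings_span:
  assumes E: "connected_grading A E" and gen: "fin_gen_in_degree_one A E" and H: "connected_grading A H"
    and v: "v \<in> carrier A"
  shows "\<exists>f\<in>graded_part A E {..n}. \<exists>h\<in>graded_part A H (- {..n}). v = f \<oplus> h"
proof -
  interpret E: graded_lmod A E by (rule connected_graded[OF E])
  interpret H: graded_lmod A H by (rule connected_graded[OF H])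
  have A: "lmod A" by unfold_locales
  obtain S where S: "S \<subseteq> E 1" "generated_algebra A S = carrier A"
    using gen by (auto simp: fin_gen_in_degree_one_def)
  \<comment> \<open>Only the two degree bounds on words matter, so \<open>W k\<close> records the
    bounds rather than the words; products of bracketed words become products of elements of
    \<open>W k\<close> and \<open>W l\<close>, which lie in \<open>W (k + l)\<close>.\<close>
  define W where "W k = graded_part A E {..k} \<inter> graded_part A H {k..}" for k
  have Wc: "(\<Union>k. W k) \<subseteq> carrier A" using E.part_carrier by (auto simp: W_def)
  let ?Z = "lspan A (\<Union>k. W k)"
  have Z: "lsubmodule ?Z A" by (rule lspan_lsub[OF A Wc])
  have WZ: "x \<in> W k \<Longrightarrow> x \<in> ?Z" for x k by (rule lspan.lspan_base) auto
  have "1 \<odot> \<one> \<in> E 0" "1 \<odot> \<one> \<in> H 0" using E H unfolding connected_grading_def by blast+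
  then have one: "\<one> \<in> E 0" "\<one> \<in> H 0" by simp_all
  have oneW: "\<one> \<in> W 0" using one E.part_base H.part_base by (auto simp: W_def)
  have gZ: "x \<in> ?Z" if "x \<in> generated_algebra A S" for x
    using that
  proof (induction rule: generated_algebra.induct)
    case (base s)
    then have sE: "s \<in> E 1" using S by auto
    have "- {0} = {1::nat..}" by auto
    then obtain h0 h where h: "h0 \<in> H 0" "h \<in> graded_part A H {1..}" "s = h0 \<oplus> h"
      using H.split_carrier[OF E.G_carrier[OF sE], of "{0}"] by (auto simp: H.part_single)
    obtain c where c: "h0 = c \<odot> \<one>" using h(1) H by (auto simp: connected_grading_def)
    have hc: "h \<in> carrier A" "s \<in> carrier A" using h H.part_carrier E.G_carrier[OF sE] by auto
    have "h = s \<ominus> h0" using h(3) c hc add_minus_cancel[of h h0] by (simp add: a_comm)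
    moreover have "s \<in> graded_part A E {..1}" "h0 \<in> graded_part A E {..1}"
      using sE c E.smult_G[OF one(1)] by (auto intro: E.part_base[of _ 1] E.part_base[of _ 0])
    ultimately have "h \<in> graded_part A E {..1}" using lsub_minus[OF A E.part_lsub] by simp
    then have "h \<in> W 1" using h by (simp add: W_def)
    moreover have "h0 \<in> ?Z" unfolding c by (intro lspan.lspan_smult WZ[OF oneW])
    ultimately show ?case using h(3) WZ by (auto intro: lspan.lspan_add)
  next
    case one
    then show ?case using WZ[OF oneW] .
  next
    case (mult x y)
    show ?case
    proof (rule lspan_mult[OF Wc Wc Z _ mult.IH])
      fix u v assume "u \<in> (\<Union>k. W k)" "v \<in> (\<Union>k. W k)"
      then obtain k l where "u \<in> W k" "v \<in> W l" by auto
      then have "u \<otimes> v \<in> W (k + l)"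
        by (auto simp: W_def intro: part_mult[OF E, of _ "{..k}" _ "{..l}"] part_mult[OF H, of _ "{k..}" _ "{l..}"])
      then show "u \<otimes> v \<in> ?Z" by (rule WZ)
    qed
  qed (auto intro: lspan.intros)
  let ?X = "graded_part A E {..n}" and ?Y = "graded_part A H (- {..n})"
  have XY: "?X \<subseteq> carrier A" "?Y \<subseteq> carrier A" using E.part_carrier H.part_carrier by auto
  \<comment> \<open>The cut-off: words of length at most \<open>n\<close> are caught by their
    \<open>E\<close>-bound, longer ones by their \<open>H\<close>-bound.\<close>
  have "W k \<subseteq> ?X \<union> ?Y" for k
  proof (cases "k \<le> n")
    case True
    then show ?thesis using E.part_mono[of "{..k}" "{..n}"] by (auto simp: W_def)
  next
    case False
    then have "{k..} \<subseteq> - {..n}" by auto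
    then show ?thesis using H.part_mono[of "{k..}" "- {..n}"] by (auto simp: W_def)
  qed
  then have "?Z \<subseteq> lspan A (?X \<union> ?Y)" by (intro lspan_mono) auto
  then have "v \<in> lspan A (?X \<union> ?Y)" using gZ v S(2) by auto
  then show ?thesis using lspan_Un[OF A XY, of v] lspan_of_lsub[OF A E.part_lsub] lspan_of_lsub[OF A H.part_lsub]
    by simp
qed

text \<open>The projection onto \<open>H\<close>-degree at most \<open>m\<close> along higher
  \<open>H\<close>-degree is linear, and by \<open>two_gradings_span\<close> it maps the part of
  \<open>E\<close>-degree at most \<open>m\<close> onto its target. Only accumulated parts can be
  compared in this way, as \<open>E\<close> and \<open>H\<close> need not share homogeneous
  pieces.\<close>

lemma vdim_gradings_le:
  assumes E: "connected_grading A E" and gen: "fin_gen_in_degree_one A E" and H: "connected_grading A H"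
    and fd: "\<And>i. fin_dim (A\<lparr>carrier := E i\<rparr>)"
  shows "fin_dim (A\<lparr>carrier := H n\<rparr>) \<and>
    (\<Sum>i\<le>n. vdim (A\<lparr>carrier := H i\<rparr>)) \<le> (\<Sum>i\<le>n. vdim (A\<lparr>carrier := E i\<rparr>))"
proof -
  interpret E: graded_lmod A E by (rule connected_graded[OF E])
  interpret H: graded_lmod A H by (rule connected_graded[OF H])
  have A: "lmod A" by unfold_locales
  have main: "fin_dim (A\<lparr>carrier := graded_part A H {..m}\<rparr>) \<and>
    vdim (A\<lparr>carrier := graded_part A H {..m}\<rparr>) \<le> vdim (A\<lparr>carrier := graded_part A E {..m}\<rparr>)" for m
  proof -
    let ?X = "graded_part A E {..m}" and ?L = "graded_part A H {..m}" and ?U = "graded_part A H (- {..m})"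
    note Xl = E.part_lsub[of "{..m}"] and Ll = H.part_lsub[of "{..m}"] and Ul = H.part_lsub[of "- {..m}"]
    have LU: "?L \<inter> ?U \<subseteq> {\<zero>}" by (rule H.part_disjoint) auto
    define g where "g x = (THE h. h \<in> ?L \<and> x \<ominus> h \<in> ?U)" for x
    have g: "g x = h" if "x \<in> carrier A" "h \<in> ?L" "x \<ominus> h \<in> ?U" for x h
      unfolding g_def
    proof (rule the_equality)
      fix h' assume h': "h' \<in> ?L \<and> x \<ominus> h' \<in> ?U"
      have c: "h \<in> carrier A" "h' \<in> carrier A" using h' that H.part_carrier by auto
      have "(x \<ominus> h) \<ominus> (x \<ominus> h') \<in> ?U" using lsub_minus[OF A Ul] that h' by blast
      moreover have "(x \<ominus> h) \<ominus> (x \<ominus> h') = h' \<ominus> h"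
      proof -
        have "(x \<ominus> h) \<ominus> (x \<ominus> h') = (x \<oplus> \<ominus> x) \<oplus> (h' \<oplus> \<ominus> h)"
          using that c by (simp add: minus_eq minus_add a_ac)
        then show ?thesis using that c by (simp add: minus_eq r_neg)
      qed
      moreover have "h' \<ominus> h \<in> ?L" using lsub_minus[OF A Ll] that h' by blast
      ultimately have "h' \<ominus> h = \<zero>" using LU by auto
      then show "h' = h" using minus_eq_zero_iff c by simp
    qed (use that in auto)
    have ex: "\<exists>h. h \<in> ?L \<and> x \<ominus> h \<in> ?U" if x: "x \<in> carrier A" for x
    proof -
      obtain h u where hu: "h \<in> ?L" "u \<in> ?U" "x = h \<oplus> u" using H.split_carrier[OF x, of "{..m}"] by blast
      then have "x \<ominus> h = u" using H.part_carrier add_minus_cancel[of u h] by (simp add: a_comm)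
      then show ?thesis using hu by auto
    qed
    have gL: "g x \<in> ?L" and gU: "x \<ominus> g x \<in> ?U" if x: "x \<in> carrier A" for x
      using ex[OF x] g[OF x] by auto
    have "fin_dim (A\<lparr>carrier := ?L\<rparr>) \<and> vdim (A\<lparr>carrier := ?L\<rparr>) \<le> vdim (A\<lparr>carrier := ?X\<rparr>)"
    proof (rule fin_dim_surj[where g = g])
      show "g \<in> module_hom (A\<lparr>carrier := ?X\<rparr>) (A\<lparr>carrier := ?L\<rparr>)"
      proof (rule module_homI; simp)
        fix x y assume x: "x \<in> ?X" and y: "y \<in> ?X"
        have c: "x \<in> carrier A" "y \<in> carrier A" using x y E.part_carrier by auto
        have gc: "g x \<in> carrier A" "g y \<in> carrier A" using gL c H.part_carrier by auto
        have "(x \<oplus> y) \<ominus> (g x \<oplus> g y) \<in> ?U"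
          using lsub_add[OF A Ul gU[OF c(1)] gU[OF c(2)]] c gc by (simp add: add_minus_add)
        then show "g (x \<oplus> y) = g x \<oplus> g y"
          using g[of "x \<oplus> y"] lsub_add[OF A Ll gL[OF c(1)] gL[OF c(2)]] c by simp
      next
        fix r x assume x: "x \<in> ?X"
        have c: "x \<in> carrier A" using x E.part_carrier by auto
        have gc: "g x \<in> carrier A" using gL c H.part_carrier by auto
        have "r \<odot> x \<ominus> r \<odot> g x \<in> ?U"
          using lsub_smult[OF A Ul gU[OF c], of r] c gc by (simp add: smult_minus)
        then show "g (r \<odot> x) = r \<odot> g x"
          using g[of "r \<odot> x"] lsub_smult[OF A Ll gL[OF c]] c by simp
      next
        fix x assume "x \<in> ?X"
        then show "g x \<in> ?L" using gL E.part_carrier by auto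
      qed
      show "g ` carrier (A\<lparr>carrier := ?X\<rparr>) = carrier (A\<lparr>carrier := ?L\<rparr>)"
      proof (rule equalityI; rule subsetI)
        fix h assume "h \<in> carrier (A\<lparr>carrier := ?L\<rparr>)"
        then have h: "h \<in> ?L" by simp
        then obtain f u where fu: "f \<in> ?X" "u \<in> ?U" "h = f \<oplus> u"
          using two_gradings_span[OF E gen H, of h m] H.part_carrier by blast
        have c: "f \<in> carrier A" "u \<in> carrier A" "h \<in> carrier A"
          using fu h E.part_carrier H.part_carrier by auto
        \<comment> \<open>\<open>f\<close> differs from \<open>h\<close> by an element of higher
          \<open>H\<close>-degree, so the projection of \<open>f\<close> is
          \<open>h\<close>.\<close>
        have "f \<ominus> h = \<ominus> u" using c fu by (simp add: minus_eq minus_add a_assoc[symmetric] r_neg)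
        then have "g f = h" using g[of f h] c h lsub_uminus[OF A Ul fu(2)] by simp
        then show "h \<in> g ` carrier (A\<lparr>carrier := ?X\<rparr>)" using fu(1) by (intro image_eqI[of _ _ f]) simp_all
      qed (use gL E.part_carrier in auto)
      show "fin_dim (A\<lparr>carrier := ?X\<rparr>)" using vdim_atMost[OF E.graded_lmod_axioms] fd by blast
    qed (rule lsub_lmod[OF A Xl], rule lsub_lmod[OF A Ll])
    then show ?thesis .
  qed
  have fdH: "fin_dim (A\<lparr>carrier := H i\<rparr>)" for i
  proof -
    have "lsubmodule (H i) (A\<lparr>carrier := graded_part A H {..i}\<rparr>)"
      using H.G_lsub[of i] H.part_base[of _ i "{..i}"] by (auto simp: lsubmodule_def)
    then show ?thesis using fin_dim_sub[OF lsub_lmod[OF A H.part_lsub] conjunct1[OF main[of i]]] by simp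
  qed
  show ?thesis
    using main[of n] vdim_atMost[OF E.graded_lmod_axioms, of n] vdim_atMost[OF H.graded_lmod_axioms, of n] fd fdH
    by simp
qed

text \<open>The two inequalities from \<open>vdim_gradings_le\<close> give equal partial sums, hence
  equal terms. The reverse inequality needs the pieces of \<open>H\<close> to be finite-dimensional,
  which the first application provides.\<close>

theorem hilbert_series_unique:
  assumes E: "connected_grading A E" "fin_gen_in_degree_one A E"
    and H: "connected_grading A H" "fin_gen_in_degree_one A H"
    and fd: "\<And>i. fin_dim (A\<lparr>carrier := E i\<rparr>)"
  shows "fin_dim (A\<lparr>carrier := H n\<rparr>) \<and> vdim (A\<lparr>carrier := H n\<rparr>) = vdim (A\<lparr>carrier := E n\<rparr>)"
proof -
  have fH: "fin_dim (A\<lparr>carrier := H i\<rparr>)" for i using vdim_gradings_le[OF E H(1) fd] by blast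
  have eq: "(\<Sum>i\<le>m. vdim (A\<lparr>carrier := H i\<rparr>)) = (\<Sum>i\<le>m. vdim (A\<lparr>carrier := E i\<rparr>))" for m
    using vdim_gradings_le[OF E H(1) fd, of m] vdim_gradings_le[OF H E(1) fH, of m] by simp
  have "vdim (A\<lparr>carrier := H n\<rparr>) = vdim (A\<lparr>carrier := E n\<rparr>)"
    using eq[of n] eq[of "n - 1"] by (cases n) auto
  then show ?thesis using fH by simp
qed

end

section \<open>Free modules and comparison of resolutions\<close>

lemma free_simps [simp]:
  "carrier (free_module X) = {p. Poly_Mapping.keys p \<subseteq> X}"
  "p \<oplus>\<^bsub>free_module X\<^esub> q = p + q"
  "\<zero>\<^bsub>free_module X\<^esub> = 0"
  "r \<odot>\<^bsub>free_module X\<^esub> p = pscale r p"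
  by (simp_all add: free_module_def module_of_def pscale_def)

lemma keys_pscale: "Poly_Mapping.keys (pscale r p) \<subseteq> Poly_Mapping.keys p"
  by (auto simp: in_keys_iff)

lemma pscale_add: "pscale r (p + q) = pscale r p + pscale r q"
  and pscale_add_left: "pscale (r + s) p = pscale r p + pscale s p"
  and pscale_mult: "pscale (r * s) p = pscale r (pscale s p)"
  by (auto intro!: poly_mapping_eqI simp: lookup_add algebra_simps)

lemma free_lmod: "lmod (free_module X)"
proof (rule lmodI; simp)
  show "Poly_Mapping.keys p \<subseteq> X \<Longrightarrow> Poly_Mapping.keys q \<subseteq> X \<Longrightarrow> Poly_Mapping.keys (p + q) \<subseteq> X" for p q :: "'a \<Rightarrow>\<^sub>0 'b"
    using keys_add[of p q] by blast
  show "Poly_Mapping.keys p \<subseteq> X \<Longrightarrow> Poly_Mapping.keys (pscale r p) \<subseteq> X" for r and p :: "'a \<Rightarrow>\<^sub>0 'b"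
    using keys_pscale[of r p] by blast
qed (auto simp: ac_simps pscale_add pscale_add_left pscale_mult)

lemma free_minus:
  assumes "p \<in> carrier (free_module X)" "q \<in> carrier (free_module X)"
  shows "p \<ominus>\<^bsub>free_module X\<^esub> q = p - q"
proof -
  interpret lmod "free_module X" by (rule free_lmod)
  have "pscale (-1) q = - q" by (rule poly_mapping_eqI) simp
  then show ?thesis using a_inv_smult[OF assms(2)] by (simp add: minus_eq)
qed

lemma free_induct [consumes 1, case_names zero single add]:
  assumes "p \<in> carrier (free_module X)"
    and zero: "Q 0" and single: "\<And>x b. x \<in> X \<Longrightarrow> Q (Poly_Mapping.single x b)"
    and add: "\<And>p q. p \<in> carrier (free_module X) \<Longrightarrow> q \<in> carrier (free_module X) \<Longrightarrow> Q p \<Longrightarrow> Q q \<Longrightarrow> Q (p + q)"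
  shows "Q p"
proof -
  have "Q (\<Sum>x\<in>A. Poly_Mapping.single x (Poly_Mapping.lookup p x)) \<and>
      (\<Sum>x\<in>A. Poly_Mapping.single x (Poly_Mapping.lookup p x)) \<in> carrier (free_module X)"
    if "finite A" "A \<subseteq> X" for A
    using that
  proof (induction A rule: finite_induct)
    case (insert x A)
    interpret lmod "free_module X" by (rule free_lmod)
    have s: "Poly_Mapping.single x (Poly_Mapping.lookup p x) \<in> carrier (free_module X)" using insert by simp
    show ?case using insert add[OF s] single a_closed[OF s] by simp
  qed (use zero in simp)
  moreover have "p = (\<Sum>x\<in>Poly_Mapping.keys p. Poly_Mapping.single x (Poly_Mapping.lookup p x))"
    by (rule poly_mapping_eqI) (simp add: lookup_sum_single in_keys_iff)
  ultimately show ?thesis using assms(1) by (metis finite_keys free_simps(1) mem_Collect_eq)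
qed

lemma single_smult: "Poly_Mapping.single x b = b \<odot>\<^bsub>free_module X\<^esub> Poly_Mapping.single x 1"
  by simp

lemma free_hom_eq:
  assumes M: "lmod M" and f: "f \<in> module_hom (free_module X) M" and g: "g \<in> module_hom (free_module X) M"
    and eq: "\<And>x. x \<in> X \<Longrightarrow> f (Poly_Mapping.single x 1) = g (Poly_Mapping.single x 1)"
    and p: "p \<in> carrier (free_module X)"
  shows "f p = g p"
  using p
proof (induction rule: free_induct)
  case zero
  then show ?case using hom_zero[OF free_lmod M f] hom_zero[OF free_lmod M g] by simp
next
  case (single x b)
  then have "Poly_Mapping.single x 1 \<in> carrier (free_module X)" by simp
  then show ?case using hom_smult[OF f, of _ b] hom_smult[OF g, of _ b] eq[OF single]
    by (metis single_smult)
next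
  case (add p q)
  then show ?case using hom_add[OF f] hom_add[OF g] by fastforce
qed

lemma free_hom_exists:
  fixes M :: "('b::ring_1, 'm) module" and g :: "'x \<Rightarrow> 'm"
  assumes M: "lmod M" and g: "\<And>x. x \<in> X \<Longrightarrow> g x \<in> carrier M"
  shows "\<exists>f\<in>module_hom (free_module X) M. \<forall>x\<in>X. f (Poly_Mapping.single x 1) = g x"
proof
  interpret M: lmod M by fact
  let ?l = Poly_Mapping.lookup
  define f where "f p = (\<Oplus>\<^bsub>M\<^esub>x\<in>Poly_Mapping.keys p. ?l p x \<odot>\<^bsub>M\<^esub> g x)" for p
  \<comment> \<open>Any finite index set containing the support gives the same sum; additivity is
    then checked over the union of two supports.\<close>
  have f: "f p = (\<Oplus>\<^bsub>M\<^esub>x\<in>A. ?l p x \<odot>\<^bsub>M\<^esub> g x)" if "finite A" "Poly_Mapping.keys p \<subseteq> A" "A \<subseteq> X" for p A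
    unfolding f_def using that g
    by (intro M.add.finprod_mono_neutral_cong_left) (auto simp: in_keys_iff)
  show "f \<in> module_hom (free_module X) M"
  proof (rule module_homI; simp)
    fix p :: "'x \<Rightarrow>\<^sub>0 'b" assume p: "Poly_Mapping.keys p \<subseteq> X"
    show "f p \<in> carrier M" unfolding f_def using p g by (intro M.finsum_closed) auto
    have "f (pscale r p) = (\<Oplus>\<^bsub>M\<^esub>x\<in>Poly_Mapping.keys p. r \<odot>\<^bsub>M\<^esub> (?l p x \<odot>\<^bsub>M\<^esub> g x))" for r
      using p g by (subst f[OF _ keys_pscale p])
        (auto simp: M.smult_assoc1 intro!: M.finsum_cong')
    moreover have "r \<odot>\<^bsub>M\<^esub> f p = (\<Oplus>\<^bsub>M\<^esub>x\<in>Poly_Mapping.keys p. r \<odot>\<^bsub>M\<^esub> (?l p x \<odot>\<^bsub>M\<^esub> g x))" for r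
      unfolding f_def by (rule M.finsum_smult) (use p g in auto)
    ultimately show "f (pscale r p) = r \<odot>\<^bsub>M\<^esub> f p" for r by simp
    fix q :: "'x \<Rightarrow>\<^sub>0 'b" assume q: "Poly_Mapping.keys q \<subseteq> X"
    let ?A = "Poly_Mapping.keys p \<union> Poly_Mapping.keys q"
    have A: "finite ?A" "?A \<subseteq> X" using p q by auto
    have "f (p + q) = (\<Oplus>\<^bsub>M\<^esub>x\<in>?A. ?l p x \<odot>\<^bsub>M\<^esub> g x \<oplus>\<^bsub>M\<^esub> ?l q x \<odot>\<^bsub>M\<^esub> g x)"
      using A g by (subst f[OF A(1) keys_add A(2)])
        (auto simp: M.smult_l_distr lookup_add intro!: M.finsum_cong')
    also have "\<dots> = f p \<oplus>\<^bsub>M\<^esub> f q"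
      using A g by (subst M.finsum_addf) (auto simp: f[OF A(1) _ A(2)])
    finally show "f (p + q) = f p \<oplus>\<^bsub>M\<^esub> f q" .
  qed
  show "\<forall>x\<in>X. f (Poly_Mapping.single x 1) = g x"
  proof
    fix x assume x: "x \<in> X"
    have "f (Poly_Mapping.single x 1) = (\<Oplus>\<^bsub>M\<^esub>y\<in>{x}. ?l (Poly_Mapping.single x 1) y \<odot>\<^bsub>M\<^esub> g y)"
      by (rule f) (use x in auto)
    then show "f (Poly_Mapping.single x 1) = g x" using x g[OF x] by simp
  qed
qed

text \<open>Projectivity of free modules: preimages are chosen on the basis and extended
  linearly.\<close>

lemma free_lift:
  assumes M: "lmod M" and N: "lmod N" and e: "e \<in> module_hom M N" and h: "h \<in> module_hom (free_module X) N"
    and im: "\<And>p. p \<in> carrier (free_module X) \<Longrightarrow> h p \<in> e ` carrier M"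
  obtains f where "f \<in> module_hom (free_module X) M"
    "\<And>p. p \<in> carrier (free_module X) \<Longrightarrow> e (f p) = h p"
proof -
  have "\<exists>m. m \<in> carrier M \<and> e m = h (Poly_Mapping.single x 1)" if "x \<in> X" for x
    using im[of "Poly_Mapping.single x 1"] that by auto
  then obtain g where g: "\<And>x. x \<in> X \<Longrightarrow> g x \<in> carrier M \<and> e (g x) = h (Poly_Mapping.single x 1)" by metis
  obtain f where f: "f \<in> module_hom (free_module X) M" "\<And>x. x \<in> X \<Longrightarrow> f (Poly_Mapping.single x 1) = g x"
    using free_hom_exists[OF M, of X g] g by auto
  have "e (f p) = h p" if "p \<in> carrier (free_module X)" for p
    by (rule free_hom_eq[OF N hom_comp[OF f(1) e] h _ that]) (use f(2) g in auto)
  then show ?thesis using that f(1) by blast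
qed

text \<open>
  Comparing classes only uses the last component \<open>s\<close> of the chain homotopy between two lifts, so
  the induction carries that component alone; \<open>\<delta>\<close> is the difference of the lifts.
\<close>

lemma homotopy_component:
  fixes X :: "nat \<Rightarrow> 'x set" and M :: "nat \<Rightarrow> ('b::ring_1, 'm) module"
  assumes d: "\<And>i. i \<le> k \<Longrightarrow> d i \<in> module_hom (free_module (X (Suc i))) (free_module (X i))"
    and dd: "\<And>i p. i < k \<Longrightarrow> p \<in> carrier (free_module (X (Suc (Suc i)))) \<Longrightarrow> d i (d (Suc i) p) = 0"
    and M: "\<And>i. i \<le> Suc k \<Longrightarrow> lmod (M i)"
    and e: "\<And>i. i \<le> k \<Longrightarrow> e i \<in> module_hom (M (Suc i)) (M i)"
    and exact: "\<And>i m. i < k \<Longrightarrow> m \<in> carrier (M (Suc i)) \<Longrightarrow> e i m = \<zero>\<^bsub>M i\<^esub> \<Longrightarrow> m \<in> e (Suc i) ` carrier (M (Suc (Suc i)))"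
    and \<delta>: "\<And>i. i \<le> Suc k \<Longrightarrow> \<delta> i \<in> module_hom (free_module (X i)) (M i)"
    and \<delta>_chain: "\<And>i p. i \<le> k \<Longrightarrow> p \<in> carrier (free_module (X (Suc i))) \<Longrightarrow> e i (\<delta> (Suc i) p) = \<delta> i (d i p)"
    and \<delta>0: "\<And>p. p \<in> carrier (free_module (X 0)) \<Longrightarrow> \<delta> 0 p \<in> e 0 ` carrier (M 1)"
  shows "\<exists>s\<in>module_hom (free_module (X k)) (M (Suc k)).
    \<forall>p\<in>carrier (free_module (X (Suc k))). e k (\<delta> (Suc k) p \<ominus>\<^bsub>M (Suc k)\<^esub> s (d k p)) = \<zero>\<^bsub>M k\<^esub>"
  using assms
proof (induction k)
  case 0
  obtain s where s: "s \<in> module_hom (free_module (X 0)) (M 1)"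
    "\<And>p. p \<in> carrier (free_module (X 0)) \<Longrightarrow> e 0 (s p) = \<delta> 0 p"
    using free_lift[of "M 1" "M 0" "e 0" "\<delta> 0" "X 0"] 0 by auto
  have "e 0 (\<delta> 1 p \<ominus>\<^bsub>M 1\<^esub> s (d 0 p)) = \<zero>\<^bsub>M 0\<^esub>" if p: "p \<in> carrier (free_module (X 1))" for p
  proof -
    have dp: "d 0 p \<in> carrier (free_module (X 0))" using hom_carrier[OF "0.prems"(1)[of 0]] p by simp
    have M1: "lmod (M 1)" and M0: "lmod (M 0)" using 0 by auto
    have "\<delta> 1 p \<in> carrier (M 1)" using hom_carrier[OF "0.prems"(6)[of 1]] p by simp
    moreover have "s (d 0 p) \<in> carrier (M 1)" using hom_carrier[OF s(1) dp] .
    ultimately have "e 0 (\<delta> 1 p \<ominus>\<^bsub>M 1\<^esub> s (d 0 p)) = e 0 (\<delta> 1 p) \<ominus>\<^bsub>M 0\<^esub> e 0 (s (d 0 p))"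
      using hom_minus[OF M1 M0, of "e 0"] "0.prems"(4)[of 0] by simp
    also have "\<dots> = \<delta> 0 (d 0 p) \<ominus>\<^bsub>M 0\<^esub> \<delta> 0 (d 0 p)" using "0.prems"(7)[of 0 p] p s(2)[OF dp] by simp
    also have "\<dots> = \<zero>\<^bsub>M 0\<^esub>"
      using hom_carrier[OF "0.prems"(6)[of 0] dp] lmod.minus_eq_zero_iff[OF M0] by simp
    finally show ?thesis .
  qed
  then show ?case using s(1) by auto
next
  case (Suc k)
  have "\<exists>s\<in>module_hom (free_module (X k)) (M (Suc k)).
    \<forall>p\<in>carrier (free_module (X (Suc k))). e k (\<delta> (Suc k) p \<ominus>\<^bsub>M (Suc k)\<^esub> s (d k p)) = \<zero>\<^bsub>M k\<^esub>"
    by (rule Suc.IH) (use Suc.prems in auto)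
  then obtain s where s: "s \<in> module_hom (free_module (X k)) (M (Suc k))"
    "\<And>p. p \<in> carrier (free_module (X (Suc k))) \<Longrightarrow> e k (\<delta> (Suc k) p \<ominus>\<^bsub>M (Suc k)\<^esub> s (d k p)) = \<zero>\<^bsub>M k\<^esub>"
    by blast
  have M1: "lmod (M (Suc k))" and M2: "lmod (M (Suc (Suc k)))" using Suc.prems by auto
  interpret M1: lmod "M (Suc k)" by (rule M1)
  have dk: "d k \<in> module_hom (free_module (X (Suc k))) (free_module (X k))"
    and dk1: "d (Suc k) \<in> module_hom (free_module (X (Suc (Suc k)))) (free_module (X (Suc k)))"
    and ek1: "e (Suc k) \<in> module_hom (M (Suc (Suc k))) (M (Suc k))"
    and \<delta>1: "\<delta> (Suc k) \<in> module_hom (free_module (X (Suc k))) (M (Suc k))"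
    and \<delta>2: "\<delta> (Suc (Suc k)) \<in> module_hom (free_module (X (Suc (Suc k)))) (M (Suc (Suc k)))"
    using Suc.prems by auto
  \<comment> \<open>The part of \<open>\<delta> (Suc k)\<close> that the homotopy found so far does
    not account for. It is killed by \<open>e k\<close>, so exactness lets it be lifted to the next
    component \<open>t\<close>.\<close>
  define h where "h = (\<lambda>p. \<delta> (Suc k) p \<ominus>\<^bsub>M (Suc k)\<^esub> s (d k p))"
  have h: "h \<in> module_hom (free_module (X (Suc k))) (M (Suc k))"
    unfolding h_def using hom_pointwise_minus[OF free_lmod M1 \<delta>1 hom_comp[OF dk s(1)]] .
  have "h p \<in> e (Suc k) ` carrier (M (Suc (Suc k)))" if "p \<in> carrier (free_module (X (Suc k)))" for p
    using Suc.prems(5)[of k "h p"] hom_carrier[OF h that] s(2)[OF that] by (simp add: h_def)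
  then obtain t where t: "t \<in> module_hom (free_module (X (Suc k))) (M (Suc (Suc k)))"
    "\<And>p. p \<in> carrier (free_module (X (Suc k))) \<Longrightarrow> e (Suc k) (t p) = h p"
    using free_lift[OF M2 M1 ek1 h] by blast
  have "e (Suc k) (\<delta> (Suc (Suc k)) p \<ominus>\<^bsub>M (Suc (Suc k))\<^esub> t (d (Suc k) p)) = \<zero>\<^bsub>M (Suc k)\<^esub>"
    if p: "p \<in> carrier (free_module (X (Suc (Suc k))))" for p
  proof -
    have dp: "d (Suc k) p \<in> carrier (free_module (X (Suc k)))" by (rule hom_carrier[OF dk1 p])
    \<comment> \<open>On boundaries the correction vanishes because two consecutive differentials
      compose to zero, so \<open>h\<close> and \<open>\<delta> (Suc k)\<close> agree there.\<close>
    have "s (d k (d (Suc k) p)) = \<zero>\<^bsub>M (Suc k)\<^esub>"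
      using Suc.prems(2)[of k p] p hom_zero[OF free_lmod M1 s(1)] by simp
    then have hd: "h (d (Suc k) p) = \<delta> (Suc k) (d (Suc k) p)"
      using hom_carrier[OF \<delta>1 dp] M1.minus_add_cancel[of "\<delta> (Suc k) (d (Suc k) p)" "\<zero>\<^bsub>M (Suc k)\<^esub>"]
      by (simp add: h_def)
    have "e (Suc k) (\<delta> (Suc (Suc k)) p \<ominus>\<^bsub>M (Suc (Suc k))\<^esub> t (d (Suc k) p))
      = e (Suc k) (\<delta> (Suc (Suc k)) p) \<ominus>\<^bsub>M (Suc k)\<^esub> e (Suc k) (t (d (Suc k) p))"
      by (rule hom_minus[OF M2 M1 ek1 hom_carrier[OF \<delta>2 p] hom_carrier[OF t(1) dp]])
    also have "\<dots> = \<zero>\<^bsub>M (Suc k)\<^esub>"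
      using Suc.prems(7)[of "Suc k" p] p t(2)[OF dp] hd hom_carrier[OF \<delta>1 dp] by (simp add: M1.minus_eq_zero_iff)
    finally show ?thesis .
  qed
  then show ?case using t(1) by blast
qed

section \<open>Cohomology of the trivial module\<close>

lemma triv_simps [simp]:
  "carrier (trivial_module a) = UNIV" "x \<oplus>\<^bsub>trivial_module a\<^esub> y = x + y"
  "\<zero>\<^bsub>trivial_module a\<^esub> = 0" "r \<odot>\<^bsub>trivial_module a\<^esub> x = a r * x"
  by (simp_all add: trivial_module_def module_of_def)

text \<open>All that the cohomological part sees of the \<open>FSG\<close> structure: a character
  \<open>a\<close> of \<open>B\<close> with a section \<open>\<iota>\<close> by central elements. In
  the end \<open>\<iota> c\<close> is \<open>scale c 1\<close>; being central, it lets
  \<open>K\<close> act on free modules by \<open>B\<close>-linear maps.\<close>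

locale trivial_resolution =
  fixes a :: "'b::ring_1 \<Rightarrow> 'k::field" and \<iota> :: "'k \<Rightarrow> 'b" and P :: "('b, 'x, 'k) resolution"
  assumes a_add: "a (r + s) = a r + a s" and a_mult: "a (r * s) = a r * a s" and a_one: "a 1 = 1"
    and a_\<iota>: "a (\<iota> c) = c" and central: "\<iota> c * b = b * \<iota> c"
    and resolution: "free_resolution a P"
begin

abbreviation "F \<equiv> res_term P"
abbreviation "d \<equiv> res_diff P"
abbreviation "\<epsilon> \<equiv> res_aug P"
abbreviation "T \<equiv> trivial_module a"
abbreviation "C \<equiv> cochains a P"
abbreviation "cl \<equiv> cohomology_class a P"

lemma a_zero: "a 0 = 0"
  using a_add[of 0 0] by (metis add.right_neutral add_cancel_right_right)

lemma T_lmod: "lmod T"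
  by (rule lmodI) (auto simp: a_add a_mult a_one a_zero algebra_simps)

lemma T_minus [simp]: "x \<ominus>\<^bsub>T\<^esub> y = x - y"
proof -
  interpret lmod T by (rule T_lmod)
  have "a (- 1) = - 1" using a_add[of 1 "- 1"] by (simp add: a_one a_zero eq_neg_iff_add_eq_0 add.commute)
  then show ?thesis using a_inv_smult[of y] by (simp add: minus_eq)
qed

lemma F_lmod: "lmod (F n)"
  by (simp add: res_term_def free_lmod)

lemma F_simps: "p \<oplus>\<^bsub>F n\<^esub> q = p + q" "\<zero>\<^bsub>F n\<^esub> = 0" "r \<odot>\<^bsub>F n\<^esub> p = pscale r p"
  by (simp_all add: res_term_def)

lemma F_minus: "p \<in> carrier (F n) \<Longrightarrow> q \<in> carrier (F n) \<Longrightarrow> p \<ominus>\<^bsub>F n\<^esub> q = p - q"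
  using free_minus[of p "res_gens P n" q] by (simp add: res_term_def)

lemma d_hom: "d n \<in> module_hom (F (Suc n)) (F n)"
  and \<epsilon>_hom: "\<epsilon> \<in> module_hom (F 0) T"
  and \<epsilon>_surj: "\<epsilon> ` carrier (F 0) = UNIV"
  using resolution by (auto simp: free_resolution_def)

lemma d_carrier: "p \<in> carrier (F (Suc n)) \<Longrightarrow> d n p \<in> carrier (F n)"
  using hom_carrier[OF d_hom] .

lemma d_zero: "d n 0 = 0"
  using hom_zero[OF F_lmod F_lmod d_hom, of n] by (simp add: F_simps)

lemma kernel_\<epsilon>: "{p \<in> carrier (F 0). \<epsilon> p = 0} = d 0 ` carrier (F 1)"
  and kernel_d: "{p \<in> carrier (F (Suc n)). d n p = 0} = d (Suc n) ` carrier (F (Suc (Suc n)))"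
  using resolution by (auto simp: free_resolution_def a_kernel_eq F_simps)

lemma \<epsilon>d: "p \<in> carrier (F 1) \<Longrightarrow> \<epsilon> (d 0 p) = 0"
  using kernel_\<epsilon> by blast

lemma dd: "p \<in> carrier (F (Suc (Suc n))) \<Longrightarrow> d n (d (Suc n) p) = 0"
  using kernel_d[of n] by blast

lemma exact_\<epsilon>: "p \<in> carrier (F 0) \<Longrightarrow> \<epsilon> p = 0 \<Longrightarrow> p \<in> d 0 ` carrier (F 1)"
  using kernel_\<epsilon> by blast

lemma exact_d: "p \<in> carrier (F (Suc n)) \<Longrightarrow> d n p = 0 \<Longrightarrow> p \<in> d (Suc n) ` carrier (F (Suc (Suc n)))"
  using kernel_d[of n] by blast

section \<open>The cochain complex and its cohomology classes\<close>

lemma C_simps: "carrier (C n) = module_hom (F n) T \<inter> extensional (carrier (F n))"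
  "f \<oplus>\<^bsub>C n\<^esub> g = (\<lambda>x\<in>carrier (F n). f x + g x)" "\<zero>\<^bsub>C n\<^esub> = (\<lambda>x\<in>carrier (F n). 0)"
  "c \<odot>\<^bsub>C n\<^esub> f = (\<lambda>x\<in>carrier (F n). c * f x)"
  by (simp_all add: cochains_def Hom_K_def module_of_def)

lemma F_closed: "p \<in> carrier (F n) \<Longrightarrow> q \<in> carrier (F n) \<Longrightarrow> p + q \<in> carrier (F n)"
  "p \<in> carrier (F n) \<Longrightarrow> pscale r p \<in> carrier (F n)" "0 \<in> carrier (F n)"
proof -
  interpret lmod "F n" by (rule F_lmod)
  show "p \<in> carrier (F n) \<Longrightarrow> q \<in> carrier (F n) \<Longrightarrow> p + q \<in> carrier (F n)"
    "p \<in> carrier (F n) \<Longrightarrow> pscale r p \<in> carrier (F n)" "0 \<in> carrier (F n)"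
    using a_closed[of p q] smult_closed[of p r] zero_closed by (simp_all add: F_simps)
qed

lemma restrict_hom: "f \<in> module_hom M T \<Longrightarrow> lmod M \<Longrightarrow> restrict f (carrier M) \<in> module_hom M T"
proof -
  assume f: "f \<in> module_hom M T" and M: "lmod M"
  interpret lmod M by (rule M)
  show ?thesis by (rule module_homI) (use hom_add[OF f] hom_smult[OF f] in auto)
qed

lemma restrict_cochain: "f \<in> module_hom (F n) T \<Longrightarrow> restrict f (carrier (F n)) \<in> carrier (C n)"
  using restrict_hom[OF _ F_lmod] by (simp add: C_simps)

lemma hom_T_add: "f \<in> module_hom M T \<Longrightarrow> g \<in> module_hom M T \<Longrightarrow> (\<lambda>x. f x + g x) \<in> module_hom M T"
  by (rule module_homI) (auto simp: hom_add hom_smult algebra_simps)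

lemma hom_T_smult: "f \<in> module_hom M T \<Longrightarrow> (\<lambda>x. c * f x) \<in> module_hom M T"
  by (rule module_homI) (auto simp: hom_add hom_smult algebra_simps)

lemma hom_T_zero: "(\<lambda>x. 0) \<in> module_hom M T"
  by (rule module_homI) auto

lemma C_lmod: "lmod (C n)"
proof (rule lmodI)
  show "\<zero>\<^bsub>C n\<^esub> \<in> carrier (C n)" using restrict_cochain[OF hom_T_zero] by (simp add: C_simps)
next
  fix f g h and r s :: 'k
  assume f: "f \<in> carrier (C n)"
  have fe: "f = (\<lambda>x\<in>carrier (F n). f x)" using f by (simp add: C_simps extensional_restrict)
  show "r \<odot>\<^bsub>C n\<^esub> f \<in> carrier (C n)" using f restrict_cochain[OF hom_T_smult, of f n r] by (simp add: C_simps)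
  show "\<zero>\<^bsub>C n\<^esub> \<oplus>\<^bsub>C n\<^esub> f = f" "1 \<odot>\<^bsub>C n\<^esub> f = f"
    by (subst (2) fe; simp add: C_simps restrict_def cong: if_cong)+
  show "(r + s) \<odot>\<^bsub>C n\<^esub> f = r \<odot>\<^bsub>C n\<^esub> f \<oplus>\<^bsub>C n\<^esub> s \<odot>\<^bsub>C n\<^esub> f" "(r * s) \<odot>\<^bsub>C n\<^esub> f = r \<odot>\<^bsub>C n\<^esub> (s \<odot>\<^bsub>C n\<^esub> f)"
    "0 \<odot>\<^bsub>C n\<^esub> f = \<zero>\<^bsub>C n\<^esub>"
    by (auto simp: C_simps algebra_simps)
  assume g: "g \<in> carrier (C n)"
  show "f \<oplus>\<^bsub>C n\<^esub> g \<in> carrier (C n)" using f g restrict_cochain[OF hom_T_add, of f n g] by (simp add: C_simps)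
  show "f \<oplus>\<^bsub>C n\<^esub> g = g \<oplus>\<^bsub>C n\<^esub> f" "r \<odot>\<^bsub>C n\<^esub> (f \<oplus>\<^bsub>C n\<^esub> g) = r \<odot>\<^bsub>C n\<^esub> f \<oplus>\<^bsub>C n\<^esub> r \<odot>\<^bsub>C n\<^esub> g"
    by (auto simp: C_simps algebra_simps)
  show "(f \<oplus>\<^bsub>C n\<^esub> g) \<oplus>\<^bsub>C n\<^esub> h = f \<oplus>\<^bsub>C n\<^esub> (g \<oplus>\<^bsub>C n\<^esub> h)" by (auto simp: C_simps algebra_simps)
qed

lemma C_minus:
  assumes "f \<in> carrier (C n)" "g \<in> carrier (C n)"
  shows "f \<ominus>\<^bsub>C n\<^esub> g = (\<lambda>x\<in>carrier (F n). f x - g x)"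
proof -
  interpret lmod "C n" by (rule C_lmod)
  show ?thesis using a_inv_smult[OF assms(2)] by (auto simp: minus_eq C_simps)
qed

lemma coboundary_hom: "coboundary P n \<in> module_hom (C n) (C (Suc n))"
proof (rule module_homI)
  fix f assume "f \<in> carrier (C n)"
  then have "f \<in> module_hom (F n) T" by (simp add: C_simps)
  then show "coboundary P n f \<in> carrier (C (Suc n))"
    unfolding coboundary_def by (intro restrict_cochain hom_comp[OF d_hom])
qed (auto simp: coboundary_def C_simps d_carrier)

lemma cocycles_eq: "cocycles a P n = {f \<in> carrier (C n). \<forall>p\<in>carrier (F (Suc n)). f (d n p) = 0}"
  by (auto simp: cocycles_def a_kernel_eq coboundary_def C_simps restrict_def fun_eq_iff)

lemma cocycles_lsub: "lsubmodule (cocycles a P n) (C n)"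
  unfolding cocycles_def by (rule kernel_lsub[OF C_lmod C_lmod coboundary_hom])

abbreviation "Z n \<equiv> (C n)\<lparr>carrier := cocycles a P n\<rparr>"

lemma Z_lmod: "lmod (Z n)"
  by (rule lsub_lmod[OF C_lmod cocycles_lsub])

text \<open>The witness \<open>s\<close> may be any homomorphism; restricting it to the carrier
  gives the normalised cochain of the definition without affecting its values on
  \<open>d n p\<close>.\<close>

lemma coboundaries_Suc: "f \<in> coboundaries a P (Suc n) \<longleftrightarrow>
    f \<in> carrier (C (Suc n)) \<and> (\<exists>s\<in>module_hom (F n) T. \<forall>p\<in>carrier (F (Suc n)). f p = s (d n p))"
proof
  assume "f \<in> coboundaries a P (Suc n)"
  then obtain s where "s \<in> carrier (C n)" "f = coboundary P n s" by (auto simp: coboundaries_def)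
  then show "f \<in> carrier (C (Suc n)) \<and> (\<exists>s\<in>module_hom (F n) T. \<forall>p\<in>carrier (F (Suc n)). f p = s (d n p))"
    using hom_carrier[OF coboundary_hom] by (auto simp: coboundary_def C_simps)
next
  assume "f \<in> carrier (C (Suc n)) \<and> (\<exists>s\<in>module_hom (F n) T. \<forall>p\<in>carrier (F (Suc n)). f p = s (d n p))"
  then obtain s where f: "f \<in> carrier (C (Suc n))" and s: "s \<in> module_hom (F n) T"
    "\<And>p. p \<in> carrier (F (Suc n)) \<Longrightarrow> f p = s (d n p)" by blast
  have "f = coboundary P n (restrict s (carrier (F n)))"
    by (rule extensionalityI[where A = "carrier (F (Suc n))"])
      (use f s(2) in \<open>auto simp: C_simps coboundary_def d_carrier\<close>)
  then show "f \<in> coboundaries a P (Suc n)" using restrict_cochain[OF s(1)] by (auto simp: coboundaries_def)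
qed

lemma coboundaries_lsub_C: "lsubmodule (coboundaries a P n) (C n)"
proof (cases n)
  case 0
  interpret lmod "C 0" by (rule C_lmod)
  show ?thesis using 0 by (auto simp: coboundaries_def lsubmodule_def)
next
  case (Suc m)
  show ?thesis using image_lsub[OF C_lmod C_lmod coboundary_hom[of m]] Suc by (simp add: coboundaries_def)
qed

lemma coboundaries_cocycles: "coboundaries a P n \<subseteq> cocycles a P n"
proof (cases n)
  case 0
  then show ?thesis using lsub_zero[OF C_lmod cocycles_lsub, of 0] by (auto simp: coboundaries_def)
next
  case (Suc m)
  have "f (d (Suc m) p) = 0" if "f \<in> coboundaries a P (Suc m)" "p \<in> carrier (F (Suc (Suc m)))" for f p
  proof -
    obtain s where s: "s \<in> module_hom (F m) T" "\<And>p. p \<in> carrier (F (Suc m)) \<Longrightarrow> f p = s (d m p)"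
      using iffD1[OF coboundaries_Suc \<open>f \<in> coboundaries a P (Suc m)\<close>] by auto
    show ?thesis using s(2)[OF d_carrier[OF that(2)]] hom_zero[OF F_lmod T_lmod s(1)] dd[OF that(2)]
      by (simp add: F_simps)
  qed
  then show ?thesis using Suc by (auto simp: cocycles_eq coboundaries_Suc)
qed

lemma coboundaries_lsub: "lsubmodule (coboundaries a P n) (Z n)"
  using coboundaries_lsub_C[of n] coboundaries_cocycles[of n] by (auto simp: lsubmodule_def)

lemma Ext_eq: "Ext a P n = quotient_module (Z n) (coboundaries a P n)"
  by (simp add: Ext_def)

lemma Ext_lmod: "lmod (Ext a P n)"
  unfolding Ext_eq by (rule quot_lmod[OF Z_lmod coboundaries_lsub])

text \<open>Classes are defined as cosets in the cochain space, \<open>Ext\<close> as a quotient of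
  the cocycles; a coset depends on the addition only, which both records share.\<close>

lemma cl_eq_coset: "cl n f = coboundaries a P n +>\<^bsub>Z n\<^esub> f"
  by (simp add: cohomology_class_def a_r_coset_def')

lemma cocycle_C: "f \<in> cocycles a P n \<Longrightarrow> f \<in> carrier (C n)"
  by (simp add: cocycles_eq)

lemma cocycle_hom: "f \<in> cocycles a P n \<Longrightarrow> f \<in> module_hom (F n) T"
  by (simp add: cocycles_eq C_simps)

lemma Ext_carrier: "carrier (Ext a P n) = cl n ` cocycles a P n"
  unfolding Ext_eq quot_carrier[OF Z_lmod coboundaries_lsub] by (simp add: cl_eq_coset)

lemma cl_add: "f \<in> cocycles a P n \<Longrightarrow> g \<in> cocycles a P n \<Longrightarrow>
    cl n f \<oplus>\<^bsub>Ext a P n\<^esub> cl n g = cl n (f \<oplus>\<^bsub>C n\<^esub> g)"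
  using quot_add[OF Z_lmod coboundaries_lsub, of f n g] by (simp add: Ext_eq cl_eq_coset)

lemma cl_smult: "f \<in> cocycles a P n \<Longrightarrow> c \<odot>\<^bsub>Ext a P n\<^esub> cl n f = cl n (c \<odot>\<^bsub>C n\<^esub> f)"
  using quot_smult[OF Z_lmod coboundaries_lsub, of f n c] by (simp add: Ext_eq cl_eq_coset)

lemma Ext_zero: "\<zero>\<^bsub>Ext a P n\<^esub> = coboundaries a P n"
  unfolding Ext_eq quot_zero[OF Z_lmod coboundaries_lsub] ..

lemma cl_eq_iff: "f \<in> cocycles a P n \<Longrightarrow> g \<in> cocycles a P n \<Longrightarrow>
    cl n f = cl n g \<longleftrightarrow> (\<lambda>x\<in>carrier (F n). f x - g x) \<in> coboundaries a P n"
  using coset_eq_iff[OF Z_lmod coboundaries_lsub, of f n g] lsub_minus_eq[OF C_lmod cocycles_lsub, of f n g]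
    C_minus[OF cocycle_C cocycle_C, of f n g]
  by (simp add: cl_eq_coset)

lemma cl_eq_Suc_iff:
  assumes f: "f \<in> cocycles a P (Suc n)" and g: "g \<in> cocycles a P (Suc n)"
  shows "cl (Suc n) f = cl (Suc n) g \<longleftrightarrow>
    (\<exists>s\<in>module_hom (F n) T. \<forall>p\<in>carrier (F (Suc n)). f p - g p = s (d n p))"
proof -
  have "(\<lambda>x. f x - g x) \<in> module_hom (F (Suc n)) T"
    using hom_pointwise_minus[OF F_lmod T_lmod cocycle_hom[OF f] cocycle_hom[OF g]] by simp
  then show ?thesis unfolding cl_eq_iff[OF f g] coboundaries_Suc using restrict_cochain by auto
qed

lemma cocycleI: "f \<in> module_hom (F n) T \<Longrightarrow> (\<And>p. p \<in> carrier (F (Suc n)) \<Longrightarrow> f (d n p) = 0) \<Longrightarrow>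
    restrict f (carrier (F n)) \<in> cocycles a P n"
  by (simp add: cocycles_eq restrict_cochain d_carrier)

lemma cocycle_zero: "f \<in> cocycles a P n \<Longrightarrow> p \<in> carrier (F (Suc n)) \<Longrightarrow> f (d n p) = 0"
  by (simp add: cocycles_eq)

section \<open>The composition product\<close>

text \<open>The comparison map from the resolution to itself that lowers degrees by \<open>n\<close>
  and covers \<open>g\<close>, with no sign in its commutation with the differentials. Composing
  with it realises multiplication by the class of \<open>g\<close> from the right.\<close>

definition chain_lift :: "nat \<Rightarrow> (('x \<Rightarrow>\<^sub>0 'b) \<Rightarrow> 'k) \<Rightarrow> (nat \<Rightarrow> ('x \<Rightarrow>\<^sub>0 'b) \<Rightarrow> ('x \<Rightarrow>\<^sub>0 'b)) \<Rightarrow> bool" where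
  "chain_lift n g \<psi> \<longleftrightarrow>
     (\<forall>i. \<psi> i \<in> module_hom (F (i + n)) (F i)) \<and>
     (\<forall>p\<in>carrier (F n). \<epsilon> (\<psi> 0 p) = g p) \<and>
     (\<forall>i. \<forall>p\<in>carrier (F (Suc i + n)). d i (\<psi> (Suc i) p) = \<psi> i (d (i + n) p))"

lemma chain_lift_exists:
  assumes g: "g \<in> cocycles a P n"
  shows "\<exists>\<psi>. chain_lift n g \<psi>"
proof -
  \<comment> \<open>Besides the homomorphism property, \<open>Q\<close> carries what the next
    lifting step needs: boundaries go to boundaries. The clause for \<open>i = 0\<close> stores the
    condition on the augmentation, as the recursive choice uses one predicate for all
    indices.\<close>
  define Q where "Q i \<psi> \<longleftrightarrow> \<psi> \<in> module_hom (F (i + n)) (F i) \<and>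
    (\<forall>p\<in>carrier (F (Suc i + n)). \<psi> (d (i + n) p) \<in> d i ` carrier (F (Suc i))) \<and>
    (i = 0 \<longrightarrow> (\<forall>p\<in>carrier (F n). \<epsilon> (\<psi> p) = g p))" for i \<psi>
  have "\<exists>\<psi>. \<forall>i. Q i (\<psi> i) \<and> (\<forall>p\<in>carrier (F (Suc i + n)). d i (\<psi> (Suc i) p) = \<psi> i (d (i + n) p))"
  proof (rule dependent_nat_choice)
    obtain \<psi> where \<psi>: "\<psi> \<in> module_hom (F n) (F 0)" "\<And>p. p \<in> carrier (F n) \<Longrightarrow> \<epsilon> (\<psi> p) = g p"
      using free_lift[OF F_lmod T_lmod \<epsilon>_hom, of g "res_gens P n"] cocycle_hom[OF g] \<epsilon>_surj
      by (auto simp: res_term_def[of P n])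
    have "\<psi> (d n p) \<in> d 0 ` carrier (F 1)" if "p \<in> carrier (F (Suc n))" for p
      using exact_\<epsilon>[OF hom_carrier[OF \<psi>(1) d_carrier[OF that]]] \<psi>(2)[OF d_carrier[OF that]] cocycle_zero[OF g that]
      by simp
    then show "\<exists>\<psi>. Q 0 \<psi>" using \<psi> by (auto simp: Q_def)
  next
    fix \<psi> i assume Q: "Q i \<psi>"
    then have \<psi>: "\<psi> \<in> module_hom (F (i + n)) (F i)" by (simp add: Q_def)
    have h: "(\<lambda>p. \<psi> (d (i + n) p)) \<in> module_hom (F (Suc i + n)) (F i)"
      using hom_comp[OF d_hom \<psi>] by simp
    obtain \<psi>' where \<psi>': "\<psi>' \<in> module_hom (F (Suc i + n)) (F (Suc i))"
      "\<And>p. p \<in> carrier (F (Suc i + n)) \<Longrightarrow> d i (\<psi>' p) = \<psi> (d (i + n) p)"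
      using free_lift[OF F_lmod F_lmod d_hom[of i] h[unfolded res_term_def[of P "Suc i + n"]]] Q
      by (auto simp: Q_def res_term_def[of P "Suc (i + n)"])
    have "\<psi>' (d (Suc i + n) p) \<in> d (Suc i) ` carrier (F (Suc (Suc i)))"
      if p: "p \<in> carrier (F (Suc (Suc i) + n))" for p
    proof (rule exact_d)
      have dp: "d (Suc i + n) p \<in> carrier (F (Suc i + n))" using d_carrier p by simp
      show "\<psi>' (d (Suc i + n) p) \<in> carrier (F (Suc i))" by (rule hom_carrier[OF \<psi>'(1) dp])
      show "d i (\<psi>' (d (Suc i + n) p)) = 0"
        using \<psi>'(2)[OF dp] dd[of p "i + n"] p hom_zero[OF F_lmod F_lmod \<psi>] by (simp add: F_simps)
    qed
    then show "\<exists>\<psi>'. Q (Suc i) \<psi>' \<and> (\<forall>p\<in>carrier (F (Suc i + n)). d i (\<psi>' p) = \<psi> (d (i + n) p))"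
      using \<psi>' by (auto simp: Q_def)
  qed
  then show ?thesis by (auto simp: chain_lift_def Q_def)
qed

lemma chain_liftD:
  assumes "chain_lift n g \<psi>"
  shows "\<psi> i \<in> module_hom (F (i + n)) (F i)" "p \<in> carrier (F n) \<Longrightarrow> \<epsilon> (\<psi> 0 p) = g p"
    "p \<in> carrier (F (Suc i + n)) \<Longrightarrow> d i (\<psi> (Suc i) p) = \<psi> i (d (i + n) p)"
  using assms by (auto simp: chain_lift_def)

definition comp_cocycle :: "nat \<Rightarrow> nat \<Rightarrow> (('x \<Rightarrow>\<^sub>0 'b) \<Rightarrow> 'k) \<Rightarrow> (nat \<Rightarrow> ('x \<Rightarrow>\<^sub>0 'b) \<Rightarrow> ('x \<Rightarrow>\<^sub>0 'b)) \<Rightarrow> ('x \<Rightarrow>\<^sub>0 'b) \<Rightarrow> 'k" where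
  "comp_cocycle m n f \<psi> = (\<lambda>p\<in>carrier (F (m + n)). f (\<psi> m p))"

lemma comp_cocycle:
  assumes f: "f \<in> cocycles a P m" and \<psi>: "chain_lift n g \<psi>"
  shows "comp_cocycle m n f \<psi> \<in> cocycles a P (m + n)"
  unfolding comp_cocycle_def
proof (rule cocycleI)
  show "(\<lambda>p. f (\<psi> m p)) \<in> module_hom (F (m + n)) T"
    by (rule hom_comp[OF chain_liftD(1)[OF \<psi>] cocycle_hom[OF f]])
  fix p assume p: "p \<in> carrier (F (Suc (m + n)))"
  then show "f (\<psi> m (d (m + n) p)) = 0"
    using chain_liftD(3)[OF \<psi>, of p m] cocycle_zero[OF f hom_carrier[OF chain_liftD(1)[OF \<psi>, of "Suc m"], of p]]
    by simp
qed

text \<open>If \<open>f - f' = s \<circ> d\<close>, the compositions differ by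
  \<open>s \<circ> d \<circ> \<psi> = s \<circ> \<psi> \<circ> d\<close>, a coboundary with witness
  \<open>s \<circ> \<psi> k\<close>.\<close>

lemma comp_cocycle_cong_left:
  assumes f: "f \<in> cocycles a P m" "f' \<in> cocycles a P m" and eq: "cl m f = cl m f'" and m: "0 < m"
    and \<psi>: "chain_lift n g \<psi>"
  shows "cl (m + n) (comp_cocycle m n f \<psi>) = cl (m + n) (comp_cocycle m n f' \<psi>)"
proof -
  obtain k where k: "m = Suc k" using m by (cases m) auto
  obtain s where s: "s \<in> module_hom (F k) T" "\<And>p. p \<in> carrier (F (Suc k)) \<Longrightarrow> f p - f' p = s (d k p)"
    using eq cl_eq_Suc_iff[of f k f'] f k by auto
  have "comp_cocycle m n f \<psi> p - comp_cocycle m n f' \<psi> p = s (\<psi> k (d (k + n) p))"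
    if p: "p \<in> carrier (F (Suc (k + n)))" for p
  proof -
    have "\<psi> (Suc k) p \<in> carrier (F (Suc k))" using hom_carrier[OF chain_liftD(1)[OF \<psi>, of "Suc k"]] p by simp
    then show ?thesis using s(2)[of "\<psi> (Suc k) p"] chain_liftD(3)[OF \<psi>, of p k] p by (simp add: comp_cocycle_def k)
  qed
  then show ?thesis
    using cl_eq_Suc_iff[of "comp_cocycle m n f \<psi>" "k + n" "comp_cocycle m n f' \<psi>"]
      comp_cocycle[OF f(1) \<psi>] comp_cocycle[OF f(2) \<psi>] hom_comp[OF chain_liftD(1)[OF \<psi>, of k] s(1)]
    by (auto simp: k)
qed

text \<open>Lifts of cohomologous cocycles agree up to a homotopy, whose last component, composed
  with \<open>f\<close>, exhibits the difference as a coboundary.\<close>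

lemma comp_cocycle_cong_right:
  assumes f: "f \<in> cocycles a P m" and m: "0 < m" and n: "0 < n"
    and g: "g \<in> cocycles a P n" "g' \<in> cocycles a P n" and eq: "cl n g = cl n g'"
    and \<psi>: "chain_lift n g \<psi>" and \<psi>': "chain_lift n g' \<psi>'"
  shows "cl (m + n) (comp_cocycle m n f \<psi>) = cl (m + n) (comp_cocycle m n f \<psi>')"
proof -
  obtain k where k: "m = Suc k" using m by (cases m) auto
  obtain j where j: "n = Suc j" using n by (cases n) auto
  obtain b where b: "b \<in> module_hom (F j) T" "\<And>p. p \<in> carrier (F n) \<Longrightarrow> g p - g' p = b (d j p)"
    using eq cl_eq_Suc_iff[of g j g'] g j by auto
  \<comment> \<open>The lifts \<open>\<psi>\<close> and \<open>\<psi>'\<close> cover maps that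
    differ by \<open>b \<circ> d\<close>. Subtracting \<open>\<kappa> \<circ> d\<close> in degree 0
    makes the difference cover zero, and no correction occurs in higher degrees because
    \<open>d \<circ> d = 0\<close>.\<close>
  obtain \<kappa> where \<kappa>: "\<kappa> \<in> module_hom (F j) (F 0)" "\<And>p. p \<in> carrier (F j) \<Longrightarrow> \<epsilon> (\<kappa> p) = b p"
    using free_lift[OF F_lmod T_lmod \<epsilon>_hom, of b "res_gens P j"] b(1) \<epsilon>_surj
    by (auto simp: res_term_def[of P j])
  define \<delta> where "\<delta> i = (\<lambda>p. (\<psi> i p \<ominus>\<^bsub>F i\<^esub> \<psi>' i p) \<ominus>\<^bsub>F i\<^esub> (if i = 0 then \<kappa> (d j p) else \<zero>\<^bsub>F i\<^esub>))" for i
  note h = chain_liftD(1)[OF \<psi>] and h' = chain_liftD(1)[OF \<psi>']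
  have hh: "(\<lambda>p. \<psi> i p \<ominus>\<^bsub>F i\<^esub> \<psi>' i p) \<in> module_hom (F (i + n)) (F i)" for i
    by (rule hom_pointwise_minus[OF F_lmod F_lmod h h'])
  have \<delta>_hom: "\<delta> i \<in> module_hom (F (i + n)) (F i)" for i
  proof (cases "i = 0")
    case True
    have "(\<lambda>p. \<kappa> (d j p)) \<in> module_hom (F n) (F 0)" unfolding j by (rule hom_comp[OF d_hom \<kappa>(1)])
    then show ?thesis using hom_pointwise_minus[OF F_lmod F_lmod hh[of 0]] True by (simp add: \<delta>_def)
  next
    case False
    interpret lmod "F i" by (rule F_lmod)
    have "(\<lambda>p. \<zero>\<^bsub>F i\<^esub>) \<in> module_hom (F (i + n)) (F i)" by (rule module_homI) auto
    then show ?thesis using hom_pointwise_minus[OF F_lmod F_lmod hh[of i]] False by (simp add: \<delta>_def)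
  qed
  have \<delta>_eq: "\<delta> i p = \<psi> i p - \<psi>' i p - (if i = 0 then \<kappa> (d j p) else 0)" if p: "p \<in> carrier (F (i + n))" for i p
  proof -
    have c: "\<psi> i p \<in> carrier (F i)" "\<psi>' i p \<in> carrier (F i)" using hom_carrier[OF h p] hom_carrier[OF h' p] .
    have c2: "\<psi> i p - \<psi>' i p \<in> carrier (F i)" using hom_carrier[OF hh p] F_minus[OF c] by simp
    have c3: "(if i = 0 then \<kappa> (d j p) else 0) \<in> carrier (F i)"
      using hom_carrier[OF \<kappa>(1) d_carrier] p j F_closed(3) by auto
    then show ?thesis using F_minus[OF c] F_minus[OF c2 c3] by (cases "i = 0") (simp_all add: \<delta>_def F_simps)
  qed
  have X: "F (i + n) = free_module (res_gens P (i + n))" for i by (simp add: res_term_def)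
  have "\<exists>s\<in>module_hom (free_module (res_gens P (k + n))) (F (Suc k)).
    \<forall>p\<in>carrier (free_module (res_gens P (Suc k + n))).
      d k (\<delta> (Suc k) p \<ominus>\<^bsub>F (Suc k)\<^esub> s (d (k + n) p)) = \<zero>\<^bsub>F k\<^esub>"
  \<comment> \<open>The target of the homotopy is the resolution itself; its source is the
    resolution shifted by \<open>n\<close>.\<close>
  proof (rule homotopy_component[where X = "\<lambda>i. res_gens P (i + n)" and d = "\<lambda>i. d (i + n)" and M = F and e = d and \<delta> = \<delta>];
      (unfold X[symmetric])?)
    show "d (i + n) \<in> module_hom (F (Suc i + n)) (F (i + n))" for i using d_hom[of "i + n"] by simp
    show "d (i + n) (d (Suc i + n) p) = 0" if "p \<in> carrier (F (Suc (Suc i) + n))" for i p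
      using dd[of p "i + n"] that by simp
    show "m \<in> d (Suc i) ` carrier (F (Suc (Suc i)))" if "m \<in> carrier (F (Suc i))" "d i m = \<zero>\<^bsub>F i\<^esub>" for i m
      using exact_d that by (simp add: F_simps)
    show "\<delta> i \<in> module_hom (F (i + n)) (F i)" for i by (rule \<delta>_hom)
    show "d i (\<delta> (Suc i) p) = \<delta> i (d (i + n) p)" if p: "p \<in> carrier (F (Suc i + n))" for i p
    proof -
      have dp: "d (i + n) p \<in> carrier (F (i + n))" using d_carrier p by simp
      have c: "\<psi> (Suc i) p \<in> carrier (F (Suc i))" "\<psi>' (Suc i) p \<in> carrier (F (Suc i))"
        using hom_carrier[OF h p] hom_carrier[OF h' p] .
      have "d i (\<delta> (Suc i) p) = d i (\<psi> (Suc i) p \<ominus>\<^bsub>F (Suc i)\<^esub> \<psi>' (Suc i) p)"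
        using \<delta>_eq[OF p] F_minus[OF c] by simp
      also have "\<dots> = d i (\<psi> (Suc i) p) \<ominus>\<^bsub>F i\<^esub> d i (\<psi>' (Suc i) p)"
        by (rule hom_minus[OF F_lmod F_lmod d_hom c])
      also have "\<dots> = \<psi> i (d (i + n) p) - \<psi>' i (d (i + n) p)"
        using chain_liftD(3)[OF \<psi> p] chain_liftD(3)[OF \<psi>' p] F_minus[OF hom_carrier[OF h dp] hom_carrier[OF h' dp]]
        by simp
      also have "\<dots> = \<delta> i (d (i + n) p)"
        using \<delta>_eq[OF dp] dd[of p j] p hom_zero[OF F_lmod F_lmod \<kappa>(1)] by (auto simp: j F_simps)
      finally show ?thesis .
    qed
    show "\<delta> 0 p \<in> d 0 ` carrier (F 1)" if "p \<in> carrier (F (0 + n))" for p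
    proof (rule exact_\<epsilon>)
      have p: "p \<in> carrier (F n)" using that by simp
      show "\<delta> 0 p \<in> carrier (F 0)" by (rule hom_carrier[OF \<delta>_hom that])
      have c: "\<psi> 0 p \<in> carrier (F 0)" "\<psi>' 0 p \<in> carrier (F 0)" using hom_carrier[OF h that] hom_carrier[OF h' that] .
      have dp: "d j p \<in> carrier (F j)" using d_carrier p j by simp
      have "\<epsilon> (\<delta> 0 p) = \<epsilon> (\<psi> 0 p \<ominus>\<^bsub>F 0\<^esub> \<psi>' 0 p) - \<epsilon> (\<kappa> (d j p))"
        using hom_minus[OF F_lmod T_lmod \<epsilon>_hom hom_carrier[OF hh that] hom_carrier[OF \<kappa>(1) dp]] by (simp add: \<delta>_def)
      also have "\<dots> = 0"
        using hom_minus[OF F_lmod T_lmod \<epsilon>_hom c] chain_liftD(2)[OF \<psi> p] chain_liftD(2)[OF \<psi>' p] \<kappa>(2)[OF dp] b(2)[OF p]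
        by simp
      finally show "\<epsilon> (\<delta> 0 p) = 0" .
    qed
  qed (use F_lmod d_hom in auto)
  then obtain s where s: "s \<in> module_hom (F (k + n)) (F (Suc k))"
    "\<And>p. p \<in> carrier (F (Suc k + n)) \<Longrightarrow> d k (\<delta> (Suc k) p \<ominus>\<^bsub>F (Suc k)\<^esub> s (d (k + n) p)) = 0"
    unfolding X[symmetric] by (auto simp: F_simps)
  have "comp_cocycle m n f \<psi> p - comp_cocycle m n f \<psi>' p = f (s (d (k + n) p))"
    if p: "p \<in> carrier (F (Suc (k + n)))" for p
  proof -
    have p': "p \<in> carrier (F (Suc k + n))" using p by simp
    have sp: "s (d (k + n) p) \<in> carrier (F (Suc k))" by (rule hom_carrier[OF s(1) d_carrier[OF p]])
    have \<delta>p: "\<delta> (Suc k) p \<in> carrier (F (Suc k))" by (rule hom_carrier[OF \<delta>_hom p'])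
    interpret lmod "F (Suc k)" by (rule F_lmod)
    have fh: "f \<in> module_hom (F (Suc k)) T" using cocycle_hom[OF f] k by simp
    \<comment> \<open>The homotopy is known only up to the kernel of \<open>d k\<close>; by
      exactness that kernel consists of boundaries, on which the cocycle \<open>f\<close>
      vanishes.\<close>
    have "\<delta> (Suc k) p \<ominus>\<^bsub>F (Suc k)\<^esub> s (d (k + n) p) \<in> d (Suc k) ` carrier (F (Suc (Suc k)))"
      by (rule exact_d) (use \<delta>p sp s(2)[OF p'] in auto)
    then have "f (\<delta> (Suc k) p \<ominus>\<^bsub>F (Suc k)\<^esub> s (d (k + n) p)) = 0" using cocycle_zero[OF f] k by auto
    then have "f (\<delta> (Suc k) p) = f (s (d (k + n) p))"
      using hom_minus[OF F_lmod T_lmod fh \<delta>p sp] by simp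
    moreover have "f (\<delta> (Suc k) p) = f (\<psi> (Suc k) p) - f (\<psi>' (Suc k) p)"
      using hom_minus[OF F_lmod T_lmod fh hom_carrier[OF h p'] hom_carrier[OF h' p']] \<delta>_eq[OF p']
        F_minus[OF hom_carrier[OF h p'] hom_carrier[OF h' p']] by simp
    ultimately show ?thesis using p by (simp add: comp_cocycle_def k)
  qed
  then show ?thesis
    using cl_eq_Suc_iff[of "comp_cocycle m n f \<psi>" "k + n" "comp_cocycle m n f \<psi>'"]
      comp_cocycle[OF f \<psi>] comp_cocycle[OF f \<psi>'] hom_comp[OF s(1), of f T] cocycle_hom[OF f]
    by (auto simp: k)
qed

lemma chain_lift_add:
  assumes "chain_lift n g \<psi>" "chain_lift n g' \<psi>'"
  shows "chain_lift n (g \<oplus>\<^bsub>C n\<^esub> g') (\<lambda>i p. \<psi> i p + \<psi>' i p)"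
  unfolding chain_lift_def
proof (intro conjI allI ballI)
  note h = chain_liftD(1)[OF assms(1)] and h' = chain_liftD(1)[OF assms(2)]
  show "(\<lambda>p. \<psi> i p + \<psi>' i p) \<in> module_hom (F (i + n)) (F i)" for i
    by (rule module_homI) (auto simp: hom_carrier[OF h] hom_carrier[OF h'] hom_add[OF h] hom_add[OF h']
      hom_smult[OF h] hom_smult[OF h'] F_simps[of i] F_closed pscale_add)
  show "\<epsilon> (\<psi> 0 p + \<psi>' 0 p) = (g \<oplus>\<^bsub>C n\<^esub> g') p" if p: "p \<in> carrier (F n)" for p
    using hom_add[OF \<epsilon>_hom, of "\<psi> 0 p" "\<psi>' 0 p"] hom_carrier[OF h, of p 0] hom_carrier[OF h', of p 0] p
      chain_liftD(2)[OF assms(1) p] chain_liftD(2)[OF assms(2) p]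
    by (simp add: F_simps C_simps)
  show "d i (\<psi> (Suc i) p + \<psi>' (Suc i) p) = \<psi> i (d (i + n) p) + \<psi>' i (d (i + n) p)"
    if p: "p \<in> carrier (F (Suc i + n))" for i p
    using hom_add[OF d_hom, of "\<psi> (Suc i) p" i "\<psi>' (Suc i) p"] hom_carrier[OF h p] hom_carrier[OF h' p]
      chain_liftD(3)[OF assms(1) p] chain_liftD(3)[OF assms(2) p]
    by (simp add: F_simps)
qed

text \<open>Multiplication by the central element \<open>\<iota> c\<close> is \<open>B\<close>-linear and lifts multiplication by \<open>c\<close>.\<close>

lemma chain_lift_smult:
  assumes "chain_lift n g \<psi>"
  shows "chain_lift n (c \<odot>\<^bsub>C n\<^esub> g) (\<lambda>i p. pscale (\<iota> c) (\<psi> i p))"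
  unfolding chain_lift_def
proof (intro conjI allI ballI)
  note h = chain_liftD(1)[OF assms(1)]
  show "(\<lambda>p. pscale (\<iota> c) (\<psi> i p)) \<in> module_hom (F (i + n)) (F i)" for i
    by (rule module_homI) (auto simp: hom_carrier[OF h] hom_add[OF h]
      hom_smult[OF h] F_simps[of i] F_closed pscale_add central simp flip: pscale_mult)
  show "\<epsilon> (pscale (\<iota> c) (\<psi> 0 p)) = (c \<odot>\<^bsub>C n\<^esub> g) p" if p: "p \<in> carrier (F n)" for p
    using hom_smult[OF \<epsilon>_hom, of "\<psi> 0 p" "\<iota> c"] hom_carrier[OF h, of p 0] p
      chain_liftD(2)[OF assms(1) p]
    by (simp add: F_simps C_simps a_\<iota>)
  show "d i (pscale (\<iota> c) (\<psi> (Suc i) p)) = pscale (\<iota> c) (\<psi> i (d (i + n) p))"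
    if p: "p \<in> carrier (F (Suc i + n))" for i p
    using hom_smult[OF d_hom, of "\<psi> (Suc i) p" i "\<iota> c"] hom_carrier[OF h p] chain_liftD(3)[OF assms(1) p]
    by (simp add: F_simps)
qed

section \<open>Extensions and their classes\<close>


lemma F_lift:
  assumes "lmod M" "lmod N" "e \<in> module_hom M N" "h \<in> module_hom (F n) N"
    "\<And>p. p \<in> carrier (F n) \<Longrightarrow> h p \<in> e ` carrier M"
  shows "\<exists>f\<in>module_hom (F n) M. \<forall>p\<in>carrier (F n). e (f p) = h p"
  using free_lift[OF assms(1-3), of h "res_gens P n"] assms(4,5) unfolding res_term_def by metis

lemma is_extensionI:
  assumes "0 < n" and "\<And>i. i < n \<Longrightarrow> lmod (ext_term E i)"
    and "\<And>i. Suc i < n \<Longrightarrow> ext_diff E i \<in> module_hom (ext_term E (Suc i)) (ext_term E i)"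
    and "ext_aug E \<in> module_hom (ext_term E 0) T" and "ext_inc E \<in> module_hom T (ext_term E (n - 1))"
    and "ext_aug E ` carrier (ext_term E 0) = UNIV" and "inj (ext_inc E)"
    and "{x \<in> carrier (ext_term E 0). ext_aug E x = 0} =
      (if Suc 0 < n then ext_diff E 0 ` carrier (ext_term E 1) else range (ext_inc E))"
    and "\<And>j. Suc j < n \<Longrightarrow> {x \<in> carrier (ext_term E (Suc j)). ext_diff E j x = \<zero>\<^bsub>ext_term E j\<^esub>} =
      (if Suc (Suc j) < n then ext_diff E (Suc j) ` carrier (ext_term E (Suc (Suc j))) else range (ext_inc E))"
  shows "is_extension a n E"
  unfolding is_extension_def a_kernel_eq left_module_iff using assms by (auto split: nat.split)

lemma is_extensionD:
  assumes "is_extension a n E"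
  shows "0 < n" and "\<And>i. i < n \<Longrightarrow> lmod (ext_term E i)"
    and "\<And>i. Suc i < n \<Longrightarrow> ext_diff E i \<in> module_hom (ext_term E (Suc i)) (ext_term E i)"
    and "ext_aug E \<in> module_hom (ext_term E 0) T" and "ext_inc E \<in> module_hom T (ext_term E (n - 1))"
    and "ext_aug E ` carrier (ext_term E 0) = UNIV" and "inj (ext_inc E)"
    and "{x \<in> carrier (ext_term E 0). ext_aug E x = 0} =
      (if Suc 0 < n then ext_diff E 0 ` carrier (ext_term E 1) else range (ext_inc E))"
    and "\<And>j. Suc j < n \<Longrightarrow> {x \<in> carrier (ext_term E (Suc j)). ext_diff E j x = \<zero>\<^bsub>ext_term E j\<^esub>} =
      (if Suc (Suc j) < n then ext_diff E (Suc j) ` carrier (ext_term E (Suc (Suc j))) else range (ext_inc E))"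
proof -
  note A = assms[unfolded is_extension_def a_kernel_eq left_module_iff]
  show n: "0 < n" and "\<And>i. i < n \<Longrightarrow> lmod (ext_term E i)"
    and "\<And>i. Suc i < n \<Longrightarrow> ext_diff E i \<in> module_hom (ext_term E (Suc i)) (ext_term E i)"
    and "ext_aug E \<in> module_hom (ext_term E 0) T" and "ext_inc E \<in> module_hom T (ext_term E (n - 1))"
    and "ext_aug E ` carrier (ext_term E 0) = UNIV" and "inj (ext_inc E)"
    using A by blast+
  have ex: "\<forall>i<n. (case i of 0 \<Rightarrow> {x \<in> carrier (ext_term E 0). ext_aug E x = \<zero>\<^bsub>T\<^esub>}
         | Suc j \<Rightarrow> {x \<in> carrier (ext_term E i). ext_diff E j x = \<zero>\<^bsub>ext_term E j\<^esub>})
        = (if Suc i < n then ext_diff E i ` carrier (ext_term E (Suc i)) else range (ext_inc E))"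
    using A by blast
  show "{x \<in> carrier (ext_term E 0). ext_aug E x = 0} =
      (if Suc 0 < n then ext_diff E 0 ` carrier (ext_term E 1) else range (ext_inc E))"
    using ex[rule_format, OF n] by simp
  show "\<And>j. Suc j < n \<Longrightarrow> {x \<in> carrier (ext_term E (Suc j)). ext_diff E j x = \<zero>\<^bsub>ext_term E j\<^esub>} =
      (if Suc (Suc j) < n then ext_diff E (Suc j) ` carrier (ext_term E (Suc (Suc j))) else range (ext_inc E))"
    subgoal for j using ex[rule_format, of "Suc j"] by simp
    done
qed

lemma representsE:
  assumes "represents a P n E f"
  obtains \<phi> where "f \<in> carrier (C n)" "\<And>i. i < n \<Longrightarrow> \<phi> i \<in> module_hom (F i) (ext_term E i)"
    "\<And>x. x \<in> carrier (F 0) \<Longrightarrow> ext_aug E (\<phi> 0 x) = \<epsilon> x"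
    "\<And>i x. Suc i < n \<Longrightarrow> x \<in> carrier (F (Suc i)) \<Longrightarrow> ext_diff E i (\<phi> (Suc i) x) = \<phi> i (d i x)"
    "\<And>x. x \<in> carrier (F n) \<Longrightarrow> ext_inc E (f x) = \<phi> (n - 1) (d (n - 1) x)"
proof -
  from assms obtain \<phi> where "f \<in> carrier (C n)" "\<forall>i<n. \<phi> i \<in> module_hom (F i) (ext_term E i)"
    "\<forall>x\<in>carrier (F 0). ext_aug E (\<phi> 0 x) = \<epsilon> x"
    "\<forall>i. Suc i < n \<longrightarrow> (\<forall>x\<in>carrier (F (Suc i)). ext_diff E i (\<phi> (Suc i) x) = \<phi> i (d i x))"
    "\<forall>x\<in>carrier (F n). ext_inc E (f x) = \<phi> (n - 1) (d (n - 1) x)"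
    unfolding represents_def by (elim conjE exE) (rule that)
  then show ?thesis using that[of \<phi>] by simp
qed

lemma representsI:
  assumes "f \<in> carrier (C n)" "\<And>i. i < n \<Longrightarrow> \<phi> i \<in> module_hom (F i) (ext_term E i)"
    "\<And>x. x \<in> carrier (F 0) \<Longrightarrow> ext_aug E (\<phi> 0 x) = \<epsilon> x"
    "\<And>i x. Suc i < n \<Longrightarrow> x \<in> carrier (F (Suc i)) \<Longrightarrow> ext_diff E i (\<phi> (Suc i) x) = \<phi> i (d i x)"
    "\<And>x. x \<in> carrier (F n) \<Longrightarrow> ext_inc E (f x) = \<phi> (n - 1) (d (n - 1) x)"
  shows "represents a P n E f"
  unfolding represents_def using assms by (intro conjI exI[of _ \<phi>]) auto

text \<open>\<open>ext_inc\<close> sends \<open>f (d n p)\<close> to the value of the chain map at a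
  double differential, and it is injective.\<close>

lemma represents_cocycle:
  assumes E: "is_extension a n E" and f: "represents a P n E f"
  shows "f \<in> cocycles a P n"
proof -
  obtain k where k: "n = Suc k" using is_extensionD(1)[OF E] by (cases n) auto
  obtain \<phi> where \<phi>: "f \<in> carrier (C n)" "\<phi> k \<in> module_hom (F k) (ext_term E k)"
    "\<And>x. x \<in> carrier (F n) \<Longrightarrow> ext_inc E (f x) = \<phi> k (d k x)"
    using f by (rule representsE) (use k in auto)
  have Ek: "lmod (ext_term E k)" and inc: "ext_inc E \<in> module_hom T (ext_term E k)"
    using is_extensionD(2,5)[OF E] k by auto
  have "f (d n p) = 0" if p: "p \<in> carrier (F (Suc n))" for p
  proof -
    have "ext_inc E (f (d n p)) = \<phi> k 0" using \<phi>(3)[OF d_carrier[OF p]] dd[of p k] p k by simp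
    also have "\<dots> = ext_inc E 0"
      using hom_zero[OF F_lmod Ek \<phi>(2)] hom_zero[OF T_lmod Ek inc] by (simp add: F_simps)
    finally show ?thesis using is_extensionD(7)[OF E] by (simp add: inj_eq)
  qed
  then show ?thesis using \<phi>(1) by (simp add: cocycles_eq)
qed

text \<open>The difference \<open>\<delta>\<close> of two lifts of the identity of \<open>K\<close>
  covers zero, so a homotopy into the extension removes it up to a map into the last term that
  factors through \<open>ext_inc\<close>; this map bounds \<open>f - f'\<close>.\<close>

lemma represents_unique:
  assumes E: "is_extension a n E" and f: "represents a P n E f" and f': "represents a P n E f'"
  shows "cl n f = cl n f'"
proof -
  obtain k where k: "n = Suc k" using is_extensionD(1)[OF E] by (cases n) auto
  obtain \<phi> where \<phi>: "\<And>i. i < n \<Longrightarrow> \<phi> i \<in> module_hom (F i) (ext_term E i)"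
    "\<And>x. x \<in> carrier (F 0) \<Longrightarrow> ext_aug E (\<phi> 0 x) = \<epsilon> x"
    "\<And>i x. Suc i < n \<Longrightarrow> x \<in> carrier (F (Suc i)) \<Longrightarrow> ext_diff E i (\<phi> (Suc i) x) = \<phi> i (d i x)"
    "\<And>x. x \<in> carrier (F n) \<Longrightarrow> ext_inc E (f x) = \<phi> k (d k x)"
    using f by (rule representsE) (use k in auto)
  obtain \<phi>' where \<phi>': "\<And>i. i < n \<Longrightarrow> \<phi>' i \<in> module_hom (F i) (ext_term E i)"
    "\<And>x. x \<in> carrier (F 0) \<Longrightarrow> ext_aug E (\<phi>' 0 x) = \<epsilon> x"
    "\<And>i x. Suc i < n \<Longrightarrow> x \<in> carrier (F (Suc i)) \<Longrightarrow> ext_diff E i (\<phi>' (Suc i) x) = \<phi>' i (d i x)"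
    "\<And>x. x \<in> carrier (F n) \<Longrightarrow> ext_inc E (f' x) = \<phi>' k (d k x)"
    using f' by (rule representsE) (use k in auto)
  note L = is_extensionD(2)[OF E]
  define \<delta> where "\<delta> i = (\<lambda>p. \<phi> i p \<ominus>\<^bsub>ext_term E i\<^esub> \<phi>' i p)" for i
  have \<delta>: "\<delta> i \<in> module_hom (F i) (ext_term E i)" if "i < n" for i
    unfolding \<delta>_def by (rule hom_pointwise_minus[OF F_lmod L[OF that] \<phi>(1)[OF that] \<phi>'(1)[OF that]])
  have \<delta>0: "ext_aug E (\<delta> 0 p) = 0" if p: "p \<in> carrier (F 0)" for p
    using hom_minus[OF L T_lmod is_extensionD(4)[OF E], OF _ hom_carrier[OF \<phi>(1) p] hom_carrier[OF \<phi>'(1) p]]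
      \<phi>(2)[OF p] \<phi>'(2)[OF p] k by (simp add: \<delta>_def)
  have \<delta>S: "ext_diff E i (\<delta> (Suc i) p) = \<delta> i (d i p)" if i: "Suc i < n" and p: "p \<in> carrier (F (Suc i))" for i p
    using hom_minus[OF L L is_extensionD(3)[OF E], OF _ _ _ hom_carrier[OF \<phi>(1) p] hom_carrier[OF \<phi>'(1) p]]
      \<phi>(3)[OF i p] \<phi>'(3)[OF i p] i by (simp add: \<delta>_def)
  have Lk: "lmod (ext_term E k)" and inc: "ext_inc E \<in> module_hom T (ext_term E k)"
    using L is_extensionD(5)[OF E] k by auto
  \<comment> \<open>\<open>h\<close> is \<open>\<delta> k\<close> corrected by the homotopy so that
    it lands in the copy of \<open>K\<close>. For \<open>k = 0\<close> exactness at the only term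
    already gives this with \<open>h = \<delta> 0\<close>.\<close>
  have "\<exists>h\<in>module_hom (F k) (ext_term E k). (\<forall>p\<in>carrier (F k). h p \<in> range (ext_inc E)) \<and>
    (\<forall>p\<in>carrier (F n). h (d k p) = \<delta> k (d k p))"
  proof (cases k)
    case 0
    then have "\<forall>p\<in>carrier (F k). \<delta> k p \<in> range (ext_inc E)"
      using is_extensionD(8)[OF E] \<delta>0 hom_carrier[OF \<delta>[of 0]] k by auto
    then show ?thesis using \<delta>[of k] k by blast
  next
    case (Suc j)
    have X: "F i = free_module (res_gens P i)" for i by (simp add: res_term_def)
    have "\<exists>s\<in>module_hom (free_module (res_gens P j)) (ext_term E (Suc j)).
      \<forall>p\<in>carrier (free_module (res_gens P (Suc j))).
        ext_diff E j (\<delta> (Suc j) p \<ominus>\<^bsub>ext_term E (Suc j)\<^esub> s (d j p)) = \<zero>\<^bsub>ext_term E j\<^esub>"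
    proof (rule homotopy_component[where X = "res_gens P" and d = d and M = "ext_term E" and e = "ext_diff E" and \<delta> = \<delta>];
        (unfold X[symmetric])?)
      show "m \<in> ext_diff E (Suc i) ` carrier (ext_term E (Suc (Suc i)))"
        if "i < j" "m \<in> carrier (ext_term E (Suc i))" "ext_diff E i m = \<zero>\<^bsub>ext_term E i\<^esub>" for i m
        using is_extensionD(9)[OF E, of i] that Suc k by auto
      show "\<delta> 0 p \<in> ext_diff E 0 ` carrier (ext_term E 1)" if "p \<in> carrier (F 0)" for p
        using is_extensionD(8)[OF E] \<delta>0[OF that] hom_carrier[OF \<delta>[of 0] that] Suc k by auto
    qed (use d_hom dd L is_extensionD(3)[OF E] \<delta> \<delta>S Suc k in auto)
    then obtain s where s: "s \<in> module_hom (F j) (ext_term E k)"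
      "\<And>p. p \<in> carrier (F k) \<Longrightarrow> ext_diff E j (\<delta> k p \<ominus>\<^bsub>ext_term E k\<^esub> s (d j p)) = \<zero>\<^bsub>ext_term E j\<^esub>"
      unfolding X[symmetric] Suc by blast
    let ?h = "\<lambda>p. \<delta> k p \<ominus>\<^bsub>ext_term E k\<^esub> s (d j p)"
    have dj: "d j \<in> module_hom (F k) (F j)" using d_hom Suc by simp
    have h: "?h \<in> module_hom (F k) (ext_term E k)"
      by (rule hom_pointwise_minus[OF F_lmod Lk \<delta> hom_comp[OF dj s(1)]]) (use k in simp)
    have "?h p \<in> range (ext_inc E)" if "p \<in> carrier (F k)" for p
      using is_extensionD(9)[OF E, of j] s(2)[OF that] hom_carrier[OF h that] Suc k by auto
    moreover have "?h (d k p) = \<delta> k (d k p)" if p: "p \<in> carrier (F n)" for p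
    proof -
      interpret lmod "ext_term E k" by (rule Lk)
      have dk: "d k p \<in> carrier (F k)" using p d_carrier k by simp
      have "\<delta> k (d k p) \<in> carrier (ext_term E k)" using hom_carrier[OF \<delta> dk] k by simp
      moreover have "s (d j (d k p)) = \<zero>\<^bsub>ext_term E k\<^esub>"
        using dd[of p j] p Suc k hom_zero[OF F_lmod Lk s(1)] by (simp add: F_simps)
      ultimately show ?thesis using minus_add_cancel[of "\<delta> k (d k p)" "\<zero>\<^bsub>ext_term E k\<^esub>"] by simp
    qed
    ultimately show ?thesis using h by (intro bexI[of _ ?h]) auto
  qed
  then obtain h where h1: "h \<in> module_hom (F k) (ext_term E k)"
    and h2: "(\<forall>p\<in>carrier (F k). h p \<in> range (ext_inc E)) \<and> (\<forall>p\<in>carrier (F n). h (d k p) = \<delta> k (d k p))" ..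
  have h: "h \<in> module_hom (F k) (ext_term E k)" "\<And>p. p \<in> carrier (F k) \<Longrightarrow> h p \<in> range (ext_inc E)"
    "\<And>p. p \<in> carrier (F n) \<Longrightarrow> h (d k p) = \<delta> k (d k p)" using h1 h2 by auto
  obtain t where t: "t \<in> module_hom (F k) T" "\<And>p. p \<in> carrier (F k) \<Longrightarrow> ext_inc E (t p) = h p"
    using F_lift[OF T_lmod Lk inc h(1)] h(2) by auto
  have "f p - f' p = t (d k p)" if p: "p \<in> carrier (F n)" for p
  proof -
    have dk: "d k p \<in> carrier (F k)" using p d_carrier k by simp
    have "ext_inc E (f p - f' p) = ext_inc E (f p) \<ominus>\<^bsub>ext_term E k\<^esub> ext_inc E (f' p)"
      using hom_minus[OF T_lmod Lk inc, of "f p" "f' p"] by simp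
    also have "\<dots> = \<delta> k (d k p)" using \<phi>(4)[OF p] \<phi>'(4)[OF p] by (simp add: \<delta>_def)
    also have "\<dots> = ext_inc E (t (d k p))" using h(3)[OF p] t(2)[OF dk] by simp
    finally show ?thesis using is_extensionD(7)[OF E] by (simp add: inj_eq)
  qed
  then show ?thesis
    using cl_eq_Suc_iff[of f k f'] represents_cocycle[OF E f] represents_cocycle[OF E f'] t(1) k by auto
qed

section \<open>Concatenation of extensions\<close>

lemma splice_extension:
  assumes E: "is_extension a m E" and G: "is_extension a n G"
  shows "is_extension a (m + n) (splice E n G)"
proof (rule is_extensionI)
  note e = is_extensionD[OF E] and g = is_extensionD[OF G]
  let ?S = "splice E n G"
  have S: "ext_term ?S i = (if i < n then ext_term G i else ext_term E (i - n))"
    "ext_diff ?S i = (if Suc i < n then ext_diff G i else if Suc i = n then (\<lambda>x. ext_inc G (ext_aug E x))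
      else ext_diff E (i - n))" "ext_aug ?S = ext_aug G" "ext_inc ?S = ext_inc E" for i
    by (simp_all add: splice_def)
  have Ln: "lmod (ext_term G (n - 1))" using g(1,2) by simp
  \<comment> \<open>The joining map \<open>ext_inc G \<circ> ext_aug E\<close> has the kernel of
    \<open>ext_aug E\<close>, as \<open>ext_inc G\<close> is injective, and the image of
    \<open>ext_inc G\<close>, as \<open>ext_aug E\<close> is onto. These facts give exactness on
    both sides of the joint.\<close>
  have inc_iff: "ext_inc G c = \<zero>\<^bsub>ext_term G (n - 1)\<^esub> \<longleftrightarrow> c = 0" for c
    using hom_zero[OF T_lmod Ln g(5)] injD[OF g(7), of c 0] by auto
  have mid: "(\<lambda>x. ext_inc G (ext_aug E x)) ` carrier (ext_term E 0) = range (ext_inc G)"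
    using e(6) by (metis image_image)
  show "0 < m + n" using e(1) by simp
  show "lmod (ext_term ?S i)" if "i < m + n" for i using that e(2) g(2) by (simp add: S)
  show "ext_diff ?S i \<in> module_hom (ext_term ?S (Suc i)) (ext_term ?S i)" if "Suc i < m + n" for i
  proof -
    consider "Suc i < n" | "Suc i = n" | "n \<le> i" by linarith
    then show ?thesis
    proof cases
      case 2
      then have "n - 1 = i" by simp
      then show ?thesis using 2 hom_comp[OF e(4) g(5)] by (simp add: S)
    next
      case 3
      then show ?thesis using e(3)[of "i - n"] that by (simp add: S Suc_diff_le)
    qed (use g(3) in \<open>simp add: S\<close>)
  qed
  show "ext_aug ?S \<in> module_hom (ext_term ?S 0) T" "ext_aug ?S ` carrier (ext_term ?S 0) = UNIV"
    using g(1,4,6) by (simp_all add: S)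
  show "ext_inc ?S \<in> module_hom T (ext_term ?S (m + n - 1))"
  proof -
    have "\<not> m + n - 1 < n" "m + n - 1 - n = m - 1" using e(1) by auto
    then show ?thesis using e(5) by (simp only: S if_False)
  qed
  show "inj (ext_inc ?S)" using e(7) by (simp add: S)
  show "{x \<in> carrier (ext_term ?S 0). ext_aug ?S x = 0} =
    (if Suc 0 < m + n then ext_diff ?S 0 ` carrier (ext_term ?S 1) else range (ext_inc ?S))"
  proof (cases "n = 1")
    case True
    then show ?thesis using e(1) g(1,8) mid unfolding S by simp
  next
    case False
    then show ?thesis using e(1) g(1,8) by (simp add: S)
  qed
  show "{x \<in> carrier (ext_term ?S (Suc j)). ext_diff ?S j x = \<zero>\<^bsub>ext_term ?S j\<^esub>} =
      (if Suc (Suc j) < m + n then ext_diff ?S (Suc j) ` carrier (ext_term ?S (Suc (Suc j))) else range (ext_inc ?S))"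
    if j: "Suc j < m + n" for j
  proof -
    \<comment> \<open>The position of term \<open>Suc j\<close>: before the last term of
      \<open>G\<close>, last in \<open>G\<close>, first in \<open>E\<close>, further inside
      \<open>E\<close>.\<close>
    consider "Suc (Suc j) < n" | "Suc (Suc j) = n" | "Suc j = n" | "n \<le> j" by linarith
    then show ?thesis
    proof cases
      case 1
      then show ?thesis using g(9)[of j] by (simp add: S)
    next
      case 2
      then have "Suc (Suc j) < m + n" "Suc j < n" "\<not> n < n" using e(1) by auto
      then show ?thesis using g(9)[of j] 2 mid by (simp add: S)
    next
      case 3
      then have j': "n - 1 = j" by simp
      have "Suc (Suc j) < m + n \<longleftrightarrow> Suc 0 < m" using 3 by auto
      moreover have "{x \<in> carrier (ext_term E 0). ext_inc G (ext_aug E x) = \<zero>\<^bsub>ext_term G j\<^esub>} =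
        {x \<in> carrier (ext_term E 0). ext_aug E x = 0}" using inc_iff j' by auto
      ultimately show ?thesis using e(8) 3 by (auto simp: S)
    next
      case 4
      have "Suc j - n = Suc (j - n)" "Suc (Suc j) - n = Suc (Suc (j - n))" using 4 by auto
      moreover have "Suc (Suc j) < m + n \<longleftrightarrow> Suc (Suc (j - n)) < m" using 4 by auto
      moreover have "Suc (j - n) < m" using 4 j by auto
      ultimately show ?thesis using e(9)[of "j - n"] 4 by (simp add: S)
    qed
  qed
qed

text \<open>The lift to \<open>G\<close> is continued into \<open>E\<close> by the lift to
  \<open>E\<close> precomposed with \<open>\<psi>\<close>. They fit at the joint:
  \<open>ext_aug E\<close> yields \<open>\<epsilon> (\<psi> 0 x) = g x\<close>, whose image under
  \<open>ext_inc G\<close> is what the lift to \<open>G\<close> prescribes.\<close>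

lemma splice_represents:
  assumes E: "is_extension a m E" and G: "is_extension a n G"
    and f: "represents a P m E f" and g: "represents a P n G g" and \<psi>: "chain_lift n g \<psi>"
  shows "represents a P (m + n) (splice E n G) (comp_cocycle m n f \<psi>)"
proof -
  let ?S = "splice E n G"
  have S: "ext_term ?S i = (if i < n then ext_term G i else ext_term E (i - n))"
    "ext_diff ?S i = (if Suc i < n then ext_diff G i else if Suc i = n then (\<lambda>x. ext_inc G (ext_aug E x))
      else ext_diff E (i - n))" "ext_aug ?S = ext_aug G" "ext_inc ?S = ext_inc E" for i
    by (simp_all add: splice_def)
  obtain k where k: "m = Suc k" using is_extensionD(1)[OF E] by (cases m) auto
  obtain l where l: "n = Suc l" using is_extensionD(1)[OF G] by (cases n) auto
  obtain \<phi> where \<phi>: "\<And>i. i < m \<Longrightarrow> \<phi> i \<in> module_hom (F i) (ext_term E i)"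
    "\<And>x. x \<in> carrier (F 0) \<Longrightarrow> ext_aug E (\<phi> 0 x) = \<epsilon> x"
    "\<And>i x. Suc i < m \<Longrightarrow> x \<in> carrier (F (Suc i)) \<Longrightarrow> ext_diff E i (\<phi> (Suc i) x) = \<phi> i (d i x)"
    "\<And>x. x \<in> carrier (F m) \<Longrightarrow> ext_inc E (f x) = \<phi> k (d k x)"
    using f by (rule representsE) (use k in auto)
  obtain \<theta> where \<theta>: "\<And>i. i < n \<Longrightarrow> \<theta> i \<in> module_hom (F i) (ext_term G i)"
    "\<And>x. x \<in> carrier (F 0) \<Longrightarrow> ext_aug G (\<theta> 0 x) = \<epsilon> x"
    "\<And>i x. Suc i < n \<Longrightarrow> x \<in> carrier (F (Suc i)) \<Longrightarrow> ext_diff G i (\<theta> (Suc i) x) = \<theta> i (d i x)"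
    "\<And>x. x \<in> carrier (F n) \<Longrightarrow> ext_inc G (g x) = \<theta> l (d l x)"
    using g by (rule representsE) (use l in auto)
  note h = chain_liftD(1)[OF \<psi>]
  define \<Theta> where "\<Theta> i = (if i < n then \<theta> i else (\<lambda>p. \<phi> (i - n) (\<psi> (i - n) p)))" for i
  show ?thesis
  proof (rule representsI[where \<phi> = \<Theta>])
    show "comp_cocycle m n f \<psi> \<in> carrier (C (m + n))"
      using comp_cocycle[OF represents_cocycle[OF E f] \<psi>] cocycle_C by simp
    show "\<Theta> i \<in> module_hom (F i) (ext_term ?S i)" if "i < m + n" for i
    proof (cases "i < n")
      case False
      then have "\<psi> (i - n) \<in> module_hom (F i) (F (i - n))" using h[of "i - n"] by simp
      from hom_comp[OF this \<phi>(1)] show ?thesis using False that by (simp add: S \<Theta>_def)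
    qed (use \<theta>(1) in \<open>simp add: S \<Theta>_def\<close>)
    show "ext_aug ?S (\<Theta> 0 x) = \<epsilon> x" if "x \<in> carrier (F 0)" for x
      using \<theta>(2)[OF that] is_extensionD(1)[OF G] by (simp add: S \<Theta>_def)
    show "ext_diff ?S i (\<Theta> (Suc i) x) = \<Theta> i (d i x)"
      if i: "Suc i < m + n" and x: "x \<in> carrier (F (Suc i))" for i x
    proof -
      consider "Suc i < n" | "Suc i = n" | "n \<le> i" by linarith
      then show ?thesis
      proof cases
        case 1
        then show ?thesis using \<theta>(3)[OF 1 x] by (simp add: S \<Theta>_def)
      next
        case 2
        then have x': "x \<in> carrier (F n)" and "i = l" using x l by auto
        have "\<psi> 0 x \<in> carrier (F 0)" using hom_carrier[OF h, of x 0] x' by simp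
        then show ?thesis using 2 \<phi>(2) chain_liftD(2)[OF \<psi> x'] \<theta>(4)[OF x'] \<open>i = l\<close> by (simp add: S \<Theta>_def)
      next
        case 3
        let ?j = "i - n"
        have x': "x \<in> carrier (F (Suc ?j + n))" and j: "Suc ?j < m" using x 3 i by auto
        have "ext_diff E ?j (\<phi> (Suc ?j) (\<psi> (Suc ?j) x)) = \<phi> ?j (d ?j (\<psi> (Suc ?j) x))"
          by (rule \<phi>(3)[OF j hom_carrier[OF h x']])
        also have "\<dots> = \<phi> ?j (\<psi> ?j (d i x))" using chain_liftD(3)[OF \<psi> x'] 3 by simp
        finally show ?thesis using 3 by (simp add: S \<Theta>_def Suc_diff_le)
      qed
    qed
    show "ext_inc ?S (comp_cocycle m n f \<psi> x) = \<Theta> (m + n - 1) (d (m + n - 1) x)" if x: "x \<in> carrier (F (m + n))" for x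
    proof -
      have x': "x \<in> carrier (F (Suc k + n))" using x k by simp
      have "ext_inc E (f (\<psi> m x)) = \<phi> k (d k (\<psi> m x))" by (rule \<phi>(4)[OF hom_carrier[OF h x]])
      also have "\<dots> = \<phi> k (\<psi> k (d (k + n) x))" using chain_liftD(3)[OF \<psi> x'] k by simp
      finally show ?thesis using x k by (simp add: S \<Theta>_def comp_cocycle_def)
    qed
  qed
qed


text \<open>
  The pushout of the resolution along a cocycle \<open>f\<close> of degree \<open>m\<close>. All its terms are quotients of
  \<open>K \<times> F i\<close>; the relations collapse this to \<open>F i\<close> for \<open>i < m - 1\<close> and to the pushout for \<open>i = m - 1\<close>.
\<close>

definition pair_module :: "nat \<Rightarrow> ('b, 'k \<times> ('x \<Rightarrow>\<^sub>0 'b)) module" where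
  "pair_module i = module_of (UNIV \<times> carrier (F i)) (\<lambda>u v. (fst u + fst v, snd u + snd v)) (0, 0)
     (\<lambda>r u. (a r * fst u, pscale r (snd u)))"

definition pushout_rel :: "nat \<Rightarrow> (('x \<Rightarrow>\<^sub>0 'b) \<Rightarrow> 'k) \<Rightarrow> nat \<Rightarrow> ('k \<times> ('x \<Rightarrow>\<^sub>0 'b)) set" where
  "pushout_rel m f i = (if Suc i = m then {(f x, - d i x) | x. x \<in> carrier (F m)} else UNIV \<times> {0})"

lemma pair_simps: "carrier (pair_module i) = UNIV \<times> carrier (F i)"
  "u \<oplus>\<^bsub>pair_module i\<^esub> v = (fst u + fst v, snd u + snd v)" "\<zero>\<^bsub>pair_module i\<^esub> = (0, 0)"
  "r \<odot>\<^bsub>pair_module i\<^esub> u = (a r * fst u, pscale r (snd u))"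
  by (simp_all add: pair_module_def module_of_def)

lemma pair_lmod: "lmod (pair_module i)"
proof -
  have z: "pscale 0 p = 0" for p :: "'x \<Rightarrow>\<^sub>0 'b" by simp
  show ?thesis
    by (rule lmodI) (auto simp: pair_simps F_closed a_add a_mult a_one a_zero algebra_simps pscale_add
      pscale_add_left pscale_mult)
qed

lemma uminus_pscale: "- p = pscale (- 1) (p :: 'x \<Rightarrow>\<^sub>0 'b)"
  by (rule poly_mapping_eqI) simp

lemma F_uminus: "p \<in> carrier (F n) \<Longrightarrow> - p \<in> carrier (F n)"
  unfolding uminus_pscale by (rule F_closed)

lemma pscale_uminus: "pscale r (- p) = - pscale r (p :: 'x \<Rightarrow>\<^sub>0 'b)"
  by (rule poly_mapping_eqI) simp

lemma F_diff: "p \<in> carrier (F n) \<Longrightarrow> q \<in> carrier (F n) \<Longrightarrow> p - q \<in> carrier (F n)"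
  using F_closed(1)[OF _ F_uminus] by fastforce

lemma d_add: "p \<in> carrier (F (Suc n)) \<Longrightarrow> q \<in> carrier (F (Suc n)) \<Longrightarrow> d n (p + q) = d n p + d n q"
  and d_pscale: "p \<in> carrier (F (Suc n)) \<Longrightarrow> d n (pscale r p) = pscale r (d n p)"
  using hom_add[OF d_hom, of p n q] hom_smult[OF d_hom, of p n r] by (simp_all add: F_simps)

lemma d_uminus: "p \<in> carrier (F (Suc n)) \<Longrightarrow> d n (- p) = - d n p"
  by (simp add: uminus_pscale d_pscale)

lemma pair_minus:
  assumes "u \<in> carrier (pair_module i)" "v \<in> carrier (pair_module i)"
  shows "u \<ominus>\<^bsub>pair_module i\<^esub> v = (fst u - fst v, snd u - snd v)"
proof -
  interpret lmod "pair_module i" by (rule pair_lmod)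
  have "a (- 1) = - 1" using a_add[of 1 "- 1"] by (simp add: a_one a_zero eq_neg_iff_add_eq_0 add.commute)
  then show ?thesis using a_inv_smult[OF assms(2)] by (simp add: minus_eq pair_simps uminus_pscale[symmetric])
qed

context
  fixes m f
  assumes f: "f \<in> cocycles a P m" and m: "0 < m"
begin

abbreviation "N \<equiv> pushout_rel m f"
abbreviation "L i \<equiv> quotient_module (pair_module i) (N i)"
abbreviation "pcls i u \<equiv> N i +>\<^bsub>pair_module i\<^esub> u"

lemma f_add: "x \<in> carrier (F m) \<Longrightarrow> y \<in> carrier (F m) \<Longrightarrow> f (x + y) = f x + f y"
  and f_pscale: "x \<in> carrier (F m) \<Longrightarrow> f (pscale r x) = a r * f x"
  using hom_add[OF cocycle_hom[OF f], of x y] hom_smult[OF cocycle_hom[OF f], of x r] by (simp_all add: F_simps)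

lemma f_zero: "f 0 = 0"
  using hom_zero[OF F_lmod T_lmod cocycle_hom[OF f]] by (simp add: F_simps)

lemma f_uminus: "x \<in> carrier (F m) \<Longrightarrow> f (- x) = - f x"
  using f_add[of x "- x"] F_uminus[of x m] f_zero by (simp add: eq_neg_iff_add_eq_0 add.commute)

lemma N_lsub: "lsubmodule (N i) (pair_module i)"
proof (cases "Suc i = m")
  case True
  have N: "N i = {(f x, - d i x) | x. x \<in> carrier (F m)}" using True by (simp add: pushout_rel_def)
  have "(0, 0) = (f 0, - d i 0)" by (simp add: f_zero d_zero)
  then have 1: "(0, 0) \<in> N i" unfolding N using F_closed(3) by blast
  have 2: "u \<oplus>\<^bsub>pair_module i\<^esub> v \<in> N i" if uv: "u \<in> N i" "v \<in> N i" for u v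
  proof -
    obtain x y where *: "x \<in> carrier (F m)" "y \<in> carrier (F m)" "u = (f x, - d i x)" "v = (f y, - d i y)"
      using uv unfolding N by blast
    then have "u \<oplus>\<^bsub>pair_module i\<^esub> v = (f (x + y), - d i (x + y))"
      using True by (auto simp: pair_simps f_add d_add)
    then show ?thesis unfolding N using F_closed(1) * by blast
  qed
  have 3: "r \<odot>\<^bsub>pair_module i\<^esub> u \<in> N i" if u: "u \<in> N i" for u r
  proof -
    obtain x where *: "x \<in> carrier (F m)" "u = (f x, - d i x)"
      using u unfolding N by blast
    then have "r \<odot>\<^bsub>pair_module i\<^esub> u = (f (pscale r x), - d i (pscale r x))"
      using True by (auto simp: pair_simps f_pscale d_pscale pscale_uminus)
    then show ?thesis unfolding N using F_closed(2) * by blast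
  qed
  have "N i \<subseteq> carrier (pair_module i)"
    unfolding N pair_simps using F_uminus d_carrier True by auto
  then show ?thesis using 1 2 3 by (auto simp: lsubmodule_def pair_simps(3))
next
  case False
  then show ?thesis by (auto simp: lsubmodule_def pair_simps pushout_rel_def F_closed)
qed

lemma q_eq_iff: "u \<in> carrier (pair_module i) \<Longrightarrow> v \<in> carrier (pair_module i) \<Longrightarrow>
    pcls i u = pcls i v \<longleftrightarrow> (fst u - fst v, snd u - snd v) \<in> N i"
  using coset_eq_iff[OF pair_lmod N_lsub, of u i v] by (simp add: pair_minus)

lemma q_zero_iff: "u \<in> carrier (pair_module i) \<Longrightarrow> pcls i u = N i \<longleftrightarrow> u \<in> N i"
  by (rule coset_zero_iff[OF pair_lmod N_lsub])

lemma L_lmod: "lmod (L i)"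
  by (rule quot_lmod[OF pair_lmod N_lsub])

lemma L_carrier: "carrier (L i) = pcls i ` carrier (pair_module i)"
  by (rule quot_carrier[OF pair_lmod N_lsub])

lemma L_zero: "\<zero>\<^bsub>L i\<^esub> = N i"
  by (rule quot_zero[OF pair_lmod N_lsub])

lemma q_hom: "pcls i \<in> module_hom (pair_module i) (L i)"
  by (rule quot_hom[OF pair_lmod N_lsub])

lemma N_snd:
  assumes "w \<in> N i"
  shows "snd w \<in> d i ` carrier (F (Suc i))"
proof (cases "Suc i = m")
  case True
  then obtain x where "x \<in> carrier (F (Suc i))" "snd w = - d i x" using assms by (auto simp: pushout_rel_def)
  then show ?thesis using d_uminus F_uminus by (metis imageI)
next
  case False
  then have "snd w = d i 0" using assms by (auto simp: pushout_rel_def d_zero)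
  then show ?thesis using F_closed(3) by auto
qed

text \<open>Reads off the second component of some representative. It is determined only up to
  boundaries, which \<open>\<epsilon>\<close> and the differentials kill, so the maps of the pushout
  can be defined through it.\<close>

definition rep :: "('k \<times> ('x \<Rightarrow>\<^sub>0 'b)) set \<Rightarrow> 'x \<Rightarrow>\<^sub>0 'b" where
  "rep A = snd (SOME u. u \<in> A)"

lemma rep:
  assumes u: "u \<in> carrier (pair_module i)"
  shows "\<exists>y\<in>carrier (F (Suc i)). rep (pcls i u) = snd u + d i y"
proof -
  have "(SOME v. v \<in> pcls i u) \<in> pcls i u" by (rule someI, rule coset_self[OF pair_lmod N_lsub u])
  then obtain w where w: "w \<in> N i" "(SOME v. v \<in> pcls i u) = w \<oplus>\<^bsub>pair_module i\<^esub> u"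
    by (auto simp: a_r_coset_def')
  then have "rep (pcls i u) = snd w + snd u" by (simp add: rep_def pair_simps)
  then show ?thesis using N_snd[OF w(1)] by (auto simp: add.commute)
qed

lemma rep_\<epsilon>: "u \<in> carrier (pair_module 0) \<Longrightarrow> \<epsilon> (rep (pcls 0 u)) = \<epsilon> (snd u)"
proof -
  assume u: "u \<in> carrier (pair_module 0)"
  obtain y where y: "y \<in> carrier (F (Suc 0))" "rep (pcls 0 u) = snd u + d 0 y" using rep[OF u] by blast
  have "snd u \<in> carrier (F 0)" using u by (auto simp: pair_simps)
  then show ?thesis using hom_add[OF \<epsilon>_hom, of "snd u" "d 0 y"] d_carrier[OF y(1)] y \<epsilon>d by (simp add: F_simps)
qed

lemma rep_d: "u \<in> carrier (pair_module (Suc i)) \<Longrightarrow> d i (rep (pcls (Suc i) u)) = d i (snd u)"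
proof -
  assume u: "u \<in> carrier (pair_module (Suc i))"
  obtain y where y: "y \<in> carrier (F (Suc (Suc i)))" "rep (pcls (Suc i) u) = snd u + d (Suc i) y" using rep[OF u] by blast
  have "snd u \<in> carrier (F (Suc i))" using u by (auto simp: pair_simps)
  then show ?thesis using d_add[OF _ d_carrier[OF y(1)]] y dd by simp
qed

definition pushout :: "('b, ('k \<times> ('x \<Rightarrow>\<^sub>0 'b)) set, 'k) extension" where
  "pushout = \<lparr>ext_term = L, ext_diff = (\<lambda>i A. pcls i (0, d i (rep A))), ext_aug = (\<lambda>A. \<epsilon> (rep A)),
     ext_inc = (\<lambda>c. pcls (m - 1) (c, 0))\<rparr>"

lemma pushout_simps: "ext_term pushout = L" "ext_diff pushout i A = pcls i (0, d i (rep A))"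
  "ext_aug pushout A = \<epsilon> (rep A)" "ext_inc pushout c = pcls (m - 1) (c, 0)"
  by (simp_all add: pushout_def)

lemma pushout_diff: "u \<in> carrier (pair_module (Suc i)) \<Longrightarrow> ext_diff pushout i (pcls (Suc i) u) = pcls i (0, d i (snd u))"
  by (simp add: pushout_simps rep_d)

lemma pushout_aug: "u \<in> carrier (pair_module 0) \<Longrightarrow> ext_aug pushout (pcls 0 u) = \<epsilon> (snd u)"
  by (simp add: pushout_simps rep_\<epsilon>)

text \<open>Together with \<open>pushout_last\<close> this reduces exactness of the pushout to
  exactness of the resolution: membership in the incoming image is visible in the second component
  alone.\<close>

lemma pushout_inner:
  assumes i: "Suc i < m" and u: "u \<in> carrier (pair_module i)"
  shows "pcls i u \<in> ext_diff pushout i ` carrier (L (Suc i)) \<longleftrightarrow> snd u \<in> d i ` carrier (F (Suc i))"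
proof
  have N: "N i = UNIV \<times> {0}" using i by (simp add: pushout_rel_def)
  assume "pcls i u \<in> ext_diff pushout i ` carrier (L (Suc i))"
  then obtain v where v: "v \<in> carrier (pair_module (Suc i))" "pcls i u = pcls i (0, d i (snd v))"
    unfolding L_carrier using pushout_diff by auto
  have sv: "snd v \<in> carrier (F (Suc i))" using v by (auto simp: pair_simps)
  then have "(0, d i (snd v)) \<in> carrier (pair_module i)" using d_carrier by (simp add: pair_simps)
  then have "snd u = d i (snd v)" using v q_eq_iff[OF u, of "(0, d i (snd v))"] N by simp
  then show "snd u \<in> d i ` carrier (F (Suc i))" using sv by auto
next
  have N: "N i = UNIV \<times> {0}" using i by (simp add: pushout_rel_def)
  assume "snd u \<in> d i ` carrier (F (Suc i))"
  then obtain x where x: "x \<in> carrier (F (Suc i))" "snd u = d i x" by auto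
  have x': "(0, x) \<in> carrier (pair_module (Suc i))" "(0, d i x) \<in> carrier (pair_module i)"
    using x d_carrier by (auto simp: pair_simps)
  have "pcls i u = ext_diff pushout i (pcls (Suc i) (0, x))"
    using q_eq_iff[OF u x'(2)] x N by (simp add: pushout_diff[OF x'(1)])
  then show "pcls i u \<in> ext_diff pushout i ` carrier (L (Suc i))" using x' unfolding L_carrier by blast
qed

lemma pushout_last:
  assumes i: "Suc i = m" and u: "u \<in> carrier (pair_module i)"
  shows "pcls i u \<in> range (ext_inc pushout) \<longleftrightarrow> snd u \<in> d i ` carrier (F (Suc i))"
proof
  have c: "(c, 0) \<in> carrier (pair_module i)" for c by (simp add: pair_simps F_closed)
  have inc: "ext_inc pushout c = pcls i (c, 0)" for c using i by (auto simp: pushout_simps)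
  {
    assume "pcls i u \<in> range (ext_inc pushout)"
    then obtain c' where "pcls i u = pcls i (c', 0)" using inc by auto
    then have "(fst u - c', snd u) \<in> N i" using q_eq_iff[OF u c, of c'] by simp
    then show "snd u \<in> d i ` carrier (F (Suc i))" using N_snd by fastforce
  next
    assume "snd u \<in> d i ` carrier (F (Suc i))"
    then obtain x where x: "x \<in> carrier (F m)" "snd u = d i x" using i by auto
    \<comment> \<open>Modulo the relation coming from \<open>- x\<close>, the pair
      \<open>(fst u, d i x)\<close> becomes \<open>(fst u + f x, 0)\<close>.\<close>
    have "(fst u - (fst u + f x), snd u - 0) = (f (- x), - d i (- x))"
      using x i d_uminus[of x i] by (auto simp: f_uminus)
    then have "(fst u - (fst u + f x), snd u - 0) \<in> N i"
      using i F_uminus[OF x(1)] by (auto simp: pushout_rel_def)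
    then have "pcls i u = pcls i (fst u + f x, 0)" using q_eq_iff[OF u c, of "fst u + f x"] by simp
    then show "pcls i u \<in> range (ext_inc pushout)" using inc by (metis rangeI)
  }
qed

lemma L_cases: "A \<in> carrier (L i) \<Longrightarrow> \<exists>u\<in>carrier (pair_module i). A = pcls i u"
  unfolding L_carrier by blast

text \<open>Equality of a kernel with an image is tested on classes of pairs, where both sides
  become conditions on the second component.\<close>

lemma kernel_via:
  assumes "\<And>u. u \<in> carrier (pair_module i) \<Longrightarrow> h (pcls i u) = z \<longleftrightarrow> pcls i u \<in> R" and "R \<subseteq> carrier (L i)"
  shows "{A \<in> carrier (L i). h A = z} = R"
proof (rule Set.set_eqI)
  fix A
  show "A \<in> {A \<in> carrier (L i). h A = z} \<longleftrightarrow> A \<in> R"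
  proof (cases "A \<in> carrier (L i)")
    case True
    then obtain u where "u \<in> carrier (pair_module i)" "A = pcls i u" using L_cases by blast
    then show ?thesis using assms(1)[of u] True by simp
  qed (use assms(2) in auto)
qed

lemma diff_hom:
  shows "ext_diff pushout i \<in> module_hom (L (Suc i)) (L i)"
proof (rule module_homI)
  fix A assume "A \<in> carrier (L (Suc i))"
  then obtain u where u: "u \<in> carrier (pair_module (Suc i))" "A = pcls (Suc i) u" using L_cases by blast
  have du: "(0, d i (snd u)) \<in> carrier (pair_module i)" using u d_carrier by (auto simp: pair_simps)
  then show "ext_diff pushout i A \<in> carrier (L i)"
    unfolding u(2) pushout_diff[OF u(1)] by (rule hom_carrier[OF q_hom])
  interpret pair: lmod "pair_module (Suc i)" by (rule pair_lmod)
  show "ext_diff pushout i (r \<odot>\<^bsub>L (Suc i)\<^esub> A) = r \<odot>\<^bsub>L i\<^esub> ext_diff pushout i A" for r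
  proof -
    have "r \<odot>\<^bsub>L (Suc i)\<^esub> A = pcls (Suc i) (r \<odot>\<^bsub>pair_module (Suc i)\<^esub> u)"
      using hom_smult[OF q_hom u(1)] u(2) by simp
    then have "ext_diff pushout i (r \<odot>\<^bsub>L (Suc i)\<^esub> A) = pcls i (0, d i (pscale r (snd u)))"
      using pushout_diff[OF pair.smult_closed[OF u(1), of r]] by (simp add: pair_simps)
    also have "\<dots> = pcls i (r \<odot>\<^bsub>pair_module i\<^esub> (0, d i (snd u)))"
      using u(1) d_pscale by (auto simp: pair_simps)
    finally show ?thesis using hom_smult[OF q_hom du] u by (simp add: pushout_diff)
  qed
  fix B assume "B \<in> carrier (L (Suc i))"
  then obtain v where v: "v \<in> carrier (pair_module (Suc i))" "B = pcls (Suc i) v" using L_cases by blast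
  have dv: "(0, d i (snd v)) \<in> carrier (pair_module i)" using v d_carrier by (auto simp: pair_simps)
  have "A \<oplus>\<^bsub>L (Suc i)\<^esub> B = pcls (Suc i) (u \<oplus>\<^bsub>pair_module (Suc i)\<^esub> v)"
    using hom_add[OF q_hom u(1) v(1)] u(2) v(2) by simp
  then have "ext_diff pushout i (A \<oplus>\<^bsub>L (Suc i)\<^esub> B) = pcls i (0, d i (snd u + snd v))"
    using pushout_diff[OF pair.a_closed[OF u(1) v(1)]] by (simp add: pair_simps)
  also have "\<dots> = pcls i ((0, d i (snd u)) \<oplus>\<^bsub>pair_module i\<^esub> (0, d i (snd v)))"
    using u(1) v(1) d_add by (auto simp: pair_simps)
  finally show "ext_diff pushout i (A \<oplus>\<^bsub>L (Suc i)\<^esub> B) = ext_diff pushout i A \<oplus>\<^bsub>L i\<^esub> ext_diff pushout i B"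
    using hom_add[OF q_hom du dv] u v by (simp add: pushout_diff)
qed

lemma aug_hom: "ext_aug pushout \<in> module_hom (L 0) T"
proof (rule module_homI)
  fix A assume "A \<in> carrier (L 0)"
  then obtain u where u: "u \<in> carrier (pair_module 0)" "A = pcls 0 u" using L_cases by blast
  interpret pair: lmod "pair_module 0" by (rule pair_lmod)
  have su: "snd u \<in> carrier (F 0)" using u by (auto simp: pair_simps)
  show "ext_aug pushout (r \<odot>\<^bsub>L 0\<^esub> A) = r \<odot>\<^bsub>T\<^esub> ext_aug pushout A" for r
  proof -
    have "r \<odot>\<^bsub>L 0\<^esub> A = pcls 0 (r \<odot>\<^bsub>pair_module 0\<^esub> u)" using hom_smult[OF q_hom u(1)] u(2) by simp
    then show ?thesis using pushout_aug[OF pair.smult_closed[OF u(1), of r]] pushout_aug[OF u(1)] u(2)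
        hom_smult[OF \<epsilon>_hom su, of r] by (simp add: pair_simps F_simps)
  qed
  fix B assume "B \<in> carrier (L 0)"
  then obtain v where v: "v \<in> carrier (pair_module 0)" "B = pcls 0 v" using L_cases by blast
  have sv: "snd v \<in> carrier (F 0)" using v by (auto simp: pair_simps)
  have "A \<oplus>\<^bsub>L 0\<^esub> B = pcls 0 (u \<oplus>\<^bsub>pair_module 0\<^esub> v)" using hom_add[OF q_hom u(1) v(1)] u(2) v(2) by simp
  then show "ext_aug pushout (A \<oplus>\<^bsub>L 0\<^esub> B) = ext_aug pushout A \<oplus>\<^bsub>T\<^esub> ext_aug pushout B"
    using pushout_aug[OF pair.a_closed[OF u(1) v(1)]] pushout_aug[OF u(1)] pushout_aug[OF v(1)] u(2) v(2)
      hom_add[OF \<epsilon>_hom su sv] by (simp add: pair_simps F_simps)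
qed simp

lemma pushout_extension: "is_extension a m pushout"
proof (rule is_extensionI)
  note [simp] = pushout_simps(1)
  have c: "(c, 0) \<in> carrier (pair_module i)" for c i by (simp add: pair_simps F_closed)
  show "0 < m" by (rule m)
  show "lmod (ext_term pushout i)" for i by (simp add: L_lmod)
  show "ext_diff pushout i \<in> module_hom (ext_term pushout (Suc i)) (ext_term pushout i)" for i
    by (simp add: diff_hom)
  show "ext_aug pushout \<in> module_hom (ext_term pushout 0) T" by (simp add: aug_hom)
  show inc_hom: "ext_inc pushout \<in> module_hom T (ext_term pushout (m - 1))"
  proof (rule module_homI)
    show "ext_inc pushout x \<in> carrier (ext_term pushout (m - 1))" for x
      unfolding pushout_simps using hom_carrier[OF q_hom c] .
    show "ext_inc pushout (x \<oplus>\<^bsub>T\<^esub> y) = ext_inc pushout x \<oplus>\<^bsub>ext_term pushout (m - 1)\<^esub> ext_inc pushout y" for x y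
      unfolding pushout_simps hom_add[OF q_hom c c, symmetric] by (simp add: pair_simps)
    show "ext_inc pushout (r \<odot>\<^bsub>T\<^esub> x) = r \<odot>\<^bsub>ext_term pushout (m - 1)\<^esub> ext_inc pushout x" for r x
      unfolding pushout_simps hom_smult[OF q_hom c, symmetric] by (simp add: pair_simps)
  qed
  show "ext_aug pushout ` carrier (ext_term pushout 0) = UNIV"
  proof -
    have "c \<in> ext_aug pushout ` carrier (L 0)" for c
    proof -
      obtain p where p: "p \<in> carrier (F 0)" "\<epsilon> p = c" using \<epsilon>_surj by (metis UNIV_I imageE)
      then have p': "(0, p) \<in> carrier (pair_module 0)" by (simp add: pair_simps)
      then have "ext_aug pushout (pcls 0 (0, p)) = c" using pushout_aug[OF p'] p by simp
      then show ?thesis using hom_carrier[OF q_hom p'] by (metis imageI)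
    qed
    then show ?thesis by auto
  qed
  show "inj (ext_inc pushout)"
  proof (rule injI)
    fix x y assume "ext_inc pushout x = ext_inc pushout y"
    then have "(x - y, 0) \<in> N (m - 1)" using q_eq_iff[OF c c, of "m - 1" x y] by (simp add: pushout_simps)
    \<comment> \<open>A pair \<open>(x - y, 0)\<close> in the relations comes from some
      \<open>z\<close> with \<open>d (m - 1) z = 0\<close>; such a \<open>z\<close> is a boundary,
      and \<open>f\<close> vanishes on it. This is where the cocycle condition enters.\<close>
    then obtain z where z: "z \<in> carrier (F m)" "x - y = f z" "d (m - 1) z = 0"
      using m by (auto simp: pushout_rel_def)
    then have "z \<in> d (Suc (m - 1)) ` carrier (F (Suc (Suc (m - 1))))" using exact_d[of z "m - 1"] m by simp
    then have "f z = 0" using cocycle_zero[OF f] m by auto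
    then show "x = y" using z by simp
  qed
  have inc_sub: "range (ext_inc pushout) \<subseteq> carrier (L i)" if "Suc i = m" for i
    using hom_carrier[OF inc_hom] that by auto
  have diff_sub: "ext_diff pushout i ` carrier (L (Suc i)) \<subseteq> carrier (L i)" for i
    using hom_carrier[OF diff_hom] by auto
  have snd_car: "snd u \<in> carrier (F i)" if "u \<in> carrier (pair_module i)" for u i
    using that by (auto simp: pair_simps)
  show "{x \<in> carrier (ext_term pushout 0). ext_aug pushout x = 0} =
      (if Suc 0 < m then ext_diff pushout 0 ` carrier (ext_term pushout 1) else range (ext_inc pushout))"
    unfolding pushout_simps(1)
  proof (rule kernel_via)
    fix u assume u: "u \<in> carrier (pair_module 0)"
    have "ext_aug pushout (pcls 0 u) = 0 \<longleftrightarrow> snd u \<in> d 0 ` carrier (F (Suc 0))"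
      using exact_\<epsilon>[OF snd_car[OF u]] \<epsilon>d pushout_aug[OF u] by auto
    also have "\<dots> \<longleftrightarrow> pcls 0 u \<in> (if Suc 0 < m then ext_diff pushout 0 ` carrier (L 1) else range (ext_inc pushout))"
      using pushout_inner[OF _ u] pushout_last[OF _ u] m by (cases "Suc 0 < m") simp_all
    finally show "ext_aug pushout (pcls 0 u) = 0 \<longleftrightarrow>
      pcls 0 u \<in> (if Suc 0 < m then ext_diff pushout 0 ` carrier (L 1) else range (ext_inc pushout))" .
  qed (use diff_sub[of 0] inc_sub[of 0] m in auto)
  show "{x \<in> carrier (ext_term pushout (Suc j)). ext_diff pushout j x = \<zero>\<^bsub>ext_term pushout j\<^esub>} =
      (if Suc (Suc j) < m then ext_diff pushout (Suc j) ` carrier (ext_term pushout (Suc (Suc j))) else range (ext_inc pushout))"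
    if j: "Suc j < m" for j
    unfolding pushout_simps(1)
  proof (rule kernel_via)
    fix u assume u: "u \<in> carrier (pair_module (Suc j))"
    have du: "(0, d j (snd u)) \<in> carrier (pair_module j)" using d_carrier[OF snd_car[OF u]] by (simp add: pair_simps)
    have "ext_diff pushout j (pcls (Suc j) u) = \<zero>\<^bsub>L j\<^esub> \<longleftrightarrow> d j (snd u) = 0"
      unfolding pushout_diff[OF u] L_zero q_zero_iff[OF du] using j by (simp add: pushout_rel_def)
    also have "\<dots> \<longleftrightarrow> snd u \<in> d (Suc j) ` carrier (F (Suc (Suc j)))"
      using exact_d[OF snd_car[OF u]] dd by auto
    also have "\<dots> \<longleftrightarrow> pcls (Suc j) u \<in> (if Suc (Suc j) < m then ext_diff pushout (Suc j) ` carrier (L (Suc (Suc j))) else range (ext_inc pushout))"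
      using pushout_inner[OF _ u] pushout_last[OF _ u] j by (cases "Suc (Suc j) < m") simp_all
    finally show "ext_diff pushout j (pcls (Suc j) u) = \<zero>\<^bsub>L j\<^esub> \<longleftrightarrow>
      pcls (Suc j) u \<in> (if Suc (Suc j) < m then ext_diff pushout (Suc j) ` carrier (L (Suc (Suc j))) else range (ext_inc pushout))" .
  qed (use diff_sub[of "Suc j"] inc_sub[of "Suc j"] j in auto)
qed

lemma pushout_represents: "represents a P m pushout f"
proof (rule representsI[where \<phi> = "\<lambda>i p. pcls i (0, p)"])
  have c: "(0, p) \<in> carrier (pair_module i)" if "p \<in> carrier (F i)" for p i using that by (simp add: pair_simps)
  show "f \<in> carrier (C m)" by (rule cocycle_C[OF f])
  show "(\<lambda>p. pcls i (0, p)) \<in> module_hom (F i) (ext_term pushout i)" for i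
    unfolding pushout_simps
  proof (rule module_homI)
    show "pcls i (0, x) \<in> carrier (L i)" if "x \<in> carrier (F i)" for x using hom_carrier[OF q_hom c[OF that]] .
    show "pcls i (0, x \<oplus>\<^bsub>F i\<^esub> y) = pcls i (0, x) \<oplus>\<^bsub>L i\<^esub> pcls i (0, y)"
      if "x \<in> carrier (F i)" "y \<in> carrier (F i)" for x y
      unfolding hom_add[OF q_hom c[OF that(1)] c[OF that(2)], symmetric] by (simp add: pair_simps F_simps)
    show "pcls i (0, r \<odot>\<^bsub>F i\<^esub> x) = r \<odot>\<^bsub>L i\<^esub> pcls i (0, x)"
      if "x \<in> carrier (F i)" for x r
      unfolding hom_smult[OF q_hom c[OF that], symmetric] by (simp add: pair_simps F_simps)
  qed
  show "ext_aug pushout (pcls 0 (0, x)) = \<epsilon> x" if "x \<in> carrier (F 0)" for x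
    using pushout_aug[OF c[OF that]] by simp
  show "ext_diff pushout i (pcls (Suc i) (0, x)) = pcls i (0, d i x)" if "x \<in> carrier (F (Suc i))" for i x
    using pushout_diff[OF c[OF that]] by simp
  \<comment> \<open>\<open>(f x, 0)\<close> and \<open>(0, d (m - 1) x)\<close> differ by the
    pushout relation of \<open>x\<close>, so the last component of the lift is \<open>f\<close>
    itself.\<close>
  show "ext_inc pushout (f x) = pcls (m - 1) (0, d (m - 1) x)" if x: "x \<in> carrier (F m)" for x
  proof -
    have dx: "d (m - 1) x \<in> carrier (F (m - 1))" using d_carrier[of x "m - 1"] x m by simp
    have "(f x, 0) \<in> carrier (pair_module (m - 1))" by (simp add: pair_simps F_closed)
    then show ?thesis using q_eq_iff[OF _ c[OF dx], of "(f x, 0)"] x m by (auto simp: pushout_simps pushout_rel_def)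
  qed
qed

end

text \<open>Evaluates the \<open>THE\<close> of the definition. Existence: both factors are realised
  by pushouts. Uniqueness: in any other realisation the splice is represented by a composition of
  cohomologous cocycles, and the class of a composition depends only on the classes of its
  factors.\<close>

theorem yoneda_product_comp:
  assumes f: "f \<in> cocycles a P m" and g: "g \<in> cocycles a P n" and m: "0 < m" and n: "0 < n"
    and \<psi>: "chain_lift n g \<psi>"
  shows "yoneda_product a P m n (cl m f) (cl n g) = cl (m + n) (comp_cocycle m n f \<psi>)"
proof -
  let ?w = "cl (m + n) (comp_cocycle m n f \<psi>)"
  have "(THE w. \<exists>E G :: ('b, ('k \<times> ('x \<Rightarrow>\<^sub>0 'b)) set, 'k) extension.
              is_extension a m E \<and> is_class_of a P m E (cl m f) \<and>
              is_extension a n G \<and> is_class_of a P n G (cl n g) \<and>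
              is_class_of a P (m + n) (splice E n G) w) = ?w"
  proof (rule the_equality)
    note E = pushout_extension[OF f m] pushout_represents[OF f m]
    note G = pushout_extension[OF g n] pushout_represents[OF g n]
    have "is_class_of a P (m + n) (splice (pushout m f) n (pushout n g)) ?w"
      unfolding is_class_of_def using splice_represents[OF E(1) G(1) E(2) G(2) \<psi>] by blast
    moreover have "is_class_of a P m (pushout m f) (cl m f)" "is_class_of a P n (pushout n g) (cl n g)"
      unfolding is_class_of_def using E(2) G(2) by blast+
    ultimately show "\<exists>E G :: ('b, ('k \<times> ('x \<Rightarrow>\<^sub>0 'b)) set, 'k) extension.
              is_extension a m E \<and> is_class_of a P m E (cl m f) \<and>
              is_extension a n G \<and> is_class_of a P n G (cl n g) \<and>
              is_class_of a P (m + n) (splice E n G) ?w"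
      using E(1) G(1) by blast
  next
    fix w
    assume "\<exists>E G :: ('b, ('k \<times> ('x \<Rightarrow>\<^sub>0 'b)) set, 'k) extension.
              is_extension a m E \<and> is_class_of a P m E (cl m f) \<and>
              is_extension a n G \<and> is_class_of a P n G (cl n g) \<and>
              is_class_of a P (m + n) (splice E n G) w"
    then obtain E G :: "('b, ('k \<times> ('x \<Rightarrow>\<^sub>0 'b)) set, 'k) extension" and f' g' h where
      E: "is_extension a m E" "represents a P m E f'" "cl m f = cl m f'" and
      G: "is_extension a n G" "represents a P n G g'" "cl n g = cl n g'" and
      h: "represents a P (m + n) (splice E n G) h" "w = cl (m + n) h"
      unfolding is_class_of_def by (elim exE conjE)
    note f' = represents_cocycle[OF E(1,2)] and g' = represents_cocycle[OF G(1,2)]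
    obtain \<psi>' where \<psi>': "chain_lift n g' \<psi>'" using chain_lift_exists[OF g'] by blast
    have "w = cl (m + n) (comp_cocycle m n f' \<psi>')"
      using represents_unique[OF splice_extension[OF E(1) G(1)] h(1)]
        splice_represents[OF E(1) G(1) E(2) G(2) \<psi>'] h(2) by simp
    also have "\<dots> = cl (m + n) (comp_cocycle m n f' \<psi>)"
      by (rule comp_cocycle_cong_right[OF f' m n g' g G(3)[symmetric] \<psi>' \<psi>])
    also have "\<dots> = ?w" by (rule comp_cocycle_cong_left[OF f' f E(3)[symmetric] m \<psi>])
    finally show "w = ?w" .
  qed
  then show ?thesis using m n by (simp add: yoneda_product_def)
qed

section \<open>The Yoneda algebra\<close>


abbreviation "X \<equiv> Ext a P"
abbreviation "yp \<equiv> yoneda_product a P"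
abbreviation "A \<equiv> yoneda_algebra a P"

definition \<epsilon>0 :: "('x \<Rightarrow>\<^sub>0 'b) \<Rightarrow> 'k" where "\<epsilon>0 = restrict \<epsilon> (carrier (F 0))"

lemma ext_one_eq: "ext_one a P = cl 0 \<epsilon>0"
  by (simp add: ext_one_def \<epsilon>0_def)

lemma \<epsilon>0_cocycle: "\<epsilon>0 \<in> cocycles a P 0"
  unfolding \<epsilon>0_def by (rule cocycleI[OF \<epsilon>_hom]) (simp add: \<epsilon>d)

lemma ext_one_carrier: "ext_one a P \<in> carrier (X 0)"
  unfolding ext_one_eq Ext_carrier using \<epsilon>0_cocycle by blast

text \<open>With \<open>\<epsilon> u = 1\<close>, subtracting \<open>\<iota> (\<epsilon> p)\<close>
  times \<open>u\<close> from \<open>p\<close> gives an element of the kernel of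
  \<open>\<epsilon>\<close>, hence a boundary killed by \<open>f\<close>; so \<open>f\<close> is
  \<open>f u\<close> times the augmentation.\<close>

lemma cocycles_zero:
  assumes f: "f \<in> cocycles a P 0"
  shows "\<exists>c. f = c \<odot>\<^bsub>C 0\<^esub> \<epsilon>0"
proof -
  obtain u where u: "u \<in> carrier (F 0)" "\<epsilon> u = 1" using \<epsilon>_surj by (metis UNIV_I imageE)
  have "f p = f u * \<epsilon> p" if p: "p \<in> carrier (F 0)" for p
  proof -
    let ?v = "pscale (\<iota> (\<epsilon> p)) u"
    have v: "?v \<in> carrier (F 0)" using F_closed u by blast
    have ev: "\<epsilon> ?v = \<epsilon> p" using hom_smult[OF \<epsilon>_hom u(1), of "\<iota> (\<epsilon> p)"] u(2) by (simp add: F_simps a_\<iota>)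
    have fv: "f ?v = \<epsilon> p * f u" using hom_smult[OF cocycle_hom[OF f] u(1), of "\<iota> (\<epsilon> p)"] by (simp add: F_simps a_\<iota>)
    have "\<epsilon> (p \<ominus>\<^bsub>F 0\<^esub> ?v) = 0" using hom_minus[OF F_lmod T_lmod \<epsilon>_hom p v] ev by simp
    then have "p \<ominus>\<^bsub>F 0\<^esub> ?v \<in> d 0 ` carrier (F 1)"
      using exact_\<epsilon> F_minus[OF p v] F_diff[OF p v] by simp
    then have "f (p \<ominus>\<^bsub>F 0\<^esub> ?v) = 0" using cocycle_zero[OF f] by auto
    then show ?thesis using hom_minus[OF F_lmod T_lmod cocycle_hom[OF f] p v] fv by simp
  qed
  moreover have "f \<in> extensional (carrier (F 0))" using cocycle_C[OF f] by (simp add: C_simps)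
  ultimately have "f = f u \<odot>\<^bsub>C 0\<^esub> \<epsilon>0" by (auto simp: C_simps \<epsilon>0_def extensional_def fun_eq_iff)
  then show ?thesis by blast
qed

lemma Ext0_scalar: "u \<in> carrier (X 0) \<Longrightarrow> \<exists>c. u = c \<odot>\<^bsub>X 0\<^esub> ext_one a P"
proof -
  assume "u \<in> carrier (X 0)"
  then obtain f where f: "f \<in> cocycles a P 0" "u = cl 0 f" unfolding Ext_carrier by blast
  then obtain c where "f = c \<odot>\<^bsub>C 0\<^esub> \<epsilon>0" using cocycles_zero by blast
  then have "u = c \<odot>\<^bsub>X 0\<^esub> ext_one a P" using f cl_smult[OF \<epsilon>0_cocycle, of c] by (simp add: ext_one_eq)
  then show ?thesis by blast
qed

lemma ext_one_nonzero: "ext_one a P \<noteq> \<zero>\<^bsub>X 0\<^esub>"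
proof
  assume "ext_one a P = \<zero>\<^bsub>X 0\<^esub>"
  then have "coboundaries a P 0 +>\<^bsub>Z 0\<^esub> \<epsilon>0 = coboundaries a P 0"
    by (simp add: ext_one_eq Ext_zero cl_eq_coset)
  then have "\<epsilon>0 \<in> coboundaries a P 0"
    using coset_zero_iff[OF Z_lmod coboundaries_lsub, of \<epsilon>0 0] \<epsilon>0_cocycle by simp
  then have z: "\<epsilon>0 = (\<lambda>x\<in>carrier (F 0). 0)" by (simp add: coboundaries_def C_simps)
  obtain u where u: "u \<in> carrier (F 0)" "\<epsilon> u = 1" using \<epsilon>_surj by (metis UNIV_I imageE)
  have "\<epsilon>0 u = 1" using u by (simp add: \<epsilon>0_def)
  moreover have "\<epsilon>0 u = 0" using u z by simp
  ultimately show False by simp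
qed

text \<open>Makes the scalar in the degree-zero clauses of \<open>yoneda_product\<close> unique, so
  that their \<open>THE\<close> can be evaluated.\<close>

lemma ext_one_cancel: "c \<odot>\<^bsub>X 0\<^esub> ext_one a P = c' \<odot>\<^bsub>X 0\<^esub> ext_one a P \<longleftrightarrow> c = c'"
proof
  interpret lmod "X 0" by (rule Ext_lmod)
  assume "c \<odot>\<^bsub>X 0\<^esub> ext_one a P = c' \<odot>\<^bsub>X 0\<^esub> ext_one a P"
  then have z: "(c - c') \<odot>\<^bsub>X 0\<^esub> ext_one a P = \<zero>\<^bsub>X 0\<^esub>"
    using smult_diff[OF ext_one_carrier, of c c'] minus_eq_zero_iff ext_one_carrier by simp
  show "c = c'"
  proof (rule ccontr)
    assume "c \<noteq> c'"
    then have "ext_one a P = (inverse (c - c') * (c - c')) \<odot>\<^bsub>X 0\<^esub> ext_one a P" using ext_one_carrier by simp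
    also have "\<dots> = \<zero>\<^bsub>X 0\<^esub>" using smult_assoc1[OF ext_one_carrier] z by simp
    finally show False using ext_one_nonzero by simp
  qed
qed simp

lemma yp_zero_left: "yp 0 n (c \<odot>\<^bsub>X 0\<^esub> ext_one a P) v = c \<odot>\<^bsub>X n\<^esub> v"
  by (simp add: yoneda_product_def ext_one_cancel)

text \<open>For \<open>m = 0\<close> the definition takes its left clause, so agreement with the
  right one comes from commutativity of \<open>K\<close>.\<close>

lemma yp_zero_right:
  assumes u: "u \<in> carrier (X m)"
  shows "yp m 0 u (c \<odot>\<^bsub>X 0\<^esub> ext_one a P) = c \<odot>\<^bsub>X m\<^esub> u"
proof (cases "m = 0")
  case True
  interpret lmod "X 0" by (rule Ext_lmod)
  obtain e where e: "u = e \<odot>\<^bsub>X 0\<^esub> ext_one a P" using Ext0_scalar u True by blast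
  show ?thesis unfolding True e yp_zero_left
    by (simp add: mult.commute ext_one_carrier flip: smult_assoc1)
next
  case False
  then show ?thesis by (simp add: yoneda_product_def ext_one_cancel)
qed

text \<open>The five laws share one case distinction. In positive degrees they are checked on
  cocycles: linearity on the left is pointwise, linearity on the right comes from adding lifts and
  from multiplying a lift by the central element \<open>\<iota> c\<close>. If one degree is 0, the
  product is scalar multiplication.\<close>

lemma yp_linear:
  assumes u: "u \<in> carrier (X m)" "u' \<in> carrier (X m)" and v: "v \<in> carrier (X n)" "v' \<in> carrier (X n)"
  shows yp_closed: "yp m n u v \<in> carrier (X (m + n))"
    and yp_add_l: "yp m n (u \<oplus>\<^bsub>X m\<^esub> u') v = yp m n u v \<oplus>\<^bsub>X (m + n)\<^esub> yp m n u' v"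
    and yp_add_r: "yp m n u (v \<oplus>\<^bsub>X n\<^esub> v') = yp m n u v \<oplus>\<^bsub>X (m + n)\<^esub> yp m n u v'"
    and yp_smult_l: "yp m n (c \<odot>\<^bsub>X m\<^esub> u) v = c \<odot>\<^bsub>X (m + n)\<^esub> yp m n u v"
    and yp_smult_r: "yp m n u (c \<odot>\<^bsub>X n\<^esub> v) = c \<odot>\<^bsub>X (m + n)\<^esub> yp m n u v"
proof -
  have "yp m n u v \<in> carrier (X (m + n)) \<and>
    yp m n (u \<oplus>\<^bsub>X m\<^esub> u') v = yp m n u v \<oplus>\<^bsub>X (m + n)\<^esub> yp m n u' v \<and>
    yp m n u (v \<oplus>\<^bsub>X n\<^esub> v') = yp m n u v \<oplus>\<^bsub>X (m + n)\<^esub> yp m n u v' \<and>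
    yp m n (c \<odot>\<^bsub>X m\<^esub> u) v = c \<odot>\<^bsub>X (m + n)\<^esub> yp m n u v \<and>
    yp m n u (c \<odot>\<^bsub>X n\<^esub> v) = c \<odot>\<^bsub>X (m + n)\<^esub> yp m n u v"
  proof -
    consider "m = 0" | "n = 0" | "0 < m" "0 < n" by blast
    then show ?thesis
    proof cases
      case 1
      interpret lmod "X n" by (rule Ext_lmod)
      interpret X0: lmod "X 0" by (rule Ext_lmod)
      obtain e e' where e: "u = e \<odot>\<^bsub>X 0\<^esub> ext_one a P" "u' = e' \<odot>\<^bsub>X 0\<^esub> ext_one a P"
        using Ext0_scalar u 1 by metis
      have "u \<oplus>\<^bsub>X 0\<^esub> u' = (e + e') \<odot>\<^bsub>X 0\<^esub> ext_one a P" "c \<odot>\<^bsub>X 0\<^esub> u = (c * e) \<odot>\<^bsub>X 0\<^esub> ext_one a P"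
        unfolding e using ext_one_carrier X0.smult_l_distr X0.smult_assoc1 by simp_all
      note y = this[THEN arg_cong[of _ _ "\<lambda>w. yp 0 n w v"], unfolded yp_zero_left]
      show ?thesis unfolding 1 add_0 y unfolding e yp_zero_left
        using v by (auto simp: smult_l_distr smult_r_distr mult.commute simp flip: smult_assoc1)
    next
      case 2
      interpret lmod "X m" by (rule Ext_lmod)
      interpret X0: lmod "X 0" by (rule Ext_lmod)
      obtain e e' where e: "v = e \<odot>\<^bsub>X 0\<^esub> ext_one a P" "v' = e' \<odot>\<^bsub>X 0\<^esub> ext_one a P"
        using Ext0_scalar v 2 by metis
      have "v \<oplus>\<^bsub>X 0\<^esub> v' = (e + e') \<odot>\<^bsub>X 0\<^esub> ext_one a P" "c \<odot>\<^bsub>X 0\<^esub> v = (c * e) \<odot>\<^bsub>X 0\<^esub> ext_one a P"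
        unfolding e using ext_one_carrier X0.smult_l_distr X0.smult_assoc1 by simp_all
      note y = this[THEN arg_cong[of _ _ "\<lambda>w. yp m 0 u w"], unfolded yp_zero_right[OF u(1)]]
      show ?thesis unfolding 2 add_0_right y unfolding e
        using u by (auto simp: yp_zero_right smult_l_distr smult_r_distr mult.commute simp flip: smult_assoc1)
    next
      case 3
      obtain f f' where f: "f \<in> cocycles a P m" "f' \<in> cocycles a P m" "u = cl m f" "u' = cl m f'"
        using u unfolding Ext_carrier by blast
      obtain g g' where g: "g \<in> cocycles a P n" "g' \<in> cocycles a P n" "v = cl n g" "v' = cl n g'"
        using v unfolding Ext_carrier by blast
      obtain \<psi> \<psi>' where \<psi>: "chain_lift n g \<psi>" "chain_lift n g' \<psi>'" using chain_lift_exists g by metis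
      note lm = lsub_add[OF C_lmod cocycles_lsub] and ls = lsub_smult[OF C_lmod cocycles_lsub]
      note y = yoneda_product_comp[OF _ _ 3] and k = comp_cocycle
      note ps = chain_lift_add[OF \<psi>] chain_lift_smult[OF \<psi>(1), of c]
      have car: "\<psi> m p \<in> carrier (F m)" "\<psi>' m p \<in> carrier (F m)" if "p \<in> carrier (F (m + n))" for p
        using hom_carrier[OF chain_liftD(1)[OF \<psi>(1)] that] hom_carrier[OF chain_liftD(1)[OF \<psi>(2)] that] .
      have 1: "comp_cocycle m n (f \<oplus>\<^bsub>C m\<^esub> f') \<psi> = comp_cocycle m n f \<psi> \<oplus>\<^bsub>C (m + n)\<^esub> comp_cocycle m n f' \<psi>"
        "comp_cocycle m n (c \<odot>\<^bsub>C m\<^esub> f) \<psi> = c \<odot>\<^bsub>C (m + n)\<^esub> comp_cocycle m n f \<psi>"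
        using car by (auto simp: comp_cocycle_def C_simps fun_eq_iff)
      have 2: "comp_cocycle m n f (\<lambda>i p. \<psi> i p + \<psi>' i p) = comp_cocycle m n f \<psi> \<oplus>\<^bsub>C (m + n)\<^esub> comp_cocycle m n f \<psi>'"
        using car f_add[OF f(1) 3(1)] by (auto simp: comp_cocycle_def C_simps fun_eq_iff)
      have 3: "comp_cocycle m n f (\<lambda>i p. pscale (\<iota> c) (\<psi> i p)) = c \<odot>\<^bsub>C (m + n)\<^esub> comp_cocycle m n f \<psi>"
        using car f_pscale[OF f(1) 3(1)] by (auto simp: comp_cocycle_def C_simps fun_eq_iff a_\<iota>)
      have c: "yp m n u v \<in> carrier (X (m + n))"
        unfolding f(3) g(3) y[OF f(1) g(1) \<psi>(1)] Ext_carrier using k[OF f(1) \<psi>(1)] by blast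
      have al: "yp m n (u \<oplus>\<^bsub>X m\<^esub> u') v = yp m n u v \<oplus>\<^bsub>X (m + n)\<^esub> yp m n u' v"
        unfolding f(3,4) g(3) cl_add[OF f(1,2)] y[OF f(1) g(1) \<psi>(1)] y[OF f(2) g(1) \<psi>(1)]
          y[OF lm[OF f(1,2)] g(1) \<psi>(1)] 1 cl_add[OF k[OF f(1) \<psi>(1)] k[OF f(2) \<psi>(1)]] ..
      have ar: "yp m n u (v \<oplus>\<^bsub>X n\<^esub> v') = yp m n u v \<oplus>\<^bsub>X (m + n)\<^esub> yp m n u v'"
        unfolding f(3) g(3,4) cl_add[OF g(1,2)] y[OF f(1) g(1) \<psi>(1)] y[OF f(1) g(2) \<psi>(2)]
          y[OF f(1) lm[OF g(1,2)] ps(1)] 2 cl_add[OF k[OF f(1) \<psi>(1)] k[OF f(1) \<psi>(2)]] ..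
      have sl: "yp m n (c \<odot>\<^bsub>X m\<^esub> u) v = c \<odot>\<^bsub>X (m + n)\<^esub> yp m n u v"
        unfolding f(3) g(3) cl_smult[OF f(1)] y[OF f(1) g(1) \<psi>(1)] y[OF ls[OF f(1)] g(1) \<psi>(1)] 1
          cl_smult[OF k[OF f(1) \<psi>(1)]] ..
      have sr: "yp m n u (c \<odot>\<^bsub>X n\<^esub> v) = c \<odot>\<^bsub>X (m + n)\<^esub> yp m n u v"
        unfolding f(3) g(3) cl_smult[OF g(1)] y[OF f(1) g(1) \<psi>(1)] y[OF f(1) ls[OF g(1)] ps(2)] 3
          cl_smult[OF k[OF f(1) \<psi>(1)]] ..
      show ?thesis using c al ar sl sr by blast
    qed
  qed
  then show "yp m n u v \<in> carrier (X (m + n))"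
    "yp m n (u \<oplus>\<^bsub>X m\<^esub> u') v = yp m n u v \<oplus>\<^bsub>X (m + n)\<^esub> yp m n u' v"
    "yp m n u (v \<oplus>\<^bsub>X n\<^esub> v') = yp m n u v \<oplus>\<^bsub>X (m + n)\<^esub> yp m n u v'"
    "yp m n (c \<odot>\<^bsub>X m\<^esub> u) v = c \<odot>\<^bsub>X (m + n)\<^esub> yp m n u v"
    "yp m n u (c \<odot>\<^bsub>X n\<^esub> v) = c \<odot>\<^bsub>X (m + n)\<^esub> yp m n u v" by blast+
qed

lemma yp_null:
  assumes "u \<in> carrier (X m)" "v \<in> carrier (X n)"
  shows "yp m n \<zero>\<^bsub>X m\<^esub> v = \<zero>\<^bsub>X (m + n)\<^esub>" "yp m n u \<zero>\<^bsub>X n\<^esub> = \<zero>\<^bsub>X (m + n)\<^esub>"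
proof -
  interpret M: lmod "X m" by (rule Ext_lmod)
  interpret N: lmod "X n" by (rule Ext_lmod)
  interpret MN: lmod "X (m + n)" by (rule Ext_lmod)
  show "yp m n \<zero>\<^bsub>X m\<^esub> v = \<zero>\<^bsub>X (m + n)\<^esub>"
    using yp_smult_l[OF M.zero_closed M.zero_closed assms(2,2), of 0] yp_closed[OF M.zero_closed M.zero_closed assms(2,2)] by simp
  show "yp m n u \<zero>\<^bsub>X n\<^esub> = \<zero>\<^bsub>X (m + n)\<^esub>"
    using yp_smult_r[OF assms(1,1) N.zero_closed N.zero_closed, of 0] yp_closed[OF assms(1,1) N.zero_closed N.zero_closed] by simp
qed

section \<open>The algebra of finitely supported sequences of classes\<close>

lemma A_simps:
  "carrier A = {u. (\<forall>n. u n \<in> carrier (X n)) \<and> finite {n. u n \<noteq> \<zero>\<^bsub>X n\<^esub>}}"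
  "u \<otimes>\<^bsub>A\<^esub> v = (\<lambda>n. \<Oplus>\<^bsub>X n\<^esub>i\<in>{..n}. yp i (n - i) (u i) (v (n - i)))"
  "\<one>\<^bsub>A\<^esub> = (\<lambda>n. if n = 0 then ext_one a P else \<zero>\<^bsub>X n\<^esub>)"
  "\<zero>\<^bsub>A\<^esub> = (\<lambda>n. \<zero>\<^bsub>X n\<^esub>)"
  "u \<oplus>\<^bsub>A\<^esub> v = (\<lambda>n. u n \<oplus>\<^bsub>X n\<^esub> v n)"
  "c \<odot>\<^bsub>A\<^esub> u = (\<lambda>n. c \<odot>\<^bsub>X n\<^esub> u n)"
  by (simp_all add: yoneda_algebra_def)

lemma X_closed:
  "x \<in> carrier (X n) \<Longrightarrow> y \<in> carrier (X n) \<Longrightarrow> x \<oplus>\<^bsub>X n\<^esub> y \<in> carrier (X n)"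
  "x \<in> carrier (X n) \<Longrightarrow> c \<odot>\<^bsub>X n\<^esub> x \<in> carrier (X n)" "\<zero>\<^bsub>X n\<^esub> \<in> carrier (X n)"
proof -
  interpret lmod "X n" by (rule Ext_lmod)
  show "x \<in> carrier (X n) \<Longrightarrow> y \<in> carrier (X n) \<Longrightarrow> x \<oplus>\<^bsub>X n\<^esub> y \<in> carrier (X n)"
    "x \<in> carrier (X n) \<Longrightarrow> c \<odot>\<^bsub>X n\<^esub> x \<in> carrier (X n)" "\<zero>\<^bsub>X n\<^esub> \<in> carrier (X n)" by simp_all
qed

lemma X_laws:
  assumes x: "x \<in> carrier (X n)"
  shows "\<zero>\<^bsub>X n\<^esub> \<oplus>\<^bsub>X n\<^esub> x = x" "(r + s) \<odot>\<^bsub>X n\<^esub> x = r \<odot>\<^bsub>X n\<^esub> x \<oplus>\<^bsub>X n\<^esub> s \<odot>\<^bsub>X n\<^esub> x"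
    "(r * s) \<odot>\<^bsub>X n\<^esub> x = r \<odot>\<^bsub>X n\<^esub> (s \<odot>\<^bsub>X n\<^esub> x)" "1 \<odot>\<^bsub>X n\<^esub> x = x" "0 \<odot>\<^bsub>X n\<^esub> x = \<zero>\<^bsub>X n\<^esub>"
    "y \<in> carrier (X n) \<Longrightarrow> x \<oplus>\<^bsub>X n\<^esub> y = y \<oplus>\<^bsub>X n\<^esub> x"
    "y \<in> carrier (X n) \<Longrightarrow> r \<odot>\<^bsub>X n\<^esub> (x \<oplus>\<^bsub>X n\<^esub> y) = r \<odot>\<^bsub>X n\<^esub> x \<oplus>\<^bsub>X n\<^esub> r \<odot>\<^bsub>X n\<^esub> y"
    "y \<in> carrier (X n) \<Longrightarrow> z \<in> carrier (X n) \<Longrightarrow> (x \<oplus>\<^bsub>X n\<^esub> y) \<oplus>\<^bsub>X n\<^esub> z = x \<oplus>\<^bsub>X n\<^esub> (y \<oplus>\<^bsub>X n\<^esub> z)"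
proof -
  interpret lmod "X n" by (rule Ext_lmod)
  show "\<zero>\<^bsub>X n\<^esub> \<oplus>\<^bsub>X n\<^esub> x = x" "(r + s) \<odot>\<^bsub>X n\<^esub> x = r \<odot>\<^bsub>X n\<^esub> x \<oplus>\<^bsub>X n\<^esub> s \<odot>\<^bsub>X n\<^esub> x"
    "(r * s) \<odot>\<^bsub>X n\<^esub> x = r \<odot>\<^bsub>X n\<^esub> (s \<odot>\<^bsub>X n\<^esub> x)" "1 \<odot>\<^bsub>X n\<^esub> x = x" "0 \<odot>\<^bsub>X n\<^esub> x = \<zero>\<^bsub>X n\<^esub>"
    using x by (simp_all add: smult_l_distr smult_assoc1)
  assume y: "y \<in> carrier (X n)"
  show "x \<oplus>\<^bsub>X n\<^esub> y = y \<oplus>\<^bsub>X n\<^esub> x" "r \<odot>\<^bsub>X n\<^esub> (x \<oplus>\<^bsub>X n\<^esub> y) = r \<odot>\<^bsub>X n\<^esub> x \<oplus>\<^bsub>X n\<^esub> r \<odot>\<^bsub>X n\<^esub> y"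
    using x y by (simp_all add: a_comm smult_r_distr)
  assume "z \<in> carrier (X n)"
  then show "(x \<oplus>\<^bsub>X n\<^esub> y) \<oplus>\<^bsub>X n\<^esub> z = x \<oplus>\<^bsub>X n\<^esub> (y \<oplus>\<^bsub>X n\<^esub> z)" using x y by (simp add: a_assoc)
qed

lemma A_lmod: "lmod A"
proof -
  have X0: "\<zero>\<^bsub>X n\<^esub> \<oplus>\<^bsub>X n\<^esub> \<zero>\<^bsub>X n\<^esub> = \<zero>\<^bsub>X n\<^esub>" "c \<odot>\<^bsub>X n\<^esub> \<zero>\<^bsub>X n\<^esub> = \<zero>\<^bsub>X n\<^esub>" for n c
  proof -
    interpret lmod "X n" by (rule Ext_lmod)
    show "\<zero>\<^bsub>X n\<^esub> \<oplus>\<^bsub>X n\<^esub> \<zero>\<^bsub>X n\<^esub> = \<zero>\<^bsub>X n\<^esub>" "c \<odot>\<^bsub>X n\<^esub> \<zero>\<^bsub>X n\<^esub> = \<zero>\<^bsub>X n\<^esub>" by simp_all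
  qed
  have fin_add: "finite {n. u n \<oplus>\<^bsub>X n\<^esub> v n \<noteq> \<zero>\<^bsub>X n\<^esub>}"
    if "finite {n. u n \<noteq> \<zero>\<^bsub>X n\<^esub>}" "finite {n. v n \<noteq> \<zero>\<^bsub>X n\<^esub>}" for u v
    by (rule finite_subset[OF _ finite_UnI[OF that]]) (auto simp: X0)
  have fin_smult: "finite {n. c \<odot>\<^bsub>X n\<^esub> u n \<noteq> \<zero>\<^bsub>X n\<^esub>}" if "finite {n. u n \<noteq> \<zero>\<^bsub>X n\<^esub>}" for u c
  proof (rule finite_subset[OF _ that], rule subsetI)
    fix n assume "n \<in> {n. c \<odot>\<^bsub>X n\<^esub> u n \<noteq> \<zero>\<^bsub>X n\<^esub>}"
    then have "c \<odot>\<^bsub>X n\<^esub> u n \<noteq> \<zero>\<^bsub>X n\<^esub>" by (rule CollectD)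
    then have "u n \<noteq> \<zero>\<^bsub>X n\<^esub>" by (rule contrapos_nn) (simp only: X0)
    then show "n \<in> {n. u n \<noteq> \<zero>\<^bsub>X n\<^esub>}" by (rule CollectI)
  qed
  show ?thesis
  proof (rule lmodI; (unfold A_simps)?)
    show "(\<lambda>n. \<zero>\<^bsub>X n\<^esub>) \<in> {u. (\<forall>n. u n \<in> carrier (X n)) \<and> finite {n. u n \<noteq> \<zero>\<^bsub>X n\<^esub>}}"
      by (simp add: X_closed)
  next
    fix u v w and r s :: 'k
    let ?A = "{u. (\<forall>n. u n \<in> carrier (X n)) \<and> finite {n. u n \<noteq> \<zero>\<^bsub>X n\<^esub>}}"
    assume u: "u \<in> ?A"
    then have cu: "u n \<in> carrier (X n)" for n by simp
    show "(\<lambda>n. r \<odot>\<^bsub>X n\<^esub> u n) \<in> ?A" using u fin_smult by (simp add: X_closed)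
    show "(\<lambda>n. \<zero>\<^bsub>X n\<^esub> \<oplus>\<^bsub>X n\<^esub> u n) = u" "(\<lambda>n. (r + s) \<odot>\<^bsub>X n\<^esub> u n) = (\<lambda>n. r \<odot>\<^bsub>X n\<^esub> u n \<oplus>\<^bsub>X n\<^esub> s \<odot>\<^bsub>X n\<^esub> u n)"
      "(\<lambda>n. (r * s) \<odot>\<^bsub>X n\<^esub> u n) = (\<lambda>n. r \<odot>\<^bsub>X n\<^esub> (s \<odot>\<^bsub>X n\<^esub> u n))" "(\<lambda>n. 1 \<odot>\<^bsub>X n\<^esub> u n) = u"
      "(\<lambda>n. 0 \<odot>\<^bsub>X n\<^esub> u n) = (\<lambda>n. \<zero>\<^bsub>X n\<^esub>)"
      using X_laws[OF cu] by auto
    assume v: "v \<in> ?A"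
    then have cv: "v n \<in> carrier (X n)" for n by simp
    show "(\<lambda>n. u n \<oplus>\<^bsub>X n\<^esub> v n) \<in> ?A" using u v fin_add by (simp add: X_closed)
    show "(\<lambda>n. u n \<oplus>\<^bsub>X n\<^esub> v n) = (\<lambda>n. v n \<oplus>\<^bsub>X n\<^esub> u n)"
      "(\<lambda>n. r \<odot>\<^bsub>X n\<^esub> (u n \<oplus>\<^bsub>X n\<^esub> v n)) = (\<lambda>n. r \<odot>\<^bsub>X n\<^esub> u n \<oplus>\<^bsub>X n\<^esub> r \<odot>\<^bsub>X n\<^esub> v n)"
      using X_laws(6,7)[OF cu cv] by auto
    assume "w \<in> ?A"
    then have "w n \<in> carrier (X n)" for n by simp
    then show "(\<lambda>n. (u n \<oplus>\<^bsub>X n\<^esub> v n) \<oplus>\<^bsub>X n\<^esub> w n) = (\<lambda>n. u n \<oplus>\<^bsub>X n\<^esub> (v n \<oplus>\<^bsub>X n\<^esub> w n))"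
      using X_laws(8)[OF cu cv] by auto
  qed
qed

lemma yp_term:
  assumes "i \<le> n" "u \<in> carrier A" "v \<in> carrier A"
  shows "yp i (n - i) (u i) (v (n - i)) \<in> carrier (X n)"
  using yp_closed[of "u i" i "u i" "v (n - i)" "n - i" "v (n - i)"] assms by (simp add: A_simps)

lemma A_mult_closed:
  assumes u: "u \<in> carrier A" and v: "v \<in> carrier A"
  shows "u \<otimes>\<^bsub>A\<^esub> v \<in> carrier A"
proof -
  have car: "(u \<otimes>\<^bsub>A\<^esub> v) n \<in> carrier (X n)" for n
  proof -
    interpret lmod "X n" by (rule Ext_lmod)
    show ?thesis unfolding A_simps using yp_term[OF _ u v] by (intro finsum_closed) auto
  qed
  \<comment> \<open>The sumset of the two supports, which contains the support of the
    product.\<close>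
  let ?S = "(\<lambda>(i, j). i + j) ` ({n. u n \<noteq> \<zero>\<^bsub>X n\<^esub>} \<times> {n. v n \<noteq> \<zero>\<^bsub>X n\<^esub>})"
  have "finite ?S" using u v by (simp add: A_simps)
  moreover have "{n. (u \<otimes>\<^bsub>A\<^esub> v) n \<noteq> \<zero>\<^bsub>X n\<^esub>} \<subseteq> ?S"
  proof
    fix n assume "n \<in> {n. (u \<otimes>\<^bsub>A\<^esub> v) n \<noteq> \<zero>\<^bsub>X n\<^esub>}"
    then have nz: "(u \<otimes>\<^bsub>A\<^esub> v) n \<noteq> \<zero>\<^bsub>X n\<^esub>" by simp
    interpret lmod "X n" by (rule Ext_lmod)
    have "\<exists>i\<le>n. yp i (n - i) (u i) (v (n - i)) \<noteq> \<zero>\<^bsub>X n\<^esub>"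
    proof (rule ccontr)
      assume "\<not> ?thesis"
      then have "(u \<otimes>\<^bsub>A\<^esub> v) n = (\<Oplus>\<^bsub>X n\<^esub>i\<in>{..n}. \<zero>\<^bsub>X n\<^esub>)" unfolding A_simps by (intro finsum_cong') auto
      then show False using nz by simp
    qed
    then obtain i where i: "i \<le> n" "yp i (n - i) (u i) (v (n - i)) \<noteq> \<zero>\<^bsub>X n\<^esub>" by blast
    have "u i \<in> carrier (X i)" "v (n - i) \<in> carrier (X (n - i))" using u v by (auto simp: A_simps)
    then have "u i \<noteq> \<zero>\<^bsub>X i\<^esub>" "v (n - i) \<noteq> \<zero>\<^bsub>X (n - i)\<^esub>" using yp_null[of "u i" i "v (n - i)" "n - i"] i by auto
    then show "n \<in> ?S" using i(1) by (intro image_eqI[of _ _ "(i, n - i)"]) auto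
  qed
  ultimately have "finite {n. (u \<otimes>\<^bsub>A\<^esub> v) n \<noteq> \<zero>\<^bsub>X n\<^esub>}" by (rule finite_subset[rotated])
  then show ?thesis using car unfolding A_simps(1) by blast
qed

lemma A_one_closed: "\<one>\<^bsub>A\<^esub> \<in> carrier A"
  unfolding A_simps using ext_one_carrier X_closed(3) by (auto intro: finite_subset[of _ "{0}"])

lemma A_bilinear: "bilinear_algebra A"
proof (intro bilinear_algebra.intro bilinear_algebra_axioms.intro)
  show "lmod A" by (rule A_lmod)
  show "\<one>\<^bsub>A\<^esub> \<in> carrier A" by (rule A_one_closed)
  fix u v w and c :: 'k
  assume u: "u \<in> carrier A" and v: "v \<in> carrier A"
  show "u \<otimes>\<^bsub>A\<^esub> v \<in> carrier A" by (rule A_mult_closed[OF u v])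
  have c: "u i \<in> carrier (X i)" "v i \<in> carrier (X i)" for i using u v by (auto simp: A_simps)
  note t = yp_term[OF _ u v]
  show "(c \<odot>\<^bsub>A\<^esub> u) \<otimes>\<^bsub>A\<^esub> v = c \<odot>\<^bsub>A\<^esub> (u \<otimes>\<^bsub>A\<^esub> v)" "u \<otimes>\<^bsub>A\<^esub> (c \<odot>\<^bsub>A\<^esub> v) = c \<odot>\<^bsub>A\<^esub> (u \<otimes>\<^bsub>A\<^esub> v)"
  proof -
    have "((c \<odot>\<^bsub>A\<^esub> u) \<otimes>\<^bsub>A\<^esub> v) n = (c \<odot>\<^bsub>A\<^esub> (u \<otimes>\<^bsub>A\<^esub> v)) n \<and> (u \<otimes>\<^bsub>A\<^esub> (c \<odot>\<^bsub>A\<^esub> v)) n = (c \<odot>\<^bsub>A\<^esub> (u \<otimes>\<^bsub>A\<^esub> v)) n" for n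
    proof -
      interpret lmod "X n" by (rule Ext_lmod)
      have e: "yp i (n - i) (c \<odot>\<^bsub>X i\<^esub> u i) (v (n - i)) = c \<odot>\<^bsub>X n\<^esub> yp i (n - i) (u i) (v (n - i))"
        "yp i (n - i) (u i) (c \<odot>\<^bsub>X (n - i)\<^esub> v (n - i)) = c \<odot>\<^bsub>X n\<^esub> yp i (n - i) (u i) (v (n - i))" if "i \<le> n" for i
        using yp_smult_l[OF c(1) c(1) c(2) c(2), of i "n - i" c] yp_smult_r[OF c(1) c(1) c(2) c(2), of i "n - i" c] that by simp_all
      have "c \<odot>\<^bsub>X n\<^esub> (\<Oplus>\<^bsub>X n\<^esub>i\<in>{..n}. yp i (n - i) (u i) (v (n - i)))
        = (\<Oplus>\<^bsub>X n\<^esub>i\<in>{..n}. c \<odot>\<^bsub>X n\<^esub> yp i (n - i) (u i) (v (n - i)))"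
        by (rule finsum_smult) (use t in auto)
      moreover have "(\<Oplus>\<^bsub>X n\<^esub>i\<in>{..n}. yp i (n - i) (c \<odot>\<^bsub>X i\<^esub> u i) (v (n - i)))
        = (\<Oplus>\<^bsub>X n\<^esub>i\<in>{..n}. c \<odot>\<^bsub>X n\<^esub> yp i (n - i) (u i) (v (n - i)))"
        "(\<Oplus>\<^bsub>X n\<^esub>i\<in>{..n}. yp i (n - i) (u i) (c \<odot>\<^bsub>X (n - i)\<^esub> v (n - i)))
        = (\<Oplus>\<^bsub>X n\<^esub>i\<in>{..n}. c \<odot>\<^bsub>X n\<^esub> yp i (n - i) (u i) (v (n - i)))"
        by (rule finsum_cong'; use e t in auto)+
      ultimately show ?thesis unfolding A_simps by simp
    qed
    then show "(c \<odot>\<^bsub>A\<^esub> u) \<otimes>\<^bsub>A\<^esub> v = c \<odot>\<^bsub>A\<^esub> (u \<otimes>\<^bsub>A\<^esub> v)" "u \<otimes>\<^bsub>A\<^esub> (c \<odot>\<^bsub>A\<^esub> v) = c \<odot>\<^bsub>A\<^esub> (u \<otimes>\<^bsub>A\<^esub> v)"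
      by (auto intro!: ext)
  qed
  assume w: "w \<in> carrier A"
  have cw: "w i \<in> carrier (X i)" for i using w by (auto simp: A_simps)
  have "((u \<oplus>\<^bsub>A\<^esub> v) \<otimes>\<^bsub>A\<^esub> w) n = (u \<otimes>\<^bsub>A\<^esub> w \<oplus>\<^bsub>A\<^esub> v \<otimes>\<^bsub>A\<^esub> w) n \<and>
    (w \<otimes>\<^bsub>A\<^esub> (u \<oplus>\<^bsub>A\<^esub> v)) n = (w \<otimes>\<^bsub>A\<^esub> u \<oplus>\<^bsub>A\<^esub> w \<otimes>\<^bsub>A\<^esub> v) n" for n
  proof -
    interpret lmod "X n" by (rule Ext_lmod)
    have e: "yp i (n - i) (u i \<oplus>\<^bsub>X i\<^esub> v i) (w (n - i)) =
        yp i (n - i) (u i) (w (n - i)) \<oplus>\<^bsub>X n\<^esub> yp i (n - i) (v i) (w (n - i))"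
      "yp i (n - i) (w i) (u (n - i) \<oplus>\<^bsub>X (n - i)\<^esub> v (n - i)) =
        yp i (n - i) (w i) (u (n - i)) \<oplus>\<^bsub>X n\<^esub> yp i (n - i) (w i) (v (n - i))" if "i \<le> n" for i
      using yp_add_l[OF c(1) c(2) cw cw, of i "n - i"] yp_add_r[OF cw cw c(1) c(2), of i "n - i"] that by simp_all
    have s: "(\<Oplus>\<^bsub>X n\<^esub>i\<in>{..n}. f i) \<oplus>\<^bsub>X n\<^esub> (\<Oplus>\<^bsub>X n\<^esub>i\<in>{..n}. g i) = (\<Oplus>\<^bsub>X n\<^esub>i\<in>{..n}. f i \<oplus>\<^bsub>X n\<^esub> g i)"
      if "\<And>i. i \<le> n \<Longrightarrow> f i \<in> carrier (X n)" "\<And>i. i \<le> n \<Longrightarrow> g i \<in> carrier (X n)" for f g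
      using that by (subst finsum_addf) auto
    note tw = yp_term[OF _ u w] yp_term[OF _ v w] yp_term[OF _ w u] yp_term[OF _ w v]
    have s1: "(\<Oplus>\<^bsub>X n\<^esub>i\<in>{..n}. yp i (n - i) (u i) (w (n - i))) \<oplus>\<^bsub>X n\<^esub> (\<Oplus>\<^bsub>X n\<^esub>i\<in>{..n}. yp i (n - i) (v i) (w (n - i)))
      = (\<Oplus>\<^bsub>X n\<^esub>i\<in>{..n}. yp i (n - i) (u i) (w (n - i)) \<oplus>\<^bsub>X n\<^esub> yp i (n - i) (v i) (w (n - i)))"
      "(\<Oplus>\<^bsub>X n\<^esub>i\<in>{..n}. yp i (n - i) (w i) (u (n - i))) \<oplus>\<^bsub>X n\<^esub> (\<Oplus>\<^bsub>X n\<^esub>i\<in>{..n}. yp i (n - i) (w i) (v (n - i)))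
      = (\<Oplus>\<^bsub>X n\<^esub>i\<in>{..n}. yp i (n - i) (w i) (u (n - i)) \<oplus>\<^bsub>X n\<^esub> yp i (n - i) (w i) (v (n - i)))"
      by (rule s; use tw in simp)+
    show ?thesis unfolding A_simps s1
      by (rule conjI; rule finsum_cong'; use e tw in auto)
  qed
  then show "(u \<oplus>\<^bsub>A\<^esub> v) \<otimes>\<^bsub>A\<^esub> w = u \<otimes>\<^bsub>A\<^esub> w \<oplus>\<^bsub>A\<^esub> v \<otimes>\<^bsub>A\<^esub> w"
    "w \<otimes>\<^bsub>A\<^esub> (u \<oplus>\<^bsub>A\<^esub> v) = w \<otimes>\<^bsub>A\<^esub> u \<oplus>\<^bsub>A\<^esub> w \<otimes>\<^bsub>A\<^esub> v"
    by (auto intro!: ext)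
qed


section \<open>The grading of the Yoneda algebra by degree\<close>

abbreviation "EG \<equiv> ext_grading a P"

definition single_degree :: "nat \<Rightarrow> (('x \<Rightarrow>\<^sub>0 'b) \<Rightarrow> 'k) set \<Rightarrow> nat \<Rightarrow> (('x \<Rightarrow>\<^sub>0 'b) \<Rightarrow> 'k) set" where
  "single_degree n x = (\<lambda>m. if m = n then x else \<zero>\<^bsub>X m\<^esub>)"

lemma EG_eq: "EG n = single_degree n ` carrier (X n)"
proof
  show "EG n \<subseteq> single_degree n ` carrier (X n)"
  proof
    fix u assume u: "u \<in> EG n"
    then have "u = single_degree n (u n)"
      by (intro ext) (simp add: ext_grading_def single_degree_def)
    then show "u \<in> single_degree n ` carrier (X n)" using u by (auto simp: ext_grading_def A_simps)
  qed
  show "single_degree n ` carrier (X n) \<subseteq> EG n"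
    using X_closed(3) by (auto simp: ext_grading_def A_simps single_degree_def intro: finite_subset[of _ "{n}"])
qed

lemma EG_carrier: "u \<in> EG n \<Longrightarrow> u \<in> carrier A"
  by (simp add: ext_grading_def)

lemma EG_zero: "u \<in> EG n \<Longrightarrow> m \<noteq> n \<Longrightarrow> u m = \<zero>\<^bsub>X m\<^esub>"
  by (simp add: ext_grading_def)

lemma A_component: "u \<in> carrier A \<Longrightarrow> u n \<in> carrier (X n)"
  by (simp add: A_simps)

lemma component_hom: "(\<lambda>u. u n) \<in> module_hom A (X n)"
  by (rule module_homI) (auto simp: A_simps)

lemma EG_lsub: "lsubmodule (EG n) A"
proof -
  interpret A: lmod A by (rule A_lmod)
  have z: "\<zero>\<^bsub>X m\<^esub> \<oplus>\<^bsub>X m\<^esub> \<zero>\<^bsub>X m\<^esub> = \<zero>\<^bsub>X m\<^esub>" "c \<odot>\<^bsub>X m\<^esub> \<zero>\<^bsub>X m\<^esub> = \<zero>\<^bsub>X m\<^esub>" for m c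
  proof -
    interpret lmod "X m" by (rule Ext_lmod)
    show "\<zero>\<^bsub>X m\<^esub> \<oplus>\<^bsub>X m\<^esub> \<zero>\<^bsub>X m\<^esub> = \<zero>\<^bsub>X m\<^esub>" "c \<odot>\<^bsub>X m\<^esub> \<zero>\<^bsub>X m\<^esub> = \<zero>\<^bsub>X m\<^esub>" by simp_all
  qed
  have add: "u \<oplus>\<^bsub>A\<^esub> v \<in> EG n" if "u \<in> EG n" "v \<in> EG n" for u v
    using that A.a_closed[of u v] by (simp add: ext_grading_def A_simps(5) z)
  have smult: "c \<odot>\<^bsub>A\<^esub> u \<in> EG n" if "u \<in> EG n" for u c
    using that A.smult_closed[of u c] by (simp add: ext_grading_def A_simps(6) z)
  show ?thesis unfolding lsubmodule_def
    using add smult A.zero_closed by (auto simp: ext_grading_def A_simps(4))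
qed

lemma finsum_component:
  assumes J: "finite J" and x: "\<And>i. x i \<in> EG i"
  shows "(\<Oplus>\<^bsub>A\<^esub>i\<in>J. x i) n = (if n \<in> J then x n n else \<zero>\<^bsub>X n\<^esub>)"
proof -
  interpret lmod "X n" by (rule Ext_lmod)
  have c: "x i n \<in> carrier (X n)" for i using x[of i] EG_carrier A_component by blast
  have xA: "x \<in> J \<rightarrow> carrier A" using x EG_carrier by auto
  have "(\<Oplus>\<^bsub>A\<^esub>i\<in>J. x i) n = (\<Oplus>\<^bsub>X n\<^esub>i\<in>J. x i n)"
    by (rule hom_finsum[OF A_lmod Ext_lmod component_hom xA])
  also have "\<dots> = (if n \<in> J then x n n else \<zero>\<^bsub>X n\<^esub>)"
  proof (cases "n \<in> J")
    case True
    have "(\<Oplus>\<^bsub>X n\<^esub>i\<in>J. x i n) = (\<Oplus>\<^bsub>X n\<^esub>i\<in>J. if n = i then x i n else \<zero>\<^bsub>X n\<^esub>)"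
      by (rule finsum_cong') (use c EG_zero[OF x] in auto)
    then show ?thesis using finsum_singleton[OF True J, of "\<lambda>i. x i n"] c True by auto
  next
    case False
    have "(\<Oplus>\<^bsub>X n\<^esub>i\<in>J. x i n) = (\<Oplus>\<^bsub>X n\<^esub>i\<in>J. \<zero>\<^bsub>X n\<^esub>)"
    proof (rule finsum_cong')
      fix i assume "i \<in> J"
      then have "n \<noteq> i" using False by auto
      then show "x i n = \<zero>\<^bsub>X n\<^esub>" using EG_zero[OF x] by simp
    qed auto
    then show ?thesis using False by simp
  qed
  finally show ?thesis .
qed

lemma EG_direct: "internal_direct_sum A EG"
  unfolding internal_direct_sum_def
proof (intro conjI allI ballI)
  show "additive_subgroup (EG i) A" for i by (rule lsub_additive[OF A_lmod EG_lsub])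
  fix v assume v: "v \<in> carrier A"
  let ?R = "\<lambda>x. (\<forall>i. x i \<in> EG i) \<and> finite {i. x i \<noteq> \<zero>\<^bsub>A\<^esub>} \<and> v = (\<Oplus>\<^bsub>A\<^esub>i\<in>{i. x i \<noteq> \<zero>\<^bsub>A\<^esub>}. x i)"
  \<comment> \<open>The \<open>n\<close>-th component of the sum sees only the summand
    \<open>x n\<close>, so \<open>v\<close> determines every summand.\<close>
  have comp: "x n n = v n" if "?R x" for x n
  proof -
    have "v n = (if n \<in> {i. x i \<noteq> \<zero>\<^bsub>A\<^esub>} then x n n else \<zero>\<^bsub>X n\<^esub>)"
      using that finsum_component[of "{i. x i \<noteq> \<zero>\<^bsub>A\<^esub>}" x n] by metis
    then show ?thesis by (auto simp: A_simps(4) split: if_splits)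
  qed
  show "\<exists>!x. ?R x"
  proof (rule ex1I)
    let ?x = "\<lambda>i. single_degree i (v i)"
    have G: "?x i \<in> EG i" for i unfolding EG_eq using A_component[OF v] by blast
    have iff: "?x i = \<zero>\<^bsub>A\<^esub> \<longleftrightarrow> v i = \<zero>\<^bsub>X i\<^esub>" for i
      by (auto simp: A_simps(4) single_degree_def fun_eq_iff)
    have fin: "finite {i. ?x i \<noteq> \<zero>\<^bsub>A\<^esub>}" using v unfolding iff by (simp add: A_simps(1))
    have "v n = (\<Oplus>\<^bsub>A\<^esub>i\<in>{i. ?x i \<noteq> \<zero>\<^bsub>A\<^esub>}. ?x i) n" for n
      unfolding finsum_component[OF fin G] using iff[of n] by (auto simp: single_degree_def)
    then have eq: "v = (\<Oplus>\<^bsub>A\<^esub>i\<in>{i. ?x i \<noteq> \<zero>\<^bsub>A\<^esub>}. ?x i)" by (rule ext)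
    show "?R ?x" by (intro conjI allI G fin eq)
    fix y assume y: "?R y"
    show "y = ?x"
    proof (intro ext)
      fix i m
      show "y i m = ?x i m"
      proof (cases "m = i")
        case True
        then show ?thesis using comp[OF y, of i] by (simp add: single_degree_def)
      next
        case False
        have "y i \<in> EG i" using y by blast
        then show ?thesis using EG_zero[OF _ False] False by (simp add: single_degree_def)
      qed
    qed
  qed
qed

lemma EG_mult:
  assumes u: "u \<in> EG m" and v: "v \<in> EG n"
  shows "u \<otimes>\<^bsub>A\<^esub> v \<in> EG (m + n)"
proof -
  interpret A: bilinear_algebra A by (rule A_bilinear)
  have c: "u \<in> carrier A" "v \<in> carrier A" using u v EG_carrier by auto
  have "(u \<otimes>\<^bsub>A\<^esub> v) k = \<zero>\<^bsub>X k\<^esub>" if k: "k \<noteq> m + n" for k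
  proof -
    interpret lmod "X k" by (rule Ext_lmod)
    have z: "yp i (k - i) (u i) (v (k - i)) = \<zero>\<^bsub>X k\<^esub>" if "i \<le> k" for i
    proof -
      have "i \<noteq> m \<or> k - i \<noteq> n" using k that by auto
      then have "u i = \<zero>\<^bsub>X i\<^esub> \<or> v (k - i) = \<zero>\<^bsub>X (k - i)\<^esub>"
        using EG_zero[OF u, of i] EG_zero[OF v, of "k - i"] by blast
      then show ?thesis
        using yp_null[OF A_component[OF c(1)] A_component[OF c(2)], of i "k - i"] that by (elim disjE) simp_all
    qed
    have "(\<Oplus>\<^bsub>X k\<^esub>i\<in>{..k}. yp i (k - i) (u i) (v (k - i))) = (\<Oplus>\<^bsub>X k\<^esub>i\<in>{..k}. \<zero>\<^bsub>X k\<^esub>)"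
      by (rule finsum_cong') (use z in auto)
    then show ?thesis by (simp add: A_simps(2))
  qed
  then show ?thesis using A.mult_closed[OF c] by (simp add: ext_grading_def)
qed

lemma one_single: "\<one>\<^bsub>A\<^esub> = single_degree 0 (ext_one a P)"
  by (auto simp: A_simps(3) single_degree_def)

lemma smult_single: "c \<odot>\<^bsub>A\<^esub> single_degree n x = single_degree n (c \<odot>\<^bsub>X n\<^esub> x)"
proof -
  have "c \<odot>\<^bsub>X m\<^esub> \<zero>\<^bsub>X m\<^esub> = \<zero>\<^bsub>X m\<^esub>" for m
  proof -
    interpret lmod "X m" by (rule Ext_lmod)
    show ?thesis by simp
  qed
  then show ?thesis by (intro ext) (simp add: A_simps(6) single_degree_def)
qed

lemma EG_connected: "connected_grading A EG"
  unfolding connected_grading_def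
proof (intro conjI allI ballI)
  show "internal_direct_sum A EG" by (rule EG_direct)
  show "c \<odot>\<^bsub>A\<^esub> x \<in> EG n" if "x \<in> EG n" for n c x using lsub_smult[OF A_lmod EG_lsub that] .
  show "x \<otimes>\<^bsub>A\<^esub> y \<in> EG (m + n)" if "x \<in> EG m" "y \<in> EG n" for m n x y by (rule EG_mult[OF that])
  show "\<one>\<^bsub>A\<^esub> \<noteq> \<zero>\<^bsub>A\<^esub>" using ext_one_nonzero by (auto simp: A_simps(3,4) fun_eq_iff)
  show "EG 0 = range (\<lambda>c. c \<odot>\<^bsub>A\<^esub> \<one>\<^bsub>A\<^esub>)"
    unfolding EG_eq one_single smult_single using Ext0_scalar X_closed(2)[OF ext_one_carrier] by blast
qed

section \<open>Finite dimension of the \<open>Ext\<close> spaces\<close>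

lemma yp_lspan:
  assumes U: "U \<subseteq> carrier (X i)" and V: "V \<subseteq> carrier (X j)"
    and u: "u \<in> lspan (X i) U" and v: "v \<in> lspan (X j) V"
  shows "yp i j u v \<in> lspan (X (i + j)) {yp i j x y | x y. x \<in> U \<and> y \<in> V}" (is "_ \<in> ?L")
proof -
  note cU = subsetD[OF lspan_carrier[OF Ext_lmod U]] and cV = subsetD[OF lspan_carrier[OF Ext_lmod V]]
  have 1: "yp i j x v \<in> ?L" if x: "x \<in> U" for x
    using v
  proof (induction rule: lspan.induct)
    case lspan_zero
    then show ?case using yp_null(2)[OF subsetD[OF U x] X_closed(3)] by (simp add: lspan.lspan_zero)
  next
    case (lspan_base y)
    then show ?case using x by (intro lspan.lspan_base) auto
  next
    case (lspan_add y z)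
    then show ?case using yp_add_r[OF subsetD[OF U x] subsetD[OF U x] cV cV, of y z] by (simp add: lspan.lspan_add)
  next
    case (lspan_smult y c)
    then show ?case using yp_smult_r[OF subsetD[OF U x] subsetD[OF U x] cV cV, of y y c] by (simp add: lspan.lspan_smult)
  qed
  show ?thesis using u
  proof (induction rule: lspan.induct)
    case lspan_zero
    then show ?case using yp_null(1)[OF X_closed(3) cV[OF v]] by (simp add: lspan.lspan_zero)
  next
    case (lspan_base x)
    then show ?case by (rule 1)
  next
    case (lspan_add y z)
    then show ?case using yp_add_l[OF cU cU cV[OF v] cV[OF v], of y z] by (simp add: lspan.lspan_add)
  next
    case (lspan_smult y c)
    then show ?case using yp_smult_l[OF cU cU cV[OF v] cV[OF v], of y y c] by (simp add: lspan.lspan_smult)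
  qed
qed

text \<open>Degree \<open>n\<close> of a product is the sum of the products of degrees
  \<open>i\<close> and \<open>n - i\<close>. For \<open>0 < i < n\<close> products of the finite
  spanning sets of lower degree suffice; for \<open>i = 0\<close> and \<open>i = n\<close> one
  factor is a scalar and the induction over generated elements applies.\<close>

lemma generated_component_span:
  assumes S: "finite S" "S \<subseteq> carrier A" and gen: "generated_algebra A S = carrier A"
  shows "\<exists>T. finite T \<and> T \<subseteq> carrier (X n) \<and> (\<forall>u\<in>generated_algebra A S. u n \<in> lspan (X n) T)"
proof (induction n rule: less_induct)
  case (less n)
  interpret lmod "X n" by (rule Ext_lmod)
  have L: "lmod (X n)" by (rule Ext_lmod)
  have "\<forall>i. \<exists>T. i < n \<longrightarrow> finite T \<and> T \<subseteq> carrier (X i) \<and> (\<forall>u\<in>generated_algebra A S. u i \<in> lspan (X i) T)"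
    using less.IH by blast
  then obtain T where T: "\<And>i. i < n \<Longrightarrow> finite (T i)" "\<And>i. i < n \<Longrightarrow> T i \<subseteq> carrier (X i)"
    "\<And>i u. i < n \<Longrightarrow> u \<in> generated_algebra A S \<Longrightarrow> u i \<in> lspan (X i) (T i)"
    by (elim choice[THEN exE]) blast
  define R where "R i = {yp i (n - i) x y | x y. x \<in> T i \<and> y \<in> T (n - i)}" for i
  define U where "U = insert (\<one>\<^bsub>A\<^esub> n) ((\<lambda>s. s n) ` S \<union> (\<Union>i\<in>{0<..<n}. R i))"
  have Rfin: "finite (R i)" if "0 < i" "i < n" for i
  proof -
    have "R i = (\<lambda>(x, y). yp i (n - i) x y) ` (T i \<times> T (n - i))" by (auto simp: R_def)
    then show ?thesis using T(1)[of i] T(1)[of "n - i"] that by simp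
  qed
  have Rcar: "R i \<subseteq> carrier (X n)" if "0 < i" "i < n" for i
  proof -
    have "yp i (n - i) x y \<in> carrier (X n)" if "x \<in> T i" "y \<in> T (n - i)" for x y
      using yp_closed[of x i x y "n - i" y] T(2)[of i] T(2)[of "n - i"] that \<open>0 < i\<close> \<open>i < n\<close> by auto
    then show ?thesis by (auto simp: R_def)
  qed
  have U: "finite U" "U \<subseteq> carrier (X n)"
  proof -
    show "finite U" unfolding U_def using Rfin S by (auto intro!: finite_UN_I)
    have "(\<Union>i\<in>{0<..<n}. R i) \<subseteq> carrier (X n)" by (rule UN_least) (use Rcar in simp)
    moreover have "(\<lambda>s. s n) ` S \<subseteq> carrier (X n)" using S A_component by blast
    ultimately show "U \<subseteq> carrier (X n)" unfolding U_def using A_component[OF A_one_closed] by simp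
  qed
  have "u n \<in> lspan (X n) U" if "u \<in> generated_algebra A S" for u
    using that
  proof (induction rule: generated_algebra.induct)
    case (base s)
    then show ?case by (intro lspan.lspan_base) (simp add: U_def)
  next
    case one
    then show ?case by (intro lspan.lspan_base) (simp add: U_def)
  next
    case (add x y)
    then show ?case by (simp add: A_simps(5) lspan.lspan_add)
  next
    case (smult x c)
    then show ?case by (simp add: A_simps(6) lspan.lspan_smult)
  next
    case (mult x y)
    have xy: "x \<in> carrier A" "y \<in> carrier A" using mult.hyps gen by auto
    have "yp i (n - i) (x i) (y (n - i)) \<in> lspan (X n) U" if i: "i \<le> n" for i
    proof -
      consider "i = 0" | "i = n" | "0 < i" "i < n" using i by linarith
      then show ?thesis
      proof cases
        case 1
        obtain c where "x 0 = c \<odot>\<^bsub>X 0\<^esub> ext_one a P" using Ext0_scalar[OF A_component[OF xy(1)]] by blast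
        then show ?thesis using mult.IH(2) 1 by (simp add: yp_zero_left lspan.lspan_smult)
      next
        case 2
        obtain c where "y 0 = c \<odot>\<^bsub>X 0\<^esub> ext_one a P" using Ext0_scalar[OF A_component[OF xy(2)]] by blast
        then show ?thesis using mult.IH(1) 2 by (simp add: yp_zero_right[OF A_component[OF xy(1)]] lspan.lspan_smult)
      next
        case 3
        have "yp i (n - i) (x i) (y (n - i)) \<in> lspan (X (i + (n - i))) (R i)"
          unfolding R_def by (rule yp_lspan) (use T 3 mult.hyps in auto)
        moreover have "R i \<subseteq> U" using 3 by (auto simp: U_def)
        ultimately show ?thesis using lspan_mono[of "R i" U "X n"] 3 by auto
      qed
    qed
    then show ?case unfolding A_simps(2) by (intro lsub_finsum[OF L lspan_lsub[OF L U(2)]]) auto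
  qed
  then show ?case using U by blast
qed

lemma single_hom: "single_degree n \<in> module_hom (X n) (A\<lparr>carrier := EG n\<rparr>)"
proof (rule module_homI)
  show "single_degree n x \<in> carrier (A\<lparr>carrier := EG n\<rparr>)" if "x \<in> carrier (X n)" for x
    using that by (simp add: EG_eq)
  have "\<zero>\<^bsub>X m\<^esub> \<oplus>\<^bsub>X m\<^esub> \<zero>\<^bsub>X m\<^esub> = \<zero>\<^bsub>X m\<^esub>" for m
  proof -
    interpret lmod "X m" by (rule Ext_lmod)
    show ?thesis by simp
  qed
  then show "single_degree n (x \<oplus>\<^bsub>X n\<^esub> y) = single_degree n x \<oplus>\<^bsub>A\<lparr>carrier := EG n\<rparr>\<^esub> single_degree n y" for x y
    by (intro ext) (simp add: A_simps(5) single_degree_def)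
qed (simp add: smult_single)

theorem Ext_fin_dim:
  assumes gen: "fin_gen_in_degree_one A EG"
  shows "fin_dim (X n)"
proof -
  obtain S where S: "finite S" "S \<subseteq> EG 1" "generated_algebra A S = carrier A"
    using gen by (auto simp: fin_gen_in_degree_one_def)
  have SA: "S \<subseteq> carrier A" using S EG_carrier by auto
  obtain T where T: "finite T" "T \<subseteq> carrier (X n)" "\<And>u. u \<in> carrier A \<Longrightarrow> u n \<in> lspan (X n) T"
    using generated_component_span[OF S(1) SA S(3), of n] S(3) by auto
  have "carrier (X n) \<subseteq> lspan (X n) T"
  proof
    fix x assume "x \<in> carrier (X n)"
    then have "single_degree n x \<in> EG n" by (simp add: EG_eq)
    from T(3)[OF EG_carrier[OF this]] show "x \<in> lspan (X n) T" by (simp add: single_degree_def)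
  qed
  then show ?thesis using fin_dim_spanned[OF Ext_lmod T(1,2)] by simp
qed

text \<open>\<open>single_degree n\<close> and the projection to component \<open>n\<close> are
  surjections in the two directions, one for each inequality.\<close>

lemma EG_vdim:
  assumes fd: "fin_dim (X n)"
  shows "fin_dim (A\<lparr>carrier := EG n\<rparr>) \<and> vdim (A\<lparr>carrier := EG n\<rparr>) = vdim (X n)"
proof -
  have L: "lmod (A\<lparr>carrier := EG n\<rparr>)" by (rule lsub_lmod[OF A_lmod EG_lsub])
  have 1: "fin_dim (A\<lparr>carrier := EG n\<rparr>) \<and> vdim (A\<lparr>carrier := EG n\<rparr>) \<le> vdim (X n)"
    by (rule fin_dim_surj[OF Ext_lmod L single_hom _ fd]) (simp add: EG_eq)
  have h: "(\<lambda>u. u n) \<in> module_hom (A\<lparr>carrier := EG n\<rparr>) (X n)"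
    by (rule module_homI) (auto simp: A_simps(5,6) EG_carrier A_component)
  have "(\<lambda>u. u n) ` EG n = carrier (X n)" by (simp add: EG_eq image_image single_degree_def)
  then have "vdim (X n) \<le> vdim (A\<lparr>carrier := EG n\<rparr>)"
    using fin_dim_surj[OF L Ext_lmod h] 1 by simp
  then show ?thesis using 1 by simp
qed

section \<open>Tensor products with the trivial module\<close>


text \<open>Reduction of coefficients along the augmentation; it underlies the identification of
  \<open>K \<otimes> F n\<close> with \<open>CT n\<close>.\<close>

definition abar :: "('x \<Rightarrow>\<^sub>0 'b) \<Rightarrow> ('x \<Rightarrow>\<^sub>0 'k)" where
  "abar = Poly_Mapping.map a"

text \<open>A section of \<open>abar\<close>, used as a map of sets. Homomorphisms into
  \<open>K\<close> do not distinguish elements with equal \<open>abar\<close>, so evaluating them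
  along \<open>up\<close> is still linear (\<open>hom_up_add\<close>,
  \<open>hom_up_pscale\<close>).\<close>

definition up :: "('x \<Rightarrow>\<^sub>0 'k) \<Rightarrow> ('x \<Rightarrow>\<^sub>0 'b)" where
  "up = Poly_Mapping.map \<iota>"

definition CT :: "nat \<Rightarrow> ('x \<Rightarrow>\<^sub>0 'k) set" where
  "CT n = {v. Poly_Mapping.keys v \<subseteq> res_gens P n}"

lemma lookup_abar: "Poly_Mapping.lookup (abar p) x = a (Poly_Mapping.lookup p x)"
  unfolding abar_def by (rule lookup_map) (rule a_zero)

lemma keys_abar: "Poly_Mapping.keys (abar p) \<subseteq> Poly_Mapping.keys p"
  by (auto simp: in_keys_iff lookup_abar a_zero)

lemma keys_up: "Poly_Mapping.keys (up v) \<subseteq> Poly_Mapping.keys v"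
  by (auto simp: in_keys_iff up_def Poly_Mapping.map.rep_eq)

lemma abar_up [simp]: "abar (up v) = v"
  by (rule poly_mapping_eqI) (simp add: lookup_abar up_def Poly_Mapping.map.rep_eq a_\<iota> when_def a_zero)

lemma F_carrier: "carrier (F n) = {p. Poly_Mapping.keys p \<subseteq> res_gens P n}"
  by (simp add: res_term_def)

lemma abar_CT: "p \<in> carrier (F n) \<Longrightarrow> abar p \<in> CT n"
  using keys_abar[of p] by (auto simp: F_carrier CT_def)

lemma up_F: "v \<in> CT n \<Longrightarrow> up v \<in> carrier (F n)"
  using keys_up[of v] by (auto simp: F_carrier CT_def)

lemma abar_add: "abar (p + q) = abar p + abar q"
  and abar_pscale: "abar (pscale r p) = pscale (a r) (abar p)"
  and abar_zero [simp]: "abar 0 = 0"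
  and abar_single: "abar (Poly_Mapping.single x b) = Poly_Mapping.single x (a b)"
  by (auto intro!: poly_mapping_eqI simp: lookup_abar lookup_add a_add a_mult a_zero lookup_single when_def)

lemma CT_closed:
  "v \<in> CT n \<Longrightarrow> w \<in> CT n \<Longrightarrow> v + w \<in> CT n" "v \<in> CT n \<Longrightarrow> pscale c v \<in> CT n" "0 \<in> CT n"
  "v \<in> CT n \<Longrightarrow> w \<in> CT n \<Longrightarrow> v - w \<in> CT n"
  using keys_add[of v w] keys_pscale[of c v] keys_diff[of v w] by (auto simp: CT_def in_keys_iff lookup_minus)

lemma CT_subspace: "pm.subspace (CT n)"
  by (rule pm.subspaceI) (auto intro: CT_closed)

section \<open>Formal tensors and their relations\<close>

abbreviation "FT n \<equiv> formal_tensors (ground_space :: ('k, 'k) module) (F n)"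
abbreviation "R n \<equiv> tensor_relations (ground_space :: ('k, 'k) module) (\<lambda>c b. c * a b) (F n)"

lemma gs_simps [simp]: "carrier ground_space = UNIV" "x \<oplus>\<^bsub>ground_space\<^esub> y = x + y"
  "c \<odot>\<^bsub>ground_space\<^esub> x = c * x"
  by (simp_all add: ground_space_def module_of_def)

lemma FT_simps: "carrier (FT n) = {z. Poly_Mapping.keys z \<subseteq> UNIV \<times> carrier (F n)}"
  "z \<oplus>\<^bsub>FT n\<^esub> w = z + w" "\<zero>\<^bsub>FT n\<^esub> = 0"
  "c \<odot>\<^bsub>FT n\<^esub> z = frag_extend (\<lambda>(k, m). frag_of (c * k, m)) z"
  by (simp_all add: formal_tensors_def module_of_def)

lemma FT_closed:
  "z \<in> carrier (FT n) \<Longrightarrow> w \<in> carrier (FT n) \<Longrightarrow> z + w \<in> carrier (FT n)"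
  "z \<in> carrier (FT n) \<Longrightarrow> w \<in> carrier (FT n) \<Longrightarrow> z - w \<in> carrier (FT n)"
  "z \<in> carrier (FT n) \<Longrightarrow> - z \<in> carrier (FT n)" "0 \<in> carrier (FT n)"
  "p \<in> carrier (F n) \<Longrightarrow> frag_of (c, p) \<in> carrier (FT n)"
  using keys_add[of z w] keys_diff[of z w] by (auto simp: FT_simps)

lemma FT_sum: "(\<And>i. i \<in> I \<Longrightarrow> f i \<in> carrier (FT n)) \<Longrightarrow> sum f I \<in> carrier (FT n)"
  by (induction I rule: infinite_finite_induct) (auto simp: FT_closed)

lemma FT_group: "group (add_monoid (FT n))"
proof (rule groupI)
  fix z assume "z \<in> carrier (add_monoid (FT n))"
  then show "\<exists>w\<in>carrier (add_monoid (FT n)). w \<otimes>\<^bsub>add_monoid (FT n)\<^esub> z = \<one>\<^bsub>add_monoid (FT n)\<^esub>"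
    using FT_closed(3)[of z n] by (intro bexI[of _ "- z"]) (simp_all add: FT_simps(2,3))
qed (use FT_closed in \<open>auto simp: FT_simps(2,3) add.assoc\<close>)

lemma FT_inv: "z \<in> carrier (FT n) \<Longrightarrow> inv\<^bsub>add_monoid (FT n)\<^esub> z = - z"
  by (rule group.inv_equality[OF FT_group]) (simp_all add: FT_simps(2,3) FT_closed(3))

text \<open>The coordinate form of the map sending \<open>c \<otimes> p\<close> to \<open>c\<close>
  times \<open>abar p\<close>, extended to formal tensors, whose coefficients are integers.\<close>

definition ten :: "('k \<times> ('x \<Rightarrow>\<^sub>0 'b) \<Rightarrow>\<^sub>0 int) \<Rightarrow> ('x \<Rightarrow>\<^sub>0 'k)" where
  "ten z = (\<Sum>u\<in>Poly_Mapping.keys z. pscale (of_int (Poly_Mapping.lookup z u) * fst u) (abar (snd u)))"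

lemma ten_superset:
  assumes "finite S" "Poly_Mapping.keys z \<subseteq> S"
  shows "ten z = (\<Sum>u\<in>S. pscale (of_int (Poly_Mapping.lookup z u) * fst u) (abar (snd u)))"
  unfolding ten_def using assms by (intro sum.mono_neutral_left) (auto simp: in_keys_iff)

lemma ten_diff: "ten (z - w) = ten z - ten w"
proof -
  let ?S = "Poly_Mapping.keys z \<union> Poly_Mapping.keys w"
  have "ten (z - w) = (\<Sum>u\<in>?S. pscale (of_int (Poly_Mapping.lookup (z - w) u) * fst u) (abar (snd u)))"
    by (rule ten_superset) (auto simp: keys_diff)
  also have "\<dots> = (\<Sum>u\<in>?S. pscale (of_int (Poly_Mapping.lookup z u) * fst u) (abar (snd u)) -
      pscale (of_int (Poly_Mapping.lookup w u) * fst u) (abar (snd u)))"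
    by (rule sum.cong) (auto intro!: poly_mapping_eqI simp: lookup_minus algebra_simps)
  also have "\<dots> = ten z - ten w"
    using ten_superset[of ?S z] ten_superset[of ?S w] by (simp add: sum_subtractf)
  finally show ?thesis .
qed

lemma ten_zero [simp]: "ten 0 = 0"
  by (simp add: ten_def)

lemma ten_uminus: "ten (- z) = - ten z"
  using ten_diff[of 0 z] by simp

lemma ten_add: "ten (z + w) = ten z + ten w"
  using ten_diff[of z "- w"] ten_uminus[of w] by simp

lemma ten_frag [simp]: "ten (frag_of (c, p)) = pscale c (abar p)"
  by (simp add: ten_def)

lemma ten_CT: "z \<in> carrier (FT n) \<Longrightarrow> ten z \<in> CT n"
  unfolding ten_def using abar_CT
  by (intro pm.subspace_sum[OF CT_subspace] CT_closed(2)) (auto simp: FT_simps)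

lemma ten_smult: "ten (c \<odot>\<^bsub>FT n\<^esub> z) = pscale c (ten z)"
  using subset_UNIV
proof (induction z rule: frag_induction)
  case (one u)
  then show ?case by (cases u) (simp add: FT_simps)
next
  case (diff z w)
  then show ?case by (simp add: FT_simps frag_extend_diff ten_diff pm.scale_right_diff_distrib)
qed (simp add: FT_simps)

lemma FT_smult_closed: "z \<in> carrier (FT n) \<Longrightarrow> c \<odot>\<^bsub>FT n\<^esub> z \<in> carrier (FT n)"
  using keys_frag_extend[of "\<lambda>(k, m). frag_of (c * k, m)" z] by (fastforce simp: FT_simps)

abbreviation "gen_rels n \<equiv>
  {frag_of (k + k', m) - frag_of (k, m) - frag_of (k', m) | k k' m. m \<in> carrier (F n)} \<union>
  {frag_of (k, m + m') - frag_of (k, m) - frag_of (k, m') | k m m'. m \<in> carrier (F n) \<and> m' \<in> carrier (F n)} \<union>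
  {frag_of (k * a b, m) - frag_of (k, pscale b m) | k b m. m \<in> carrier (F n)}"

lemma R_generate: "R n = generate (add_monoid (FT n)) (gen_rels n)"
  unfolding tensor_relations_def gs_simps F_simps by simp

lemma gen_rels_FT: "gen_rels n \<subseteq> carrier (add_monoid (FT n))"
proof
  fix z assume z: "z \<in> gen_rels n"
  then consider k k' m where "m \<in> carrier (F n)" "z = frag_of (k + k', m) - frag_of (k, m) - frag_of (k', m)"
    | k m m' where "m \<in> carrier (F n)" "m' \<in> carrier (F n)" "z = frag_of (k, m + m') - frag_of (k, m) - frag_of (k, m')"
    | k b m where "m \<in> carrier (F n)" "z = frag_of (k * a b, m) - frag_of (k, pscale b m)"
    by blast
  then have "z \<in> carrier (FT n)"
    by cases (auto intro!: FT_closed(2,5) F_closed(1,2))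
  then show "z \<in> carrier (add_monoid (FT n))" by simp
qed

lemma R_subgroup: "subgroup (R n) (add_monoid (FT n))"
  unfolding R_generate by (rule group.generate_is_subgroup[OF FT_group gen_rels_FT])

lemma R_closed: "z \<in> R n \<Longrightarrow> w \<in> R n \<Longrightarrow> z + w \<in> R n" "z \<in> R n \<Longrightarrow> - z \<in> R n" "0 \<in> R n"
  "z \<in> R n \<Longrightarrow> w \<in> R n \<Longrightarrow> z - w \<in> R n" "z \<in> R n \<Longrightarrow> z \<in> carrier (FT n)"
proof -
  show c: "z \<in> R n \<Longrightarrow> z \<in> carrier (FT n)" for z using subgroup.subset[OF R_subgroup] by auto
  show add: "z \<in> R n \<Longrightarrow> w \<in> R n \<Longrightarrow> z + w \<in> R n" for z w
    using subgroup.m_closed[OF R_subgroup, of z n w] by (simp add: FT_simps)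
  show neg: "z \<in> R n \<Longrightarrow> - z \<in> R n" for z
    using subgroup.m_inv_closed[OF R_subgroup, of z n] FT_inv[OF c] by simp
  show "0 \<in> R n" using subgroup.one_closed[OF R_subgroup, of n] by (simp add: FT_simps)
  show "z \<in> R n \<Longrightarrow> w \<in> R n \<Longrightarrow> z - w \<in> R n" using add[OF _ neg] by fastforce
qed

lemma R_sum: "(\<And>i. i \<in> I \<Longrightarrow> f i \<in> R n) \<Longrightarrow> sum f I \<in> R n"
  by (induction I rule: infinite_finite_induct) (auto simp: R_closed)

lemma R_rel:
  "m \<in> carrier (F n) \<Longrightarrow> frag_of (k + k', m) - frag_of (k, m) - frag_of (k', m) \<in> R n"
  "m \<in> carrier (F n) \<Longrightarrow> m' \<in> carrier (F n) \<Longrightarrow> frag_of (k, m + m') - frag_of (k, m) - frag_of (k, m') \<in> R n"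
  "m \<in> carrier (F n) \<Longrightarrow> frag_of (k * a b, m) - frag_of (k, pscale b m) \<in> R n"
  unfolding R_generate by (rule generate.incl; blast)+

lemma R_ten: "z \<in> R n \<Longrightarrow> ten z = 0"
proof -
  have "subgroup {z \<in> carrier (FT n). ten z = 0} (add_monoid (FT n))"
  proof (rule subgroup.intro)
    fix z assume "z \<in> {z \<in> carrier (FT n). ten z = 0}"
    then show "inv\<^bsub>add_monoid (FT n)\<^esub> z \<in> {z \<in> carrier (FT n). ten z = 0}"
      using FT_inv[of z n] FT_closed(3)[of z n] by (simp only: mem_Collect_eq ten_uminus) simp
  qed (auto simp: FT_closed FT_simps(2,3) ten_add)
  moreover have "gen_rels n \<subseteq> {z \<in> carrier (FT n). ten z = 0}"
  proof
    fix z assume z: "z \<in> gen_rels n"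
    then have "ten z = 0"
      by (auto simp: ten_diff abar_add abar_pscale pm.scale_left_distrib pm.scale_right_distrib)
    then show "z \<in> {z \<in> carrier (FT n). ten z = 0}" using subsetD[OF gen_rels_FT z] by simp
  qed
  ultimately have "R n \<subseteq> {z \<in> carrier (FT n). ten z = 0}"
    unfolding R_generate by (intro group.generate_subgroup_incl[OF FT_group])
  then show "z \<in> R n \<Longrightarrow> ten z = 0" by auto
qed

text \<open>The standard tensors: each coefficient of \<open>v\<close> is paired with its basis
  element. This splits \<open>ten\<close> exactly but is additive only modulo the relations.\<close>

definition sec :: "('x \<Rightarrow>\<^sub>0 'k) \<Rightarrow> ('k \<times> ('x \<Rightarrow>\<^sub>0 'b) \<Rightarrow>\<^sub>0 int)" where
  "sec v = (\<Sum>x\<in>Poly_Mapping.keys v. frag_of (Poly_Mapping.lookup v x, Poly_Mapping.single x 1))"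

lemma e_F: "x \<in> res_gens P n \<Longrightarrow> Poly_Mapping.single x 1 \<in> carrier (F n)"
  by (simp add: F_carrier)

lemma sec_FT: "v \<in> CT n \<Longrightarrow> sec v \<in> carrier (FT n)"
  unfolding sec_def by (rule FT_sum) (auto simp: CT_def intro!: FT_closed(5) e_F)

lemma ten_sum: "ten (sum f I) = (\<Sum>i\<in>I. ten (f i))"
  by (induction I rule: infinite_finite_induct) (auto simp: ten_add)

lemma ten_sec: "ten (sec v) = v"
proof -
  have "ten (sec v) = (\<Sum>x\<in>Poly_Mapping.keys v. Poly_Mapping.single x (Poly_Mapping.lookup v x))"
    by (simp add: sec_def ten_sum abar_single a_one)
  also have "\<dots> = v" by (rule poly_mapping_eqI) (simp add: lookup_sum_single in_keys_iff)
  finally show ?thesis .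
qed

lemma R_zero_left: "m \<in> carrier (F n) \<Longrightarrow> frag_of (0, m) \<in> R n"
  using R_closed(2)[OF R_rel(1)[of m n 0 0]] by simp

lemma R_zero_right: "frag_of (k, 0) \<in> R n"
  using R_closed(2)[OF R_rel(2)[of 0 n 0 k]] F_closed(3) by simp

text \<open>Supports change under addition, and a summand with coefficient 0 is a formal tensor in
  its own right that vanishes only modulo the relations.\<close>

lemma sec_superset:
  assumes S: "finite S" "Poly_Mapping.keys v \<subseteq> S" "S \<subseteq> res_gens P n"
  shows "sec v - (\<Sum>x\<in>S. frag_of (Poly_Mapping.lookup v x, Poly_Mapping.single x 1)) \<in> R n"
proof -
  let ?K = "Poly_Mapping.keys v"
  have "(\<Sum>x\<in>S. frag_of (Poly_Mapping.lookup v x, Poly_Mapping.single x 1)) = sec v +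
    (\<Sum>x\<in>S - ?K. frag_of (Poly_Mapping.lookup v x, Poly_Mapping.single x (1::'b)))"
    using sum.subset_diff[OF S(2,1), of "\<lambda>x. frag_of (Poly_Mapping.lookup v x, Poly_Mapping.single x (1::'b))"]
    by (simp add: sec_def add.commute)
  moreover have "(\<Sum>x\<in>S - ?K. frag_of (Poly_Mapping.lookup v x, Poly_Mapping.single x (1::'b))) \<in> R n"
    by (rule R_sum) (use S in \<open>auto simp: in_keys_iff intro!: R_zero_left e_F\<close>)
  ultimately show ?thesis using R_closed(2) by simp
qed

lemma sec_add:
  assumes v: "v \<in> CT n" and w: "w \<in> CT n"
  shows "sec (v + w) - sec v - sec w \<in> R n"
proof -
  let ?S = "Poly_Mapping.keys v \<union> Poly_Mapping.keys w"
  let ?g = "\<lambda>u. \<Sum>x\<in>?S. frag_of (Poly_Mapping.lookup u x, Poly_Mapping.single x (1::'b))"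
  have S: "finite ?S" "?S \<subseteq> res_gens P n" using v w by (auto simp: CT_def)
  have 1: "sec v - ?g v \<in> R n" "sec w - ?g w \<in> R n" "sec (v + w) - ?g (v + w) \<in> R n"
    using S keys_add[of v w] by (auto intro!: sec_superset)
  have "?g (v + w) - ?g v - ?g w = (\<Sum>x\<in>?S. frag_of (Poly_Mapping.lookup v x + Poly_Mapping.lookup w x, Poly_Mapping.single x 1)
     - frag_of (Poly_Mapping.lookup v x, Poly_Mapping.single x 1) - frag_of (Poly_Mapping.lookup w x, Poly_Mapping.single x 1))"
    by (simp add: lookup_add sum_subtractf)
  moreover have "\<dots> \<in> R n" by (rule R_sum, rule R_rel(1)) (use S e_F in blast)
  ultimately have 2: "?g (v + w) - ?g v - ?g w \<in> R n" by simp
  have "sec (v + w) - sec v - sec w =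
    ((sec (v + w) - ?g (v + w)) + (?g (v + w) - ?g v - ?g w)) - (sec v - ?g v) - (sec w - ?g w)" by simp
  also have "\<dots> \<in> R n" by (intro R_closed(4) R_closed(1) 1 2)
  finally show ?thesis .
qed

text \<open>Additivity in the right factor reduces to monomials, whose coefficient in
  \<open>B\<close> passes to the left factor by the balancing relation.\<close>

lemma frag_sec:
  assumes "p \<in> carrier (F n)"
  shows "frag_of (c, p) - sec (pscale c (abar p)) \<in> R n"
proof -
  have "p \<in> carrier (free_module (res_gens P n))" using assms by (simp add: res_term_def)
  then show ?thesis
  proof (induction rule: free_induct)
    case zero
    then show ?case using R_zero_right by (simp add: sec_def)
  next
    case (single x b)
    have s: "frag_of (c, Poly_Mapping.single x b) - frag_of (c * a b, Poly_Mapping.single x 1) \<in> R n"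
      using R_closed(2)[OF R_rel(3)[OF e_F[OF single], of c b]] by simp
    have "frag_of (c * a b, Poly_Mapping.single x 1) - sec (Poly_Mapping.single x (c * a b)) \<in> R n"
      using R_zero_left[OF e_F[OF single]] R_closed(3) by (auto simp: sec_def)
    from R_closed(1)[OF s this] show ?case by (simp add: abar_single)
  next
    case (add p q)
    have pq: "p \<in> carrier (F n)" "q \<in> carrier (F n)" using add by (simp_all add: res_term_def)
    have 1: "frag_of (c, p + q) - frag_of (c, p) - frag_of (c, q) \<in> R n" by (rule R_rel(2)[OF pq])
    have 2: "sec (pscale c (abar p) + pscale c (abar q)) - sec (pscale c (abar p)) - sec (pscale c (abar q)) \<in> R n"
      by (intro sec_add CT_closed(2) abar_CT pq)
    have "frag_of (c, p + q) - sec (pscale c (abar (p + q))) =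
      (frag_of (c, p + q) - frag_of (c, p) - frag_of (c, q)) + (frag_of (c, p) - sec (pscale c (abar p)))
      + (frag_of (c, q) - sec (pscale c (abar q))) -
      (sec (pscale c (abar p) + pscale c (abar q)) - sec (pscale c (abar p)) - sec (pscale c (abar q)))"
      by (simp add: abar_add pscale_add)
    also have "\<dots> \<in> R n" by (intro R_closed(4) R_closed(1) 1 2 add.IH)
    finally show ?case .
  qed
qed

lemma z_sec:
  assumes z: "z \<in> carrier (FT n)"
  shows "z - sec (ten z) \<in> R n"
proof -
  have "Poly_Mapping.keys z \<subseteq> UNIV \<times> carrier (F n)" using z by (simp add: FT_simps)
  then have "z \<in> carrier (FT n) \<and> z - sec (ten z) \<in> R n"
  proof (induction z rule: frag_induction)
    case zero
    then show ?case using R_closed(3) FT_closed(4) by (simp add: sec_def)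
  next
    case (one u)
    then show ?case using frag_sec FT_closed(5) by (cases u) auto
  next
    case (diff z w)
    have c: "ten (z - w) \<in> CT n" "ten w \<in> CT n" using diff ten_CT FT_closed(2) by blast+
    have 1: "sec (ten (z - w) + ten w) - sec (ten (z - w)) - sec (ten w) \<in> R n" by (rule sec_add[OF c])
    have "(z - w) - sec (ten (z - w)) = (z - sec (ten z)) - (w - sec (ten w))
      + (sec (ten (z - w) + ten w) - sec (ten (z - w)) - sec (ten w))" by (simp add: ten_diff)
    also have "\<dots> \<in> R n" by (intro R_closed(4) R_closed(1) conjunct2[OF diff(1)] conjunct2[OF diff(2)] 1)
    finally show ?case using diff FT_closed(2) by blast
  qed
  then show ?thesis by blast
qed

text \<open>\<open>ten\<close> kills the relations, and every formal tensor is congruent to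
  \<open>sec\<close> of its image, so the relations are the whole kernel. From here on identities in
  the tensor product are identities of coordinates.\<close>

lemma R_eq: "R n = {z \<in> carrier (FT n). ten z = 0}"
proof -
  have "z \<in> R n" if "z \<in> carrier (FT n)" "ten z = 0" for z
    using z_sec[OF that(1)] that(2) by (simp add: sec_def)
  then show ?thesis using R_ten R_closed(5) by blast
qed

text \<open>The elements of the tensor product \<open>K \<otimes>\<^sub>B F n\<close> are the fibres of \<^term>\<open>ten\<close>.\<close>

definition fib :: "nat \<Rightarrow> ('x \<Rightarrow>\<^sub>0 'k) \<Rightarrow> ('k \<times> ('x \<Rightarrow>\<^sub>0 'b) \<Rightarrow>\<^sub>0 int) set" where
  "fib n v = {z \<in> carrier (FT n). ten z = v}"

abbreviation "TC \<equiv> tensor_chains a P"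

lemma fib_sec: "v \<in> CT n \<Longrightarrow> sec v \<in> fib n v"
  by (simp add: fib_def sec_FT ten_sec)

lemma R_coset: "z \<in> carrier (FT n) \<Longrightarrow> R n +>\<^bsub>FT n\<^esub> z = fib n (ten z)"
proof
  assume z: "z \<in> carrier (FT n)"
  show "R n +>\<^bsub>FT n\<^esub> z \<subseteq> fib n (ten z)"
    using z by (auto simp: a_r_coset_def' fib_def R_eq FT_simps(2) ten_add FT_closed)
  show "fib n (ten z) \<subseteq> R n +>\<^bsub>FT n\<^esub> z"
  proof
    fix w assume "w \<in> fib n (ten z)"
    then have "w - z \<in> R n" using z by (auto simp: R_eq fib_def ten_diff FT_closed)
    then show "w \<in> R n +>\<^bsub>FT n\<^esub> z" unfolding a_r_coset_def' FT_simps(2) by force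
  qed
qed

lemma TC_carrier: "carrier (TC n) = fib n ` CT n"
proof -
  have "carrier (TC n) = (\<lambda>z. R n +>\<^bsub>FT n\<^esub> z) ` carrier (FT n)"
    by (auto simp: tensor_chains_def tensor_product_def quotient_module_def module_of_def A_RCOSETS_def')
  also have "\<dots> = (\<lambda>z. fib n (ten z)) ` carrier (FT n)" by (rule image_cong) (auto simp: R_coset)
  also have "\<dots> = fib n ` CT n"
  proof -
    have "ten ` carrier (FT n) = CT n"
    proof
      show "CT n \<subseteq> ten ` carrier (FT n)"
        using sec_FT ten_sec by (metis image_eqI subsetI)
    qed (use ten_CT in auto)
    then show ?thesis by (metis image_image)
  qed
  finally show ?thesis .
qed

lemma TC_zero: "\<zero>\<^bsub>TC n\<^esub> = fib n 0"
  by (simp add: tensor_chains_def tensor_product_def quotient_module_def module_of_def R_eq fib_def)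

lemma TC_add:
  assumes v: "v \<in> CT n" and w: "w \<in> CT n"
  shows "fib n v \<oplus>\<^bsub>TC n\<^esub> fib n w = fib n (v + w)"
proof -
  have "fib n v \<oplus>\<^bsub>TC n\<^esub> fib n w = (\<Union>y\<in>fib n v. \<Union>z\<in>fib n w. {y + z})"
    by (simp add: tensor_chains_def tensor_product_def quotient_module_def module_of_def set_add_def' FT_simps(2))
  also have "\<dots> = fib n (v + w)"
  proof
    show "(\<Union>y\<in>fib n v. \<Union>z\<in>fib n w. {y + z}) \<subseteq> fib n (v + w)" by (auto simp: fib_def FT_closed ten_add)
    show "fib n (v + w) \<subseteq> (\<Union>y\<in>fib n v. \<Union>z\<in>fib n w. {y + z})"
    proof
      fix y assume "y \<in> fib n (v + w)"
      then have "y - sec w \<in> fib n v" using sec_FT[OF w] by (auto simp: fib_def FT_closed ten_diff ten_sec)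
      moreover have "y = (y - sec w) + sec w" by simp
      ultimately show "y \<in> (\<Union>y\<in>fib n v. \<Union>z\<in>fib n w. {y + z})" using fib_sec[OF w] by blast
    qed
  qed
  finally show ?thesis .
qed

lemma TC_smult:
  assumes v: "v \<in> CT n"
  shows "c \<odot>\<^bsub>TC n\<^esub> fib n v = fib n (pscale c v)"
proof -
  have "R n +>\<^bsub>FT n\<^esub> (c \<odot>\<^bsub>FT n\<^esub> z) = fib n (pscale c v)" if "z \<in> fib n v" for z
    using that by (simp add: fib_def R_coset FT_smult_closed ten_smult)
  then have "(\<Union>z\<in>fib n v. R n +>\<^bsub>FT n\<^esub> (c \<odot>\<^bsub>FT n\<^esub> z)) = fib n (pscale c v)"
    using fib_sec[OF v] by blast
  then show ?thesis
    by (simp add: tensor_chains_def tensor_product_def quotient_module_def module_of_def)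
qed

lemma TC_lmod: "lmod (TC n)"
  by (rule lmodI; (unfold TC_carrier TC_zero)?)
    (auto simp: TC_add TC_smult CT_closed pm.scale_right_distrib pm.scale_left_distrib ac_simps)

lemma fib_inj: "v \<in> CT n \<Longrightarrow> fib n v = fib n w \<Longrightarrow> v = w"
proof -
  assume "v \<in> CT n" "fib n v = fib n w"
  then have "sec v \<in> fib n w" using fib_sec by blast
  then show "v = w" by (simp add: fib_def ten_sec)
qed

text \<open>\<open>ten\<close> is constant on each fibre, so an arbitrary element of it yields the
  coordinates.\<close>

definition val :: "('k \<times> ('x \<Rightarrow>\<^sub>0 'b) \<Rightarrow>\<^sub>0 int) set \<Rightarrow> ('x \<Rightarrow>\<^sub>0 'k)" where
  "val t = ten (SOME z. z \<in> t)"

lemma val_fib [simp]: "v \<in> CT n \<Longrightarrow> val (fib n v) = v"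
proof -
  assume "v \<in> CT n"
  then have "(SOME z. z \<in> fib n v) \<in> fib n v" using fib_sec by (metis someI_ex)
  then show ?thesis by (simp add: val_def fib_def)
qed

lemma TC_cases: "t \<in> carrier (TC n) \<Longrightarrow> \<exists>v\<in>CT n. t = fib n v \<and> val t = v"
  by (auto simp: TC_carrier)

section \<open>The differential of the tensor complex in coordinates\<close>

definition dbar :: "nat \<Rightarrow> ('x \<Rightarrow>\<^sub>0 'k) \<Rightarrow> ('x \<Rightarrow>\<^sub>0 'k)" where
  "dbar n v = (\<Sum>x\<in>Poly_Mapping.keys v. pscale (Poly_Mapping.lookup v x) (abar (d n (Poly_Mapping.single x 1))))"

lemma dbar_superset:
  assumes "finite S" "Poly_Mapping.keys v \<subseteq> S"
  shows "dbar n v = (\<Sum>x\<in>S. pscale (Poly_Mapping.lookup v x) (abar (d n (Poly_Mapping.single x 1))))"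
  unfolding dbar_def using assms by (intro sum.mono_neutral_left) (auto simp: in_keys_iff)

lemma dbar_add: "dbar n (v + w) = dbar n v + dbar n w"
proof -
  let ?S = "Poly_Mapping.keys v \<union> Poly_Mapping.keys w"
  have S: "finite ?S" by simp
  show ?thesis
    unfolding dbar_superset[OF S keys_add] dbar_superset[OF S Un_upper1] dbar_superset[OF S Un_upper2]
    by (simp add: lookup_add pm.scale_left_distrib sum.distrib)
qed

lemma dbar_pscale: "dbar n (pscale c v) = pscale c (dbar n v)"
  unfolding dbar_superset[OF finite_keys keys_pscale]
  by (simp add: dbar_def pm.scale_sum_right)

lemma dbar_linear: "Vector_Spaces.linear pscale pscale (dbar n)"
  by (simp add: Vector_Spaces.linear_iff pm.vector_space_axioms dbar_add dbar_pscale)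

text \<open>\<open>B\<close> acts on \<open>K\<close> through \<open>a\<close>, so a homomorphism
  into \<open>K\<close> sees coefficients only through \<open>a\<close>. This is the factorisation
  of cochains through \<open>abar\<close>.\<close>

lemma hom_expand:
  assumes h: "h \<in> module_hom (F n) T" and p: "p \<in> carrier (F n)"
    and S: "finite S" "Poly_Mapping.keys p \<subseteq> S"
  shows "h p = (\<Sum>x\<in>S. a (Poly_Mapping.lookup p x) * h (Poly_Mapping.single x 1))"
proof -
  have "(\<Sum>x\<in>Y. Poly_Mapping.single x (Poly_Mapping.lookup p x)) \<in> carrier (F n) \<and>
    h (\<Sum>x\<in>Y. Poly_Mapping.single x (Poly_Mapping.lookup p x)) =
      (\<Sum>x\<in>Y. a (Poly_Mapping.lookup p x) * h (Poly_Mapping.single x 1))"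
    if "finite Y" "Y \<subseteq> res_gens P n" for Y
    using that
  proof (induction Y rule: finite_induct)
    case empty
    then show ?case using hom_zero[OF F_lmod T_lmod h] F_closed(3) by (simp add: F_simps)
  next
    case (insert x Y)
    let ?s = "Poly_Mapping.single x (Poly_Mapping.lookup p x)"
    let ?r = "\<Sum>x\<in>Y. Poly_Mapping.single x (Poly_Mapping.lookup p x)"
    have s: "?s \<in> carrier (F n)" using insert.prems by (simp add: F_carrier)
    have "h ?s = a (Poly_Mapping.lookup p x) * h (Poly_Mapping.single x 1)"
      using hom_smult[OF h e_F, of x "Poly_Mapping.lookup p x"] insert.prems by (simp add: F_simps)
    then show ?case using insert F_closed(1)[OF s] hom_add[OF h s, of ?r] by (simp add: F_simps)
  qed
  from this[OF finite_keys[of p]] have "h (\<Sum>x\<in>Poly_Mapping.keys p. Poly_Mapping.single x (Poly_Mapping.lookup p x)) =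
      (\<Sum>x\<in>Poly_Mapping.keys p. a (Poly_Mapping.lookup p x) * h (Poly_Mapping.single x 1))"
    using p by (simp add: F_carrier)
  moreover have "(\<Sum>x\<in>Poly_Mapping.keys p. Poly_Mapping.single x (Poly_Mapping.lookup p x)) = p"
    by (rule poly_mapping_eqI) (simp add: lookup_sum_single in_keys_iff)
  moreover have "(\<Sum>x\<in>Poly_Mapping.keys p. a (Poly_Mapping.lookup p x) * h (Poly_Mapping.single x 1)) =
    (\<Sum>x\<in>S. a (Poly_Mapping.lookup p x) * h (Poly_Mapping.single x 1))"
    using S by (intro sum.mono_neutral_left) (auto simp: in_keys_iff a_zero)
  ultimately show ?thesis by simp
qed

lemma hom_abar_eq:
  assumes h: "h \<in> module_hom (F n) T" and p: "p \<in> carrier (F n)" and q: "q \<in> carrier (F n)" and eq: "abar p = abar q"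
  shows "h p = h q"
proof -
  let ?S = "Poly_Mapping.keys p \<union> Poly_Mapping.keys q"
  have "a (Poly_Mapping.lookup p x) = a (Poly_Mapping.lookup q x)" for x
    using eq by (metis lookup_abar)
  then show ?thesis using hom_expand[OF h p, of ?S] hom_expand[OF h q, of ?S] by simp
qed

text \<open>Each coordinate of \<open>abar (d n p)\<close> is a homomorphism into \<open>K\<close>
  as a function of \<open>p\<close>, so \<open>hom_expand\<close> computes it from the augmented
  coefficients.\<close>

lemma abar_d:
  assumes p: "p \<in> carrier (F (Suc n))"
  shows "abar (d n p) = dbar n (abar p)"
proof (rule poly_mapping_eqI)
  fix y
  let ?h = "\<lambda>p. a (Poly_Mapping.lookup (d n p) y)"
  have h: "?h \<in> module_hom (F (Suc n)) T"
    by (rule module_homI)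
      (auto simp: F_simps hom_add[OF d_hom, unfolded F_simps] hom_smult[OF d_hom, unfolded F_simps] lookup_add a_add a_mult)
  show "Poly_Mapping.lookup (abar (d n p)) y = Poly_Mapping.lookup (dbar n (abar p)) y"
    using hom_expand[OF h p finite_keys subset_refl]
    unfolding dbar_superset[OF finite_keys keys_abar] by (simp add: lookup_sum lookup_abar)
qed

lemma dbar_CT: "v \<in> CT (Suc n) \<Longrightarrow> dbar n v \<in> CT n"
  using abar_d[OF up_F] abar_CT[OF d_carrier[OF up_F]] by (metis abar_up)

lemma dbar_dbar: "v \<in> CT (Suc (Suc n)) \<Longrightarrow> dbar n (dbar (Suc n) v) = 0"
  using abar_d[OF up_F, of v "Suc n"] abar_d[OF d_carrier[OF up_F], of v n] dd[OF up_F, of v n] by simp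

lemma tensor_diff_fib:
  assumes v: "v \<in> CT (Suc n)"
  shows "tensor_diff a P n (fib (Suc n) v) = fib n (dbar n v)"
proof -
  let ?g = "frag_extend (\<lambda>(k, m). frag_of (k, d n m)) :: _ \<Rightarrow> ('k \<times> ('x \<Rightarrow>\<^sub>0 'b) \<Rightarrow>\<^sub>0 int)"
  have g: "?g z \<in> carrier (FT n) \<and> ten (?g z) = dbar n (ten z)" if z: "z \<in> carrier (FT (Suc n))" for z
  proof -
    have "Poly_Mapping.keys z \<subseteq> UNIV \<times> carrier (F (Suc n))" using z by (simp add: FT_simps)
    then show ?thesis
    proof (induction z rule: frag_induction)
      case zero
      then show ?case using FT_closed(4) by (simp add: dbar_def)
    next
      case (one u)
      then show ?case using abar_d d_carrier FT_closed(5) by (cases u) (auto simp: dbar_pscale)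
    next
      case (diff z w)
      have "dbar n (ten z - ten w) = dbar n (ten z) - dbar n (ten w)"
        using dbar_add[of n "ten z - ten w" "ten w"] by simp
      then show ?case using diff FT_closed(2) by (simp add: frag_extend_diff ten_diff)
    qed
  qed
  have "R n +>\<^bsub>FT n\<^esub> ?g z = fib n (dbar n v)" if "z \<in> fib (Suc n) v" for z
    using that g[of z] by (simp add: fib_def R_coset)
  then have "(\<Union>z\<in>fib (Suc n) v. R n +>\<^bsub>FT n\<^esub> ?g z) = fib n (dbar n v)" using fib_sec[OF v] by blast
  then show ?thesis by (simp add: tensor_diff_def tensor_map_def)
qed

section \<open>Duality of Ext and Tor\<close>


text \<open>For \<open>n = 0\<close> the condition is void, matching the convention for
  \<open>Tor\<close> in degree 0.\<close>

definition cyc :: "nat \<Rightarrow> ('x \<Rightarrow>\<^sub>0 'k) set" where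
  "cyc n = {v \<in> CT n. \<forall>m. n = Suc m \<longrightarrow> dbar m v = 0}"

abbreviation "Num n \<equiv> (case n of 0 \<Rightarrow> carrier (TC 0)
   | Suc m \<Rightarrow> a_kernel (TC n) (TC m) (tensor_diff a P m))"

abbreviation "Bd n \<equiv> tensor_diff a P n ` carrier (TC (Suc n))"

lemma Num_eq: "Num n = fib n ` cyc n"
proof (cases n)
  case 0
  then show ?thesis by (simp add: cyc_def TC_carrier)
next
  case (Suc m)
  have "t \<in> a_kernel (TC (Suc m)) (TC m) (tensor_diff a P m) \<longleftrightarrow> t \<in> fib (Suc m) ` cyc (Suc m)" for t
  proof (cases "t \<in> carrier (TC (Suc m))")
    case True
    then obtain v where v: "v \<in> CT (Suc m)" "t = fib (Suc m) v" using TC_cases by blast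
    have "t \<in> fib (Suc m) ` cyc (Suc m) \<longleftrightarrow> dbar m v = 0"
      using v fib_inj[of v "Suc m"] by (auto simp: cyc_def)
    moreover have "fib m (dbar m v) = fib m 0 \<longleftrightarrow> dbar m v = 0" using fib_inj[OF dbar_CT[OF v(1)]] by auto
    ultimately show ?thesis using True v by (simp add: a_kernel_eq TC_zero tensor_diff_fib)
  next
    case False
    then show ?thesis by (auto simp: a_kernel_eq TC_carrier cyc_def)
  qed
  then show ?thesis using Suc by auto
qed

lemma Bd_eq: "Bd n = fib n ` dbar n ` CT (Suc n)"
  unfolding TC_carrier image_image by (rule image_cong) (simp_all add: tensor_diff_fib)

lemma cyc_CT: "v \<in> cyc n \<Longrightarrow> v \<in> CT n"
  by (simp add: cyc_def)

lemma dbar_zero: "dbar m 0 = 0"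
  by (simp add: dbar_def)

lemma cyc_closed: "v \<in> cyc n \<Longrightarrow> w \<in> cyc n \<Longrightarrow> v + w \<in> cyc n" "v \<in> cyc n \<Longrightarrow> pscale c v \<in> cyc n" "0 \<in> cyc n"
  by (auto simp: cyc_def CT_closed dbar_add dbar_pscale dbar_zero)

lemma boundary_cyc: "v \<in> CT (Suc n) \<Longrightarrow> dbar n v \<in> cyc n"
  using dbar_dbar by (auto simp: cyc_def dbar_CT)

abbreviation "NM n \<equiv> (TC n)\<lparr>carrier := Num n\<rparr>"

lemma Num_lsub: "lsubmodule (Num n) (TC n)"
  unfolding lsubmodule_def Num_eq unfolding TC_carrier TC_zero
  by (auto simp: cyc_CT TC_add TC_smult cyc_closed)

lemma NM_lmod: "lmod (NM n)"
  by (rule lsub_lmod[OF TC_lmod Num_lsub])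

lemma Bd_lsub: "lsubmodule (Bd n) (NM n)"
proof -
  have "fib n 0 \<in> fib n ` dbar n ` CT (Suc n)" using CT_closed(3) dbar_zero by (metis imageI)
  moreover have "fib n v \<oplus>\<^bsub>TC n\<^esub> fib n w \<in> fib n ` dbar n ` CT (Suc n)"
    if "v \<in> dbar n ` CT (Suc n)" "w \<in> dbar n ` CT (Suc n)" for v w
  proof -
    obtain v' w' where "v' \<in> CT (Suc n)" "w' \<in> CT (Suc n)" "v = dbar n v'" "w = dbar n w'" using \<open>v \<in> _\<close> \<open>w \<in> _\<close> by blast
    then show ?thesis using TC_add[OF dbar_CT dbar_CT, of v' n w'] CT_closed(1)[of v' "Suc n" w'] by (auto simp flip: dbar_add)
  qed
  moreover have "c \<odot>\<^bsub>TC n\<^esub> fib n v \<in> fib n ` dbar n ` CT (Suc n)" if "v \<in> dbar n ` CT (Suc n)" for v c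
  proof -
    obtain v' where "v' \<in> CT (Suc n)" "v = dbar n v'" using \<open>v \<in> _\<close> by blast
    then show ?thesis using TC_smult[OF dbar_CT, of v' n c] CT_closed(2)[of v' "Suc n" c] by (auto simp flip: dbar_pscale)
  qed
  ultimately show ?thesis unfolding lsubmodule_def Bd_eq Num_eq
    using boundary_cyc[of _ n] by (auto simp: TC_zero)
qed

text \<open>Evaluation of a cochain on \<open>K \<otimes> F n\<close>: the cochain factors through
  \<open>abar\<close>, so any preimage of the coordinates can be inserted.\<close>

definition pairing :: "(('x \<Rightarrow>\<^sub>0 'b) \<Rightarrow> 'k) \<Rightarrow> ('k \<times> ('x \<Rightarrow>\<^sub>0 'b) \<Rightarrow>\<^sub>0 int) set \<Rightarrow> 'k" where
  "pairing f t = f (up (val t))"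

lemma hom_up_add:
  assumes f: "f \<in> module_hom (F n) T" and v: "v \<in> CT n" and w: "w \<in> CT n"
  shows "f (up (v + w)) = f (up v) + f (up w)"
proof -
  have "f (up (v + w)) = f (up v + up w)"
    by (rule hom_abar_eq[OF f]) (use v w CT_closed up_F F_closed(1) in \<open>auto simp: abar_add\<close>)
  then show ?thesis using hom_add[OF f up_F[OF v] up_F[OF w]] by (simp add: F_simps)
qed

lemma hom_up_pscale:
  assumes f: "f \<in> module_hom (F n) T" and v: "v \<in> CT n"
  shows "f (up (pscale c v)) = c * f (up v)"
proof -
  have "f (up (pscale c v)) = f (pscale (\<iota> c) (up v))"
    by (rule hom_abar_eq[OF f]) (use v CT_closed up_F F_closed(2) in \<open>auto simp: abar_pscale a_\<iota>\<close>)
  then show ?thesis using hom_smult[OF f up_F[OF v], of "\<iota> c"] by (simp add: F_simps a_\<iota>)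
qed

lemma hom_up_abar: "f \<in> module_hom (F n) T \<Longrightarrow> p \<in> carrier (F n) \<Longrightarrow> f (up (abar p)) = f p"
  by (rule hom_abar_eq) (auto simp: abar_CT up_F)

lemma pairing_fib: "v \<in> CT n \<Longrightarrow> pairing f (fib n v) = f (up v)"
  by (simp add: pairing_def)

lemma pairing_bilinear: "bilinear_pairing (Z n) (NM n) pairing"
proof (intro bilinear_pairing.intro bilinear_pairing_axioms.intro Z_lmod NM_lmod)
  fix f g t u and c :: 'k
  assume "f \<in> carrier (Z n)"
  then have f: "f \<in> module_hom (F n) T" by (simp add: cocycle_hom)
  assume "t \<in> carrier (NM n)"
  then have "t \<in> fib n ` cyc n" by (simp add: Num_eq)
  then obtain v where v: "v \<in> CT n" "t = fib n v" using cyc_CT by blast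
  show "pairing (c \<odot>\<^bsub>Z n\<^esub> f) t = c * pairing f t" using v up_F[OF v(1)] by (simp add: pairing_fib C_simps)
  show "pairing f (c \<odot>\<^bsub>NM n\<^esub> t) = c * pairing f t"
    using v by (simp add: TC_smult pairing_fib CT_closed hom_up_pscale[OF f])
  show "pairing (f \<oplus>\<^bsub>Z n\<^esub> g) t = pairing f t + pairing g t" using v up_F[OF v(1)] by (simp add: pairing_fib C_simps)
  assume "u \<in> carrier (NM n)"
  then have "u \<in> fib n ` cyc n" by (simp add: Num_eq)
  then obtain w where w: "w \<in> CT n" "u = fib n w" using cyc_CT by blast
  show "pairing f (t \<oplus>\<^bsub>NM n\<^esub> u) = pairing f t + pairing f u"
    using v w by (simp add: TC_add pairing_fib CT_closed hom_up_add[OF f])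
qed

text \<open>A cocycle vanishing on all cycles factors through the reduced differential; a linear
  splitting of that differential turns the factorisation into a homomorphism on the preceding term.
  In degree 0 everything is a cycle and only the zero cochain is a coboundary.\<close>

lemma left_radical: "coboundaries a P n = {f \<in> carrier (Z n). \<forall>t\<in>carrier (NM n). pairing f t = 0}"
proof -
  have "f \<in> coboundaries a P n \<longleftrightarrow> (\<forall>v\<in>cyc n. f (up v) = 0)" if f: "f \<in> cocycles a P n" for f
  proof (cases n)
    case 0
    have fh: "f \<in> module_hom (F n) T" by (rule cocycle_hom[OF f])
    have "f \<in> coboundaries a P 0 \<longleftrightarrow> (\<forall>p\<in>carrier (F 0). f p = 0)"
      using cocycle_C[OF f] 0 by (auto simp: coboundaries_def C_simps extensional_def fun_eq_iff)
    also have "\<dots> \<longleftrightarrow> (\<forall>v\<in>cyc 0. f (up v) = 0)"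
      using hom_up_abar[OF fh] abar_CT up_F 0 by (fastforce simp: cyc_def)
    finally show ?thesis using 0 by simp
  next
    case (Suc m)
    have fh: "f \<in> module_hom (F (Suc m)) T" using cocycle_hom[OF f] Suc by simp
    show ?thesis
    proof
      assume "f \<in> coboundaries a P n"
      then have "\<exists>s\<in>module_hom (F m) T. \<forall>p\<in>carrier (F (Suc m)). f p = s (d m p)"
        using Suc coboundaries_Suc by simp
      then obtain s where s: "s \<in> module_hom (F m) T" "\<forall>p\<in>carrier (F (Suc m)). f p = s (d m p)" ..
      show "\<forall>v\<in>cyc n. f (up v) = 0"
      proof
        fix v assume "v \<in> cyc n"
        then have v: "v \<in> CT (Suc m)" "dbar m v = 0" using Suc by (auto simp: cyc_def)
        have du: "d m (up v) \<in> carrier (F m)" by (rule d_carrier[OF up_F[OF v(1)]])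
        have "f (up v) = s (d m (up v))" using s(2) up_F[OF v(1)] by blast
        also have "\<dots> = s 0"
          by (rule hom_abar_eq[OF s(1) du F_closed(3)]) (simp add: abar_d[OF up_F[OF v(1)]] v(2))
        also have "\<dots> = 0" using hom_zero[OF F_lmod T_lmod s(1)] by (simp add: F_simps)
        finally show "f (up v) = 0" .
      qed
    next
      assume z: "\<forall>v\<in>cyc n. f (up v) = 0"
      interpret vector_space_pair "pscale :: 'k \<Rightarrow> ('x \<Rightarrow>\<^sub>0 'k) \<Rightarrow> _" "pscale :: 'k \<Rightarrow> ('x \<Rightarrow>\<^sub>0 'k) \<Rightarrow> _"
        by (rule vector_space_pair.intro) (rule pm.vector_space_axioms)+
      \<comment> \<open>\<open>g\<close> is linear on all coordinate vectors, so \<open>s\<close> is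
        a homomorphism on the whole of \<open>F m\<close> and not only on boundaries.\<close>
      obtain g where g: "g ` UNIV \<subseteq> CT (Suc m)" "Vector_Spaces.linear pscale pscale g"
        "\<forall>v\<in>dbar m ` CT (Suc m). dbar m (g v) = v"
        using linear_exists_right_inverse_on[OF dbar_linear CT_subspace[of "Suc m"], of m] by blast
      have gC: "g v \<in> CT (Suc m)" for v using g(1) by blast
      have g_add: "g (v + w) = g v + g w" and g_scale: "g (pscale c v) = pscale c (g v)" for v w c
        using g(2) by (auto simp: Vector_Spaces.linear_iff)
      define s where "s p = f (up (g (abar p)))" for p
      have "s \<in> module_hom (F m) T"
        by (rule module_homI) (auto simp: s_def F_simps abar_add abar_pscale g_add g_scale hom_up_add[OF fh]
          hom_up_pscale[OF fh] gC)
      moreover have "f p = s (d m p)" if p: "p \<in> carrier (F (Suc m))" for p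
      proof -
        let ?u = "abar p" and ?w = "g (abar (d m p))"
        have u: "?u \<in> CT (Suc m)" by (rule abar_CT[OF p])
        \<comment> \<open>\<open>?u\<close> and \<open>?w\<close> have the same boundary, so their
          difference is a cycle, where \<open>f\<close> vanishes.\<close>
        have dw: "dbar m ?w = dbar m ?u" using g(3) u unfolding abar_d[OF p] by blast
        have "dbar m (?u - ?w) = 0" using dbar_add[of m "?u - ?w" ?w] dw by simp
        then have "?u - ?w \<in> cyc n" using Suc CT_closed(4)[OF u gC] by (simp add: cyc_def)
        then have "f (up (?u - ?w)) = 0" using z by blast
        moreover have "f (up ((?u - ?w) + ?w)) = f (up (?u - ?w)) + f (up ?w)"
          by (rule hom_up_add[OF fh CT_closed(4)[OF u gC] gC])
        ultimately have "f (up ?u) = f (up ?w)" by simp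
        then show ?thesis using hom_up_abar[OF fh p] by (simp add: s_def)
      qed
      moreover have "f \<in> carrier (C (Suc m))" using cocycle_C[OF f] Suc by simp
      ultimately show "f \<in> coboundaries a P n" unfolding Suc coboundaries_Suc by blast
    qed
  qed
  moreover have "(\<forall>t\<in>carrier (NM n). pairing f t = 0) \<longleftrightarrow> (\<forall>v\<in>cyc n. f (up v) = 0)" for f
    unfolding Num_eq by (simp add: pairing_fib cyc_CT)
  ultimately show ?thesis using coboundaries_cocycles[of n] by auto
qed

text \<open>A vector outside \<open>Y\<close> enlarges a basis of \<open>Y\<close> to an independent
  set; sending the basis to 0 and fixing \<open>v\<close> defines \<open>\<phi>\<close>. The scalar
  functional is one coordinate of this endomorphism, so a single vector space structure
  suffices.\<close>

lemma separate:
  assumes Y: "pm.subspace Y" and v: "v \<notin> (Y :: ('x \<Rightarrow>\<^sub>0 'k) set)"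
  shows "\<exists>(\<phi> :: ('x \<Rightarrow>\<^sub>0 'k) \<Rightarrow> ('x \<Rightarrow>\<^sub>0 'k)) x. Vector_Spaces.linear pscale pscale \<phi> \<and> (\<forall>w\<in>Y. \<phi> w = 0) \<and> Poly_Mapping.lookup (\<phi> v) x \<noteq> (0::'k)"
proof -
  interpret vector_space_pair "pscale :: 'k \<Rightarrow> ('x \<Rightarrow>\<^sub>0 'k) \<Rightarrow> _" "pscale :: 'k \<Rightarrow> ('x \<Rightarrow>\<^sub>0 'k) \<Rightarrow> _"
    by (rule vector_space_pair.intro) (rule pm.vector_space_axioms)+
  obtain B where B: "B \<subseteq> Y" "pm.independent B" "Y \<subseteq> pm.span B" using pm.maximal_independent_subset by blast
  have "v \<notin> pm.span B" using v pm.span_minimal[OF B(1) Y] by blast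
  then have "pm.independent (insert v B)" using B(2) by (rule pm.independent_insertI)
  then obtain \<phi> where \<phi>: "Vector_Spaces.linear pscale pscale \<phi>" "\<forall>x\<in>insert v B. \<phi> x = (if x = v then v else 0)"
    using linear_independent_extend[of "insert v B" "\<lambda>x. if x = v then v else 0"] by blast
  have "v \<notin> B" using B(1) v by blast
  have "\<phi> w = 0" if "w \<in> Y" for w
  proof (rule linear_eq_0_on_span[OF \<phi>(1), of B])
    show "\<phi> x = 0" if "x \<in> B" for x using \<phi>(2) that \<open>v \<notin> B\<close> by auto
    show "w \<in> pm.span B" using B(3) that by blast
  qed
  moreover have "\<phi> v = v" using \<phi>(2) by simp
  moreover have "v \<noteq> 0" using v pm.subspace_0[OF Y] by blast
  then have "\<exists>x. Poly_Mapping.lookup v x \<noteq> 0" by (metis lookup_zero poly_mapping_eqI)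
  then obtain x where "Poly_Mapping.lookup v x \<noteq> 0" ..
  ultimately show ?thesis using \<phi>(1) by (intro exI[of _ \<phi>] exI[of _ x]) simp
qed

text \<open>A functional on coordinate vectors that vanishes on boundaries becomes a cocycle after
  composition with \<open>abar\<close>; separating a non-boundary from the subspace of boundaries
  thus produces a cocycle that detects it.\<close>

lemma right_radical: "Bd n = {t \<in> carrier (NM n). \<forall>f\<in>carrier (Z n). pairing f t = 0}"
proof -
  have "v \<in> dbar n ` CT (Suc n) \<longleftrightarrow> (\<forall>f\<in>cocycles a P n. f (up v) = 0)" if v: "v \<in> CT n" for v
  proof
    assume "v \<in> dbar n ` CT (Suc n)"
    then obtain w where w: "w \<in> CT (Suc n)" "v = dbar n w" by blast
    have eq: "v = abar (d n (up w))" using abar_d[OF up_F[OF w(1)]] w(2) by simp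
    show "\<forall>f\<in>cocycles a P n. f (up v) = 0"
    proof
      fix f assume f: "f \<in> cocycles a P n"
      show "f (up v) = 0" unfolding eq hom_up_abar[OF cocycle_hom[OF f] d_carrier[OF up_F[OF w(1)]]]
        by (rule cocycle_zero[OF f up_F[OF w(1)]])
    qed
  next
    assume z: "\<forall>f\<in>cocycles a P n. f (up v) = 0"
    show "v \<in> dbar n ` CT (Suc n)"
    proof (rule ccontr)
      assume nv: "v \<notin> dbar n ` CT (Suc n)"
      have "pm.subspace (dbar n ` CT (Suc n))"
      proof (rule pm.subspaceI)
        show "0 \<in> dbar n ` CT (Suc n)" using CT_closed(3) dbar_zero by (metis imageI)
        show "x + y \<in> dbar n ` CT (Suc n)" if "x \<in> dbar n ` CT (Suc n)" "y \<in> dbar n ` CT (Suc n)" for x y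
          using that CT_closed(1) by (auto simp flip: dbar_add)
        show "pscale c x \<in> dbar n ` CT (Suc n)" if "x \<in> dbar n ` CT (Suc n)" for x c
          using that CT_closed(2) by (auto simp flip: dbar_pscale)
      qed
      from separate[OF this nv] obtain \<phi> :: "('x \<Rightarrow>\<^sub>0 'k) \<Rightarrow> ('x \<Rightarrow>\<^sub>0 'k)" and x where \<phi>: "Vector_Spaces.linear pscale pscale \<phi>"
        "\<forall>w\<in>dbar n ` CT (Suc n). \<phi> w = 0" "Poly_Mapping.lookup (\<phi> v) x \<noteq> (0::'k)" by blast
      have lin: "\<phi> (u + w) = \<phi> u + \<phi> w" "\<phi> (pscale c u) = pscale c (\<phi> u)" for u w c
        using \<phi>(1) by (auto simp: Vector_Spaces.linear_iff)
      let ?f = "\<lambda>p. Poly_Mapping.lookup (\<phi> (abar p)) x"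
      have "restrict ?f (carrier (F n)) \<in> cocycles a P n"
      proof (rule cocycleI)
        show "?f \<in> module_hom (F n) T"
          by (rule module_homI) (auto simp: F_simps abar_add abar_pscale lin lookup_add)
        show "?f (d n p) = 0" if "p \<in> carrier (F (Suc n))" for p
          using \<phi>(2) abar_CT[OF that] by (simp add: abar_d[OF that])
      qed
      from bspec[OF z this] have "?f (up v) = 0" using up_F[OF v] by simp
      then show False using \<phi>(3) by simp
    qed
  qed
  note key = this
  show ?thesis
  proof (rule Set.set_eqI)
    fix t
    show "t \<in> Bd n \<longleftrightarrow> t \<in> {t \<in> carrier (NM n). \<forall>f\<in>carrier (Z n). pairing f t = 0}"
    proof (cases "t \<in> Num n")
      case True
      then obtain v where v: "v \<in> cyc n" "t = fib n v" unfolding Num_eq by blast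
      have "t \<in> Bd n \<longleftrightarrow> v \<in> dbar n ` CT (Suc n)"
        unfolding Bd_eq v(2) using fib_inj[OF cyc_CT[OF v(1)]] by blast
      then show ?thesis using key[OF cyc_CT[OF v(1)]] True v(2) by (simp add: pairing_fib[OF cyc_CT[OF v(1)]])
    next
      case False
      then show ?thesis using Bd_lsub[of n] by (auto simp: lsubmodule_def)
    qed
  qed
qed

theorem Tor_vdim:
  assumes "fin_dim (Ext a P n)"
  shows "fin_dim (Tor a P n) \<and> vdim (Tor a P n) = vdim (Ext a P n)"
  using bilinear_pairing.perfect_pairing_vdim[OF pairing_bilinear coboundaries_lsub left_radical Bd_lsub right_radical, of n] assms
  by (simp only: Ext_eq Tor_def)

end

section \<open>The augmentation\<close>

lemma algebra_of_simps [simp]: "carrier (algebra_of scale) = UNIV" "x \<otimes>\<^bsub>algebra_of scale\<^esub> y = x * y"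
  "\<one>\<^bsub>algebra_of scale\<^esub> = 1" "\<zero>\<^bsub>algebra_of scale\<^esub> = 0" "x \<oplus>\<^bsub>algebra_of scale\<^esub> y = x + y"
  "c \<odot>\<^bsub>algebra_of scale\<^esub> x = scale c x"
  by (simp_all add: algebra_of_def)

text \<open>Connects the finite sums in \<open>fsg_algebra\<close> and \<open>augmentation\<close>
  with the spans used for gradings; the support of a decomposition serves as the index set.\<close>

lemma (in graded_lmod) sum_of_subgroups_part: "sum_of_subgroups M I G = graded_part M G I"
proof
  show "sum_of_subgroups M I G \<subseteq> graded_part M G I"
  proof
    fix v assume "v \<in> sum_of_subgroups M I G"
    then obtain J x where J: "v = (\<Oplus>i\<in>J. x i)" "J \<subseteq> I" "\<forall>i\<in>J. x i \<in> G i"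
      unfolding sum_of_subgroups_def by blast
    then have "x \<in> J \<rightarrow> graded_part M G I" using part_base by blast
    then show "v \<in> graded_part M G I" unfolding J(1) by (rule lsub_finsum[OF M part_lsub])
  qed
  show "graded_part M G I \<subseteq> sum_of_subgroups M I G"
  proof
    fix v assume "v \<in> graded_part M G I"
    then obtain x where x: "decomp v x" "\<forall>i. i \<notin> I \<longrightarrow> x i = \<zero>" using part_decomp by blast
    have "finite {i. x i \<noteq> \<zero>} \<and> {i. x i \<noteq> \<zero>} \<subseteq> I \<and> (\<forall>i\<in>{i. x i \<noteq> \<zero>}. x i \<in> G i) \<and> v = (\<Oplus>i\<in>{i. x i \<noteq> \<zero>}. x i)"
      using x by (auto simp: decomp_def)
    then show "v \<in> sum_of_subgroups M I G" unfolding sum_of_subgroups_def by blast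
  qed
qed

text \<open>\<open>B\<close> is the direct sum of the scalars and the part of positive degree. The
  projection to the scalars is multiplicative because that part is closed under products and
  scalars.\<close>

lemma augmentation_hom:
  fixes scale :: "'k::field \<Rightarrow> 'b::ring_1 \<Rightarrow> 'b"
  assumes fsg: "fsg_algebra scale G"
  defines "a \<equiv> augmentation scale G"
  shows "a (r + s) = a r + a s" "a (r * s) = a r * a s" "a 1 = 1" "a (scale c 1) = c"
    "scale c 1 * b = b * scale c 1"
proof -
  let ?A = "algebra_of scale"
  have KA: "K_algebra ?A" and semi: "semi_graded_ring ?A G" and sm: "\<And>n c x. c \<in> G 0 \<Longrightarrow> x \<in> G n \<Longrightarrow> c * x \<in> G n"
    and G0: "G 0 = range (\<lambda>c. scale c 1)"
    and plus: "\<And>p q x y. p \<ge> 1 \<Longrightarrow> q \<ge> 1 \<Longrightarrow> x \<in> G p \<Longrightarrow> y \<in> G q \<Longrightarrow> x * y \<in> sum_of_subgroups ?A {1..p + q} G"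
    using fsg by (auto simp: fsg_algebra_def fsg_ring_def)
  have L: "lmod ?A" using KA by (simp add: K_algebra_def left_module_iff)
  interpret lmod ?A by (rule L)
  have ml: "scale c x * y = scale c (x * y)" and mr: "x * scale c y = scale c (x * y)" for c x y
    using KA by (simp_all add: K_algebra_def)
  have sc_add: "scale c (x + y) = scale c x + scale c y" and add_sc: "scale (c + c') x = scale c x + scale c' x"
    and sc_mult: "scale (c * c') x = scale c (scale c' x)" and sc_one: "scale 1 x = x" for c c' x y
    using smult_r_distr[of x y c] smult_l_distr[of x c c'] smult_assoc1[of x c c'] smult_one[of x] by simp_all
  interpret graded_lmod ?A G
  proof unfold_locales
    show "internal_direct_sum ?A G" using semi by (simp add: semi_graded_ring_def)
    show "r \<odot>\<^bsub>?A\<^esub> x \<in> G n" if "x \<in> G n" for x n r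
      using sm[of "scale r 1" x n] that G0 ml[of r 1 x] by auto
  qed
  interpret bilinear_algebra ?A
    by unfold_locales (auto simp: algebra_simps ml mr)
  let ?B = "graded_part ?A G {1..}"
  have B_add: "x + y \<in> ?B" and B_sc: "scale c x \<in> ?B" if "x \<in> ?B" "y \<in> ?B" for x y c
    using lsub_add[OF L part_lsub that] lsub_smult[OF L part_lsub that(1), of c] by simp_all
  have B_zero: "0 \<in> ?B" using lsub_zero[OF L part_lsub] by simp
  have mi: "x \<ominus>\<^bsub>?A\<^esub> y = x - y" for x y
    using minus_add_cancel[of x y] by (simp add: eq_diff_eq)
  have B_minus: "x - y \<in> ?B" if "x \<in> ?B" "y \<in> ?B" for x y using lsub_minus[OF L part_lsub that] by (simp add: mi)
  \<comment> \<open>Here the sharper product condition in degrees \<open>p, q \<ge> 1\<close>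
    enters; the general semi-graded law would allow components in degree 0.\<close>
  have B_mult: "x * y \<in> ?B" if xy: "x \<in> ?B" "y \<in> ?B" for x y
  proof -
    have "x \<otimes>\<^bsub>?A\<^esub> y \<in> ?B"
    proof (rule lspan_mult[OF UN_carrier UN_carrier part_lsub _ xy[unfolded graded_part_def]])
      fix u v assume "u \<in> (\<Union>i\<in>{1..}. G i)" "v \<in> (\<Union>i\<in>{1..}. G i)"
      then obtain p q where "p \<ge> 1" "q \<ge> 1" "u \<in> G p" "v \<in> G q" by auto
      then have "u * v \<in> graded_part ?A G {1..p + q}" using plus by (simp add: sum_of_subgroups_part)
      then show "u \<otimes>\<^bsub>?A\<^esub> v \<in> ?B" using part_mono[of "{1..p + q}" "{1..}"] by auto
    qed
    then show ?thesis by simp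
  qed
  have uniq: "c = c'" if "b - scale c 1 \<in> ?B" "b - scale c' 1 \<in> ?B" for b c c'
  proof -
    have "scale (c' - c) 1 = (b - scale c 1) - (b - scale c' 1)"
      using add_sc[of "c' - c" c 1] by (simp add: algebra_simps)
    then have "scale (c' - c) 1 \<in> ?B" using B_minus[OF that] by simp
    moreover have "scale (c' - c) 1 \<in> graded_part ?A G {0}" using G0 by (simp add: part_single)
    ultimately have z: "scale (c' - c) 1 = 0" using part_disjoint[of "{0}" "{1..}"] by auto
    show "c = c'"
    proof (rule ccontr)
      assume "c \<noteq> c'"
      then have "(1::'b) = scale (inverse (c' - c)) (scale (c' - c) 1)" by (simp add: sc_one flip: sc_mult)
      also have "\<dots> = 0" using z smult_r_zero[of "inverse (c' - c)"] by simp
      finally show False by simp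
    qed
  qed
  have aI: "a b = c" if "b - scale c 1 \<in> ?B" for b c
    unfolding a_def augmentation_def sum_of_subgroups_part using that uniq by blast
  have aE: "b - scale (a b) 1 \<in> ?B" for b
  proof -
    have "- {0} = {1::nat..}" by auto
    then obtain x y where "x \<in> G 0" "y \<in> ?B" "b = x + y"
      using split_carrier[of b "{0}"] by (auto simp: part_single)
    moreover then obtain c where "x = scale c 1" using G0 by auto
    ultimately have "b - scale c 1 \<in> ?B" by simp
    then show ?thesis using aI by simp
  qed
  show "a (r + s) = a r + a s"
    using B_add[OF aE[of r] aE[of s]] by (intro aI) (simp add: add_sc algebra_simps)
  show "a 1 = 1" using B_zero by (intro aI) (simp add: sc_one)
  show "a (scale c 1) = c" using B_zero by (intro aI) simp
  show "a (r * s) = a r * a s"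
  proof (rule aI)
    \<comment> \<open>After expansion all terms but the first have positive degree, so the first one
      is the scalar part of \<open>r * s\<close>.\<close>
    have gen: "(scale c 1 + x) * (scale c' 1 + y) = scale (c * c') 1 + (scale c y + scale c' x + x * y)" for c c' x y
      by (simp add: distrib_left distrib_right ml mr sc_add mult.commute add_ac flip: sc_mult)
    let ?x = "r - scale (a r) 1" and ?y = "s - scale (a s) 1"
    have "r * s = (scale (a r) 1 + ?x) * (scale (a s) 1 + ?y)" by simp
    also have "\<dots> = scale (a r * a s) 1 + (scale (a r) ?y + scale (a s) ?x + ?x * ?y)"
      by (rule gen)
    finally have "r * s - scale (a r * a s) 1 = scale (a r) ?y + scale (a s) ?x + ?x * ?y" by simp
    moreover have "scale (a r) ?y + scale (a s) ?x + ?x * ?y \<in> ?B"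
      by (intro B_add B_sc B_mult aE) (rule aE)+
    ultimately show "r * s - scale (a r * a s) 1 \<in> ?B" by simp
  qed
  show "scale c 1 * b = b * scale c 1" by (simp add: ml mr)
qed

theorem corollary3p9:
  fixes scale :: "'k::field \<Rightarrow> 'b::ring_1 \<Rightarrow> 'b"
    and G :: "nat \<Rightarrow> 'b set"
    and a :: "'b \<Rightarrow> 'k"
    and P :: "('b, 'x, 'k) resolution"
  assumes "fsg_algebra scale G"
    and "a = augmentation scale G"
    and "homogeneous_free_resolution scale G P"
    and "fin_gen_in_degree_one (yoneda_algebra a P) (ext_grading a P)"
  shows "(\<forall>n. fin_dim (Ext a P n)) \<and>
    (\<forall>H. connected_grading (yoneda_algebra a P) H \<and> fin_gen_in_degree_one (yoneda_algebra a P) H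
       \<longrightarrow> (\<forall>n. fin_dim ((yoneda_algebra a P)\<lparr>carrier := H n\<rparr>)) \<and>
           hilbert_series (yoneda_algebra a P) H = poincare_series a P) \<and>
    (\<forall>n. fin_dim (Tor a P n)) \<and>
    poincare_series a P = Abs_fps (\<lambda>n. int (vdim (Tor a P n)))"
proof -
  interpret trivial_resolution a "\<lambda>c. scale c 1" P
  proof
    show "free_resolution a P" using assms(2,3) by (simp add: homogeneous_free_resolution_def)
  qed (use augmentation_hom[OF assms(1)] assms(2) in auto)
  interpret bilinear_algebra "yoneda_algebra a P" by (rule A_bilinear)
  have fd: "fin_dim (Ext a P n)" for n by (rule Ext_fin_dim[OF assms(4)])
  \<comment> \<open>\<open>ext_grading\<close> is itself connected and generated in degree one, so
    every other such grading is compared with it, and its pieces are the \<open>Ext\<close>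
    spaces.\<close>
  have H: "fin_dim ((yoneda_algebra a P)\<lparr>carrier := H n\<rparr>) \<and>
      vdim ((yoneda_algebra a P)\<lparr>carrier := H n\<rparr>) = vdim (Ext a P n)"
    if "connected_grading (yoneda_algebra a P) H" "fin_gen_in_degree_one (yoneda_algebra a P) H" for H n
    using hilbert_series_unique[OF EG_connected assms(4) that] EG_vdim[OF fd] by simp
  show ?thesis
    using fd H Tor_vdim[OF fd] by (simp add: hilbert_series_def poincare_series_def)
qed

end
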